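(* Assume hypotheses (D), (M), (I) and (A) of the context, and let $\gamma>0$ be compatible with the existence of the following attractors: for each $\varepsilon\in[0,\frac15]$ the set-valued process $\Phi^\varepsilon$ on $C_\gamma$ has a unique global $\mathcal{D}$-pullback attractor $\{A_{\Phi^\varepsilon}(t)\}_{t\in\mathbb{R}}$, and for each $\varepsilon\in(0,\frac15]$ the process $S^\varepsilon$ on $C_\gamma$ has a unique global $\mathcal{D}$-pullback attractor $\{A_{S^\varepsilon}(t)\}_{t\in\mathbb{R}}$. Then the attractors of $S^\varepsilon$ converge pointwise to the attractor of $\Phi^0$ upper semicontinuously in $C_\gamma$, i.e. $$\lim_{\varepsilon\to0^+}\mathrm{dist}_{C_\gamma}(A_{S^\varepsilon}(t),A_{\Phi^0}(t))=0\qquad\text{for all }t\in\mathbb{R}.$$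
   Context: Let $n$ be a positive integer; $i,j,k$ range over $\{1,\dots,n\}$. Identify $\mathbb{R}^{n^2}$ with $\mathbb{R}^n\times\mathbb{R}^{n(n-1)}$, with elements $u=(x,z)=((x_i)_i,(z_{ij})_{i\ne j})$ and norm $\|u\|=\max\{\max_i|x_i|,\max_{i\neq j}|z_{ij}|\}$. For $\gamma>0$, $C_\gamma$ is the Banach space of continuous $u:(-\infty,0]\to\mathbb{R}^{n^2}$ for which $\lim_{t\to-\infty}e^{\gamma t}u(t)$ exists in $\mathbb{R}^{n^2}$, with norm $\|u\|_\gamma=\sup_{t\le0}e^{\gamma t}\|u(t)\|$; $\overline{B}_\gamma(0,r)=\{u\in C_\gamma:\|u\|_\gamma\le r\}$. The history at $t$ of a function $u$ is $u_t(s)=u(t+s)$, $s\le0$. $\mathbb{R}^2_\ge=\{(t,t_0)\in\mathbb{R}^2:t\ge t_0\}$. Data: functions $A_i,B_{ij},I_i:\mathbb{R}\to\mathbb{R}$, constants $c_{ij},d_{ij}\ge0$, $\Gamma_i\in\mathbb{R}$, positive regular Borel measures $\mu_{ij}$ on $(-\infty,0]$ ($i\ne j$), with total variation $|\mu_{ij}|$ (finite by (M) below). $[s]^+=\max\{s,0\}$. Hypotheses. (D) All $A_i,B_{ij}$ are locally Lipschitz continuous and there is $\alpha>0$ with $A_i(s)\ge\alpha$, $B_{ij}(s)\ge\alpha$ for all $s\in\mathbb{R}$ and all $i\neq j$. (M) $\int_{-\infty}^0e^{-\gamma t}\,d\mu_{ij}(t)<\infty$ for all $i\ne j$, where $\gamma$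 is the exponent of the phase space $C_\gamma$. (I) Every $I_i$ is continuous on $\mathbb{R}$. (A) For all $i\ne j$ there exist $\lambda^x_{ij},\lambda^z_{ij}\in\{1,|\mu_{ij}|^2,d_{ij}^2,|\mu_{ij}|^2d_{ij}^2\}$ with $\lambda^x_{ij}\lambda^z_{ij}=|\mu_{ij}|^2d_{ij}^2$, $\nu^x_{ij},\nu^z_{ij}\in\{1,|\mu_{ij}|^2\}$ with $\nu^x_{ij}\nu^z_{ij}=|\mu_{ij}|^2$, $\eta_{ij}>0$ and $\varepsilon_{ij}>0$ such that, for all $i\ne j$, $\sum_{k\ne i}(\nu^x_{ki}\eta_{ki}+\lambda^x_{ki}\varepsilon_{ki})<2\alpha$ and $\frac{\nu^z_{ij}}{\eta_{ij}}+\frac{\lambda^z_{ij}}{\varepsilon_{ij}}<2\alpha$. For $u=(x,z)\in C_\gamma$, $t\in\mathbb{R}$: $D(u)=\big((-A_i(x_i(0))x_i(0))_i,(-B_{ij}(z_{ij}(0))z_{ij}(0))_{i\ne j}\big)$, $I(t)=((I_i(t))_i,0)$. Sigmoidal system. With $\sigma_\varepsilon(s)=1/(1+e^{-s/\varepsilon})$, $\varepsilon\in(0,1)$, $$\Sigma^\varepsilon(u)=\Big(\big(\textstyle\sum_{k\ne i}(z_{ki}(0)-c_{ki})\int_{-\infty}^0\sigma_\varepsilon(x_k(\tau)-\Gamma_k)\,d\mu_{ki}(\tau)\big)_i,\ \big(d_{ij}\int_{-\infty}^0\sigma_\varepsilon(x_i(\tau)-\Gamma_i)\,d\mu_{ij}(\tau)\,[x_j(0)]^+\big)_{i\ne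 j}\Big).$$ Under (D), (M), (I), the equation $u'(t)=D(u_t)+\Sigma^\varepsilon(u_t)+I(t)$, $t\ge t_0$, has for every $u_0\in C_\gamma$, $t_0\in\mathbb{R}$ a unique solution with $u_{t_0}=u_0$, defined for all $t\ge t_0$; $S^\varepsilon(t,t_0,u_0)=u_t$ for $(t,t_0)\in\mathbb{R}^2_\ge$, and $S^\varepsilon(t,t_0,B)$ is the image of $B\subset C_\gamma$. Inflated and Heaviside inclusions. Let $b(0)=0$, $b(\varepsilon)=\varepsilon\log\frac{1-\varepsilon}{\varepsilon}$ for $\varepsilon\in(0,1)$. For $\varepsilon\in[0,\frac15]$ let $\chi_\varepsilon(s)=[0,\varepsilon]$ if $s<-b(\varepsilon)$, $[0,1]$ if $-b(\varepsilon)\le s\le b(\varepsilon)$, $[1-\varepsilon,1]$ if $s>b(\varepsilon)$ (so $\chi_0$ is the set-valued Heaviside function). The Aumann integral of a measurable set-valued $F:(-\infty,0]\to\mathcal{P}(\mathbb{R})$ is $\int F\,d\mu=\{\int s\,d\mu: s\text{ a }\mu\text{-integrable selector of }F\}$. $X^\varepsilon(u)\subset\mathbb{R}^{n^2}$ is the Cartesian product of the sets $\sum_{k\ne i}(z_{ki}(0)-c_{ki})\int_{-\infty}^0\chi_\varepsilon(x_k(\tau)-\Gamma_k)\,d\mu_{ki}(\tau)$ (component $x_i$; Minkowski sum) and $d_{ij}[x_j(0)]^+\int_{-\infty}^0\chi_\varepsilon(x_i(\tau)-\Gamma_i)\,d\mu_{ij}(\tau)$ (component $z_{ij}$). $(H_\varepsilon)$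 is $u'(t)\in D(u_t)+X^\varepsilon(u_t)+I(t)$, $t\ge t_0$; a solution with initial datum $u_0\in C_\gamma$ at $t_0$ is a function $u$ with $u_{t_0}=u_0$, locally absolutely continuous for $t\ge t_0$, satisfying the inclusion for almost every $t\ge t_0$. $\Phi^\varepsilon(t,t_0,u_0)=\{u_t:u\text{ solution of }(H_\varepsilon)\text{ with }u_{t_0}=u_0\}$ for $(t,t_0)\in\mathbb{R}^2_\ge$, $u_0\in C_\gamma$; $\Phi^\varepsilon(t,t_0,B)=\bigcup_{u_0\in B}\Phi^\varepsilon(t,t_0,u_0)$. Attractors. $\mathcal{D}$ is the collection of families $\{D(t)\}_{t\in\mathbb{R}}$ of nonempty closed subsets of $C_\gamma$ for which there is $r>0$ with $D(t)\subset\overline{B}_\gamma(0,r)$ for all $t$. $\mathrm{dist}_{C_\gamma}(A,B)=\sup_{a\in A}\inf_{b\in B}\|a-b\|_\gamma$. A global $\mathcal{D}$-pullback attractor of a (single- or set-valued) process $\Phi$ is a family $\{A(t)\}_{t\in\mathbb{R}}$ of compact subsets of $C_\gamma$ that is invariant ($\Phi(t,t_0,A(t_0))=A(t)$ for all $t\ge t_0$) and satisfies $\lim_{\tau\to\infty}\mathrm{dist}_{C_\gamma}(\Phi(t,t-\tau,D(t-\tau)),A(t))=0$ for all $t\in\mathbb{R}$ and $\{D(t)\}\in\mathcal{D}$. *)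

theory Defs
  imports "HOL-Analysis.Analysis" "HOL-Library.Set_Algebras" "HOL-Library.Disjoint_Sets"
begin

section \<open>State space\<close>

text \<open>
  A point \<open>u = (x, z)\<close> of \<open>\<real>\<^sup>n \<times> \<real>\<^bsup>n(n-1)\<^esup>\<close> is stored as an \<open>n \<times> n\<close> array: the diagonal entry
  \<open>u $ i $ i\<close> is \<open>x\<^sub>i\<close> and the off-diagonal entry \<open>u $ i $ j\<close> is \<open>z\<^sub>i\<^sub>j\<close>.  With this encoding the
  norm \<open>max {max \<bar>x\<^sub>i\<bar>, max \<bar>z\<^sub>i\<^sub>j\<bar>}\<close> is exactly the library's \<open>infnorm\<close>, the largest absolute
  value of an entry (see \<open>infnorm_state\<close> below).
\<close>

type_synonym 'n state = "real ^ 'n ^ 'n"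

abbreviation xc :: "'n::finite state \<Rightarrow> 'n \<Rightarrow> real" where
  "xc u i \<equiv> u $ i $ i"

abbreviation zc :: "'n::finite state \<Rightarrow> 'n \<Rightarrow> 'n \<Rightarrow> real" where
  "zc u i j \<equiv> u $ i $ j"

definition state_of :: "('n \<Rightarrow> real) \<Rightarrow> ('n \<Rightarrow> 'n \<Rightarrow> real) \<Rightarrow> 'n::finite state" where
  "state_of x z = (\<chi> i j. if i = j then x i else z i j)"

lemma infnorm_state:
  fixes u :: "'n::finite state"
  shows "infnorm u = Max ({\<bar>xc u i\<bar> |i. True} \<union> {\<bar>zc u i j\<bar> |i j. i \<noteq> j})"
proof -
  have eq: "{\<bar>u \<bullet> b\<bar> |b. b \<in> Basis} = {\<bar>xc u i\<bar> |i. True} \<union> {\<bar>zc u i j\<bar> |i j. i \<noteq> j}"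
    by (force simp: Basis_vec_def inner_axis)
  have fin: "finite {\<bar>u \<bullet> b\<bar> |b. b \<in> Basis}"
    by (simp add: setcompr_eq_image)
  have ne: "{\<bar>u \<bullet> b\<bar> |b. b \<in> Basis} \<noteq> {}"
    unfolding eq by blast
  show ?thesis
    unfolding infnorm_def using cSup_eq_Max[OF fin ne] eq by simp
qed


section \<open>The phase space\<close>

text \<open>
  Functions on \<open>(-\<infinity>, 0]\<close> are total functions that take the value \<open>undefined\<close> on \<open>(0, \<infinity>)\<close>
  (\<open>extensional\<close>), so that equality of phase-space elements is equality on \<open>(-\<infinity>, 0]\<close>.
\<close>

definition phase_space :: "real \<Rightarrow> (real \<Rightarrow> 'n::finite state) set" where
  "phase_space \<gamma> = {u. u \<in> extensional {..0} \<and> continuous_on {..0} u \<and>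
     (\<exists>l. ((\<lambda>t. exp (\<gamma> * t) *\<^sub>R u t) \<longlongrightarrow> l) at_bot)}"

definition phase_norm :: "real \<Rightarrow> (real \<Rightarrow> 'n::finite state) \<Rightarrow> real" where
  "phase_norm \<gamma> u = (SUP t\<in>{..0}. exp (\<gamma> * t) * infnorm (u t))"

text \<open>
  Outside the phase space the supremum may be taken over an unbounded set; the distance is set to
  \<open>0\<close> there because the library's \<open>Metric_space\<close> asks for nonnegativity of a total function.
\<close>

definition phase_dist ::
    "real \<Rightarrow> (real \<Rightarrow> 'n::finite state) \<Rightarrow> (real \<Rightarrow> 'n state) \<Rightarrow> real" where
  "phase_dist \<gamma> u v =
     (if u \<in> phase_space \<gamma> \<and> v \<in> phase_space \<gamma> then phase_norm \<gamma> (\<lambda>s. u s - v s) else 0)"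

abbreviation phase_topology :: "real \<Rightarrow> (real \<Rightarrow> 'n::finite state) topology" where
  "phase_topology \<gamma> \<equiv> Metric_space.mtopology (phase_space \<gamma>) (phase_dist \<gamma>)"

definition phase_cball :: "real \<Rightarrow> real \<Rightarrow> (real \<Rightarrow> 'n::finite state) set" where
  "phase_cball \<gamma> r = {u \<in> phase_space \<gamma>. phase_norm \<gamma> u \<le> r}"

definition history :: "real \<Rightarrow> (real \<Rightarrow> 'n::finite state) \<Rightarrow> (real \<Rightarrow> 'n state)" where
  "history t u = restrict (\<lambda>s. u (t + s)) {..0}"

text \<open>Values in \<open>ennreal\<close>, so that suprema of unbounded sets and infima over \<open>{}\<close> are \<open>\<infinity>\<close>.\<close>

definition hsemidist ::
    "real \<Rightarrow> (real \<Rightarrow> 'n::finite state) set \<Rightarrow> (real \<Rightarrow> 'n state) set \<Rightarrow> ennreal" where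
  "hsemidist \<gamma> X Y = (SUP a\<in>X. INF b\<in>Y. ennreal (phase_dist \<gamma> a b))"

lemma phase_space_bounded:
  fixes u :: "real \<Rightarrow> 'n::finite state"
  assumes "u \<in> phase_space \<gamma>"
  shows "\<exists>K. \<forall>t\<le>0. norm (exp (\<gamma> * t) *\<^sub>R u t) \<le> K"
proof -
  obtain l where l: "((\<lambda>t. exp (\<gamma> * t) *\<^sub>R u t) \<longlongrightarrow> l) at_bot" and c: "continuous_on {..0} u"
    using assms by (auto simp: phase_space_def)
  have "eventually (\<lambda>t. dist (exp (\<gamma> * t) *\<^sub>R u t) l < 1) at_bot"
    using l by (rule tendstoD) simp
  then obtain T where T: "\<And>t. t \<le> T \<Longrightarrow> dist (exp (\<gamma> * t) *\<^sub>R u t) l < 1"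
    by (auto simp: eventually_at_bot_linorder)
  have "continuous_on {T..0} (\<lambda>t. exp (\<gamma> * t) *\<^sub>R u t)"
    by (intro continuous_intros continuous_on_subset[OF c]) auto
  then have "compact ((\<lambda>t. exp (\<gamma> * t) *\<^sub>R u t) ` {T..0})"
    by (rule compact_continuous_image) simp
  then obtain K where K: "\<And>t. t \<in> {T..0} \<Longrightarrow> norm (exp (\<gamma> * t) *\<^sub>R u t) \<le> K"
    by (meson bounded_iff compact_imp_bounded imageI)
  have "norm (exp (\<gamma> * t) *\<^sub>R u t) \<le> max K (norm l + 1)" if "t \<le> 0" for t
  proof (cases "t \<le> T")
    case True
    then have "norm (exp (\<gamma> * t) *\<^sub>R u t) \<le> norm l + 1"
      using T[of t] norm_triangle_ineq2[of "exp (\<gamma> * t) *\<^sub>R u t" l] by (simp add: dist_norm)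
    then show ?thesis by simp
  next
    case False
    then show ?thesis using K[of t] that by auto
  qed
  then show ?thesis by blast
qed

lemma phase_diff_bdd_above:
  fixes u v :: "real \<Rightarrow> 'n::finite state"
  assumes "u \<in> phase_space \<gamma>" "v \<in> phase_space \<gamma>"
  shows "bdd_above ((\<lambda>t. exp (\<gamma> * t) * infnorm (u t - v t)) ` {..0})"
proof -
  obtain K L where K: "\<And>t. t \<le> 0 \<Longrightarrow> norm (exp (\<gamma> * t) *\<^sub>R u t) \<le> K"
    and L: "\<And>t. t \<le> 0 \<Longrightarrow> norm (exp (\<gamma> * t) *\<^sub>R v t) \<le> L"
    using phase_space_bounded assms by meson
  have "exp (\<gamma> * t) * infnorm (u t - v t) \<le> K + L" if "t \<le> 0" for t
  proof -
    have "exp (\<gamma> * t) * infnorm (u t - v t) \<le> exp (\<gamma> * t) * norm (u t - v t)"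
      by (intro mult_left_mono infnorm_le_norm) simp
    also have "\<dots> = norm (exp (\<gamma> * t) *\<^sub>R u t - exp (\<gamma> * t) *\<^sub>R v t)"
      by (simp flip: scaleR_right_diff_distrib)
    also have "\<dots> \<le> K + L"
      using K[OF that] L[OF that] norm_triangle_ineq4 by (meson add_mono order_trans)
    finally show ?thesis .
  qed
  then show ?thesis by (auto intro!: bdd_aboveI)
qed

lemma Metric_space_phase: "Metric_space (phase_space \<gamma>) (phase_dist \<gamma>)"
proof
  fix u v :: "real \<Rightarrow> 'n::finite state"
  show "0 \<le> phase_dist \<gamma> u v"
    unfolding phase_dist_def phase_norm_def
    by (auto intro!: cSUP_upper2[where x = 0] phase_diff_bdd_above simp: infnorm_pos_le)
  show "phase_dist \<gamma> u v = phase_dist \<gamma> v u"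
    by (simp add: phase_dist_def phase_norm_def infnorm_sub)
next
  fix u v :: "real \<Rightarrow> 'n::finite state"
  assume u: "u \<in> phase_space \<gamma>" and v: "v \<in> phase_space \<gamma>"
  show "phase_dist \<gamma> u v = 0 \<longleftrightarrow> u = v"
  proof
    assume 0: "phase_dist \<gamma> u v = 0"
    have "u t = v t" if "t \<le> 0" for t
    proof -
      have "exp (\<gamma> * t) * infnorm (u t - v t) \<le> 0"
        using cSUP_upper[OF _ phase_diff_bdd_above[OF u v], of t] 0 u v that
        by (simp add: phase_dist_def phase_norm_def)
      then have "infnorm (u t - v t) = 0"
        by (metis exp_gt_zero infnorm_pos_le linorder_not_less mult_pos_pos order_le_less)
      then show ?thesis by (simp add: infnorm_eq_0)
    qed
    then show "u = v"
      using u v by (auto simp: phase_space_def intro: extensionalityI)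
  next
    assume "u = v"
    then show "phase_dist \<gamma> u v = 0"
      by (simp add: phase_dist_def phase_norm_def infnorm_0)
  qed
next
  fix u v w :: "real \<Rightarrow> 'n::finite state"
  assume u: "u \<in> phase_space \<gamma>" and v: "v \<in> phase_space \<gamma>" and w: "w \<in> phase_space \<gamma>"
  have "exp (\<gamma> * t) * infnorm (u t - w t) \<le> phase_dist \<gamma> u v + phase_dist \<gamma> v w"
    if "t \<le> 0" for t
  proof -
    have "infnorm (u t - w t) \<le> infnorm (u t - v t) + infnorm (v t - w t)"
      using infnorm_triangle[of "u t - v t" "v t - w t"] by simp
    then have "exp (\<gamma> * t) * infnorm (u t - w t)
        \<le> exp (\<gamma> * t) * infnorm (u t - v t) + exp (\<gamma> * t) * infnorm (v t - w t)"
      by (simp flip: distrib_left)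
    also have "\<dots> \<le> phase_dist \<gamma> u v + phase_dist \<gamma> v w"
      using u v w that
      by (auto simp: phase_dist_def phase_norm_def
          intro!: add_mono cSUP_upper phase_diff_bdd_above)
    finally show ?thesis .
  qed
  then have "(SUP t\<in>{..0}. exp (\<gamma> * t) * infnorm (u t - w t))
      \<le> phase_dist \<gamma> u v + phase_dist \<gamma> v w"
    by (intro cSUP_least) auto
  then show "phase_dist \<gamma> u w \<le> phase_dist \<gamma> u v + phase_dist \<gamma> v w"
    using u w by (simp add: phase_dist_def phase_norm_def)
qed


section \<open>Hypotheses on the data\<close>

definition locally_Lipschitz :: "(real \<Rightarrow> real) \<Rightarrow> bool" where
  "locally_Lipschitz f \<longleftrightarrow> (\<forall>s. \<exists>\<delta>>0. \<exists>L. L-lipschitz_on (ball s \<delta>) f)"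

definition regular_Borel_measure :: "real set \<Rightarrow> real measure \<Rightarrow> bool" where
  "regular_Borel_measure S M \<longleftrightarrow>
     sets M = sets (restrict_space borel S) \<and>
     (\<forall>E\<in>sets M. emeasure M E = (SUP K\<in>{K. compact K \<and> K \<subseteq> E}. emeasure M K)) \<and>
     (\<forall>E\<in>sets M. emeasure M E = (INF U\<in>{U. openin (top_of_set S) U \<and> E \<subseteq> U}. emeasure M U))"

definition total_variation :: "real measure \<Rightarrow> real" where
  "total_variation M =
     (SUP P\<in>{P. finite P \<and> P \<subseteq> sets M \<and> partition_on (space M) P}. \<Sum>E\<in>P. \<bar>measure M E\<bar>)"

lemma total_variation_eq:
  assumes "finite_measure M"
  shows "total_variation M = measure M (space M)"
proof -
  interpret finite_measure M by fact
  let ?Q = "{P. finite P \<and> P \<subseteq> sets M \<and> partition_on (space M) P}"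
  have 1: "(\<Sum>E\<in>P. \<bar>measure M E\<bar>) = measure M (space M)" if "P \<in> ?Q" for P
  proof -
    have P: "finite P" "P \<subseteq> sets M" "disjoint P" "\<Union>P = space M"
      using that by (auto simp: partition_on_def)
    have "measure M (\<Union>E\<in>P. E) = (\<Sum>E\<in>P. measure M E)"
      by (rule finite_measure_finite_Union)
        (use P in \<open>auto simp: disjoint_family_on_def disjoint_def\<close>)
    then show ?thesis using P by simp
  qed
  have "(if space M = {} then {} else {space M}) \<in> ?Q"
    by (auto simp: partition_on_def disjoint_def)
  then have "?Q \<noteq> {}" by blast
  then show ?thesis
    unfolding total_variation_def using 1 by (simp cong: SUP_cong_simp)
qed

text \<open>
  The existentially chosen weights \<open>lx\<close>, \<open>lz\<close>, \<open>nx\<close>, \<open>nz\<close> are \<open>\<lambda>\<^sup>x\<close>, \<open>\<lambda>\<^sup>z\<close>, \<open>\<nu>\<^sup>x\<close>, \<open>\<nu>\<^sup>z\<close>.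
\<close>

definition coupling_condition ::
    "real \<Rightarrow> ('n::finite \<Rightarrow> 'n \<Rightarrow> real) \<Rightarrow> ('n \<Rightarrow> 'n \<Rightarrow> real measure) \<Rightarrow> bool" where
  "coupling_condition \<alpha> d \<mu> \<longleftrightarrow>
    (\<exists>lx lz nx nz \<eta> e :: 'n \<Rightarrow> 'n \<Rightarrow> real.
      (\<forall>i j. i \<noteq> j \<longrightarrow>
        (let m = (total_variation (\<mu> i j))\<^sup>2; \<delta> = (d i j)\<^sup>2 in
          lx i j \<in> {1, m, \<delta>, m * \<delta>} \<and> lz i j \<in> {1, m, \<delta>, m * \<delta>} \<and> lx i j * lz i j = m * \<delta> \<and>
          nx i j \<in> {1, m} \<and> nz i j \<in> {1, m} \<and> nx i j * nz i j = m \<and>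
          \<eta> i j > 0 \<and> e i j > 0)) \<and>
      (\<forall>i j. i \<noteq> j \<longrightarrow>
        (\<Sum>k\<in>UNIV - {i}. nx k i * \<eta> k i + lx k i * e k i) < 2 * \<alpha> \<and>
        nz i j / \<eta> i j + lz i j / e i j < 2 * \<alpha>))"


section \<open>The sigmoidal system\<close>

definition decay_term ::
    "('n::finite \<Rightarrow> real \<Rightarrow> real) \<Rightarrow> ('n \<Rightarrow> 'n \<Rightarrow> real \<Rightarrow> real) \<Rightarrow> (real \<Rightarrow> 'n state) \<Rightarrow> 'n state" where
  "decay_term A B u =
     state_of (\<lambda>i. - A i (xc (u 0) i) * xc (u 0) i)
              (\<lambda>i j. - B i j (zc (u 0) i j) * zc (u 0) i j)"

definition input_term :: "('n::finite \<Rightarrow> real \<Rightarrow> real) \<Rightarrow> real \<Rightarrow> 'n state" where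
  "input_term I t = state_of (\<lambda>i. I i t) (\<lambda>i j. 0)"

definition sigmoid :: "real \<Rightarrow> real \<Rightarrow> real" where
  "sigmoid \<epsilon> s = 1 / (1 + exp (- s / \<epsilon>))"

definition sigmoid_term ::
    "('n::finite \<Rightarrow> 'n \<Rightarrow> real) \<Rightarrow> ('n \<Rightarrow> 'n \<Rightarrow> real) \<Rightarrow> ('n \<Rightarrow> real) \<Rightarrow> ('n \<Rightarrow> 'n \<Rightarrow> real measure) \<Rightarrow>
     real \<Rightarrow> (real \<Rightarrow> 'n state) \<Rightarrow> 'n state" where
  "sigmoid_term c d \<Gamma> \<mu> \<epsilon> u =
     state_of
       (\<lambda>i. \<Sum>k\<in>UNIV - {i}. (zc (u 0) k i - c k i) * (LINT \<tau>|\<mu> k i. sigmoid \<epsilon> (xc (u \<tau>) k - \<Gamma> k)))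
       (\<lambda>i j. d i j * (LINT \<tau>|\<mu> i j. sigmoid \<epsilon> (xc (u \<tau>) i - \<Gamma> i)) * max (xc (u 0) j) 0)"

text \<open>The derivative at \<open>t0\<close> is the right-hand one.\<close>

definition sigmoid_solution ::
    "('n::finite \<Rightarrow> real \<Rightarrow> real) \<Rightarrow> ('n \<Rightarrow> 'n \<Rightarrow> real \<Rightarrow> real) \<Rightarrow> ('n \<Rightarrow> real \<Rightarrow> real) \<Rightarrow>
     ('n \<Rightarrow> 'n \<Rightarrow> real) \<Rightarrow> ('n \<Rightarrow> 'n \<Rightarrow> real) \<Rightarrow> ('n \<Rightarrow> real) \<Rightarrow> ('n \<Rightarrow> 'n \<Rightarrow> real measure) \<Rightarrow>
     real \<Rightarrow> real \<Rightarrow> (real \<Rightarrow> 'n state) \<Rightarrow> (real \<Rightarrow> 'n state) \<Rightarrow> bool" where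
  "sigmoid_solution A B I c d \<Gamma> \<mu> \<epsilon> t0 u0 u \<longleftrightarrow>
     history t0 u = u0 \<and>
     (\<forall>t\<ge>t0. (u has_vector_derivative
        (decay_term A B (history t u) + sigmoid_term c d \<Gamma> \<mu> \<epsilon> (history t u) + input_term I t))
        (at t within {t0..}))"

definition sigmoid_process ::
    "('n::finite \<Rightarrow> real \<Rightarrow> real) \<Rightarrow> ('n \<Rightarrow> 'n \<Rightarrow> real \<Rightarrow> real) \<Rightarrow> ('n \<Rightarrow> real \<Rightarrow> real) \<Rightarrow>
     ('n \<Rightarrow> 'n \<Rightarrow> real) \<Rightarrow> ('n \<Rightarrow> 'n \<Rightarrow> real) \<Rightarrow> ('n \<Rightarrow> real) \<Rightarrow> ('n \<Rightarrow> 'n \<Rightarrow> real measure) \<Rightarrow>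
     real \<Rightarrow> real \<Rightarrow> real \<Rightarrow> (real \<Rightarrow> 'n state) \<Rightarrow> (real \<Rightarrow> 'n state)" where
  "sigmoid_process A B I c d \<Gamma> \<mu> \<epsilon> t t0 u0 =
     history t (THE u. sigmoid_solution A B I c d \<Gamma> \<mu> \<epsilon> t0 u0 u)"


section \<open>The inflated and Heaviside inclusions\<close>

definition inflation_width :: "real \<Rightarrow> real" where
  "inflation_width \<epsilon> = (if \<epsilon> = 0 then 0 else \<epsilon> * ln ((1 - \<epsilon>) / \<epsilon>))"

definition inflated_Heaviside :: "real \<Rightarrow> real \<Rightarrow> real set" where
  "inflated_Heaviside \<epsilon> s =
     (if s < - inflation_width \<epsilon> then {0..\<epsilon>}
      else if s \<le> inflation_width \<epsilon> then {0..1}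
      else {1 - \<epsilon>..1})"

definition Aumann_integral :: "real measure \<Rightarrow> (real \<Rightarrow> real set) \<Rightarrow> real set" where
  "Aumann_integral M F = {(LINT \<tau>|M. s \<tau>) |s. integrable M s \<and> (\<forall>\<tau>\<in>space M. s \<tau> \<in> F \<tau>)}"

text \<open>
  The sum over \<open>k\<close> is a Minkowski sum, the library's pointwise addition of sets (an empty sum is
  \<open>{0}\<close>), and \<open>a *o S\<close> is the dilate \<open>{a * s |s. s \<in> S}\<close>.
\<close>

definition inflated_term ::
    "('n::finite \<Rightarrow> 'n \<Rightarrow> real) \<Rightarrow> ('n \<Rightarrow> 'n \<Rightarrow> real) \<Rightarrow> ('n \<Rightarrow> real) \<Rightarrow> ('n \<Rightarrow> 'n \<Rightarrow> real measure) \<Rightarrow>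
     real \<Rightarrow> (real \<Rightarrow> 'n state) \<Rightarrow> 'n state set" where
  "inflated_term c d \<Gamma> \<mu> \<epsilon> u = {w.
     (\<forall>i. xc w i \<in> (\<Sum>k\<in>UNIV - {i}. (zc (u 0) k i - c k i) *o
            Aumann_integral (\<mu> k i) (\<lambda>\<tau>. inflated_Heaviside \<epsilon> (xc (u \<tau>) k - \<Gamma> k)))) \<and>
     (\<forall>i j. i \<noteq> j \<longrightarrow> zc w i j \<in> (d i j * max (xc (u 0) j) 0) *o
            Aumann_integral (\<mu> i j) (\<lambda>\<tau>. inflated_Heaviside \<epsilon> (xc (u \<tau>) i - \<Gamma> i)))}"

definition absolutely_continuous_on :: "real \<Rightarrow> real \<Rightarrow> (real \<Rightarrow> 'a::real_normed_vector) \<Rightarrow> bool" where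
  "absolutely_continuous_on a b f \<longleftrightarrow>
     (\<forall>e>0. \<exists>\<delta>>0. \<forall>J :: (real \<times> real) set.
        finite J \<and> (\<forall>(p, q)\<in>J. a \<le> p \<and> p \<le> q \<and> q \<le> b) \<and>
        disjoint_family_on (\<lambda>(p, q). {p<..<q}) J \<and> (\<Sum>(p, q)\<in>J. q - p) < \<delta> \<longrightarrow>
        (\<Sum>(p, q)\<in>J. norm (f q - f p)) < e)"

definition inflated_solution ::
    "('n::finite \<Rightarrow> real \<Rightarrow> real) \<Rightarrow> ('n \<Rightarrow> 'n \<Rightarrow> real \<Rightarrow> real) \<Rightarrow> ('n \<Rightarrow> real \<Rightarrow> real) \<Rightarrow>
     ('n \<Rightarrow> 'n \<Rightarrow> real) \<Rightarrow> ('n \<Rightarrow> 'n \<Rightarrow> real) \<Rightarrow> ('n \<Rightarrow> real) \<Rightarrow> ('n \<Rightarrow> 'n \<Rightarrow> real measure) \<Rightarrow>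
     real \<Rightarrow> real \<Rightarrow> (real \<Rightarrow> 'n state) \<Rightarrow> (real \<Rightarrow> 'n state) \<Rightarrow> bool" where
  "inflated_solution A B I c d \<Gamma> \<mu> \<epsilon> t0 u0 u \<longleftrightarrow>
     history t0 u = u0 \<and>
     (\<forall>T\<ge>t0. absolutely_continuous_on t0 T u) \<and>
     (AE t in lebesgue. t \<ge> t0 \<longrightarrow>
        (\<exists>w\<in>inflated_term c d \<Gamma> \<mu> \<epsilon> (history t u).
           (u has_vector_derivative (decay_term A B (history t u) + w + input_term I t)) (at t)))"

definition inflated_process ::
    "('n::finite \<Rightarrow> real \<Rightarrow> real) \<Rightarrow> ('n \<Rightarrow> 'n \<Rightarrow> real \<Rightarrow> real) \<Rightarrow> ('n \<Rightarrow> real \<Rightarrow> real) \<Rightarrow>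
     ('n \<Rightarrow> 'n \<Rightarrow> real) \<Rightarrow> ('n \<Rightarrow> 'n \<Rightarrow> real) \<Rightarrow> ('n \<Rightarrow> real) \<Rightarrow> ('n \<Rightarrow> 'n \<Rightarrow> real measure) \<Rightarrow>
     real \<Rightarrow> real \<Rightarrow> real \<Rightarrow> (real \<Rightarrow> 'n state) \<Rightarrow> (real \<Rightarrow> 'n state) set" where
  "inflated_process A B I c d \<Gamma> \<mu> \<epsilon> t t0 u0 =
     {history t u |u. inflated_solution A B I c d \<Gamma> \<mu> \<epsilon> t0 u0 u}"


section \<open>Pullback attractors\<close>

definition bounded_families :: "real \<Rightarrow> (real \<Rightarrow> (real \<Rightarrow> 'n::finite state) set) set" where
  "bounded_families \<gamma> = {D. (\<forall>t. D t \<noteq> {} \<and> closedin (phase_topology \<gamma>) (D t)) \<and>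
     (\<exists>r>0. \<forall>t. D t \<subseteq> phase_cball \<gamma> r)}"

definition is_pullback_attractor ::
    "real \<Rightarrow> (real \<Rightarrow> real \<Rightarrow> (real \<Rightarrow> 'n::finite state) \<Rightarrow> (real \<Rightarrow> 'n state) set) \<Rightarrow>
     (real \<Rightarrow> (real \<Rightarrow> 'n state) set) \<Rightarrow> bool" where
  "is_pullback_attractor \<gamma> \<Phi> K \<longleftrightarrow>
     (\<forall>t. compactin (phase_topology \<gamma>) (K t)) \<and>
     (\<forall>t0 t. t0 \<le> t \<longrightarrow> (\<Union>u0\<in>K t0. \<Phi> t t0 u0) = K t) \<and>
     (\<forall>D\<in>bounded_families \<gamma>. \<forall>t.
        ((\<lambda>\<tau>. hsemidist \<gamma> (\<Union>u0\<in>D (t - \<tau>). \<Phi> t (t - \<tau>) u0) (K t)) \<longlongrightarrow> 0) at_top)"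

definition pullback_attractor ::
    "real \<Rightarrow> (real \<Rightarrow> real \<Rightarrow> (real \<Rightarrow> 'n::finite state) \<Rightarrow> (real \<Rightarrow> 'n state) set) \<Rightarrow>
     real \<Rightarrow> (real \<Rightarrow> 'n state) set" where
  "pullback_attractor \<gamma> \<Phi> = (THE K. is_pullback_attractor \<gamma> \<Phi> K)"

text \<open>A single-valued process is treated as the set-valued process with singleton values.\<close>

definition as_set_valued ::
    "(real \<Rightarrow> real \<Rightarrow> (real \<Rightarrow> 'n::finite state) \<Rightarrow> (real \<Rightarrow> 'n state)) \<Rightarrow>
     real \<Rightarrow> real \<Rightarrow> (real \<Rightarrow> 'n state) \<Rightarrow> (real \<Rightarrow> 'n state) set" where
  "as_set_valued S t t0 u0 = {S t t0 u0}"

end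

theory Submission
  imports Defs "HOL-Complex_Analysis.Great_Picard"
begin

text \<open>
  The attractors are unique by hypothesis, and a unique attractor contains every compact invariant
  family, because its union with such a family is an attractor again
  (\<open>unique_attractor_maximal\<close>).  This turns the convergence of attractors into a question about
  solutions on bounded time intervals only.

  First, attractors are monotone in the process: if every orbit of \<open>G\<close> is an orbit of \<open>H\<close>, then the
  \<open>G\<close>-invariant part of the intersection of both attractors attracts bounded families, so it is the
  attractor of \<open>G\<close> (\<open>attractor_subset\<close>).  The graph of the sigmoid with parameter \<open>\<epsilon>\<close> lies in the
  inflated Heaviside graph with parameter \<open>\<delta>\<close> if \<open>\<epsilon> \<le> \<delta> \<le> 1/5\<close>, so the attractor of the sigmoidal
  process at \<open>\<epsilon>\<close> lies in the attractor of the inflated process at \<open>\<delta>\<close> for each such \<open>\<delta>\<close>.  Therefore points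
  \<open>a\<^sub>k\<close> of the sigmoidal attractors at time \<open>t\<close>, with parameters \<open>\<epsilon>\<^sub>k\<close> tending to \<open>0\<close>, accumulate in
  \<open>N t\<close>, the intersection over \<open>\<delta> > 0\<close> of the inflated attractors at time \<open>t\<close>, which is compact.  By
  invariance \<open>a\<^sub>k\<close> is the endpoint of an orbit that starts at an earlier time \<open>s\<close> in the sigmoidal
  attractor, and those starting points accumulate in \<open>N s\<close>.  A limit of orbits with \<open>\<epsilon>\<^sub>k \<rightarrow> 0\<close> is an
  orbit of the Heaviside inclusion, so an accumulation point of \<open>a\<^sub>k\<close> is reached by the Heaviside
  process from \<open>N s\<close>, for every \<open>s \<le> t\<close>.  The points with this property form a compact invariant
  family of the Heaviside process (\<open>core_invariant\<close>), hence lie in its attractor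
  (\<open>attractors_upper_semicontinuous\<close>).

  What remains is analysis of the two systems.  The sigmoidal equation has unique global solutions:
  truncation makes it globally Lipschitz, so that Banach's theorem applies, and an energy
  inequality, uniform in \<open>\<epsilon>\<close>, removes the truncation (\<open>sigmoid_solution_exists1\<close>).  For the
  inclusion, Aumann integrals of interval-valued maps are intervals, so the inclusion amounts to
  upper bounds for \<open>\<plusminus>\<close> each component of the velocity (\<open>inflated_term_iff\<close>), and those bounds are
  upper semicontinuous as \<open>\<epsilon> \<rightarrow> 0\<close> (\<open>rate_bound_usc\<close>).  Integrating them along approximating
  solutions and passing to the limit shows that the limit is Lipschitz; by Lebesgue's
  differentiation theorem (\<open>lipschitz_AE_differentiable\<close>) it is differentiable almost everywhere and
  there it satisfies the Heaviside inclusion (\<open>inclusion_path_closure\<close>).  The limit so obtained lives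
  on a bounded interval; it is continued by a global solution of the Heaviside inclusion, which the
  Arzela--Ascoli theorem extracts from sigmoidal solutions (\<open>Heaviside_solution_exists\<close>).
\<close>

section \<open>Upper semicontinuity of unique pullback attractors\<close>

lemma phase_dist_ge_pointwise:
  assumes "u \<in> phase_space \<gamma>" "v \<in> phase_space \<gamma>" "t \<le> 0"
  shows "exp (\<gamma> * t) * infnorm (u t - v t) \<le> phase_dist \<gamma> u v"
  using assms unfolding phase_dist_def phase_norm_def
  by (auto intro!: cSUP_upper phase_diff_bdd_above)

abbreviation phase_limit :: "real \<Rightarrow> (nat \<Rightarrow> real \<Rightarrow> 'n::finite state) \<Rightarrow> (real \<Rightarrow> 'n state) \<Rightarrow> bool" where
  "phase_limit \<gamma> x l \<equiv> limitin (phase_topology \<gamma>) x l sequentially"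

lemma phase_limit_iff:
  "phase_limit \<gamma> x l \<longleftrightarrow> l \<in> phase_space \<gamma> \<and>
     (\<forall>e>0. \<forall>\<^sub>F k in sequentially. x k \<in> phase_space \<gamma> \<and> phase_dist \<gamma> (x k) l < e)"
  by (rule Metric_space.limitin_metric[OF Metric_space_phase])

lemma phase_limit_pointwise:
  assumes lim: "phase_limit \<gamma> x l" and t: "t \<le> 0"
  shows "(\<lambda>k. x k t) \<longlonglongrightarrow> l t"
proof (rule metric_LIMSEQ_I)
  fix e :: real assume e: "e > 0"
  let ?n = "sqrt DIM('a state)"
  have n: "?n > 0" by simp
  define d where "d = e * exp (\<gamma> * t) / ?n"
  have "d > 0" using e n by (simp add: d_def)
  then have "\<forall>\<^sub>F k in sequentially. x k \<in> phase_space \<gamma> \<and> phase_dist \<gamma> (x k) l < d"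
    and l: "l \<in> phase_space \<gamma>"
    using lim unfolding phase_limit_iff by blast+
  then have "\<forall>\<^sub>F k in sequentially. dist (x k t) (l t) < e"
  proof (elim eventually_mono conjE)
    fix k assume k: "x k \<in> phase_space \<gamma>" "phase_dist \<gamma> (x k) l < d"
    have "exp (\<gamma> * t) * infnorm (x k t - l t) < e * exp (\<gamma> * t) / ?n"
      using phase_dist_ge_pointwise[OF k(1) l t] k(2) by (simp add: d_def)
    then have "?n * infnorm (x k t - l t) < e" using n by (simp add: field_simps)
    then show "dist (x k t) (l t) < e"
      using norm_le_infnorm[of "x k t - l t"] by (simp add: dist_norm)
  qed
  then show "\<exists>no. \<forall>k\<ge>no. dist (x k t) (l t) < e" by (simp add: eventually_sequentially)
qed

text \<open>The weight \<open>exp (\<gamma> * t)\<close> is bounded below by \<open>exp (- \<gamma> * r)\<close> on \<open>[-r, 0]\<close>, so the weighted norm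
  dominates the supremum norm there.\<close>

lemma phase_limit_locally_uniform:
  assumes lim: "phase_limit \<gamma> x l" and g: "\<gamma> > 0" and e: "e > 0"
  shows "\<forall>\<^sub>F k in sequentially. \<forall>t\<in>{-r..0}. dist (x k t) (l t) < e"
proof -
  let ?n = "sqrt DIM('a state)"
  have n: "?n > 0" by simp
  define d where "d = e * exp (- \<gamma> * r) / ?n"
  have "d > 0" using e n by (simp add: d_def)
  then have "\<forall>\<^sub>F k in sequentially. x k \<in> phase_space \<gamma> \<and> phase_dist \<gamma> (x k) l < d"
    and l: "l \<in> phase_space \<gamma>"
    using lim unfolding phase_limit_iff by blast+
  then show ?thesis
  proof (elim eventually_mono conjE, intro ballI)
    fix k t assume k: "x k \<in> phase_space \<gamma>" "phase_dist \<gamma> (x k) l < d" and t: "t \<in> {-r..0}"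
    have "exp (- \<gamma> * r) * infnorm (x k t - l t) \<le> exp (\<gamma> * t) * infnorm (x k t - l t)"
      using t g mult_left_mono[of "- r" t \<gamma>] by (intro mult_right_mono) (auto simp: infnorm_pos_le)
    also have "\<dots> < e * exp (- \<gamma> * r) / ?n"
      using phase_dist_ge_pointwise[OF k(1) l, of t] t k(2) by (simp add: d_def)
    finally have "?n * infnorm (x k t - l t) < e" using n by (simp add: field_simps)
    then show "dist (x k t) (l t) < e"
      using norm_le_infnorm[of "x k t - l t"] by (simp add: dist_norm)
  qed
qed

lemma phase_compact_subseq:
  fixes x :: "nat \<Rightarrow> real \<Rightarrow> 'n::finite state"
  assumes "compactin (phase_topology \<gamma>) K" "\<And>k. x k \<in> K"
  obtains l r where "l \<in> K" "strict_mono r" "phase_limit \<gamma> (x \<circ> r) l"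
proof -
  have "range x \<subseteq> K" using assms(2) by auto
  moreover have "\<forall>s :: nat \<Rightarrow> _. range s \<subseteq> K \<longrightarrow> (\<exists>l r. l \<in> K \<and> strict_mono r \<and> phase_limit \<gamma> (s \<circ> r) l)"
    using assms(1) unfolding Metric_space.compactin_sequentially[OF Metric_space_phase] by simp
  ultimately show ?thesis using that by metis
qed

lemma phase_compactI:
  assumes "K \<subseteq> phase_space \<gamma>"
    and "\<And>x :: nat \<Rightarrow> _. (\<And>k. x k \<in> K) \<Longrightarrow> \<exists>l r. l \<in> K \<and> strict_mono r \<and> phase_limit \<gamma> (x \<circ> r) l"
  shows "compactin (phase_topology \<gamma>) K"
  unfolding Metric_space.compactin_sequentially[OF Metric_space_phase]
  using assms by blast

lemma phase_compact_subset: "compactin (phase_topology \<gamma>) K \<Longrightarrow> K \<subseteq> phase_space \<gamma>"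
  unfolding Metric_space.compactin_sequentially[OF Metric_space_phase] by blast

lemma phase_limit_unique: "phase_limit \<gamma> x l \<Longrightarrow> phase_limit \<gamma> x m \<Longrightarrow> l = m"
  by (metis Metric_space.limitin_metric_unique[OF Metric_space_phase] trivial_limit_sequentially)

lemma phase_limit_subseq: fixes r :: "nat \<Rightarrow> nat" shows "phase_limit \<gamma> x l \<Longrightarrow> strict_mono r \<Longrightarrow> phase_limit \<gamma> (x \<circ> r) l"
  by (rule limitin_subsequence)

lemma phase_compact_closed:
  fixes x :: "nat \<Rightarrow> real \<Rightarrow> 'n::finite state"
  assumes K: "compactin (phase_topology \<gamma>) K" and lim: "phase_limit \<gamma> x l" and x: "\<And>k. x k \<in> K"
  shows "l \<in> K"
proof -
  obtain m r where "m \<in> K" "strict_mono r" "phase_limit \<gamma> (x \<circ> r) m"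
    using phase_compact_subseq[where x=x, OF K x] by blast
  then show ?thesis using phase_limit_unique phase_limit_subseq[OF lim] by blast
qed

lemma phase_limit_dist_tendsto:
  assumes "phase_limit \<gamma> x l" "\<And>k. x k \<in> phase_space \<gamma>"
  shows "(\<lambda>k. phase_dist \<gamma> (x k) l) \<longlonglongrightarrow> 0"
proof (rule LIMSEQ_I)
  fix e :: real assume "e > 0"
  then have "\<forall>\<^sub>F k in sequentially. phase_dist \<gamma> (x k) l < e"
    using assms(1) unfolding phase_limit_iff by (auto elim!: allE[of _ e] eventually_mono)
  then show "\<exists>no. \<forall>k\<ge>no. norm (phase_dist \<gamma> (x k) l - 0) < e"
    by (simp add: eventually_sequentially Metric_space.nonneg[OF Metric_space_phase])
qed

text \<open>Sequential form of attraction by a compact set: replace the points by almost nearest points of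
  the compact set and extract a convergent subsequence of those.\<close>

lemma attracted_subseq:
  fixes x :: "nat \<Rightarrow> real \<Rightarrow> 'n::finite state"
  assumes K: "compactin (phase_topology \<gamma>) K" and x: "\<And>k::nat. x k \<in> phase_space \<gamma>"
    and lim: "(\<lambda>k. INF b\<in>K. ennreal (phase_dist \<gamma> (x k) b)) \<longlonglongrightarrow> 0"
  obtains l r where "l \<in> K" "strict_mono r" "phase_limit \<gamma> (x \<circ> r) l"
proof -
  interpret Metric_space "phase_space \<gamma>" "phase_dist \<gamma>" by (rule Metric_space_phase)
  have KM: "K \<subseteq> phase_space \<gamma>" using K by (rule phase_compact_subset)
  have "\<forall>\<^sub>F k in sequentially. (INF b\<in>K. ennreal (phase_dist \<gamma> (x k) b)) < ennreal (1 / Suc n)" for n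
    using order_tendstoD(2)[OF lim, of "ennreal (1 / Suc n)"] by simp
  then have "\<exists>k0. \<forall>k\<ge>k0. (INF b\<in>K. ennreal (phase_dist \<gamma> (x k) b)) < ennreal (1 / Suc n)" for n
    by (simp add: eventually_sequentially)
  then obtain k0 where k0: "\<And>n k. k \<ge> k0 n \<Longrightarrow> (INF b\<in>K. ennreal (phase_dist \<gamma> (x k) b)) < ennreal (1 / Suc n)"
    by metis
  \<comment> \<open>The sum makes the sequence strictly increasing while staying above \<open>k0\<close>.\<close>
  define s where "s n = (\<Sum>i\<le>n. k0 i) + n" for n
  have s: "strict_mono s" by (auto simp: strict_mono_Suc_iff s_def)
  have sk: "s n \<ge> k0 n" for n
    unfolding s_def using member_le_sum[of n "{..n}" k0] by simp
  have "\<exists>b\<in>K. phase_dist \<gamma> (x (s n)) b < 1 / Suc n" for n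
    using k0[OF sk, of n] by (auto simp: INF_less_iff ennreal_less_iff)
  then obtain b where b: "\<And>n. b n \<in> K" "\<And>n. phase_dist \<gamma> (x (s n)) (b n) < 1 / Suc n" by metis
  obtain l and r :: "nat \<Rightarrow> nat" where lr: "l \<in> K" "strict_mono r" "phase_limit \<gamma> (b \<circ> r) l"
    using phase_compact_subseq[where x=b, OF K b(1)] by blast
  have "phase_limit \<gamma> (x \<circ> (s \<circ> r)) l"
    unfolding phase_limit_iff
  proof (intro conjI allI impI)
    show "l \<in> phase_space \<gamma>" using lr(1) KM by blast
    fix e :: real assume e: "e > 0"
    then obtain N where N: "1 / Suc N < e / 2" by (meson half_gt_zero nat_approx_posE)
    have "\<forall>\<^sub>F n in sequentially. phase_dist \<gamma> (b (r n)) l < e / 2"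
      using lr(3) e unfolding phase_limit_iff by (auto elim!: allE[of _ "e/2"] eventually_mono)
    then show "\<forall>\<^sub>F n in sequentially. (x \<circ> (s \<circ> r)) n \<in> phase_space \<gamma> \<and> phase_dist \<gamma> ((x \<circ> (s \<circ> r)) n) l < e"
      using eventually_ge_at_top[of N]
    proof eventually_elim
      case (elim n)
      have "r n \<ge> N" using elim(2) lr(2) by (meson order_trans seq_suble)
      then have "1 / Suc (r n) \<le> 1 / Suc N" by (simp add: frac_le)
      then have "phase_dist \<gamma> (x (s (r n))) (b (r n)) < e / 2" using b(2)[of "r n"] N by simp
      moreover have "phase_dist \<gamma> (x (s (r n))) l \<le> phase_dist \<gamma> (x (s (r n))) (b (r n)) + phase_dist \<gamma> (b (r n)) l"
        using x b(1) lr(1) KM by (intro triangle) auto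
      ultimately show ?case using elim(1) x by simp
    qed
  qed
  then show ?thesis using that[OF lr(1), of "s \<circ> r"] s lr(2) by (simp add: strict_mono_o)
qed

text \<open>The semidistance is a supremum over \<open>X i\<close>, so if it does not tend to \<open>0\<close>, there are indices
  tending along the filter and points of \<open>X i\<close> that stay away from \<open>Y\<close>; a subsequence converging into \<open>Y\<close>
  contradicts this.  The assumption \<open>freq\<close> expresses that failure of an eventual property is
  witnessed by a sequence, as for \<open>at_top\<close> and \<open>at_right 0\<close>.\<close>

lemma hsemidist_tendsto_0I:
  assumes freq: "\<And>P. \<not> eventually P F \<Longrightarrow> \<exists>s. filterlim s F sequentially \<and> (\<forall>n::nat. \<not> P (s n) \<and> Q (s n))"
    and X: "\<And>i::real. Q i \<Longrightarrow> X i \<subseteq> phase_space \<gamma>"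
    and sub: "\<And>s x. filterlim s F sequentially \<Longrightarrow> (\<And>n. Q (s n)) \<Longrightarrow> (\<And>n::nat. x n \<in> X (s n)) \<Longrightarrow>
          \<exists>l r. l \<in> Y \<and> strict_mono r \<and> phase_limit \<gamma> (x \<circ> r) l"
  shows "((\<lambda>i. hsemidist \<gamma> (X i) Y) \<longlongrightarrow> 0) F"
proof -
  have "\<forall>\<^sub>F i in F. hsemidist \<gamma> (X i) Y < e" if e: "e > 0" for e :: ennreal
  proof (rule ccontr)
    assume "\<not> ?thesis"
    then obtain s where s: "filterlim s F sequentially" "\<And>n. Q (s n)"
        and neg: "\<And>n::nat. \<not> hsemidist \<gamma> (X (s n)) Y < e"
      using freq by metis
    obtain d where d: "0 < d" "d < e" using e dense by blast
    have "\<exists>a\<in>X (s n). d < (INF b\<in>Y. ennreal (phase_dist \<gamma> a b))" for n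
    proof -
      have "d < (SUP a\<in>X (s n). INF b\<in>Y. ennreal (phase_dist \<gamma> a b))"
        using neg[of n] d(2) unfolding hsemidist_def by simp
      then show ?thesis by (simp add: less_SUP_iff)
    qed
    then obtain x where x: "\<And>n. x n \<in> X (s n)" "\<And>n. d < (INF b\<in>Y. ennreal (phase_dist \<gamma> (x n) b))"
      by metis
    have xM: "x n \<in> phase_space \<gamma>" for n using x(1) X s(2) by blast
    obtain l and r :: "nat \<Rightarrow> nat" where lr: "l \<in> Y" "strict_mono r" "phase_limit \<gamma> (x \<circ> r) l"
      using sub[where x=x, OF s x(1)] by blast
    have "(\<lambda>k. phase_dist \<gamma> ((x \<circ> r) k) l) \<longlonglongrightarrow> 0"
      using xM by (intro phase_limit_dist_tendsto[OF lr(3)]) auto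
    then have "(\<lambda>k. ennreal (phase_dist \<gamma> ((x \<circ> r) k) l)) \<longlonglongrightarrow> ennreal 0"
      by (rule tendsto_ennrealI)
    then have "\<forall>\<^sub>F k in sequentially. ennreal (phase_dist \<gamma> ((x \<circ> r) k) l) < d"
      using d(1) by (auto dest: order_tendstoD(2))
    then obtain k where "ennreal (phase_dist \<gamma> (x (r k)) l) < d"
      by (auto simp: eventually_sequentially)
    moreover have "(INF b\<in>Y. ennreal (phase_dist \<gamma> (x (r k)) b)) \<le> ennreal (phase_dist \<gamma> (x (r k)) l)"
      using lr(1) by (rule INF_lower)
    ultimately show False using x(2)[of "r k"] by simp
  qed
  then show ?thesis by (intro order_tendstoI) auto
qed

lemma not_eventually_at_top_seq:
  fixes P :: "real \<Rightarrow> bool"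
  assumes "\<not> eventually P at_top"
  shows "\<exists>s. filterlim s at_top sequentially \<and> (\<forall>n::nat. \<not> P (s n) \<and> 0 \<le> s n)"
proof -
  have "\<exists>x\<ge>real n. \<not> P x" for n :: nat
    using assms unfolding eventually_at_top_linorder by auto
  then obtain s where s: "\<And>n. s n \<ge> real n" "\<And>n. \<not> P (s n)" by metis
  have "filterlim s at_top sequentially"
    using s(1) by (intro filterlim_at_top_mono[OF filterlim_real_sequentially]) auto
  moreover have "0 \<le> s n" for n using s(1)[of n] by (meson of_nat_0_le_iff order_trans)
  ultimately show ?thesis using s(2) by blast
qed

lemma not_eventually_at_right_seq:
  fixes P :: "real \<Rightarrow> bool"
  assumes "\<not> eventually P (at_right 0)" "c > 0"
  shows "\<exists>s. filterlim s (at_right 0) sequentially \<and> (\<forall>n::nat. \<not> P (s n) \<and> s n \<in> {0<..c})"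
proof -
  have "\<exists>x>0. x < min c (1 / Suc n) \<and> \<not> P x" for n :: nat
  proof (rule ccontr)
    assume "\<not> ?thesis"
    then have "eventually P (at_right 0)"
      using assms(2) unfolding eventually_at_right_field by (intro exI[of _ "min c (1 / Suc n)"]) auto
    then show False using assms(1) by blast
  qed
  then obtain s where s: "\<And>n. s n > 0" "\<And>n. s n < min c (1 / Suc n)" "\<And>n. \<not> P (s n)" by metis
  have "s \<longlonglongrightarrow> 0"
  proof (rule tendsto_sandwich[OF _ _ tendsto_const LIMSEQ_inverse_real_of_nat])
    show "\<forall>\<^sub>F n in sequentially. s n \<le> inverse (real (Suc n))"
      using s(2) by (auto simp: inverse_eq_divide intro!: always_eventually less_imp_le)
  qed (use s(1) in \<open>auto intro!: always_eventually less_imp_le\<close>)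
  moreover have "s n \<noteq> 0" for n using s(1)[of n] by simp
  ultimately have "filterlim s (at_right 0) sequentially"
    using s(1) by (auto simp: filterlim_at intro!: always_eventually)
  then show ?thesis using s by (intro exI[of _ s]) (auto simp: less_imp_le)
qed

definition cocycle_on :: "real \<Rightarrow> (real \<Rightarrow> real \<Rightarrow> (real \<Rightarrow> 'n::finite state) \<Rightarrow> (real \<Rightarrow> 'n state) set) \<Rightarrow> bool" where
  "cocycle_on \<gamma> G \<longleftrightarrow> (\<forall>x\<in>phase_space \<gamma>. \<forall>s r t. s \<le> r \<longrightarrow> r \<le> t \<longrightarrow>
      G s s x = {x} \<and> G r s x \<subseteq> phase_space \<gamma> \<and> (\<Union>y\<in>G r s x. G t r y) = G t s x)"

definition closed_graph :: "real \<Rightarrow> (real \<Rightarrow> real \<Rightarrow> (real \<Rightarrow> 'n::finite state) \<Rightarrow> (real \<Rightarrow> 'n state) set) \<Rightarrow> bool" where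
  "closed_graph \<gamma> G \<longleftrightarrow> (\<forall>s t (x :: nat \<Rightarrow> _) y a b. s \<le> t \<longrightarrow> phase_limit \<gamma> x a \<longrightarrow> phase_limit \<gamma> y b \<longrightarrow>
     (\<forall>k. x k \<in> phase_space \<gamma> \<and> y k \<in> G t s (x k)) \<longrightarrow> b \<in> G t s a)"

lemma closed_graphD:
  fixes x y :: "nat \<Rightarrow> real \<Rightarrow> 'n::finite state"
  assumes "closed_graph \<gamma> G" "s \<le> t" "phase_limit \<gamma> x a" "phase_limit \<gamma> y b"
    "\<And>k. x k \<in> phase_space \<gamma>" "\<And>k. y k \<in> G t s (x k)"
  shows "b \<in> G t s a"
  using assms unfolding closed_graph_def by blast

text \<open>The points at time \<open>t\<close> that are reached from \<open>N s\<close> for every \<open>s \<le> t\<close>.  If \<open>G\<close> maps \<open>N s\<close> into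
  \<open>N t\<close>, this is a decreasing intersection as \<open>s \<rightarrow> -\<infinity>\<close>, the pullback limit set of the family \<open>N\<close>.\<close>

definition core :: "(real \<Rightarrow> real \<Rightarrow> (real \<Rightarrow> 'n::finite state) \<Rightarrow> (real \<Rightarrow> 'n state) set) \<Rightarrow> (real \<Rightarrow> (real \<Rightarrow> 'n state) set) \<Rightarrow> real \<Rightarrow> (real \<Rightarrow> 'n state) set" where
  "core G N t = (\<Inter>s\<in>{..t}. \<Union>x\<in>N s. G t s x)"

text \<open>Closedness of the graph and compactness of \<open>N s\<close> make each set in the intersection closed,
  which gives compactness.  For the inclusion of \<open>core G N t\<close> in the image of \<open>core G N s\<close>, write a
  point \<open>y\<close> as an image of \<open>b\<^sub>k\<close>, where \<open>b\<^sub>k\<close> itself is reached at time \<open>s\<close> from time \<open>s - k\<close>; an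
  accumulation point of \<open>b\<^sub>k\<close> is reached from every earlier time and is still mapped to \<open>y\<close>.\<close>

lemma core_invariant:
  assumes coc: "cocycle_on \<gamma> G" and cl: "closed_graph \<gamma> G"
    and N: "\<And>t. compactin (phase_topology \<gamma>) (N t)"
    and pos: "\<And>s t. s \<le> t \<Longrightarrow> (\<Union>x\<in>N s. G t s x) \<subseteq> N t"
  shows "compactin (phase_topology \<gamma>) (core G N t)"
    and "core G N t \<subseteq> N t"
    and "s \<le> t \<Longrightarrow> (\<Union>x\<in>core G N s. G t s x) = core G N t"
proof -
  have NM: "N t \<subseteq> phase_space \<gamma>" for t using N by (rule phase_compact_subset)
  have coc': "(\<Union>y\<in>(\<Union>x\<in>N s. G r s x). G t r y) = (\<Union>x\<in>N s. G t s x)" if "s \<le> r" "r \<le> t" for s r t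
  proof -
    have "(\<Union>y\<in>G r s x. G t r y) = G t s x" if "x \<in> N s" for x
      using coc \<open>s \<le> r\<close> \<open>r \<le> t\<close> subsetD[OF NM that] unfolding cocycle_on_def by simp
    then show ?thesis by (simp add: UN_UN_flatten)
  qed
  have closed: "l \<in> (\<Union>x\<in>N s. G t s x)"
    if st: "s \<le> t" and yl: "phase_limit \<gamma> y l" and y: "\<And>k::nat. y k \<in> (\<Union>x\<in>N s. G t s x)" for s t y l
  proof -
    have "\<exists>x. x \<in> N s \<and> y k \<in> G t s x" for k using y[of k] by blast
    then obtain x where x: "\<And>k. x k \<in> N s" "\<And>k. y k \<in> G t s (x k)" by metis
    obtain a r where ar: "a \<in> N s" "strict_mono r" "phase_limit \<gamma> (x \<circ> r) a"
      using phase_compact_subseq[where x=x, OF N x(1)] by blast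
    have "phase_limit \<gamma> (y \<circ> r) l" using phase_limit_subseq[OF yl ar(2)] .
    then have "l \<in> G t s a"
    proof (rule closed_graphD[OF cl st ar(3)])
      show "(x \<circ> r) k \<in> phase_space \<gamma>" for k using x(1)[of "r k"] NM by auto
      show "(y \<circ> r) k \<in> G t s ((x \<circ> r) k)" for k using x(2)[of "r k"] by simp
    qed
    then show ?thesis using ar(1) by blast
  qed
  show sub: "core G N t \<subseteq> N t" for t
  proof -
    have "core G N t \<subseteq> (\<Union>x\<in>N t. G t t x)" unfolding core_def by (rule INT_lower) simp
    then show ?thesis using pos[of t t] by simp
  qed
  show "compactin (phase_topology \<gamma>) (core G N t)"
  proof (rule phase_compactI)
    show "core G N t \<subseteq> phase_space \<gamma>" using sub NM by blast
    fix x :: "nat \<Rightarrow> _" assume x: "\<And>k. x k \<in> core G N t"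
    then have xN: "x k \<in> N t" for k using sub by blast
    obtain l and r :: "nat \<Rightarrow> nat" where lr: "l \<in> N t" "strict_mono r" "phase_limit \<gamma> (x \<circ> r) l"
      using phase_compact_subseq[where x=x, OF N xN] by blast
    have "l \<in> core G N t" unfolding core_def
    proof
      fix s assume "s \<in> {..t}"
      then show "l \<in> (\<Union>x\<in>N s. G t s x)"
        using x by (intro closed[OF _ lr(3)]) (auto simp: core_def)
    qed
    then show "\<exists>l r. l \<in> core G N t \<and> strict_mono r \<and> phase_limit \<gamma> (x \<circ> r) l" using lr by blast
  qed
  show "(\<Union>x\<in>core G N s. G t s x) = core G N t" if st: "s \<le> t"
  proof
    show "(\<Union>x\<in>core G N s. G t s x) \<subseteq> core G N t"
    proof
      fix y assume "y \<in> (\<Union>x\<in>core G N s. G t s x)"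
      then obtain x where x: "x \<in> core G N s" "y \<in> G t s x" by blast
      show "y \<in> core G N t" unfolding core_def
      proof
        fix r assume r: "r \<in> {..t}"
        show "y \<in> (\<Union>x\<in>N r. G t r x)"
        proof (cases "r \<le> s")
          case True
          then have "x \<in> (\<Union>x\<in>N r. G s r x)" using x(1) unfolding core_def by blast
          then show ?thesis using coc'[OF True st] x(2) by blast
        next
          case False
          then have sr: "s \<le> r" "r \<le> t" using r by auto
          have "y \<in> (\<Union>y\<in>(\<Union>x\<in>N s. G r s x). G t r y)"
            unfolding coc'[OF sr] using x sub[of s] by blast
          then show ?thesis using pos[OF sr(1)] by blast
        qed
      qed
    qed
    show "core G N t \<subseteq> (\<Union>x\<in>core G N s. G t s x)"
    proof
      fix y assume y: "y \<in> core G N t"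
      have "\<exists>b. b \<in> (\<Union>x\<in>N (s - real k). G s (s - real k) x) \<and> y \<in> G t s b" for k :: nat
      proof -
        have "y \<in> (\<Union>x\<in>N (s - real k). G t (s - real k) x)" using y st unfolding core_def by auto
        then have "y \<in> (\<Union>b\<in>(\<Union>x\<in>N (s - real k). G s (s - real k) x). G t s b)"
          by (subst coc') (use st in auto)
        then show ?thesis by blast
      qed
      then obtain b where b: "\<And>k. b k \<in> (\<Union>x\<in>N (s - real k). G s (s - real k) x)" "\<And>k. y \<in> G t s (b k)"
        by metis
      have bN: "b k \<in> N s" for k using b(1)[of k] pos[of "s - real k" s] by auto
      obtain l and r :: "nat \<Rightarrow> nat" where lr: "l \<in> N s" "strict_mono r" "phase_limit \<gamma> (b \<circ> r) l"
        using phase_compact_subseq[where x=b, OF N bN] by blast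
      have "l \<in> core G N s" unfolding core_def
      proof
        fix q assume q: "q \<in> {..s}"
        obtain k0 :: nat where k0: "real k0 \<ge> s - q" using real_arch_simple by blast
        have 1: "phase_limit \<gamma> (b \<circ> (r \<circ> (\<lambda>k. k + k0))) l"
          using phase_limit_subseq[OF lr(3), of "\<lambda>k. k + k0"] by (simp add: comp_assoc strict_mono_def)
        have 2: "(b \<circ> (r \<circ> (\<lambda>k. k + k0))) k \<in> (\<Union>x\<in>N q. G s q x)" for k
        proof -
          define m where "m = r (k + k0)"
          have "m \<ge> k0" unfolding m_def using seq_suble[OF lr(2), of "k + k0"] by simp
          then have m: "s - real m \<le> q" using k0 by linarith
          have "b m \<in> (\<Union>y\<in>(\<Union>x\<in>N (s - real m). G q (s - real m) x). G s q y)"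
            using b(1)[of m] m q by (subst coc') auto
          then obtain z where "z \<in> (\<Union>x\<in>N (s - real m). G q (s - real m) x)" "b m \<in> G s q z" by blast
          then have "z \<in> N q" "b m \<in> G s q z" using pos[OF m] by blast+
          then show ?thesis unfolding m_def comp_def by (intro UN_I)
        qed
        show "l \<in> (\<Union>x\<in>N q. G s q x)"
          by (rule closed[OF _ 1 2]) (use q in simp)
      qed
      moreover have "y \<in> G t s l"
      proof -
        have yN: "y \<in> phase_space \<gamma>" using y sub NM by blast
        then have "phase_limit \<gamma> (\<lambda>k. y) y"
          unfolding phase_limit_iff using Metric_space.mdist_zero[OF Metric_space_phase yN] by simp
        then show ?thesis
        proof (rule closed_graphD[OF cl st lr(3)])
          show "(b \<circ> r) k \<in> phase_space \<gamma>" for k using bN[of "r k"] NM by auto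
          show "y \<in> G t s ((b \<circ> r) k)" for k using b(2)[of "r k"] by simp
        qed
      qed
      ultimately show "y \<in> (\<Union>x\<in>core G N s. G t s x)" by blast
    qed
  qed
qed

text \<open>The union of the attractor with a compact invariant family is compact, invariant and attracts
  at least as well, so it is an attractor and equals the given one.\<close>

lemma unique_attractor_maximal:
  fixes G :: "real \<Rightarrow> real \<Rightarrow> (real \<Rightarrow> 'n::finite state) \<Rightarrow> (real \<Rightarrow> 'n state) set"
  assumes ex1: "\<exists>!K. is_pullback_attractor \<gamma> G K"
    and C: "\<And>t. compactin (phase_topology \<gamma>) (C t)"
    and inv: "\<And>s t. s \<le> t \<Longrightarrow> (\<Union>x\<in>C s. G t s x) = C t"
  shows "C t \<subseteq> pullback_attractor \<gamma> G t"
proof -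
  define K where "K = pullback_attractor \<gamma> G"
  have K: "is_pullback_attractor \<gamma> G K"
    unfolding K_def pullback_attractor_def by (rule theI'[OF ex1])
  have "is_pullback_attractor \<gamma> G (\<lambda>t. K t \<union> C t)"
    unfolding is_pullback_attractor_def
  proof (intro conjI allI impI ballI)
    show "compactin (phase_topology \<gamma>) (K t \<union> C t)" for t
      using K C unfolding is_pullback_attractor_def by (intro compactin_Un) auto
    show "(\<Union>x\<in>K s \<union> C s. G t s x) = K t \<union> C t" if "s \<le> t" for s t
      using K inv[OF that] that unfolding is_pullback_attractor_def by (simp add: UN_Un)
    fix D :: "real \<Rightarrow> (real \<Rightarrow> 'n state) set" and t assume D: "D \<in> bounded_families \<gamma>"
    show "((\<lambda>\<tau>. hsemidist \<gamma> (\<Union>u0\<in>D (t - \<tau>). G t (t - \<tau>) u0) (K t \<union> C t)) \<longlongrightarrow> 0) at_top"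
    proof (rule tendsto_sandwich[OF _ _ tendsto_const])
      show "((\<lambda>\<tau>. hsemidist \<gamma> (\<Union>u0\<in>D (t - \<tau>). G t (t - \<tau>) u0) (K t)) \<longlongrightarrow> 0) at_top"
        using K D unfolding is_pullback_attractor_def by blast
      show "\<forall>\<^sub>F \<tau> in at_top. hsemidist \<gamma> (\<Union>u0\<in>D (t - \<tau>). G t (t - \<tau>) u0) (K t \<union> C t)
          \<le> hsemidist \<gamma> (\<Union>u0\<in>D (t - \<tau>). G t (t - \<tau>) u0) (K t)"
        unfolding hsemidist_def by (intro always_eventually allI SUP_mono' INF_superset_mono) auto
    qed simp
  qed
  then have "(\<lambda>t. K t \<union> C t) = K" using ex1 K by blast
  then show ?thesis unfolding K_def by (metis Un_upper2)
qed

lemma attractor_subseq: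
  fixes x b :: "nat \<Rightarrow> real \<Rightarrow> 'n::finite state"
  assumes K: "is_pullback_attractor \<gamma> G K" and D: "D \<in> bounded_families \<gamma>"
    and \<tau>: "filterlim \<tau> at_top sequentially"
    and b: "\<And>k. b k \<in> D (t - \<tau> k)" and x: "\<And>k. x k \<in> G t (t - \<tau> k) (b k)"
    and xM: "\<And>k. x k \<in> phase_space \<gamma>"
  obtains l r where "l \<in> K t" "strict_mono (r :: nat \<Rightarrow> nat)" "phase_limit \<gamma> (x \<circ> r) l"
proof (rule attracted_subseq[where x=x and K="K t" and \<gamma>=\<gamma>])
  show "compactin (phase_topology \<gamma>) (K t)" using K unfolding is_pullback_attractor_def by blast
  have lim: "((\<lambda>\<tau>. hsemidist \<gamma> (\<Union>u0\<in>D (t - \<tau>). G t (t - \<tau>) u0) (K t)) \<longlongrightarrow> 0) at_top"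
    using K D unfolding is_pullback_attractor_def by blast
  show "(\<lambda>k. INF b\<in>K t. ennreal (phase_dist \<gamma> (x k) b)) \<longlonglongrightarrow> 0"
  proof (rule tendsto_sandwich[OF _ _ tendsto_const])
    show "(\<lambda>k. hsemidist \<gamma> (\<Union>u0\<in>D (t - \<tau> k). G t (t - \<tau> k) u0) (K t)) \<longlonglongrightarrow> 0"
      using filterlim_compose[OF lim \<tau>] .
    have "(INF b\<in>K t. ennreal (phase_dist \<gamma> (x k) b)) \<le> hsemidist \<gamma> (\<Union>u0\<in>D (t - \<tau> k). G t (t - \<tau> k) u0) (K t)" for k
      unfolding hsemidist_def using b[of k] x[of k] by (intro SUP_upper) blast
    then show "\<forall>\<^sub>F k in sequentially. (INF b\<in>K t. ennreal (phase_dist \<gamma> (x k) b))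
       \<le> hsemidist \<gamma> (\<Union>u0\<in>D (t - \<tau> k). G t (t - \<tau> k) u0) (K t)" by simp
  qed simp
qed (use xM that in auto)

lemma bounded_families_subset: "D \<in> bounded_families \<gamma> \<Longrightarrow> D t \<subseteq> phase_space \<gamma>"
  unfolding bounded_families_def phase_cball_def by blast

text \<open>Let \<open>N\<close> be the intersection of the attractors \<open>K\<close> of \<open>G\<close> and \<open>L\<close> of \<open>H\<close>.  Orbits of \<open>G\<close> are
  attracted by both, so at every intermediate time \<open>q\<close> a pulled back orbit accumulates in \<open>N q\<close>, and
  its accumulation points at time \<open>t\<close> are reached from \<open>N q\<close>.  Hence \<open>core G N\<close> attracts bounded
  families; it is an attractor of \<open>G\<close>, equals \<open>K\<close> by uniqueness, and is contained in \<open>L\<close>.\<close>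

lemma attractor_subset:
  fixes G H :: "real \<Rightarrow> real \<Rightarrow> (real \<Rightarrow> 'n::finite state) \<Rightarrow> (real \<Rightarrow> 'n state) set"
  assumes coc: "cocycle_on \<gamma> G" and cl: "closed_graph \<gamma> G"
    and ex1: "\<exists>!K. is_pullback_attractor \<gamma> G K"
    and L: "is_pullback_attractor \<gamma> H L"
    and GH: "\<And>s t x. s \<le> t \<Longrightarrow> x \<in> phase_space \<gamma> \<Longrightarrow> G t s x \<subseteq> H t s x"
  shows "pullback_attractor \<gamma> G t \<subseteq> L t"
proof -
  define K where "K = pullback_attractor \<gamma> G"
  have K: "is_pullback_attractor \<gamma> G K"
    unfolding K_def pullback_attractor_def by (rule theI'[OF ex1])
  define N where "N t = K t \<inter> L t" for t
  have Kc: "compactin (phase_topology \<gamma>) (K t)" for t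
    using K by (simp add: is_pullback_attractor_def)
  have Lc: "compactin (phase_topology \<gamma>) (L t)" for t
    using L by (simp add: is_pullback_attractor_def)
  have Nc: "compactin (phase_topology \<gamma>) (N t)" for t
  proof (rule phase_compactI)
    show "N t \<subseteq> phase_space \<gamma>" using phase_compact_subset[OF Kc] unfolding N_def by blast
    fix x :: "nat \<Rightarrow> _" assume x: "\<And>k. x k \<in> N t"
    then have xK: "x k \<in> K t" and xL: "x k \<in> L t" for k unfolding N_def by auto
    obtain l r where lr: "l \<in> K t" "strict_mono (r :: nat \<Rightarrow> nat)" "phase_limit \<gamma> (x \<circ> r) l"
      using phase_compact_subseq[where x=x, OF Kc xK] by blast
    have "l \<in> L t" by (rule phase_compact_closed[OF Lc lr(3)]) (use xL in auto)
    then show "\<exists>l r. l \<in> N t \<and> strict_mono r \<and> phase_limit \<gamma> (x \<circ> r) l"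
      using lr unfolding N_def by blast
  qed
  have pos: "(\<Union>x\<in>N s. G t s x) \<subseteq> N t" if st: "s \<le> t" for s t
  proof -
    have "(\<Union>x\<in>K s. G t s x) = K t" "(\<Union>x\<in>L s. H t s x) = L t"
      using K L st by (simp_all add: is_pullback_attractor_def)
    moreover have "G t s x \<subseteq> H t s x" if "x \<in> N s" for x
      using GH[OF st subsetD[OF phase_compact_subset[OF Nc] that]] .
    ultimately show ?thesis unfolding N_def by fast
  qed
  have core1: "compactin (phase_topology \<gamma>) (core G N t)" for t
    by (rule core_invariant(1)[OF coc cl Nc]) (rule pos)
  have core2: "core G N t \<subseteq> N t" for t
    by (rule core_invariant(2)[OF coc cl Nc]) (rule pos)
  have core3: "(\<Union>x\<in>core G N s. G t s x) = core G N t" if "s \<le> t" for s t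
    by (rule core_invariant(3)[OF coc cl Nc _ that]) (rule pos)
  have "is_pullback_attractor \<gamma> G (core G N)"
    unfolding is_pullback_attractor_def
  proof (intro conjI allI impI ballI)
    show "compactin (phase_topology \<gamma>) (core G N t)" for t by (rule core1)
    show "(\<Union>x\<in>core G N s. G t s x) = core G N t" if "s \<le> t" for s t using that by (rule core3)
    fix D :: "real \<Rightarrow> (real \<Rightarrow> 'n state) set" and t assume D: "D \<in> bounded_families \<gamma>"
    have GM: "G t s x \<subseteq> phase_space \<gamma>" if "s \<le> t" "x \<in> phase_space \<gamma>" for s t x
      using coc that unfolding cocycle_on_def by (meson order_refl)
    show "((\<lambda>\<tau>. hsemidist \<gamma> (\<Union>u0\<in>D (t - \<tau>). G t (t - \<tau>) u0) (core G N t)) \<longlongrightarrow> 0) at_top"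
    proof (rule hsemidist_tendsto_0I[where Q="\<lambda>\<tau>. 0 \<le> \<tau>"])
      show "\<exists>s. filterlim s at_top sequentially \<and> (\<forall>n::nat. \<not> P (s n) \<and> 0 \<le> s n)"
        if "\<not> eventually P at_top" for P :: "real \<Rightarrow> bool"
        using that by (rule not_eventually_at_top_seq)
      show "(\<Union>u0\<in>D (t - \<tau>). G t (t - \<tau>) u0) \<subseteq> phase_space \<gamma>" if "0 \<le> \<tau>" for \<tau>
        using GM[of "t - \<tau>" t] bounded_families_subset[OF D, of "t - \<tau>"] that by auto
      fix s :: "nat \<Rightarrow> real" and x
      assume s: "filterlim s at_top sequentially" "\<And>n. 0 \<le> s n"
        and x: "\<And>n::nat. x n \<in> (\<Union>u0\<in>D (t - s n). G t (t - s n) u0)"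
      have "\<exists>b. b \<in> D (t - s n) \<and> x n \<in> G t (t - s n) b" for n using x[of n] by blast
      then obtain b where b: "\<And>n. b n \<in> D (t - s n)" "\<And>n. x n \<in> G t (t - s n) (b n)" by metis
      have bM: "b n \<in> phase_space \<gamma>" for n using b(1) bounded_families_subset[OF D] by blast
      have xM: "x n \<in> phase_space \<gamma>" for n using GM[of "t - s n" t "b n"] s(2)[of n] b(2) bM by auto
      obtain l r where lr: "l \<in> K t" "strict_mono (r :: nat \<Rightarrow> nat)" "phase_limit \<gamma> (x \<circ> r) l"
        by (rule attractor_subseq[OF K D s(1) b xM])
      have "l \<in> core G N t" unfolding core_def
      proof
        fix q assume q: "q \<in> {..t}"
        have "\<forall>\<^sub>F n in sequentially. s n \<ge> t - q" using s(1) by (auto simp: filterlim_at_top)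
        then obtain n0 where n0: "\<And>n. n \<ge> n0 \<Longrightarrow> s n \<ge> t - q" by (auto simp: eventually_sequentially)
        define \<rho> where "\<rho> k = r (k + n0)" for k
        have \<rho>: "strict_mono \<rho>" using lr(2) unfolding \<rho>_def by (simp add: strict_mono_def)
        have s\<rho>: "t - s (\<rho> k) \<le> q" for k
          using n0[of "\<rho> k"] seq_suble[OF lr(2), of "k + n0"] unfolding \<rho>_def by simp
        have "\<exists>y. y \<in> G q (t - s (\<rho> k)) (b (\<rho> k)) \<and> x (\<rho> k) \<in> G t q y" for k
        proof -
          have "(\<Union>y\<in>G q (t - s (\<rho> k)) (b (\<rho> k)). G t q y) = G t (t - s (\<rho> k)) (b (\<rho> k))"
            using coc bM s\<rho>[of k] q unfolding cocycle_on_def by simp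
          then show ?thesis using b(2)[of "\<rho> k"] by blast
        qed
        then obtain y where y: "\<And>k. y k \<in> G q (t - s (\<rho> k)) (b (\<rho> k))" "\<And>k. x (\<rho> k) \<in> G t q (y k)"
          by metis
        have yM: "y k \<in> phase_space \<gamma>" for k using GM[OF s\<rho> bM] y(1) by blast
        \<comment> \<open>Time elapsed at the intermediate time \<open>q\<close> since the start of the orbit.\<close>
        define \<sigma> where "\<sigma> k = q - t + s (\<rho> k)" for k
        have \<sigma>: "filterlim \<sigma> at_top sequentially"
          unfolding \<sigma>_def
          by (intro filterlim_tendsto_add_at_top[OF tendsto_const])
             (rule filterlim_compose[OF s(1) filterlim_subseq[OF \<rho>]])
        have q\<sigma>: "q - \<sigma> k = t - s (\<rho> k)" for k by (simp add: \<sigma>_def)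
        obtain m r1 where m: "m \<in> K q" "strict_mono (r1 :: nat \<Rightarrow> nat)" "phase_limit \<gamma> (y \<circ> r1) m"
          by (rule attractor_subseq[OF K D \<sigma>, of "b \<circ> \<rho>" q y]) (use b y yM in \<open>auto simp: q\<sigma>\<close>)
        have \<sigma>1: "filterlim (\<sigma> \<circ> r1) at_top sequentially"
          using filterlim_compose[OF \<sigma> filterlim_subseq[OF m(2)]] by (simp add: comp_def)
        have yH: "y k \<in> H q (t - s (\<rho> k)) (b (\<rho> k))" for k
          using y(1) GH[OF s\<rho> bM] by blast
        obtain m' r2 where m': "m' \<in> L q" "strict_mono (r2 :: nat \<Rightarrow> nat)" "phase_limit \<gamma> (y \<circ> r1 \<circ> r2) m'"
          by (rule attractor_subseq[OF L D \<sigma>1, of "b \<circ> \<rho> \<circ> r1" q "y \<circ> r1"])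
             (use b yH yM in \<open>auto simp: q\<sigma>\<close>)
        have "m' = m" using phase_limit_unique[OF m'(3) phase_limit_subseq[OF m(3) m'(2)]] .
        then have "m \<in> N q" using m m' unfolding N_def by simp
        moreover have "l \<in> G t q m"
        proof (rule closed_graphD[OF cl _ m(3)])
          show "q \<le> t" using q by simp
          show "phase_limit \<gamma> (x \<circ> r \<circ> (\<lambda>k. k + n0) \<circ> r1) l"
            by (intro phase_limit_subseq lr m) (simp add: strict_mono_def)
          show "(y \<circ> r1) k \<in> phase_space \<gamma>" for k using yM by simp
          show "(x \<circ> r \<circ> (\<lambda>k. k + n0) \<circ> r1) k \<in> G t q ((y \<circ> r1) k)" for k
            using y(2)[of "r1 k"] by (simp add: \<rho>_def)
        qed
        ultimately show "l \<in> (\<Union>x\<in>N q. G t q x)" by blast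
      qed
      then show "\<exists>l r. l \<in> core G N t \<and> strict_mono r \<and> phase_limit \<gamma> (x \<circ> r) l" using lr by blast
    qed
  qed
  then have "core G N = K" using ex1 K by blast
  then show ?thesis using core2[of t] unfolding N_def K_def by auto
qed

text \<open>The abstract form of the result.  The attractors of the intermediate processes \<open>H \<delta>\<close> serve only as
  compact sets that contain the attractors of all \<open>G \<epsilon>\<close> with \<open>\<epsilon> \<le> \<delta>\<close>; this supplies the
  precompactness that is uniform in \<open>\<epsilon>\<close>.\<close>

theorem attractors_upper_semicontinuous:
  fixes G H :: "real \<Rightarrow> real \<Rightarrow> real \<Rightarrow> (real \<Rightarrow> 'n::finite state) \<Rightarrow> (real \<Rightarrow> 'n state) set"
  assumes c: "c > 0"
    and cocG: "\<And>\<epsilon>. \<epsilon> \<in> {0<..c} \<Longrightarrow> cocycle_on \<gamma> (G \<epsilon>)" and clG: "\<And>\<epsilon>. \<epsilon> \<in> {0<..c} \<Longrightarrow> closed_graph \<gamma> (G \<epsilon>)"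
    and cocH: "cocycle_on \<gamma> (H 0)" and clH: "closed_graph \<gamma> (H 0)"
    and GH: "\<And>\<epsilon> \<delta> s t x. 0 < \<epsilon> \<Longrightarrow> \<epsilon> \<le> \<delta> \<Longrightarrow> \<delta> \<le> c \<Longrightarrow> s \<le> t \<Longrightarrow> x \<in> phase_space \<gamma> \<Longrightarrow> G \<epsilon> t s x \<subseteq> H \<delta> t s x"
    and HH: "\<And>\<delta> s t x. 0 < \<delta> \<Longrightarrow> \<delta> \<le> c \<Longrightarrow> s \<le> t \<Longrightarrow> x \<in> phase_space \<gamma> \<Longrightarrow> H 0 t s x \<subseteq> H \<delta> t s x"
    and lim: "\<And>\<epsilon> s t (x :: nat \<Rightarrow> _) y a b. filterlim \<epsilon> (at_right 0) sequentially \<Longrightarrow> (\<And>k. \<epsilon> k \<in> {0<..c}) \<Longrightarrow>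
       s \<le> t \<Longrightarrow> phase_limit \<gamma> x a \<Longrightarrow> phase_limit \<gamma> y b \<Longrightarrow> (\<And>k. x k \<in> phase_space \<gamma>) \<Longrightarrow>
       (\<And>k. y k \<in> G (\<epsilon> k) t s (x k)) \<Longrightarrow> b \<in> H 0 t s a"
    and exH: "\<And>\<epsilon>. \<epsilon> \<in> {0..c} \<Longrightarrow> \<exists>!K. is_pullback_attractor \<gamma> (H \<epsilon>) K"
    and exG: "\<And>\<epsilon>. \<epsilon> \<in> {0<..c} \<Longrightarrow> \<exists>!K. is_pullback_attractor \<gamma> (G \<epsilon>) K"
  shows "((\<lambda>\<epsilon>. hsemidist \<gamma> (pullback_attractor \<gamma> (G \<epsilon>) t) (pullback_attractor \<gamma> (H 0) t)) \<longlongrightarrow> 0) (at_right 0)"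
proof -
  define KG where "KG \<epsilon> = pullback_attractor \<gamma> (G \<epsilon>)" for \<epsilon>
  define KH where "KH \<epsilon> = pullback_attractor \<gamma> (H \<epsilon>)" for \<epsilon>
  have KG: "is_pullback_attractor \<gamma> (G \<epsilon>) (KG \<epsilon>)" if "\<epsilon> \<in> {0<..c}" for \<epsilon>
    unfolding KG_def pullback_attractor_def by (rule theI'[OF exG[OF that]])
  have KH: "is_pullback_attractor \<gamma> (H \<epsilon>) (KH \<epsilon>)" if "\<epsilon> \<in> {0..c}" for \<epsilon>
    unfolding KH_def pullback_attractor_def by (rule theI'[OF exH[OF that]])
  have KHc: "compactin (phase_topology \<gamma>) (KH \<epsilon> t)" if "\<epsilon> \<in> {0..c}" for \<epsilon> t
    using KH[OF that] unfolding is_pullback_attractor_def by blast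
  have KGM: "KG \<epsilon> t \<subseteq> phase_space \<gamma>" if "\<epsilon> \<in> {0<..c}" for \<epsilon> t
    using KG[OF that] phase_compact_subset unfolding is_pullback_attractor_def by blast
  have KGH: "KG \<epsilon> t \<subseteq> KH \<delta> t" if "0 < \<epsilon>" "\<epsilon> \<le> \<delta>" "\<delta> \<le> c" for \<epsilon> \<delta> t
    unfolding KG_def
    by (rule attractor_subset[OF cocG clG exG KH]) (use that GH in auto)
  define N where "N t = (\<Inter>\<delta>\<in>{0<..c}. KH \<delta> t)" for t
  \<comment> \<open>A sequence that is eventually in each of the decreasing compact sets accumulates in their intersection.\<close>
  have limN: "\<exists>l r. l \<in> N t \<and> strict_mono r \<and> phase_limit \<gamma> (x \<circ> r) l"
    if x: "\<And>\<delta>. \<delta> \<in> {0<..c} \<Longrightarrow> \<forall>\<^sub>F k in sequentially. x k \<in> KH \<delta> t" for x t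
  proof -
    obtain k0 where k0: "\<And>k. k \<ge> k0 \<Longrightarrow> x k \<in> KH c t"
      using x[of c] c by (auto simp: eventually_sequentially)
    obtain l r where lr: "l \<in> KH c t" "strict_mono (r :: nat \<Rightarrow> nat)" "phase_limit \<gamma> ((\<lambda>k. x (k + k0)) \<circ> r) l"
      by (rule phase_compact_subseq[where x="\<lambda>k. x (k + k0)", OF KHc[of c t]]) (use k0 c in auto)
    define r' where "r' k = r k + k0" for k
    have r': "strict_mono r'" using lr(2) unfolding r'_def by (simp add: strict_mono_def)
    have xr': "phase_limit \<gamma> (x \<circ> r') l" using lr(3) by (simp add: r'_def comp_def)
    have "l \<in> N t" unfolding N_def
    proof
      fix \<delta> assume \<delta>: "\<delta> \<in> {0<..c}"
      obtain k1 where k1: "\<And>k. k \<ge> k1 \<Longrightarrow> x k \<in> KH \<delta> t"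
        using x[OF \<delta>] by (auto simp: eventually_sequentially)
      show "l \<in> KH \<delta> t"
      proof (rule phase_compact_closed[OF KHc])
        show "phase_limit \<gamma> (x \<circ> r' \<circ> (\<lambda>k. k + k1)) l"
          by (rule phase_limit_subseq[OF xr']) (simp add: strict_mono_def)
        show "(x \<circ> r' \<circ> (\<lambda>k. k + k1)) k \<in> KH \<delta> t" for k
          using k1[of "r' (k + k1)"] seq_suble[OF r', of "k + k1"] by simp
      qed (use \<delta> in auto)
    qed
    then show ?thesis using r' xr' by blast
  qed
  have Nc: "compactin (phase_topology \<gamma>) (N t)" for t
  proof (rule phase_compactI)
    show "N t \<subseteq> phase_space \<gamma>" using phase_compact_subset[OF KHc[of c t]] c unfolding N_def by force
    show "\<exists>l r. l \<in> N t \<and> strict_mono r \<and> phase_limit \<gamma> (x \<circ> r) l" if "\<And>k. x k \<in> N t" for x :: "nat \<Rightarrow> _"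
      using that by (intro limN always_eventually) (auto simp: N_def)
  qed
  have pos: "(\<Union>x\<in>N s. H 0 t s x) \<subseteq> N t" if st: "s \<le> t" for s t
  proof -
    have "y \<in> KH \<delta> t" if x: "x \<in> N s" "y \<in> H 0 t s x" and \<delta>: "\<delta> \<in> {0<..c}" for x y \<delta>
    proof -
      have "x \<in> KH \<delta> s" using x(1) \<delta> unfolding N_def by blast
      moreover have "y \<in> H \<delta> t s x"
        using HH[of \<delta> s t x] st \<delta> x phase_compact_subset[OF Nc] by auto
      moreover have "(\<Union>x\<in>KH \<delta> s. H \<delta> t s x) = KH \<delta> t"
        using KH[of \<delta>] \<delta> st unfolding is_pullback_attractor_def by auto
      ultimately show ?thesis by blast
    qed
    then show ?thesis unfolding N_def by blast
  qed
  have core1: "compactin (phase_topology \<gamma>) (core (H 0) N t)" for t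
    by (rule core_invariant(1)[OF cocH clH Nc]) (rule pos)
  have core2: "core (H 0) N t \<subseteq> N t" for t
    by (rule core_invariant(2)[OF cocH clH Nc]) (rule pos)
  have core3: "(\<Union>x\<in>core (H 0) N s. (H 0) t s x) = core (H 0) N t" if "s \<le> t" for s t
    by (rule core_invariant(3)[OF cocH clH Nc _ that]) (rule pos)
  have coreK: "core (H 0) N t \<subseteq> KH 0 t"
    unfolding KH_def using core1 core3 exH[of 0] c by (intro unique_attractor_maximal) auto
  have "((\<lambda>\<epsilon>. hsemidist \<gamma> (KG \<epsilon> t) (KH 0 t)) \<longlongrightarrow> 0) (at_right 0)"
  proof (rule hsemidist_tendsto_0I[where Q="\<lambda>\<epsilon>. \<epsilon> \<in> {0<..c}"])
    show "\<exists>s. filterlim s (at_right 0) sequentially \<and> (\<forall>n::nat. \<not> P (s n) \<and> s n \<in> {0<..c})"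
      if "\<not> eventually P (at_right 0)" for P :: "real \<Rightarrow> bool"
      using not_eventually_at_right_seq[OF that c] .
    show "KG \<epsilon> t \<subseteq> phase_space \<gamma>" if "\<epsilon> \<in> {0<..c}" for \<epsilon> using KGM[OF that] .
    fix \<epsilon> :: "nat \<Rightarrow> real" and x
    assume \<epsilon>: "filterlim \<epsilon> (at_right 0) sequentially" "\<And>n. \<epsilon> n \<in> {0<..c}" and x: "\<And>n::nat. x n \<in> KG (\<epsilon> n) t"
    have evN: "\<forall>\<^sub>F k in sequentially. z k \<in> KH \<delta> q"
      if \<delta>: "\<delta> \<in> {0<..c}" and \<eta>: "filterlim \<eta> (at_right 0) sequentially" "\<And>n. \<eta> n \<in> {0<..c}"
        and z: "\<And>n::nat. z n \<in> KG (\<eta> n) q" for \<delta> q z and \<eta> :: "nat \<Rightarrow> real"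
    proof -
      have "\<eta> \<longlonglongrightarrow> 0" using \<eta>(1) by (simp add: filterlim_at)
      then have "\<forall>\<^sub>F k in sequentially. \<eta> k < \<delta>" using \<delta> by (auto dest: order_tendstoD(2))
      then show ?thesis
      proof eventually_elim
        case (elim k)
        then show ?case using KGH[of "\<eta> k" \<delta> q] \<eta>(2)[of k] \<delta> z[of k] by auto
      qed
    qed
    obtain l r where lr: "l \<in> N t" "strict_mono (r :: nat \<Rightarrow> nat)" "phase_limit \<gamma> (x \<circ> r) l"
      using limN[where x=x, OF evN[where z=x, OF _ \<epsilon> x]] by blast
    have \<epsilon>r: "filterlim (\<epsilon> \<circ> r) (at_right 0) sequentially"
      using filterlim_compose[OF \<epsilon>(1) filterlim_subseq[OF lr(2)]] by (simp add: comp_def)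
    have "l \<in> core (H 0) N t" unfolding core_def
    proof
      fix q assume q: "q \<in> {..t}"
      have "\<exists>y. y \<in> KG (\<epsilon> (r k)) q \<and> x (r k) \<in> G (\<epsilon> (r k)) t q y" for k
      proof -
        have "(\<Union>y\<in>KG (\<epsilon> (r k)) q. G (\<epsilon> (r k)) t q y) = KG (\<epsilon> (r k)) t"
          using KG[OF \<epsilon>(2)] q unfolding is_pullback_attractor_def by auto
        then show ?thesis using x[of "r k"] by blast
      qed
      then obtain y where y: "\<And>k. y k \<in> KG (\<epsilon> (r k)) q" "\<And>k. x (r k) \<in> G (\<epsilon> (r k)) t q (y k)" by metis
      obtain m r1 where m: "m \<in> N q" "strict_mono (r1 :: nat \<Rightarrow> nat)" "phase_limit \<gamma> (y \<circ> r1) m"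
        using limN[where x=y, OF evN[where z=y, OF _ \<epsilon>r]] \<epsilon>(2) y(1) by (metis comp_apply)
      have "l \<in> H 0 t q m"
      proof (rule lim[where \<epsilon>="\<epsilon> \<circ> r \<circ> r1", OF _ _ _ m(3)])
        show "filterlim (\<epsilon> \<circ> r \<circ> r1) (at_right 0) sequentially"
          using filterlim_compose[OF \<epsilon>r filterlim_subseq[OF m(2)]] by (simp add: comp_def)
        show "phase_limit \<gamma> (x \<circ> r \<circ> r1) l" by (intro phase_limit_subseq lr m)
        show "(\<epsilon> \<circ> r \<circ> r1) k \<in> {0<..c}" for k using \<epsilon>(2)[of "r (r1 k)"] by simp
        show "(y \<circ> r1) k \<in> phase_space \<gamma>" for k using y(1)[of "r1 k"] KGM[OF \<epsilon>(2)] by auto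
        show "(x \<circ> r \<circ> r1) k \<in> G ((\<epsilon> \<circ> r \<circ> r1) k) t q ((y \<circ> r1) k)" for k using y(2)[of "r1 k"] by simp
      qed (use q in auto)
      then show "l \<in> (\<Union>x\<in>N q. H 0 t q x)" using m(1) by blast
    qed
    then show "\<exists>l r. l \<in> KH 0 t \<and> strict_mono r \<and> phase_limit \<gamma> (x \<circ> r) l" using lr coreK by blast
  qed
  then show ?thesis by (simp add: KG_def KH_def)
qed

section \<open>Almost everywhere differentiability of Lipschitz functions\<close>

text \<open>Vitali's covering theorem: the short intervals on which \<open>G\<close> grows with slope at least \<open>q\<close> contain
  a disjoint subfamily that covers almost all of \<open>E\<close>, and their images, which \<open>G\<close> stretches by the
  factor \<open>q\<close>, are disjoint intervals inside a set barely larger than the image of \<open>E\<close>.\<close>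

lemma emeasure_image_steep_ge:
  fixes G H :: "real \<Rightarrow> real"
  assumes G: "continuous_on UNIV G" "strict_mono G" and H: "continuous_on UNIV H"
    and HG: "\<And>x. H (G x) = x" and GH: "\<And>y. G (H y) = y"
    and E: "E \<in> sets borel" and q: "q > 0"
    and steep: "\<And>x e. x \<in> E \<Longrightarrow> e > 0 \<Longrightarrow>
       \<exists>u v. u \<le> x \<and> x \<le> v \<and> u < v \<and> v - u < e \<and> q * (v - u) \<le> G v - G u"
  shows "ennreal q * emeasure lborel E \<le> emeasure lborel (H -` E)"
proof (rule ennreal_le_epsilon)
  fix e :: real assume e: "e > 0"
  have HE: "H -` E \<in> sets borel"
    using measurable_sets_borel[OF borel_measurable_continuous_onI[OF H] E] by simp
  obtain W where W: "open W" "H -` E \<subseteq> W" "emeasure lborel (W - H -` E) < e"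
    using outer_regular_lborel[OF HE e] by blast
  define V where "V = G -` W"
  have V: "open V" unfolding V_def using G(1) W(1) by (simp add: open_vimage)
  have EV: "E \<subseteq> V" using W(2) by (force simp: V_def HG)
  define K where "K = {(u, v). u < v \<and> {u..v} \<subseteq> V \<and> q * (v - u) \<le> G v - G u}"
  let ?a = "\<lambda>(u, v). (u + v) / 2 :: real" and ?r = "\<lambda>(u, v). (v - u) / 2 :: real"
  have cb: "cball (?a i) (?r i) = {fst i..snd i}" for i
    by (cases i) (auto simp: cball_eq_atLeastAtMost field_simps)
  obtain C where C: "countable C" "C \<subseteq> K"
     "pairwise (\<lambda>i j. disjnt (cball (?a i) (?r i)) (cball (?a j) (?r j))) C"
     "negligible (E - (\<Union>i \<in> C. cball (?a i) (?r i)))"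
  proof (rule Vitali_covering_theorem_cballs[of K ?r E ?a])
    show "0 < ?r i" if "i \<in> K" for i using that by (auto simp: K_def)
    fix x d :: real assume x: "x \<in> E" and d: "0 < d"
    then obtain b where b: "b > 0" "ball x b \<subseteq> V" using V EV open_contains_ball by blast
    obtain u v where uv: "u \<le> x" "x \<le> v" "u < v" "v - u < min b d" "q * (v - u) \<le> G v - G u"
      using steep[OF x, of "min b d"] b d by auto
    have "{u..v} \<subseteq> ball x b" using uv by (auto simp: dist_real_def)
    then have "(u, v) \<in> K" using uv b by (auto simp: K_def)
    moreover have "x \<in> cball (?a (u, v)) (?r (u, v))" unfolding cb using uv by auto
    moreover have "?r (u, v) < d" using uv by auto
    ultimately show "\<exists>i. i \<in> K \<and> x \<in> cball (?a i) (?r i) \<and> ?r i < d" by blast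
  qed blast
  let ?I = "\<lambda>i. {fst i..snd i} :: real set"
  let ?J = "\<lambda>i. {G (fst i)..G (snd i)}"
  have disj: "disjoint_family_on ?I C"
    using C(3) unfolding cb by (auto simp: disjoint_family_on_def pairwise_def disjnt_def)
  have GI: "?J i = H -` ?I i" for i
  proof -
    have "H y \<in> ?I i \<longleftrightarrow> y \<in> ?J i" for y
      using strict_mono_less_eq[OF G(2), of "fst i" "H y"] strict_mono_less_eq[OF G(2), of "H y" "snd i"]
      by (simp add: GH)
    then show ?thesis by auto
  qed
  have disj': "disjoint_family_on ?J C"
    using disj unfolding GI disjoint_family_on_def by (metis vimage_Int vimage_empty)
  have CU: "(\<Union>i\<in>C. ?I i) \<in> sets borel" using C(1) by (intro sets.countable_UN') auto
  have null: "emeasure lborel (E - (\<Union>i\<in>C. ?I i)) = 0"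
  proof -
    have "E - (\<Union>i\<in>C. ?I i) \<in> sets borel"
      using E CU by (rule sets.Diff)
    moreover have "E - (\<Union>i\<in>C. ?I i) \<in> null_sets lebesgue"
      using C(4) unfolding cb by (simp add: negligible_iff_null_sets)
    ultimately show ?thesis by (auto simp: null_sets_def)
  qed
  have "emeasure lborel E \<le> emeasure lborel ((E - (\<Union>i\<in>C. ?I i)) \<union> (\<Union>i\<in>C. ?I i))"
    using E CU by (intro emeasure_mono) auto
  also have "\<dots> \<le> emeasure lborel (E - (\<Union>i\<in>C. ?I i)) + emeasure lborel (\<Union>i\<in>C. ?I i)"
    using E CU by (intro emeasure_subadditive) auto
  also have "\<dots> = emeasure lborel (\<Union>i\<in>C. ?I i)" using null by simp
  also have "\<dots> = (\<integral>\<^sup>+i. emeasure lborel (?I i) \<partial>count_space C)"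
    using C(1) disj by (intro emeasure_UN_countable) auto
  finally have "ennreal q * emeasure lborel E \<le> ennreal q * (\<integral>\<^sup>+i. emeasure lborel (?I i) \<partial>count_space C)"
    by (rule mult_left_mono) simp
  also have "\<dots> = (\<integral>\<^sup>+i. ennreal q * emeasure lborel (?I i) \<partial>count_space C)"
    by (simp add: nn_integral_cmult)
  also have "\<dots> \<le> (\<integral>\<^sup>+i. emeasure lborel (?J i) \<partial>count_space C)"
  proof (rule nn_integral_mono)
    fix i assume "i \<in> space (count_space C)"
    then have "i \<in> K" using C(2) by auto
    then obtain u v where [simp]: "i = (u, v)" and uv: "u < v" "q * (v - u) \<le> G v - G u"
      by (auto simp: K_def)
    have "G u \<le> G v" using uv(1) G(2) by (simp add: strict_mono_less less_imp_le)
    then show "ennreal q * emeasure lborel (?I i) \<le> emeasure lborel (?J i)"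
      using uv q by (simp flip: ennreal_mult add: ennreal_leI)
  qed
  also have "\<dots> = emeasure lborel (\<Union>i\<in>C. ?J i)"
    using C(1) disj' by (intro emeasure_UN_countable[symmetric]) auto
  also have "\<dots> \<le> emeasure lborel W"
  proof (rule emeasure_mono)
    show "(\<Union>i\<in>C. ?J i) \<subseteq> W"
    proof
      fix y assume "y \<in> (\<Union>i\<in>C. ?J i)"
      then obtain i where "i \<in> C" "H y \<in> ?I i" unfolding GI by auto
      note this(2)
      moreover have "i \<in> K" using C(2) \<open>i \<in> C\<close> by blast
      ultimately have "H y \<in> V" by (auto simp: K_def)
      then show "y \<in> W" by (simp add: V_def GH)
    qed
  qed (use W in auto)
  also have "\<dots> \<le> emeasure lborel (H -` E) + emeasure lborel (W - H -` E)"
  proof -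
    have "W = H -` E \<union> (W - H -` E)" using W(2) by auto
    then show ?thesis using HE W(1)
      by (metis borel_open emeasure_subadditive sets.Diff sets_lborel)
  qed
  also have "\<dots> \<le> emeasure lborel (H -` E) + e"
    using W(3) by (intro add_left_mono) auto
  finally show "ennreal q * emeasure lborel E \<le> emeasure lborel (H -` E) + e" .
qed

text \<open>The points in arbitrarily short open intervals with average slope above \<open>q\<close>: the upper derivate,
  taken over straddling intervals, is then at least \<open>q\<close>.\<close>

definition steeper :: "(real \<Rightarrow> real) \<Rightarrow> real \<Rightarrow> real set" where
  "steeper G q = {x. \<forall>e>0. \<exists>u v. u < x \<and> x < v \<and> v - u < e \<and> q * (v - u) < G v - G u}"

text \<open>The mirror image of \<open>steeper\<close>: the lower straddling derivate is at most \<open>p\<close>.\<close>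

definition flatter :: "(real \<Rightarrow> real) \<Rightarrow> real \<Rightarrow> real set" where
  "flatter G p = {x. \<forall>e>0. \<exists>u v. u < x \<and> x < v \<and> v - u < e \<and> G v - G u < p * (v - u)}"

lemma flatter_eq_steeper: "flatter G p = steeper (\<lambda>x. - G x) (- p)"
proof -
  have "G v - G u < p * (v - u) \<longleftrightarrow> - p * (v - u) < - G v - - G u" for u v by auto
  then show ?thesis by (simp add: flatter_def steeper_def)
qed

lemma steeper_borel [measurable]: "steeper G q \<in> sets borel"
proof -
  define U where "U n = \<Union>{{u<..<v} |u v. v - u < 1 / Suc n \<and> q * (v - u) < G v - G u}" for n
  have "steeper G q = (\<Inter>n. U n)"
  proof (intro equalityI subsetI)
    fix x assume x: "x \<in> steeper G q"
    have "x \<in> U n" for n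
    proof -
      have "1 / real (Suc n) > 0" by simp
      then obtain u v where "u < x" "x < v" "v - u < 1 / Suc n" "q * (v - u) < G v - G u"
        using x unfolding steeper_def by blast
      then show ?thesis unfolding U_def by (auto intro!: exI[of _ "{u<..<v}"])
    qed
    then show "x \<in> (\<Inter>n. U n)" by blast
  next
    fix x assume x: "x \<in> (\<Inter>n. U n)"
    show "x \<in> steeper G q" unfolding steeper_def
    proof (intro CollectI allI impI)
      fix e :: real assume "e > 0"
      then obtain n where n: "1 / Suc n < e" by (meson nat_approx_posE)
      have "x \<in> U n" using x by blast
      then obtain u v where "u < x" "x < v" "v - u < 1 / Suc n" "q * (v - u) < G v - G u"
        unfolding U_def by auto
      then show "\<exists>u v. u < x \<and> x < v \<and> v - u < e \<and> q * (v - u) < G v - G u"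
        using n by (meson less_trans)
    qed
  qed
  moreover have "open (U n)" for n unfolding U_def by (intro open_Union) auto
  ultimately show ?thesis by auto
qed

lemma flatter_borel [measurable]: "flatter G q \<in> sets borel"
  unfolding flatter_eq_steeper by measurable

context
  fixes G :: "real \<Rightarrow> real" and c C :: real
  assumes c: "c > 0" and lower: "\<And>u v. u \<le> v \<Longrightarrow> c * (v - u) \<le> G v - G u"
    and upper: "\<And>u v. u \<le> v \<Longrightarrow> G v - G u \<le> C * (v - u)"
begin

lemma bilipschitz_strict_mono: "strict_mono G"
proof (rule strict_monoI)
  fix u v :: real assume "u < v"
  then have "0 < c * (v - u)" using c by simp
  then show "G u < G v" using lower[of u v] \<open>u < v\<close> by simp
qed

lemma bilipschitz_C: "C > 0"
  using lower[of 0 1] upper[of 0 1] c by simp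

lemma bilipschitz_abs: "\<bar>G u - G v\<bar> \<le> C * \<bar>u - v\<bar>"
proof (cases "u \<le> v")
  case True
  then show ?thesis using upper[of u v] strict_mono_less_eq[OF bilipschitz_strict_mono, of u v] by simp
next
  case False
  then show ?thesis using upper[of v u] strict_mono_less_eq[OF bilipschitz_strict_mono, of v u] by simp
qed

lemma bilipschitz_continuous: "continuous_on UNIV G"
proof -
  have "C-lipschitz_on UNIV G"
    using bilipschitz_C by (auto intro!: lipschitz_onI bilipschitz_abs simp: dist_real_def)
  then show ?thesis by (rule lipschitz_on_continuous_on)
qed

lemma bilipschitz_surj: "\<exists>x. G x = y"
proof -
  \<comment> \<open>By the lower slope \<open>c\<close>, the values of \<open>G\<close> at \<open>\<plusminus>a\<close> enclose \<open>y\<close>.\<close>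
  define a where "a = \<bar>y - G 0\<bar> / c"
  have a: "a \<ge> 0" "c * a = \<bar>y - G 0\<bar>" using c by (auto simp: a_def)
  have "G (- a) \<le> y" using lower[of "- a" 0] a by simp
  moreover have "y \<le> G a" using lower[of 0 a] a by simp
  ultimately show ?thesis
    using IVT'[of G "- a" y a] continuous_on_subset[OF bilipschitz_continuous] a by auto
qed

text \<open>Where the upper derivate is at least \<open>q\<close> and the lower one at most \<open>p < q\<close>, the stretching estimate
  for \<open>G\<close> and for its inverse, whose slopes there reach \<open>1 / p\<close>, combine to
  \<open>q / p * |E| \<le> |E|\<close> on bounded pieces \<open>E\<close>, so these pieces are null sets.\<close>

lemma bilipschitz_exceptional_null:
  assumes p: "0 < p" "p < q"
  shows "steeper G q \<inter> flatter G p \<in> null_sets lborel"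
proof -
  define H where "H = inv G"
  have GH: "G (H y) = y" for y unfolding H_def using bilipschitz_surj by (metis f_inv_into_f rangeI)
  have HG: "H (G x) = x" for x unfolding H_def
    using bilipschitz_strict_mono by (simp add: strict_mono_imp_inj_on)
  have sm: "strict_mono H"
    using bilipschitz_strict_mono by (metis GH strict_mono_def linorder_not_le order_le_less not_less_iff_gr_or_eq)
  have H: "continuous_on UNIV H"
  proof -
    have *: "\<bar>u - v\<bar> \<le> (1 / c) * \<bar>G u - G v\<bar>" for u v
      using lower[of u v] lower[of v u] c by (cases "u \<le> v") (auto simp: field_simps)
    have "(1 / c)-lipschitz_on UNIV H"
      using c *[of "H _" "H _"] by (auto intro!: lipschitz_onI simp: dist_real_def GH)
    then show ?thesis by (rule lipschitz_on_continuous_on)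
  qed
  have *: "emeasure lborel (steeper G q \<inter> flatter G p \<inter> {-real n..real n}) = 0" for n :: nat
  proof -
    define E where "E = steeper G q \<inter> flatter G p \<inter> {-real n..real n}"
    have E: "E \<in> sets borel" unfolding E_def by measurable
    have HE: "H -` E \<in> sets borel"
      using measurable_sets_borel[OF borel_measurable_continuous_onI[OF H] E] by simp
    have "ennreal q * emeasure lborel E \<le> emeasure lborel (H -` E)"
    proof (rule emeasure_image_steep_ge[OF bilipschitz_continuous bilipschitz_strict_mono H HG GH E])
      show "q > 0" using p by simp
      fix x e :: real assume "x \<in> E" "e > 0"
      then obtain u v where "u < x" "x < v" "v - u < e" "q * (v - u) < G v - G u"
        unfolding E_def steeper_def by blast
      then show "\<exists>u v. u \<le> x \<and> x \<le> v \<and> u < v \<and> v - u < e \<and> q * (v - u) \<le> G v - G u"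
        by (intro exI[of _ u] exI[of _ v]) auto
    qed
    moreover have "ennreal (1 / p) * emeasure lborel (H -` E) \<le> emeasure lborel (G -` (H -` E))"
    proof (rule emeasure_image_steep_ge[OF H sm bilipschitz_continuous GH HG HE])
      show "1 / p > 0" using p by simp
      fix y e :: real assume y: "y \<in> H -` E" "e > 0"
      then obtain u v where uv: "u < H y" "H y < v" "v - u < e / C" "G v - G u < p * (v - u)"
      proof -
        have "H y \<in> flatter G p" "e / C > 0" using y bilipschitz_C by (auto simp: E_def)
        then show ?thesis using that unfolding flatter_def by blast
      qed
      have "G u < y" "y < G v" using uv bilipschitz_strict_mono by (metis GH strict_mono_less)+
      moreover have "G v - G u < e"
      proof -
        have "G v - G u \<le> C * (v - u)" using upper[of u v] uv by simp
        also have "\<dots> < e" using uv(3) bilipschitz_C by (simp add: field_simps)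
        finally show ?thesis .
      qed
      moreover have "1 / p * (G v - G u) \<le> H (G v) - H (G u)"
        using uv(4) p unfolding HG by (simp add: field_simps)
      ultimately show "\<exists>u v. u \<le> y \<and> y \<le> v \<and> u < v \<and> v - u < e \<and> 1 / p * (v - u) \<le> H v - H u"
        by (intro exI[of _ "G u"] exI[of _ "G v"]) auto
    qed
    moreover have "G -` (H -` E) = E" by (auto simp: HG)
    moreover have fin: "emeasure lborel E < \<infinity>"
    proof -
      have "emeasure lborel E \<le> emeasure lborel {-real n..real n}"
        by (intro emeasure_mono) (auto simp: E_def)
      also have "\<dots> < \<infinity>" by simp
      finally show ?thesis .
    qed
    ultimately have 1: "ennreal q * emeasure lborel E \<le> emeasure lborel (H -` E)"
      and 2: "ennreal (1 / p) * emeasure lborel (H -` E) \<le> emeasure lborel E" by simp_all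
    \<comment> \<open>Going forth with \<open>G\<close> and back with its inverse enlarges the measure by the factor \<open>q / p > 1\<close>.\<close>
    have "ennreal (q / p) * emeasure lborel E = ennreal (1 / p) * (ennreal q * emeasure lborel E)"
      using p by (simp flip: ennreal_mult add: mult.assoc[symmetric])
    also have "\<dots> \<le> emeasure lborel E" using 1 2 by (meson mult_left_mono order_trans zero_le)
    finally have 3: "ennreal (q / p) * emeasure lborel E \<le> emeasure lborel E" .
    obtain r where r: "emeasure lborel E = ennreal r" "r \<ge> 0"
      using fin by (cases "emeasure lborel E") auto
    have "q / p * r \<le> r" using 3 p r by (simp flip: ennreal_mult)
    then have "r \<le> 0" using p r by (simp add: field_simps mult_le_cancel_right)
    then show ?thesis using r by (simp add: E_def)
  qed
  have "(\<Union>n::nat. steeper G q \<inter> flatter G p \<inter> {-real n..real n}) \<in> null_sets lborel"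
    using * by (intro null_sets_UN) (auto simp: null_sets_def)
  moreover have "(\<Union>n::nat. steeper G q \<inter> flatter G p \<inter> {-real n..real n}) = steeper G q \<inter> flatter G p"
  proof -
    have "\<exists>n::nat. x \<in> {-real n..real n}" for x :: real
      using real_arch_simple[of "\<bar>x\<bar>"] by (auto simp: abs_le_iff minus_le_iff)
    then show ?thesis by blast
  qed
  ultimately show ?thesis by simp
qed

text \<open>The derivative is the supremum \<open>d\<close> of the slopes \<open>q\<close> with \<open>x \<in> steeper G q\<close>.  If the lower derivate
  were smaller, two rational slopes would separate them, which the assumption excludes.  The derivates
  are taken over intervals that contain \<open>x\<close> in the interior; continuity passes to intervals ending
  at \<open>x\<close>.\<close>

lemma bilipschitz_differentiable_outside:
  assumes x: "\<And>p q. p \<in> \<rat> \<Longrightarrow> q \<in> \<rat> \<Longrightarrow> 0 < p \<Longrightarrow> p < q \<Longrightarrow> x \<notin> steeper G q \<inter> flatter G p"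
  shows "\<exists>d. (G has_real_derivative d) (at x)"
proof -
  define A where "A = {q. x \<in> steeper G q}"
  have c2: "c / 2 \<in> A"
    unfolding A_def steeper_def
  proof (intro CollectI allI impI)
    fix e :: real assume e: "e > 0"
    have "c / 2 * (e / 2) < c * (e / 2)" using c e by simp
    also have "\<dots> \<le> G (x + e / 4) - G (x - e / 4)" using lower[of "x - e / 4" "x + e / 4"] e by simp
    finally show "\<exists>u v. u < x \<and> x < v \<and> v - u < e \<and> c / 2 * (v - u) < G v - G u"
      using e by (intro exI[of _ "x - e/4"] exI[of _ "x + e/4"]) auto
  qed
  have ub: "q \<le> C" if "q \<in> A" for q
  proof -
    have "x \<in> steeper G q" using that by (simp add: A_def)
    then obtain u v where uv: "u < x" "x < v" "q * (v - u) < G v - G u"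
      using zero_less_one unfolding A_def steeper_def by blast
    have "q * (v - u) < C * (v - u)" using uv upper[of u v] by linarith
    moreover have "v - u > 0" using uv by simp
    ultimately show ?thesis using mult_less_cancel_right_pos less_imp_le by blast
  qed
  have bdd: "bdd_above A" using ub by (rule bdd_aboveI)
  define d where "d = Sup A"
  have d0: "d > 0" using cSup_upper[OF c2 bdd] c unfolding d_def by simp
  have A_down: "q \<in> A" if qd: "q < d" for q
  proof -
    have "A \<noteq> {}" using c2 by auto
    then obtain a where a: "a \<in> A" "q < a" using less_cSupD[of A q] qd unfolding d_def by blast
    show ?thesis unfolding A_def steeper_def
    proof (intro CollectI allI impI)
      fix e :: real assume "e > 0"
      then obtain u v where uv: "u < x" "x < v" "v - u < e" "a * (v - u) < G v - G u"
        using a unfolding A_def steeper_def by blast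
      have "q * (v - u) < a * (v - u)" using a uv by simp
      then show "\<exists>u v. u < x \<and> x < v \<and> v - u < e \<and> q * (v - u) < G v - G u" using uv by (intro exI[of _ u] exI[of _ v] conjI) linarith+
    qed
  qed
  have up: "\<exists>r>0. \<forall>u v. u < x \<and> x < v \<and> v - u < r \<longrightarrow> G v - G u \<le> (d + e) * (v - u)" if "e > 0" for e
  proof -
    have "d + e \<notin> A" using cSup_upper[OF _ bdd] that unfolding d_def by force
    then show ?thesis unfolding A_def steeper_def by (force simp: not_less)
  qed
  have lo: "\<exists>r>0. \<forall>u v. u < x \<and> x < v \<and> v - u < r \<longrightarrow> (d - e) * (v - u) \<le> G v - G u" if e: "e > 0" for e
  proof (rule ccontr)
    assume neg: "\<not> ?thesis"
    obtain p where p: "p \<in> \<rat>" "max (d - e) 0 < p" "p < d" using Rats_dense_in_real[of "max (d - e) 0" d] d0 e by auto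
    obtain q where q: "q \<in> \<rat>" "p < q" "q < d" using Rats_dense_in_real p by blast
    have "x \<in> flatter G p" unfolding flatter_def
    proof (intro CollectI allI impI)
      fix r :: real assume "r > 0"
      then obtain u v where uv: "u < x" "x < v" "v - u < r" "G v - G u < (d - e) * (v - u)"
        using neg by (force simp: not_le)
      have "(d - e) * (v - u) \<le> p * (v - u)" using p uv by (intro mult_right_mono) auto
      then show "\<exists>u v. u < x \<and> x < v \<and> v - u < r \<and> G v - G u < p * (v - u)" using uv by (intro exI[of _ u] exI[of _ v] conjI) linarith+
    qed
    moreover have "x \<in> steeper G q" using A_down[OF q(3)] by (simp add: A_def)
    ultimately show False using x[OF p(1) q(1)] p q by auto
  qed
  have cont: "isCont G y" for y using bilipschitz_continuous by (simp add: continuous_on_eq_continuous_at)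
  have "(G has_derivative (\<lambda>h. h * d)) (at x)"
    unfolding has_derivative_within_alt
  proof (intro conjI allI impI)
    show "bounded_linear (\<lambda>h. h * d)" by (rule bounded_linear_mult_left)
    fix e :: real assume e: "0 < e"
    obtain r1 where r1: "r1 > 0" "\<And>u v. u < x \<Longrightarrow> x < v \<Longrightarrow> v - u < r1 \<Longrightarrow> G v - G u \<le> (d + e) * (v - u)"
      using up[OF e] by blast
    obtain r2 where r2: "r2 > 0" "\<And>u v. u < x \<Longrightarrow> x < v \<Longrightarrow> v - u < r2 \<Longrightarrow> (d - e) * (v - u) \<le> G v - G u"
      using lo[OF e] by blast
    define r where "r = min r1 r2 / 2"
    have r: "r > 0" "2 * r \<le> r1" "2 * r \<le> r2" using r1 r2 by (auto simp: r_def)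
    have "norm (G y - G x - (y - x) * d) \<le> e * norm (y - x)" if y: "norm (y - x) < r" for y
    proof -
      consider "y = x" | "y > x" | "y < x" by linarith
      then show ?thesis
      proof cases
        case 2
        have t: "((\<lambda>u. G y - G u) \<longlongrightarrow> G y - G x) (at_left x)" "((\<lambda>u. y - u) \<longlongrightarrow> y - x) (at_left x)"
          using cont[of x] by (auto intro!: tendsto_intros simp: isCont_def tendsto_within_subset)
             (metis filterlim_at_split isCont_def)
        have ev: "\<forall>\<^sub>F u in at_left x. x - r < u \<and> u < x"
          using r(1) by (auto simp: eventually_at_left[of "x - r"] intro!: exI[of _ "x - r"])
        have "G y - G x \<le> (d + e) * (y - x)"
          by (rule tendsto_le[OF _ tendsto_mult[OF tendsto_const t(2)] t(1)])
             (use 2 y r r1(2)[of _ y] in \<open>auto intro!: eventually_mono[OF ev]\<close>)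
        moreover have "(d - e) * (y - x) \<le> G y - G x"
          by (rule tendsto_le[OF _ t(1) tendsto_mult[OF tendsto_const t(2)]])
             (use 2 y r r2(2)[of _ y] in \<open>auto intro!: eventually_mono[OF ev]\<close>)
        ultimately show ?thesis using 2 by (auto simp: abs_le_iff algebra_simps)
      next
        case 3
        have t: "((\<lambda>u. G u - G y) \<longlongrightarrow> G x - G y) (at_right x)" "((\<lambda>u. u - y) \<longlongrightarrow> x - y) (at_right x)"
          using cont[of x] by (auto intro!: tendsto_intros simp: isCont_def tendsto_within_subset)
             (metis filterlim_at_split isCont_def)
        have ev: "\<forall>\<^sub>F u in at_right x. x < u \<and> u < x + r"
          using r(1) by (auto simp: eventually_at_right[of x "x + r"] intro!: exI[of _ "x + r"])
        have "G x - G y \<le> (d + e) * (x - y)"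
          by (rule tendsto_le[OF _ tendsto_mult[OF tendsto_const t(2)] t(1)])
             (use 3 y r r1(2)[of y] in \<open>auto intro!: eventually_mono[OF ev]\<close>)
        moreover have "(d - e) * (x - y) \<le> G x - G y"
          by (rule tendsto_le[OF _ t(1) tendsto_mult[OF tendsto_const t(2)]])
             (use 3 y r r2(2)[of y] in \<open>auto intro!: eventually_mono[OF ev]\<close>)
        ultimately show ?thesis using 3 by (auto simp: abs_le_iff algebra_simps)
      qed simp
    qed
    then show "\<exists>\<delta>>0. \<forall>y\<in>UNIV. norm (y - x) < \<delta> \<longrightarrow> norm (G y - G x - (y - x) * d) \<le> e * norm (y - x)"
      using r(1) by blast
  qed
  then have "(G has_real_derivative d) (at x)"
    unfolding has_field_derivative_def by (simp add: mult_commute_abs)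
  then show ?thesis by blast
qed

lemma bilipschitz_AE_differentiable: "AE x in lborel. \<exists>d. (G has_real_derivative d) (at x)"
proof -
  define P where "P = {(p, q). p \<in> \<rat> \<and> q \<in> \<rat> \<and> 0 < p \<and> p < (q::real)}"
  have "countable P"
    by (rule countable_subset[of _ "\<rat> \<times> \<rat>"]) (auto simp: P_def countable_rat)
  then have "(\<Union>i\<in>P. steeper G (snd i) \<inter> flatter G (fst i)) \<in> null_sets lborel"
    by (intro null_sets_UN') (auto simp: P_def intro: bilipschitz_exceptional_null)
  then show ?thesis
  proof (rule AE_I')
    show "{x \<in> space lborel. \<not> (\<exists>d. (G has_real_derivative d) (at x))}
      \<subseteq> (\<Union>i\<in>P. steeper G (snd i) \<inter> flatter G (fst i))"
    proof
      fix x assume "x \<in> {x \<in> space lborel. \<not> (\<exists>d. (G has_real_derivative d) (at x))}"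
      then obtain p q where "p \<in> \<rat>" "q \<in> \<rat>" "0 < p" "p < q" "x \<in> steeper G q \<inter> flatter G p"
        using bilipschitz_differentiable_outside by blast
      then show "x \<in> (\<Union>i\<in>P. steeper G (snd i) \<inter> flatter G (fst i))"
        by (intro UN_I[of "(p, q)"]) (auto simp: P_def)
    qed
  qed
qed

end

text \<open>Lebesgue's theorem.  Adding the linear function of slope \<open>L + 1\<close> makes the function
  bi-Lipschitz and increasing.\<close>

theorem lipschitz_AE_differentiable:
  fixes f :: "real \<Rightarrow> real"
  assumes "L-lipschitz_on UNIV f"
  shows "AE x in lborel. \<exists>d. (f has_real_derivative d) (at x)"
proof -
  have L: "L \<ge> 0" "\<bar>f u - f v\<bar> \<le> L * \<bar>u - v\<bar>" for u v
    using lipschitz_on_nonneg[OF assms] lipschitz_onD[OF assms, of u v] by (auto simp: dist_real_def)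
  have "AE x in lborel. \<exists>d. ((\<lambda>x. f x + (L + 1) * x) has_real_derivative d) (at x)"
  proof (rule bilipschitz_AE_differentiable[of 1 _ "2 * L + 1"])
    fix u v :: real assume "u \<le> v"
    then have "\<bar>f u - f v\<bar> \<le> L * (v - u)" using L(2)[of u v] by simp
    then show "1 * (v - u) \<le> f v + (L + 1) * v - (f u + (L + 1) * u)"
      and "f v + (L + 1) * v - (f u + (L + 1) * u) \<le> (2 * L + 1) * (v - u)"
      by (auto simp: algebra_simps abs_le_iff)
  qed simp
  then show ?thesis
  proof (rule AE_mp, intro AE_I2 impI)
    fix x assume "\<exists>d. ((\<lambda>x. f x + (L + 1) * x) has_real_derivative d) (at x)"
    then obtain d where "((\<lambda>x. f x + (L + 1) * x) has_real_derivative d) (at x)" by blast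
    from DERIV_diff[OF this DERIV_cmult_Id[of "L + 1"]]
    show "\<exists>d. (f has_real_derivative d) (at x)" by auto
  qed
qed

section \<open>Absolutely continuous functions\<close>

lemma absolutely_continuous_on_subset:
  assumes "absolutely_continuous_on a b f" "a \<le> a'" "b' \<le> b"
  shows "absolutely_continuous_on a' b' f"
  unfolding absolutely_continuous_on_def
proof (intro allI impI)
  fix e :: real assume "e > 0"
  then obtain d where d: "d > 0"
    "\<And>J. finite J \<and> (\<forall>(p, q)\<in>J. a \<le> p \<and> p \<le> q \<and> q \<le> b) \<and>
        disjoint_family_on (\<lambda>(p, q). {p<..<q}) J \<and> (\<Sum>(p, q)\<in>J. q - p) < d \<longrightarrow>
        (\<Sum>(p, q)\<in>J. norm (f q - f p)) < e"
    using assms(1) unfolding absolutely_continuous_on_def by blast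
  show "\<exists>d>0. \<forall>J. finite J \<and> (\<forall>(p, q)\<in>J. a' \<le> p \<and> p \<le> q \<and> q \<le> b') \<and>
        disjoint_family_on (\<lambda>(p, q). {p<..<q}) J \<and> (\<Sum>(p, q)\<in>J. q - p) < d \<longrightarrow>
        (\<Sum>(p, q)\<in>J. norm (f q - f p)) < e"
  proof (intro exI[of _ d] conjI allI impI, rule d(1), elim conjE)
    fix J assume J: "finite J" "\<forall>(p, q)\<in>J. a' \<le> p \<and> p \<le> q \<and> q \<le> b'"
      "disjoint_family_on (\<lambda>(p, q). {p<..<q}) J" "(\<Sum>(p, q)\<in>J. q - p) < d"
    have "\<forall>(p, q)\<in>J. a \<le> p \<and> p \<le> q \<and> q \<le> b" using J(2) assms(2,3) by fastforce
    then show "(\<Sum>(p, q)\<in>J. norm (f q - f p)) < e" using d(2)[of J] J by blast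
  qed
qed

lemma absolutely_continuous_on_mono_norm:
  assumes "absolutely_continuous_on a b f"
    and "\<And>p q. a \<le> p \<Longrightarrow> p \<le> q \<Longrightarrow> q \<le> b \<Longrightarrow> norm (g q - g p) \<le> norm (f q - f p)"
  shows "absolutely_continuous_on a b g"
  unfolding absolutely_continuous_on_def
proof (intro allI impI)
  fix e :: real assume "e > 0"
  then obtain d where d: "d > 0"
    "\<And>J. finite J \<and> (\<forall>(p, q)\<in>J. a \<le> p \<and> p \<le> q \<and> q \<le> b) \<and>
        disjoint_family_on (\<lambda>(p, q). {p<..<q}) J \<and> (\<Sum>(p, q)\<in>J. q - p) < d \<longrightarrow>
        (\<Sum>(p, q)\<in>J. norm (f q - f p)) < e"
    using assms(1) unfolding absolutely_continuous_on_def by blast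
  show "\<exists>d>0. \<forall>J. finite J \<and> (\<forall>(p, q)\<in>J. a \<le> p \<and> p \<le> q \<and> q \<le> b) \<and>
        disjoint_family_on (\<lambda>(p, q). {p<..<q}) J \<and> (\<Sum>(p, q)\<in>J. q - p) < d \<longrightarrow>
        (\<Sum>(p, q)\<in>J. norm (g q - g p)) < e"
  proof (intro exI[of _ d] conjI allI impI, rule d(1), elim conjE)
    fix J assume J: "finite J" "\<forall>(p, q)\<in>J. a \<le> p \<and> p \<le> q \<and> q \<le> b"
      "disjoint_family_on (\<lambda>(p, q). {p<..<q}) J" "(\<Sum>(p, q)\<in>J. q - p) < d"
    have "(\<Sum>(p, q)\<in>J. norm (g q - g p)) \<le> (\<Sum>(p, q)\<in>J. norm (f q - f p))"
      using J(2) assms(2) by (intro sum_mono) auto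
    also have "\<dots> < e" using d(2)[of J] J by blast
    finally show "(\<Sum>(p, q)\<in>J. norm (g q - g p)) < e" .
  qed
qed

lemma lipschitz_imp_absolutely_continuous_on:
  assumes "\<And>p q. a \<le> p \<Longrightarrow> p \<le> q \<Longrightarrow> q \<le> b \<Longrightarrow> norm (f q - f p) \<le> L * (q - p)"
  shows "absolutely_continuous_on a b f"
  unfolding absolutely_continuous_on_def
proof (intro allI impI)
  fix e :: real assume e: "e > 0"
  define M where "M = \<bar>L\<bar> + 1"
  have M: "M > 0" "L \<le> M" by (auto simp: M_def)
  show "\<exists>d>0. \<forall>J. finite J \<and> (\<forall>(p, q)\<in>J. a \<le> p \<and> p \<le> q \<and> q \<le> b) \<and>
        disjoint_family_on (\<lambda>(p, q). {p<..<q}) J \<and> (\<Sum>(p, q)\<in>J. q - p) < d \<longrightarrow>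
        (\<Sum>(p, q)\<in>J. norm (f q - f p)) < e"
  proof (intro exI[of _ "e / M"] conjI allI impI)
    show "e / M > 0" using e M by simp
    fix J :: "(real \<times> real) set"
    assume J: "finite J \<and> (\<forall>(p, q)\<in>J. a \<le> p \<and> p \<le> q \<and> q \<le> b) \<and>
      disjoint_family_on (\<lambda>(p, q). {p<..<q}) J \<and> (\<Sum>(p, q)\<in>J. q - p) < e / M"
    have "(\<Sum>(p, q)\<in>J. norm (f q - f p)) \<le> (\<Sum>(p, q)\<in>J. M * (q - p))"
    proof (rule sum_mono, clarify)
      fix p q assume "(p, q) \<in> J"
      then have "a \<le> p" "p \<le> q" "q \<le> b" using J by auto
      moreover have "L * (q - p) \<le> M * (q - p)" using M \<open>p \<le> q\<close> by (intro mult_right_mono) auto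
      ultimately show "norm (f q - f p) \<le> M * (q - p)" using assms by (meson order_trans)
    qed
    also have "\<dots> = M * (\<Sum>(p, q)\<in>J. q - p)" by (simp add: sum_distrib_left case_prod_unfold)
    also have "\<dots> < e" using J M by (simp add: field_simps)
    finally show "(\<Sum>(p, q)\<in>J. norm (f q - f p)) < e" .
  qed
qed

lemma absolutely_continuous_on_imp_continuous_on:
  assumes "absolutely_continuous_on a b f"
  shows "continuous_on {a..b} f"
  unfolding continuous_on_iff
proof (intro ballI allI impI)
  fix x e :: real assume x: "x \<in> {a..b}" and "e > 0"
  then obtain d where d: "d > 0"
    "\<And>J. finite J \<and> (\<forall>(p, q)\<in>J. a \<le> p \<and> p \<le> q \<and> q \<le> b) \<and>
        disjoint_family_on (\<lambda>(p, q). {p<..<q}) J \<and> (\<Sum>(p, q)\<in>J. q - p) < d \<longrightarrow>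
        (\<Sum>(p, q)\<in>J. norm (f q - f p)) < e"
    using assms unfolding absolutely_continuous_on_def by blast
  have *: "norm (f q - f p) < e" if "a \<le> p" "p \<le> q" "q \<le> b" "q - p < d" for p q
    using d(2)[of "{(p, q)}"] that by (simp add: disjoint_family_on_def)
  then have "dist (f y) (f x) < e" if "y \<in> {a..b}" "dist y x < d" for y
  proof (cases "x \<le> y")
    case True
    then show ?thesis using *[of x y] that x by (auto simp: dist_norm)
  next
    case False
    then show ?thesis using *[of y x] that x by (auto simp: dist_norm norm_minus_commute)
  qed
  then show "\<exists>d>0. \<forall>x'\<in>{a..b}. dist x' x < d \<longrightarrow> dist (f x') (f x) < e" using d(1) by blast
qed

text \<open>The mean value inequality with an exceptional null set \<open>N\<close>.  A gauge makes the function grow with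
  slope at most \<open>c + e\<close> on the pieces of a tagged division with tag outside \<open>N\<close>, and a second gauge, from
  negligibility, makes the pieces with tag in \<open>N\<close> so short in total that absolute continuity bounds
  the growth over them.\<close>

lemma absolutely_continuous_derivative_le:
  fixes f :: "real \<Rightarrow> real"
  assumes ac: "absolutely_continuous_on a b f" and ab: "a \<le> b"
    and der: "AE t in lebesgue. a < t \<and> t < b \<longrightarrow> (\<exists>d\<le>c. (f has_real_derivative d) (at t))"
  shows "f b - f a \<le> c * (b - a)"
proof (rule field_le_epsilon)
  fix e0 :: real assume e0: "e0 > 0"
  define e where "e = e0 / (b - a + 2)"
  have e: "e > 0" "e * (b - a + 2) = e0" using e0 ab by (auto simp: e_def)
  obtain \<delta> where \<delta>: "\<delta> > 0"
    "\<And>J. finite J \<and> (\<forall>(p, q)\<in>J. a \<le> p \<and> p \<le> q \<and> q \<le> b) \<and>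
        disjoint_family_on (\<lambda>(p, q). {p<..<q}) J \<and> (\<Sum>(p, q)\<in>J. q - p) < \<delta> \<longrightarrow>
        (\<Sum>(p, q)\<in>J. norm (f q - f p)) < e"
    using ac e(1) unfolding absolutely_continuous_on_def by blast
  define N where "N = {t. \<not> (a < t \<and> t < b \<longrightarrow> (\<exists>d\<le>c. (f has_real_derivative d) (at t)))} \<union> {a, b}"
  have "negligible {t. \<not> (a < t \<and> t < b \<longrightarrow> (\<exists>d\<le>c. (f has_real_derivative d) (at t)))}"
    using der by (simp add: eventually_ae_filter_negligible) (meson negligible_subset)
  then have negN: "negligible N" unfolding N_def by (intro negligible_Un) auto
  \<comment> \<open>Total length of the pieces with tag in \<open>N\<close>: below \<open>\<delta>\<close> for absolute continuity, and so small that the missing length changes \<open>(c + e) * (b - a)\<close> by at most \<open>e\<close>.\<close>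
  define \<eta> where "\<eta> = min \<delta> (e / (\<bar>c + e\<bar> + 1))"
  have \<eta>: "\<eta> > 0" "\<eta> \<le> \<delta>" "\<bar>c + e\<bar> * \<eta> \<le> e"
  proof -
    show "\<eta> > 0" "\<eta> \<le> \<delta>" using \<delta>(1) e by (auto simp: \<eta>_def)
    have "\<bar>c + e\<bar> * \<eta> \<le> (\<bar>c + e\<bar> + 1) * (e / (\<bar>c + e\<bar> + 1))"
      using \<open>\<eta> > 0\<close> by (intro mult_mono) (auto simp: \<eta>_def)
    also have "\<dots> = e" by auto
    finally show "\<bar>c + e\<bar> * \<eta> \<le> e" .
  qed
  have "((indicator N :: real \<Rightarrow> real) has_integral 0) (cbox a b)"
    using negN unfolding negligible_def by blast
  then obtain \<gamma>1 where \<gamma>1: "gauge \<gamma>1"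
    "\<And>D. D tagged_division_of cbox a b \<Longrightarrow> \<gamma>1 fine D \<Longrightarrow>
       norm ((\<Sum>(x,k)\<in>D. measure lborel k *\<^sub>R indicator N x) - (0::real)) < \<eta>"
    using has_integral[THEN iffD1, rule_format, OF _ \<eta>(1)] by metis
  have "\<exists>r>0. \<forall>u v. u \<le> x \<and> x \<le> v \<and> x - u < r \<and> v - x < r \<longrightarrow> f v - f u \<le> (c + e) * (v - u)"
    if x: "x \<in> {a..b} - N" for x
  proof -
    obtain d where "d \<le> c" "(f has_real_derivative d) (at x)"
      using x by (auto simp: N_def)
    then have d: "d \<le> c" "(f has_derivative (\<lambda>h. h * d)) (at x)"
      unfolding has_field_derivative_def by (simp_all add: mult_commute_abs)
    obtain r where r: "r > 0" "\<And>y. norm (y - x) < r \<Longrightarrow> norm (f y - f x - (y - x) * d) \<le> e * norm (y - x)"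
    proof -
      have "\<forall>e>0. \<exists>r>0. \<forall>y\<in>UNIV. norm (y - x) < r \<longrightarrow> norm (f y - f x - (y - x) * d) \<le> e * norm (y - x)"
        using d(2) unfolding has_derivative_within_alt by blast
      then show ?thesis using e(1) that by blast
    qed
    have "f v - f u \<le> (c + e) * (v - u)" if "u \<le> x" "x \<le> v" "x - u < r" "v - x < r" for u v
    proof -
      have "f v - f x - (v - x) * d \<le> e * (v - x)" "f x - f u - (x - u) * d \<le> e * (x - u)"
        using r(2)[of v] r(2)[of u] that by (auto simp: abs_le_iff algebra_simps)
      then have "f v - f u \<le> (d + e) * (v - u)" by (simp add: algebra_simps)
      also have "\<dots> \<le> (c + e) * (v - u)" using d that by (intro mult_right_mono) auto
      finally show ?thesis .
    qed
    then show ?thesis using r(1) by blast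
  qed
  then obtain r where r: "\<And>x. x \<in> {a..b} - N \<Longrightarrow> r x > 0"
    "\<And>x u v. x \<in> {a..b} - N \<Longrightarrow> u \<le> x \<Longrightarrow> x \<le> v \<Longrightarrow> x - u < r x \<Longrightarrow> v - x < r x
       \<Longrightarrow> f v - f u \<le> (c + e) * (v - u)"
    by metis
  define \<gamma> where "\<gamma> x = \<gamma>1 x \<inter> ball x (if x \<in> {a..b} - N then r x else 1)" for x
  have "gauge \<gamma>"
  proof -
    have "gauge (\<lambda>x. ball x (if x \<in> {a..b} - N then r x else 1))"
      using r(1) by (intro gauge_ball_dependent) auto
    then show ?thesis using \<gamma>1(1) unfolding \<gamma>_def by (rule gauge_Int[OF _ , rotated])
  qed
  then obtain D where D: "D tagged_division_of {a..b}" "\<gamma> fine D"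
    using fine_division_exists_real by blast
  have finD: "finite D" using D(1) by (rule tagged_division_of_finite)
  have K: "a \<le> Inf K \<and> Inf K \<le> x \<and> x \<le> Sup K \<and> Sup K \<le> b \<and> K = {Inf K..Sup K} \<and> measure lborel K = Sup K - Inf K"
    if xK: "(x, K) \<in> D" for x K
  proof -
    obtain u v where uv: "K = cbox u v" using tagged_division_ofD(4)[OF D(1) xK] by blast
    moreover have "x \<in> K" "K \<subseteq> {a..b}" using tagged_division_ofD(2,3)[OF D(1) xK] by auto
    ultimately show ?thesis by auto
  qed
  define DN where "DN = {(x, K)\<in>D. x \<in> N}"
  have DN: "DN \<subseteq> D" "finite DN" using finD by (auto simp: DN_def intro: finite_subset[OF _ finD])
  define h where "h = (\<lambda>(x :: real, K :: real set). (Inf K, Sup K))"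
  \<comment> \<open>Different tagged pieces coincide as intervals only if they are degenerate, so nothing is lost when the tags are forgotten.\<close>
  have coll: "Inf K = Sup K" if "(x, K) \<in> DN" "(x', K') \<in> DN" "(x, K) \<noteq> (x', K')" "h (x, K) = h (x', K')" for x K x' K'
  proof -
    have D': "(x, K) \<in> D" "(x', K') \<in> D" using that DN by auto
    have "K = K'" using that K[OF D'(1)] K[OF D'(2)] unfolding h_def by (metis case_prod_conv prod.inject)
    then have "interior K = {}" using tagged_division_ofD(5)[OF D(1) D'] that(3) by auto
    moreover have "interior K = {Inf K<..<Sup K}" using K[OF D'(1)] by (metis interior_atLeastAtMost_real)
    ultimately show ?thesis using K[OF D'(1)] by (metis greaterThanLessThan_empty_iff order_antisym_conv order_trans)
  qed
  have lenDN: "(\<Sum>(x,K)\<in>DN. measure lborel K) < \<eta>" and len0: "0 \<le> (\<Sum>(x,K)\<in>DN. measure lborel K)"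
  proof -
    have "\<gamma>1 fine D" using D(2) unfolding \<gamma>_def fine_def by auto
    then have "norm ((\<Sum>(x,k)\<in>D. measure lborel k *\<^sub>R indicator N x) - (0::real)) < \<eta>"
      using \<gamma>1(2) D(1) by simp
    moreover have "(\<Sum>(x,k)\<in>D. measure lborel k *\<^sub>R indicator N x) = (\<Sum>(x,K)\<in>DN. measure lborel K)"
      using finD by (intro sum.mono_neutral_cong_right) (auto simp: DN_def indicator_def)
    ultimately show "(\<Sum>(x,K)\<in>DN. measure lborel K) < \<eta>" by auto
    show "0 \<le> (\<Sum>(x,K)\<in>DN. measure lborel K)" by (intro sum_nonneg) auto
  qed
  have sumN: "(\<Sum>(x,K)\<in>DN. norm (f (Sup K) - f (Inf K))) < e"
  proof -
    define J where "J = h ` DN"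
    have "(\<Sum>(p, q)\<in>J. norm (f q - f p)) = (\<Sum>i\<in>DN. (case h i of (p, q) \<Rightarrow> norm (f q - f p)))"
      unfolding J_def
    proof (rule sum.reindex_nontrivial[OF DN(2), unfolded comp_def])
      fix i j assume "i \<in> DN" "j \<in> DN" "i \<noteq> j" "h i = h j"
      then show "(case h i of (p, q) \<Rightarrow> norm (f q - f p)) = 0"
        using coll[of "fst i" "snd i" "fst j" "snd j"] by (simp add: h_def case_prod_unfold)
    qed
    also have "\<dots> = (\<Sum>(x,K)\<in>DN. norm (f (Sup K) - f (Inf K)))"
      by (intro sum.cong) (auto simp: h_def)
    finally have 1: "(\<Sum>(p, q)\<in>J. norm (f q - f p)) = (\<Sum>(x,K)\<in>DN. norm (f (Sup K) - f (Inf K)))" .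
    have "(\<Sum>(p, q)\<in>J. q - p) = (\<Sum>i\<in>DN. (case h i of (p, q) \<Rightarrow> q - p))"
      unfolding J_def
    proof (rule sum.reindex_nontrivial[OF DN(2), unfolded comp_def])
      fix i j assume "i \<in> DN" "j \<in> DN" "i \<noteq> j" "h i = h j"
      then show "(case h i of (p, q) \<Rightarrow> q - p) = 0"
        using coll[of "fst i" "snd i" "fst j" "snd j"] by (simp add: h_def case_prod_unfold)
    qed
    also have "\<dots> = (\<Sum>(x,K)\<in>DN. measure lborel K)"
      using K DN(1) by (intro sum.cong) (auto simp: h_def)
    finally have 2: "(\<Sum>(p, q)\<in>J. q - p) < \<delta>" using lenDN \<eta>(2) by simp
    have 3: "disjoint_family_on (\<lambda>(p, q). {p<..<q}) J"
      unfolding disjoint_family_on_def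
    proof (intro ballI impI)
      fix i j assume ij: "i \<in> J" "j \<in> J" "i \<noteq> j"
      obtain x K where 1: "(x, K) \<in> DN" "i = h (x, K)" using ij(1) unfolding J_def by force
      obtain x' K' where 2: "(x', K') \<in> DN" "j = h (x', K')" using ij(2) unfolding J_def by force
      have xk: "(x, K) \<in> D" "(x', K') \<in> D" "i = (Inf K, Sup K)" "j = (Inf K', Sup K')"
        using DN(1) 1 2 by (auto simp: h_def)
      then have "interior K \<inter> interior K' = {}"
        using tagged_division_ofD(5)[OF D(1) xk(1,2)] ij by auto
      moreover have "interior K = {Inf K<..<Sup K}" "interior K' = {Inf K'<..<Sup K'}"
        using K[OF xk(1)] K[OF xk(2)] by (metis interior_atLeastAtMost_real)+
      ultimately show "(case i of (p, q) \<Rightarrow> {p<..<q}) \<inter> (case j of (p, q) \<Rightarrow> {p<..<q}) = {}"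
        using xk by simp
    qed
    have 4: "\<forall>(p, q)\<in>J. a \<le> p \<and> p \<le> q \<and> q \<le> b"
      using K DN(1) unfolding J_def h_def by fastforce
    show ?thesis using \<delta>(2)[of J] 1 2 3 4 DN(2) by (simp add: J_def)
  qed
  have "f b - f a = (\<Sum>(x,K)\<in>D. f (Sup K) - f (Inf K))"
    using additive_tagged_division_1[OF ab D(1), of f] by simp
  also have "\<dots> = (\<Sum>(x,K)\<in>DN. f (Sup K) - f (Inf K)) + (\<Sum>(x,K)\<in>D - DN. f (Sup K) - f (Inf K))"
    using sum.subset_diff[OF DN(1) finD] by (simp add: add.commute)
  also have "\<dots> \<le> (\<Sum>(x,K)\<in>DN. norm (f (Sup K) - f (Inf K))) + (\<Sum>(x,K)\<in>D - DN. (c + e) * measure lborel K)"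
  proof (rule add_mono; rule sum_mono)
    fix i assume i: "i \<in> D - DN"
    obtain x K where [simp]: "i = (x, K)" by (cases i)
    have xK: "(x, K) \<in> D" "x \<notin> N" using i by (auto simp: DN_def)
    note K' = K[OF xK(1)]
    then have x: "x \<in> {a..b} - N" using xK by auto
    have "K \<subseteq> ball x (r x)" using D(2) xK(1) x unfolding \<gamma>_def fine_def by fastforce
    moreover have "Inf K \<in> K" "Sup K \<in> K" using K' by (metis atLeastAtMost_iff order_refl order_trans)+
    ultimately have "x - Inf K < r x" "Sup K - x < r x" by (auto simp: dist_real_def subset_iff)
    then show "(case i of (x, K) \<Rightarrow> f (Sup K) - f (Inf K)) \<le> (case i of (x, K) \<Rightarrow> (c + e) * measure lborel K)"
      using r(2)[OF x, of "Inf K" "Sup K"] K' by simp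
  qed auto
  also have "(\<Sum>(x,K)\<in>D - DN. (c + e) * measure lborel K) = (c + e) * ((b - a) - (\<Sum>(x,K)\<in>DN. measure lborel K))"
  proof -
    have "(\<Sum>(x,K)\<in>D. measure lborel K) = b - a"
      using additive_content_tagged_division[of D a b] D(1) ab by simp
    then have "(\<Sum>(x,K)\<in>D - DN. measure lborel K) = (b - a) - (\<Sum>(x,K)\<in>DN. measure lborel K)"
      using sum.subset_diff[OF DN(1) finD, of "\<lambda>(x,K). measure lborel K"] by simp
    then show ?thesis by (simp add: sum_distrib_left[symmetric] case_prod_unfold)
  qed
  also have "\<dots> \<le> (c + e) * (b - a) + e"
  proof -
    have "- (c + e) * (\<Sum>(x,K)\<in>DN. measure lborel K) \<le> \<bar>c + e\<bar> * \<eta>"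
      using lenDN len0 by (intro mult_mono) auto
    then show ?thesis using \<eta>(3) by (simp add: algebra_simps)
  qed
  finally have "f b - f a \<le> e + ((c + e) * (b - a) + e)" using sumN by simp
  also have "\<dots> = c * (b - a) + e0" using e(2) by (simp add: algebra_simps)
  finally show "f b - f a \<le> c * (b - a) + e0" .
qed

section \<open>Volterra equations and bounded Lipschitz functionals\<close>

text \<open>The right-hand side at time \<open>s\<close> may depend on the whole path but, by \<open>lip\<close>, only on its values up to
  \<open>s\<close>; the initial value is \<open>a\<close>.\<close>

locale volterra =
  fixes F :: "real \<Rightarrow> (real \<Rightarrow> 'a::euclidean_space) \<Rightarrow> 'a" and t0 T L :: real and a :: 'a
  assumes T: "t0 \<le> T" and L: "0 \<le> L"
    and cont: "\<And>w. continuous_on {t0..T} w \<Longrightarrow> continuous_on {t0..T} (\<lambda>s. F s w)"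
    and lip: "\<And>s w1 w2 M. s \<in> {t0..T} \<Longrightarrow> continuous_on {t0..T} w1 \<Longrightarrow> continuous_on {t0..T} w2 \<Longrightarrow>
      (\<And>r. r \<in> {t0..s} \<Longrightarrow> norm (w1 r - w2 r) \<le> M) \<Longrightarrow> norm (F s w1 - F s w2) \<le> L * M"
begin

definition K :: real where "K = 2 * L + 1"

lemma K: "K > 0" "L / K \<le> 1 / 2"
  using L unfolding K_def by (auto simp: field_simps)

text \<open>In the norm weighted with \<open>exp (- K * (r - t0))\<close> the integral operator contracts by the factor
  \<open>L / K \<le> 1 / 2\<close>, on intervals of any length.\<close>

lemma weighted_estimate:
  assumes w: "continuous_on {t0..T} w1" "continuous_on {t0..T} w2"
    and \<delta>: "\<delta> \<ge> 0" "\<And>r. r \<in> {t0..T} \<Longrightarrow> norm (w1 r - w2 r) \<le> exp (K * (r - t0)) * \<delta>"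
    and t: "t \<in> {t0..T}"
  shows "norm (integral {t0..t} (\<lambda>s. F s w1) - integral {t0..t} (\<lambda>s. F s w2)) \<le> exp (K * (t - t0)) * (\<delta> / 2)"
proof -
  have int: "(\<lambda>s. F s w1) integrable_on {t0..t}" "(\<lambda>s. F s w2) integrable_on {t0..t}"
    using t by (auto intro!: integrable_continuous_real continuous_on_subset[OF cont] w)
  have bound: "norm (F s w1 - F s w2) \<le> L * (exp (K * (s - t0)) * \<delta>)" if s: "s \<in> {t0..t}" for s
  proof (rule lip[OF _ w])
    fix r assume r: "r \<in> {t0..s}"
    have "norm (w1 r - w2 r) \<le> exp (K * (r - t0)) * \<delta>" using r s t by (intro \<delta>) auto
    also have "\<dots> \<le> exp (K * (s - t0)) * \<delta>"
      using r K \<delta>(1) by (intro mult_right_mono) auto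
    finally show "norm (w1 r - w2 r) \<le> exp (K * (s - t0)) * \<delta>" .
  qed (use s t in auto)
  have hi: "((\<lambda>s. L * (exp (K * (s - t0)) * \<delta>)) has_integral
      (L / K * exp (K * (t - t0)) * \<delta> - L / K * exp (K * (t0 - t0)) * \<delta>)) {t0..t}"
    using t K(1)
    by (intro fundamental_theorem_of_calculus)
       (auto intro!: derivative_eq_intros simp flip: has_real_derivative_iff_has_vector_derivative)
  have "norm (integral {t0..t} (\<lambda>s. F s w1) - integral {t0..t} (\<lambda>s. F s w2))
      = norm (integral {t0..t} (\<lambda>s. F s w1 - F s w2))"
    using int by (simp add: integral_diff)
  also have "\<dots> \<le> integral {t0..t} (\<lambda>s. L * (exp (K * (s - t0)) * \<delta>))"
    using int hi bound by (intro integral_norm_bound_integral) (auto intro: integrable_diff)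
  also have "\<dots> = L / K * exp (K * (t - t0)) * \<delta> - L / K * exp (K * (t0 - t0)) * \<delta>"
    using hi by (rule integral_unique)
  also have "\<dots> \<le> L / K * (exp (K * (t - t0)) * \<delta>)"
  proof -
    have "0 \<le> L / K * exp (K * (t0 - t0)) * \<delta>" using L K(1) \<delta>(1) by simp
    then show ?thesis by (simp add: mult.assoc)
  qed
  also have "\<dots> \<le> 1 / 2 * (exp (K * (t - t0)) * \<delta>)"
    using K(2) \<delta>(1) by (intro mult_right_mono) auto
  finally show ?thesis by simp
qed

lemma unique:
  assumes w: "continuous_on {t0..T} w1" "continuous_on {t0..T} w2"
    and eq: "\<And>t. t \<in> {t0..T} \<Longrightarrow> w1 t = a + integral {t0..t} (\<lambda>s. F s w1)"
      "\<And>t. t \<in> {t0..T} \<Longrightarrow> w2 t = a + integral {t0..t} (\<lambda>s. F s w2)"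
    and t: "t \<in> {t0..T}"
  shows "w1 t = w2 t"
proof -
  define g where "g r = exp (- K * (r - t0)) * norm (w1 r - w2 r)" for r
  have "continuous_on {t0..T} g" unfolding g_def by (intro continuous_intros w)
  then obtain m where m: "m \<in> {t0..T}" "\<And>r. r \<in> {t0..T} \<Longrightarrow> g r \<le> g m"
    using continuous_attains_sup[of "{t0..T}" g] T by auto
  have g: "norm (w1 r - w2 r) = exp (K * (r - t0)) * g r" for r
  proof -
    have "exp (K * (r - t0)) * exp (- K * (r - t0)) = 1" by (simp flip: exp_add)
    then show ?thesis unfolding g_def by (metis mult.assoc mult_1)
  qed
  have "norm (w1 r - w2 r) \<le> exp (K * (r - t0)) * g m" if "r \<in> {t0..T}" for r
    unfolding g using m(2)[OF that] by simp
  moreover have "g m \<ge> 0" by (simp add: g_def)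
  ultimately have "norm (integral {t0..m} (\<lambda>s. F s w1) - integral {t0..m} (\<lambda>s. F s w2)) \<le> exp (K * (m - t0)) * (g m / 2)"
    using m(1) by (intro weighted_estimate w) auto
  then have "norm (w1 m - w2 m) \<le> exp (K * (m - t0)) * (g m / 2)"
    using eq[OF m(1)] by simp
  then have "g m \<le> g m / 2" unfolding g[of m] by simp
  then have "g t \<le> 0" using m(2)[OF t] by simp
  then have "norm (w1 t - w2 t) \<le> 0" unfolding g[of t] by (simp add: mult_nonneg_nonpos)
  then show ?thesis by simp
qed

text \<open>Banach's fixed point theorem for the weighted path, which is extended to the whole line by
  constants so that the complete space of bounded continuous functions can be used.\<close>

lemma exists_solution:
  obtains w where "continuous_on {t0..T} w" "\<And>t. t \<in> {t0..T} \<Longrightarrow> w t = a + integral {t0..t} (\<lambda>s. F s w)"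
proof -
  define c where "c t = max t0 (min T t)" for t
  have c: "c t \<in> {t0..T}" for t using T by (auto simp: c_def)
  have ceq: "c t = t" if "t \<in> {t0..T}" for t using that by (auto simp: c_def)
  have cc: "continuous_on UNIV c" unfolding c_def by (intro continuous_intros)
  \<comment> \<open>The unknown of the fixed point problem is the path divided by the exponential weight.\<close>
  define lift where "lift v = (\<lambda>r. exp (K * (r - t0)) *\<^sub>R apply_bcontfun v r)" for v :: "real \<Rightarrow>\<^sub>C 'a"
  have lc: "continuous_on {t0..T} (lift v)" for v unfolding lift_def by (intro continuous_intros) auto
  define h where "h v t = exp (- K * (t - t0)) *\<^sub>R (a + integral {t0..t} (\<lambda>s. F s (lift v)))" for v t
  have hc: "continuous_on {t0..T} (h v)" for v
    unfolding h_def
    by (intro continuous_intros indefinite_integral_continuous_1 integrable_continuous_real cont lc)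
  have hb: "(\<lambda>t. h v (c t)) \<in> bcontfun" for v
  proof -
    have "continuous_on UNIV (\<lambda>t. h v (c t))"
      by (rule continuous_on_compose2[OF hc cc]) (use c in auto)
    moreover have "bounded (range (\<lambda>t. h v (c t)))"
      by (rule bounded_subset[OF compact_imp_bounded[OF compact_continuous_image[OF hc compact_Icc]]]) (use c in auto)
    ultimately show ?thesis by (simp add: bcontfun_def)
  qed
  define P where "P v = Bcontfun (\<lambda>t. h v (c t))" for v
  have P: "apply_bcontfun (P v) t = h v (c t)" for v t
    unfolding P_def using Bcontfun_inverse[OF hb] by simp
  have "dist (P v1) (P v2) \<le> 1 / 2 * dist v1 v2" for v1 v2
  proof (rule dist_bound)
    fix t
    define \<delta> where "\<delta> = dist v1 v2"
    have "norm (lift v1 r - lift v2 r) \<le> exp (K * (r - t0)) * \<delta>" for r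
    proof -
      have "norm (lift v1 r - lift v2 r) = exp (K * (r - t0)) * dist (apply_bcontfun v1 r) (apply_bcontfun v2 r)"
        unfolding lift_def by (simp add: dist_norm flip: scaleR_right_diff_distrib)
      then show ?thesis unfolding \<delta>_def using dist_bounded[of v1 r v2] by simp
    qed
    then have *: "norm (integral {t0..c t} (\<lambda>s. F s (lift v1)) - integral {t0..c t} (\<lambda>s. F s (lift v2)))
        \<le> exp (K * (c t - t0)) * (\<delta> / 2)"
      by (intro weighted_estimate lc c) (auto simp: \<delta>_def)
    have "dist (apply_bcontfun (P v1) t) (apply_bcontfun (P v2) t)
      = exp (- K * (c t - t0)) * norm (integral {t0..c t} (\<lambda>s. F s (lift v1)) - integral {t0..c t} (\<lambda>s. F s (lift v2)))"
      unfolding P h_def by (simp add: dist_norm flip: scaleR_right_diff_distrib)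
    also have "\<dots> \<le> exp (- K * (c t - t0)) * (exp (K * (c t - t0)) * (\<delta> / 2))"
      using * by (rule mult_left_mono) simp
    also have "\<dots> = 1 / 2 * \<delta>"
    proof -
      have "exp (- K * (c t - t0)) * exp (K * (c t - t0)) = 1" by (simp flip: exp_add)
      then have "exp (- K * (c t - t0)) * (exp (K * (c t - t0)) * (\<delta> / 2)) = 1 * (\<delta> / 2)"
        by (metis mult.assoc)
      then show ?thesis by simp
    qed
    finally show "dist (apply_bcontfun (P v1) t) (apply_bcontfun (P v2) t) \<le> 1 / 2 * dist v1 v2"
      by (simp add: \<delta>_def)
  qed
  then obtain v where v: "P v = v" using banach_fix_type[of "1/2" P] by auto
  have "lift v t = a + integral {t0..t} (\<lambda>s. F s (lift v))" if t: "t \<in> {t0..T}" for t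
  proof -
    have "apply_bcontfun v t = h v t" using P[of v t] ceq[OF t] v by simp
    then show ?thesis unfolding lift_def[of v] h_def by (simp flip: exp_add add: lift_def)
  qed
  then show ?thesis using that lc by blast
qed

end

text \<open>Gronwall's inequality for \<open>1 + |w|\<^sup>2\<close>.\<close>

lemma growth_bound:
  fixes w :: "real \<Rightarrow> 'a::real_inner"
  assumes der: "\<And>t. t \<in> {t0..T} \<Longrightarrow> (w has_vector_derivative w' t) (at t within {t0..T})"
    and en: "\<And>t. t \<in> {t0..T} \<Longrightarrow> inner (w t) (w' t) \<le> C * (1 + (norm (w t))\<^sup>2)"
    and t: "t \<in> {t0..T}"
  shows "1 + (norm (w t))\<^sup>2 \<le> (1 + (norm (w t0))\<^sup>2) * exp (2 * C * (t - t0))"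
proof -
  define g where "g s = exp (- 2 * C * (s - t0)) * (1 + inner (w s) (w s))" for s
  have wc: "continuous_on {t0..T} w"
    unfolding continuous_on_eq_continuous_within
    using has_vector_derivative_continuous[OF der] by blast
  have "g t \<le> g t0"
  proof (rule DERIV_nonpos_imp_decreasing_open[of t0 t g])
    show "t0 \<le> t" using t by simp
    show "continuous_on {t0..t} g" unfolding g_def
      using t by (intro continuous_intros continuous_on_subset[OF wc]) auto
    fix x assume x: "t0 < x" "x < t"
    have "(w has_vector_derivative w' x) (at x within {t0..T})" using der x t by auto
    then have wx: "(w has_derivative (\<lambda>h. h *\<^sub>R w' x)) (at x)"
      using x t at_within_interior[of x "{t0..T}"] by (simp add: has_vector_derivative_def)
    have "(g has_derivative (\<lambda>h. h * (exp (- 2 * C * (x - t0)) * (2 * inner (w x) (w' x) - 2 * C * (1 + inner (w x) (w x)))))) (at x)"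
      unfolding g_def
      by (rule derivative_eq_intros wx refl)+
         (auto simp: fun_eq_iff algebra_simps inner_commute)
    then have "(g has_real_derivative (exp (- 2 * C * (x - t0)) * (2 * inner (w x) (w' x) - 2 * C * (1 + inner (w x) (w x))))) (at x)"
      by (simp add: has_field_derivative_def mult_commute_abs)
    moreover have "2 * inner (w x) (w' x) - 2 * C * (1 + inner (w x) (w x)) \<le> 0"
      using en[of x] x t by (simp add: power2_norm_eq_inner)
    ultimately show "\<exists>y. DERIV g x :> y \<and> y \<le> 0"
      by (meson exp_ge_zero mult_nonneg_nonpos)
  qed
  then have "exp (- 2 * C * (t - t0)) * (1 + (norm (w t))\<^sup>2) \<le> 1 + (norm (w t0))\<^sup>2"
    by (simp add: g_def power2_norm_eq_inner)
  then have "exp (2 * C * (t - t0)) * (exp (- 2 * C * (t - t0)) * (1 + (norm (w t))\<^sup>2))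
      \<le> exp (2 * C * (t - t0)) * (1 + (norm (w t0))\<^sup>2)"
    by (rule mult_left_mono) simp
  moreover have "exp (2 * C * (t - t0)) * exp (- 2 * C * (t - t0)) = 1" by (simp flip: exp_add)
  ultimately have "1 + (norm (w t))\<^sup>2 \<le> exp (2 * C * (t - t0)) * (1 + (norm (w t0))\<^sup>2)"
    by (simp only: mult.assoc[symmetric] mult_1)
  then show ?thesis by (simp only: mult.commute)
qed

text \<open>Nonanticipating functionals of a path with bound \<open>B\<close> and Lipschitz constant \<open>L\<close> in the supremum norm
  of the past.  Boundedness is included because it is what makes products Lipschitz again.\<close>

definition bounded_lipschitz_with :: "real \<Rightarrow> real \<Rightarrow> (real \<Rightarrow> (real \<Rightarrow> 'a::real_normed_vector) \<Rightarrow> real) \<Rightarrow> real \<Rightarrow> real \<Rightarrow> bool" where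
  "bounded_lipschitz_with t0 T f B L \<longleftrightarrow> 0 \<le> B \<and> 0 \<le> L \<and>
    (\<forall>s\<in>{t0..T}. \<forall>w. continuous_on {t0..T} w \<longrightarrow> \<bar>f s w\<bar> \<le> B) \<and>
    (\<forall>s\<in>{t0..T}. \<forall>w1 w2 M. continuous_on {t0..T} w1 \<longrightarrow> continuous_on {t0..T} w2 \<longrightarrow>
     (\<forall>r\<in>{t0..s}. norm (w1 r - w2 r) \<le> M) \<longrightarrow> \<bar>f s w1 - f s w2\<bar> \<le> L * M)"

definition bounded_lipschitz :: "real \<Rightarrow> real \<Rightarrow> (real \<Rightarrow> (real \<Rightarrow> 'a::real_normed_vector) \<Rightarrow> real) \<Rightarrow> bool" where
  "bounded_lipschitz t0 T f \<longleftrightarrow> (\<exists>B L. bounded_lipschitz_with t0 T f B L)"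

lemma bounded_lipschitz_constants: "bounded_lipschitz t0 T f \<Longrightarrow> \<exists>B L. bounded_lipschitz_with t0 T f B L" by (simp add: bounded_lipschitz_def)

lemma bounded_lipschitzI:
  fixes f :: "real \<Rightarrow> (real \<Rightarrow> 'a::real_normed_vector) \<Rightarrow> real"
  assumes bd: "\<And>s w. s \<in> {t0..T} \<Longrightarrow> continuous_on {t0..T} w \<Longrightarrow> \<bar>f s w\<bar> \<le> B"
    and lip: "\<And>s w1 w2 M. s \<in> {t0..T} \<Longrightarrow> continuous_on {t0..T} w1 \<Longrightarrow> continuous_on {t0..T} w2 \<Longrightarrow>
     (\<And>r. r \<in> {t0..s} \<Longrightarrow> norm (w1 r - w2 r) \<le> M) \<Longrightarrow> M \<ge> 0 \<Longrightarrow> \<bar>f s w1 - f s w2\<bar> \<le> L * M"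
  shows "bounded_lipschitz t0 T f"
proof -
  have "\<bar>f s w1 - f s w2\<bar> \<le> \<bar>L\<bar> * M"
    if s: "s \<in> {t0..T}" and w: "continuous_on {t0..T} w1" "continuous_on {t0..T} w2"
      and M: "\<forall>r\<in>{t0..s}. norm (w1 r - w2 r) \<le> M" for s w1 w2 M
  proof -
    have "0 \<le> M" using M s norm_ge_zero order_trans[of 0 "norm (w1 s - w2 s)" M] by auto
    then have "\<bar>f s w1 - f s w2\<bar> \<le> L * M" using lip[OF s w] M by blast
    also have "\<dots> \<le> \<bar>L\<bar> * M" using \<open>0 \<le> M\<close> by (intro mult_right_mono) auto
    finally show ?thesis .
  qed
  moreover have "\<bar>f s w\<bar> \<le> \<bar>B\<bar>" if "s \<in> {t0..T}" "continuous_on {t0..T} w" for s w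
    using bd[OF that] by simp
  ultimately have "bounded_lipschitz_with t0 T f \<bar>B\<bar> \<bar>L\<bar>" unfolding bounded_lipschitz_with_def by simp
  then show ?thesis unfolding bounded_lipschitz_def by blast
qed

lemma bounded_lipschitz_withD:
  assumes "bounded_lipschitz_with t0 T f B L"
  shows "B \<ge> 0" "L \<ge> 0" "\<And>s w. s \<in> {t0..T} \<Longrightarrow> continuous_on {t0..T} w \<Longrightarrow> \<bar>f s w\<bar> \<le> B"
    "\<And>s w1 w2 M. s \<in> {t0..T} \<Longrightarrow> continuous_on {t0..T} w1 \<Longrightarrow> continuous_on {t0..T} w2 \<Longrightarrow>
     (\<And>r. r \<in> {t0..s} \<Longrightarrow> norm (w1 r - w2 r) \<le> M) \<Longrightarrow> \<bar>f s w1 - f s w2\<bar> \<le> L * M"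
  using assms by (auto simp: bounded_lipschitz_with_def)

lemma bounded_lipschitz_const:
  assumes "continuous_on {t0..T} g"
  shows "bounded_lipschitz t0 T (\<lambda>s w. g s)"
proof -
  have "bounded (g ` {t0..T})" by (intro compact_imp_bounded compact_continuous_image assms compact_Icc)
  then obtain B where "\<forall>s\<in>{t0..T}. \<bar>g s\<bar> \<le> B" unfolding bounded_iff by auto
  then show ?thesis by (intro bounded_lipschitzI[of _ _ _ B 0]) auto
qed

lemma bounded_lipschitz_add:
  fixes f g :: "real \<Rightarrow> (real \<Rightarrow> 'a::real_normed_vector) \<Rightarrow> real"
  assumes "bounded_lipschitz t0 T f" "bounded_lipschitz t0 T g" shows "bounded_lipschitz t0 T (\<lambda>s w. f s w + g s w)"
proof -
  obtain B1 L1 where "bounded_lipschitz_with t0 T f B1 L1" using bounded_lipschitz_constants[OF assms(1)] by blast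
  note 1 = bounded_lipschitz_withD[OF this]
  obtain B2 L2 where "bounded_lipschitz_with t0 T g B2 L2" using bounded_lipschitz_constants[OF assms(2)] by blast
  note 2 = bounded_lipschitz_withD[OF this]
  show ?thesis
  proof (rule bounded_lipschitzI[of _ _ _ "B1 + B2" "L1 + L2"])
    show "\<bar>f s w + g s w\<bar> \<le> B1 + B2" if "s \<in> {t0..T}" "continuous_on {t0..T} w" for s w
      using 1(3)[OF that] 2(3)[OF that] by linarith
    fix s and w1 w2 :: "real \<Rightarrow> 'a" and M :: real
    assume *: "s \<in> {t0..T}" "continuous_on {t0..T} w1" "continuous_on {t0..T} w2"
      "\<And>r. r \<in> {t0..s} \<Longrightarrow> norm (w1 r - w2 r) \<le> M"
    show "\<bar>f s w1 + g s w1 - (f s w2 + g s w2)\<bar> \<le> (L1 + L2) * M"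
      using 1(4)[OF *] 2(4)[OF *] by (simp add: algebra_simps)
  qed
qed

lemma bounded_lipschitz_mult:
  fixes f g :: "real \<Rightarrow> (real \<Rightarrow> 'a::real_normed_vector) \<Rightarrow> real"
  assumes "bounded_lipschitz t0 T f" "bounded_lipschitz t0 T g" shows "bounded_lipschitz t0 T (\<lambda>s w. f s w * g s w)"
proof -
  obtain B1 L1 where "bounded_lipschitz_with t0 T f B1 L1" using bounded_lipschitz_constants[OF assms(1)] by blast
  note 1 = bounded_lipschitz_withD[OF this]
  obtain B2 L2 where "bounded_lipschitz_with t0 T g B2 L2" using bounded_lipschitz_constants[OF assms(2)] by blast
  note 2 = bounded_lipschitz_withD[OF this]
  show ?thesis
  proof (rule bounded_lipschitzI[of _ _ _ "B1 * B2" "B1 * L2 + L1 * B2"])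
    show "\<bar>f s w * g s w\<bar> \<le> B1 * B2" if "s \<in> {t0..T}" "continuous_on {t0..T} w" for s w
      using 1(3)[OF that] 2(3)[OF that] 1(1) unfolding abs_mult by (intro mult_mono) auto
    fix s and w1 w2 :: "real \<Rightarrow> 'a" and M :: real
    assume *: "s \<in> {t0..T}" "continuous_on {t0..T} w1" "continuous_on {t0..T} w2"
      "\<And>r. r \<in> {t0..s} \<Longrightarrow> norm (w1 r - w2 r) \<le> M" and M: "M \<ge> 0"
    have "\<bar>f s w1 * g s w1 - f s w2 * g s w2\<bar> = \<bar>f s w1 * (g s w1 - g s w2) + (f s w1 - f s w2) * g s w2\<bar>"
      by (simp add: algebra_simps)
    also have "\<dots> \<le> \<bar>f s w1\<bar> * \<bar>g s w1 - g s w2\<bar> + \<bar>f s w1 - f s w2\<bar> * \<bar>g s w2\<bar>"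
      unfolding abs_mult[symmetric] by (rule abs_triangle_ineq)
    also have "\<dots> \<le> B1 * (L2 * M) + (L1 * M) * B2"
      using 1(3)[OF *(1,2)] 2(3)[OF *(1,3)] 1(4)[OF *] 2(4)[OF *] 1(1,2) M
      by (intro add_mono mult_mono) auto
    finally show "\<bar>f s w1 * g s w1 - f s w2 * g s w2\<bar> \<le> (B1 * L2 + L1 * B2) * M"
      by (simp add: algebra_simps)
  qed
qed

lemma bounded_lipschitz_sum:
  fixes f :: "'i \<Rightarrow> real \<Rightarrow> (real \<Rightarrow> 'a::real_normed_vector) \<Rightarrow> real"
  assumes "finite S" "\<And>i. i \<in> S \<Longrightarrow> bounded_lipschitz t0 T (f i)"
  shows "bounded_lipschitz t0 T (\<lambda>s w. \<Sum>i\<in>S. f i s w)"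
  using assms
proof (induction S rule: finite_induct)
  case empty
  then show ?case using bounded_lipschitz_const[of t0 T "\<lambda>_. 0"] by simp
next
  case (insert i S)
  then show ?case using bounded_lipschitz_add[of t0 T "f i" "\<lambda>s w. \<Sum>i\<in>S. f i s w"] by simp
qed

lemma bounded_lipschitz_compose:
  fixes p :: "real \<Rightarrow> (real \<Rightarrow> 'a::real_normed_vector) \<Rightarrow> real"
  assumes g: "L-lipschitz_on {-R..R} g" and p: "bounded_lipschitz t0 T p" and R: "\<And>s w. \<bar>p s w\<bar> \<le> R"
  shows "bounded_lipschitz t0 T (\<lambda>s w. g (p s w))"
proof -
  obtain B1 L1 where bounded_lipschitz_with: "bounded_lipschitz_with t0 T p B1 L1" using bounded_lipschitz_constants[OF p] by blast
  note 1 = bounded_lipschitz_withD(2)[OF bounded_lipschitz_with] and 2 = bounded_lipschitz_withD(4)[OF bounded_lipschitz_with]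
  have pR: "p s w \<in> {-R..R}" for s w using R[of s w] by (auto simp: abs_le_iff)
  have L: "L \<ge> 0" using lipschitz_on_nonneg[OF g] .
  have "bounded (g ` {-R..R})"
    by (intro compact_imp_bounded compact_continuous_image lipschitz_on_continuous_on[OF g] compact_Icc)
  then obtain B where B: "\<forall>s\<in>{-R..R}. \<bar>g s\<bar> \<le> B" unfolding bounded_iff by auto
  show ?thesis
  proof (rule bounded_lipschitzI[of _ _ _ B "L * L1"])
    show "\<bar>g (p s w)\<bar> \<le> B" for s w using B pR by blast
    fix s and w1 w2 :: "real \<Rightarrow> 'a" and M :: real
    assume *: "s \<in> {t0..T}" "continuous_on {t0..T} w1" "continuous_on {t0..T} w2"
      "\<And>r. r \<in> {t0..s} \<Longrightarrow> norm (w1 r - w2 r) \<le> M" and M: "M \<ge> 0"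
    have "\<bar>g (p s w1) - g (p s w2)\<bar> \<le> L * \<bar>p s w1 - p s w2\<bar>"
      using lipschitz_onD[OF g pR pR] by (simp add: dist_real_def)
    also have "\<dots> \<le> L * (L1 * M)" using L 2[OF *] by (rule mult_left_mono[rotated])
    finally show "\<bar>g (p s w1) - g (p s w2)\<bar> \<le> L * L1 * M" by simp
  qed
qed

section \<open>The sigmoid and the inflated Heaviside graph\<close>

lemma sigmoid_bounds: "0 \<le> sigmoid \<epsilon> s" "sigmoid \<epsilon> s \<le> 1"
  by (auto simp: sigmoid_def field_simps add_pos_pos intro: add_nonneg_nonneg)

lemma sigmoid_DERIV:
  "\<epsilon> > 0 \<Longrightarrow> (sigmoid \<epsilon> has_real_derivative exp (- s / \<epsilon>) / \<epsilon> / (1 + exp (- s / \<epsilon>))\<^sup>2) (at s)"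
  unfolding sigmoid_def
  by (rule derivative_eq_intros refl | simp add: add_pos_pos add_pos_pos[THEN less_imp_neq, symmetric])+
     (simp add: power2_eq_square)

lemma sigmoid_lipschitz:
  assumes "\<epsilon> > 0"
  shows "\<bar>sigmoid \<epsilon> x - sigmoid \<epsilon> y\<bar> \<le> 1 / \<epsilon> * \<bar>x - y\<bar>"
proof -
  have "norm (sigmoid \<epsilon> x - sigmoid \<epsilon> y) \<le> 1 / \<epsilon> * norm (x - y)"
  proof (rule field_differentiable_bound[of UNIV])
    fix s :: real
    show "(sigmoid \<epsilon> has_field_derivative exp (- s / \<epsilon>) / \<epsilon> / (1 + exp (- s / \<epsilon>))\<^sup>2) (at s within UNIV)"
      using sigmoid_DERIV[OF assms] by simp
    define e where "e = exp (- s / \<epsilon>)"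
    have e: "e > 0" by (simp add: e_def)
    then have "e \<le> (1 + e)\<^sup>2" "(1 + e)\<^sup>2 > 0" by (auto simp: power2_eq_square algebra_simps add_pos_pos)
    then have "e / (1 + e)\<^sup>2 \<le> 1" by (simp add: divide_le_eq)
    moreover have "norm (e / \<epsilon> / (1 + e)\<^sup>2) = e / (1 + e)\<^sup>2 * (1 / \<epsilon>)"
      using e assms by simp
    ultimately show "norm (exp (- s / \<epsilon>) / \<epsilon> / (1 + exp (- s / \<epsilon>))\<^sup>2) \<le> 1 / \<epsilon>"
      unfolding e_def[symmetric] using assms
      by (metis mult_left_le_one_le less_eq_real_def mult.commute mult_1 mult_right_mono zero_less_divide_1_iff)
  qed auto
  then show ?thesis by simp
qed

lemma sigmoid_continuous: "\<epsilon> > 0 \<Longrightarrow> continuous_on S (sigmoid \<epsilon>)"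
  by (meson DERIV_isCont continuous_at_imp_continuous_on sigmoid_DERIV)

lemma inflation_width_nonneg:
  assumes "0 \<le> \<epsilon>" "\<epsilon> \<le> 1/5" shows "0 \<le> inflation_width \<epsilon>"
  using assms by (auto simp: inflation_width_def field_simps intro!: mult_nonneg_nonneg ln_ge_zero)

text \<open>The derivative of \<open>x * ln ((1 - x) / x)\<close> is \<open>ln ((1 - x) / x) - 1 / (1 - x)\<close>.  For \<open>x \<le> 1/5\<close> the
  logarithm is at least \<open>ln 4 \<ge> 4/3\<close> and the fraction at most \<open>5/4\<close>; this is where the bound \<open>1/5\<close>
  on the parameters comes from.\<close>

lemma inflation_width_mono:
  assumes "0 < \<epsilon>" "\<epsilon> \<le> \<delta>" "\<delta> \<le> 1/5"
  shows "inflation_width \<epsilon> \<le> inflation_width \<delta>"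
proof -
  define b where "b e = e * (ln (1 - e) - ln e)" for e :: real
  have "b \<epsilon> \<le> b \<delta>"
  proof (rule DERIV_nonneg_imp_nondecreasing[of \<epsilon> \<delta> b])
    show "\<epsilon> \<le> \<delta>" by fact
    fix x assume x: "\<epsilon> \<le> x" "x \<le> \<delta>"
    then have x': "0 < x" "x \<le> 1/5" using assms by auto
    have "(b has_real_derivative (ln (1 - x) - ln x) + x * (- 1 / (1 - x) - 1 / x)) (at x)"
      unfolding b_def using x' by (auto intro!: derivative_eq_intros)
    moreover have "0 \<le> (ln (1 - x) - ln x) + x * (- 1 / (1 - x) - 1 / x)"
    proof -
      have "x * (- 1 / (1 - x) - 1 / x) = - 1 / (1 - x)" using x' by (simp add: field_simps)
      moreover have "1 / (1 - x) \<le> 5 / 4" using x' by (simp add: field_simps)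
      moreover have "5 / 4 \<le> ln (4 :: real)"
      proof -
        have "ln (4 :: real) = 2 * ln 2" using ln_realpow[of "2 :: real" 2] by simp
        then show ?thesis using ln2_ge_two_thirds by simp
      qed
      moreover have "ln 4 \<le> ln (1 - x) - ln x"
      proof -
        have "4 \<le> (1 - x) / x" using x' by (simp add: field_simps)
        then have "ln 4 \<le> ln ((1 - x) / x)" by (intro ln_mono) auto
        then show ?thesis using x' by (simp add: ln_div)
      qed
      ultimately show ?thesis by simp
    qed
    ultimately show "\<exists>y. (b has_real_derivative y) (at x) \<and> 0 \<le> y" by blast
  qed
  then show ?thesis using assms by (simp add: inflation_width_def b_def ln_div)
qed

lemma inflated_Heaviside_mono:
  assumes "0 \<le> \<epsilon>" "\<epsilon> \<le> \<delta>" "\<delta> \<le> 1/5"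
  shows "inflated_Heaviside \<epsilon> s \<subseteq> inflated_Heaviside \<delta> s"
proof -
  have "inflation_width \<epsilon> \<le> inflation_width \<delta>"
  proof (cases "\<epsilon> = 0")
    case True
    then show ?thesis using inflation_width_nonneg[of \<delta>] assms by (simp add: inflation_width_def)
  qed (use inflation_width_mono assms in auto)
  then show ?thesis using assms inflation_width_nonneg[of \<epsilon>] by (auto simp: inflated_Heaviside_def)
qed

text \<open>The inflation width is chosen such that the sigmoid takes the values \<open>\<epsilon>\<close> and \<open>1 - \<epsilon>\<close> exactly at
  \<open>\<plusminus>\<close> the width.\<close>

lemma sigmoid_in_inflated_Heaviside:
  assumes e: "0 < \<epsilon>" "\<epsilon> \<le> 1/5"
  shows "sigmoid \<epsilon> s \<in> inflated_Heaviside \<epsilon> s"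
proof -
  have pos: "1 + exp z > 0" for z :: real by (simp add: add_pos_pos)
  have 1: "1 - \<epsilon> \<le> sigmoid \<epsilon> s" if "s > inflation_width \<epsilon>"
  proof -
    have "ln ((1 - \<epsilon>) / \<epsilon>) < s / \<epsilon>"
      using that e by (simp add: inflation_width_def field_simps)
    then have "exp (ln ((1 - \<epsilon>) / \<epsilon>)) < exp (s / \<epsilon>)" by (rule exp_less_mono)
    then have "(1 - \<epsilon>) / \<epsilon> < exp (s / \<epsilon>)" using e by simp
    then have "exp (- s / \<epsilon>) \<le> \<epsilon> / (1 - \<epsilon>)" using e by (simp add: exp_minus field_simps)
    then show ?thesis using e pos[of "- s / \<epsilon>"] by (simp add: sigmoid_def field_simps)
  qed
  have 2: "sigmoid \<epsilon> s \<le> \<epsilon>" if "s < - inflation_width \<epsilon>"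
  proof -
    have "ln ((1 - \<epsilon>) / \<epsilon>) < - s / \<epsilon>"
      using that e by (simp add: inflation_width_def field_simps)
    then have "exp (ln ((1 - \<epsilon>) / \<epsilon>)) < exp (- s / \<epsilon>)" by (rule exp_less_mono)
    then have "(1 - \<epsilon>) / \<epsilon> < exp (- s / \<epsilon>)" using e by simp
    then show ?thesis using e pos[of "- s / \<epsilon>"] by (simp add: sigmoid_def field_simps)
  qed
  show ?thesis using 1 2 sigmoid_bounds[of \<epsilon> s] by (auto simp: inflated_Heaviside_def)
qed

definition chi_lo :: "real \<Rightarrow> real \<Rightarrow> real" where
  "chi_lo \<epsilon> s = (if s \<le> inflation_width \<epsilon> then 0 else 1 - \<epsilon>)"
definition chi_up :: "real \<Rightarrow> real \<Rightarrow> real" where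
  "chi_up \<epsilon> s = (if s < - inflation_width \<epsilon> then \<epsilon> else 1)"

lemma inflated_Heaviside_eq:
  assumes "0 \<le> \<epsilon>" "\<epsilon> \<le> 1/5"
  shows "inflated_Heaviside \<epsilon> s = {chi_lo \<epsilon> s..chi_up \<epsilon> s}"
  using inflation_width_nonneg[OF assms] by (auto simp: inflated_Heaviside_def chi_lo_def chi_up_def)

lemma chi_bounds:
  assumes "0 \<le> \<epsilon>" "\<epsilon> \<le> 1/5"
  shows "0 \<le> chi_lo \<epsilon> s" "chi_lo \<epsilon> s \<le> chi_up \<epsilon> s" "chi_up \<epsilon> s \<le> 1"
  using assms inflation_width_nonneg[OF assms] by (auto simp: chi_lo_def chi_up_def)

lemma chi_measurable [measurable]: "chi_lo \<epsilon> \<in> borel_measurable borel" "chi_up \<epsilon> \<in> borel_measurable borel"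
  unfolding chi_lo_def chi_up_def by measurable

text \<open>The integrals of the lower and upper envelope are the extreme values, and convex combinations of
  the two envelopes are selectors that attain every value in between.\<close>

lemma Aumann_integral_interval:
  assumes M: "finite_measure M" and x: "x \<in> borel_measurable M" and e: "0 \<le> \<epsilon>" "\<epsilon> \<le> 1/5"
  shows "Aumann_integral M (\<lambda>\<tau>. inflated_Heaviside \<epsilon> (x \<tau>)) = {(LINT \<tau>|M. chi_lo \<epsilon> (x \<tau>))..(LINT \<tau>|M. chi_up \<epsilon> (x \<tau>))}"
proof -
  interpret finite_measure M by fact
  have lo: "integrable M (\<lambda>\<tau>. chi_lo \<epsilon> (x \<tau>))" and up: "integrable M (\<lambda>\<tau>. chi_up \<epsilon> (x \<tau>))"
    using chi_bounds[OF e] x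
    by (auto intro!: integrable_const_bound[of _ 1] AE_I2 measurable_compose[OF x] simp: abs_le_iff)
       (meson chi_bounds(1-3)[OF e] order_trans neg_le_0_iff_le zero_le_one)+
  show ?thesis
  proof (intro equalityI subsetI)
    fix y assume "y \<in> Aumann_integral M (\<lambda>\<tau>. inflated_Heaviside \<epsilon> (x \<tau>))"
    then obtain s where "y = (LINT \<tau>|M. s \<tau>)" "integrable M s"
      "\<And>\<tau>. \<tau> \<in> space M \<Longrightarrow> s \<tau> \<in> {chi_lo \<epsilon> (x \<tau>)..chi_up \<epsilon> (x \<tau>)}"
      unfolding Aumann_integral_def inflated_Heaviside_eq[OF e] by auto
    then show "y \<in> {(LINT \<tau>|M. chi_lo \<epsilon> (x \<tau>))..(LINT \<tau>|M. chi_up \<epsilon> (x \<tau>))}"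
      using lo up by (auto intro!: integral_mono)
  next
    fix y assume y: "y \<in> {(LINT \<tau>|M. chi_lo \<epsilon> (x \<tau>))..(LINT \<tau>|M. chi_up \<epsilon> (x \<tau>))}"
    define a where "a = (LINT \<tau>|M. chi_lo \<epsilon> (x \<tau>))"
    define b where "b = (LINT \<tau>|M. chi_up \<epsilon> (x \<tau>))"
    have "\<exists>l. 0 \<le> l \<and> l \<le> 1 \<and> y = (1 - l) * a + l * b"
    proof (cases "a = b")
      case True
      then show ?thesis using y by (intro exI[of _ 0]) (auto simp: a_def b_def)
    next
      case False
      then have "a < b" "a \<le> y" "y \<le> b" using y by (auto simp: a_def b_def)
      moreover from this have "(y - a) / (b - a) * (b - a) = y - a" by simp
      then have "y = (1 - (y - a) / (b - a)) * a + (y - a) / (b - a) * b"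
        by (simp only: algebra_simps)
      ultimately show ?thesis by (intro exI[of _ "(y - a) / (b - a)"]) auto
    qed
    then obtain l where l: "0 \<le> l" "l \<le> 1" "y = (1 - l) * a + l * b" by blast
    define s where "s \<tau> = (1 - l) * chi_lo \<epsilon> (x \<tau>) + l * chi_up \<epsilon> (x \<tau>)" for \<tau>
    have "integrable M s" unfolding s_def using lo up by auto
    moreover have "(LINT \<tau>|M. s \<tau>) = y" unfolding s_def l(3) a_def b_def using lo up by simp
    moreover have "s \<tau> \<in> {chi_lo \<epsilon> (x \<tau>)..chi_up \<epsilon> (x \<tau>)}" for \<tau>
    proof -
      define p q where "p = chi_lo \<epsilon> (x \<tau>)" and "q = chi_up \<epsilon> (x \<tau>)"
      have "p \<le> q" using chi_bounds[OF e] by (simp add: p_def q_def)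
      then have "l * p \<le> l * q" "(1 - l) * p \<le> (1 - l) * q" using l by (auto intro: mult_left_mono)
      then show ?thesis unfolding s_def p_def[symmetric] q_def[symmetric] by (auto simp: algebra_simps)
    qed
    ultimately show "y \<in> Aumann_integral M (\<lambda>\<tau>. inflated_Heaviside \<epsilon> (x \<tau>))"
      unfolding Aumann_integral_def inflated_Heaviside_eq[OF e] by blast
  qed
qed

section \<open>The sigmoidal equation\<close>

lemma continuous_on_state:
  fixes f :: "real \<Rightarrow> 'n::finite state"
  assumes "\<And>i j. continuous_on S (\<lambda>s. f s $ i $ j)"
  shows "continuous_on S f"
proof -
  have "continuous_on S (\<lambda>s. \<chi> i j. f s $ i $ j)" by (intro continuous_on_vec_lambda assms)
  then show ?thesis by simp
qed

lemma norm_state_le_sum: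
  fixes v :: "'n::finite state"
  shows "norm v \<le> (\<Sum>i\<in>UNIV. \<Sum>j\<in>UNIV. \<bar>v $ i $ j\<bar>)"
proof -
  have "norm v \<le> (\<Sum>i\<in>UNIV. norm (v $ i))" unfolding norm_vec_def by (intro L2_set_le_sum) auto
  also have "\<dots> \<le> (\<Sum>i\<in>UNIV. \<Sum>j\<in>UNIV. \<bar>v $ i $ j\<bar>)"
  proof (rule sum_mono)
    fix i show "norm (v $ i) \<le> (\<Sum>j\<in>UNIV. \<bar>v $ i $ j\<bar>)"
      unfolding norm_vec_def real_norm_def[symmetric] by (intro L2_set_le_sum) auto
  qed
  finally show ?thesis .
qed

lemma state_component_le_norm:
  fixes v :: "'n::finite state"
  shows "\<bar>v $ i $ j\<bar> \<le> norm v"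
  using Finite_Cartesian_Product.norm_nth_le[of v i] Finite_Cartesian_Product.norm_nth_le[of "v $ i" j]
  by (simp add: real_norm_def[symmetric] del: real_norm_def)

lemma bounded_lipschitz_components_lipschitz:
  fixes F :: "real \<Rightarrow> (real \<Rightarrow> 'n::finite state) \<Rightarrow> 'n state"
  assumes "\<And>i j. bounded_lipschitz t0 T (\<lambda>s w. F s w $ i $ j)"
  obtains L where "L \<ge> 0"
    "\<And>s w1 w2 M. s \<in> {t0..T} \<Longrightarrow> continuous_on {t0..T} w1 \<Longrightarrow> continuous_on {t0..T} w2 \<Longrightarrow>
      (\<And>r. r \<in> {t0..s} \<Longrightarrow> norm (w1 r - w2 r) \<le> M) \<Longrightarrow> norm (F s w1 - F s w2) \<le> L * M"
proof -
  obtain B L where "\<And>i j. bounded_lipschitz_with t0 T (\<lambda>s w. F s w $ i $ j) (B i j) (L i j)"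
    using bounded_lipschitz_constants[OF assms] by metis
  note BL = bounded_lipschitz_withD[OF this]
  show ?thesis
  proof (rule that)
    show "0 \<le> (\<Sum>i\<in>UNIV. \<Sum>j\<in>UNIV. L i j)" using BL(2) by (intro sum_nonneg) auto
    fix s M and w1 w2 :: "real \<Rightarrow> 'n state"
    assume *: "s \<in> {t0..T}" "continuous_on {t0..T} w1" "continuous_on {t0..T} w2"
      "\<And>r. r \<in> {t0..s} \<Longrightarrow> norm (w1 r - w2 r) \<le> M"
    have "norm (F s w1 - F s w2) \<le> (\<Sum>i\<in>UNIV. \<Sum>j\<in>UNIV. \<bar>(F s w1 - F s w2) $ i $ j\<bar>)"
      by (rule norm_state_le_sum)
    also have "\<dots> \<le> (\<Sum>i\<in>UNIV. \<Sum>j\<in>UNIV. L i j * M)"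
      using BL(4)[OF *] by (intro sum_mono) auto
    finally show "norm (F s w1 - F s w2) \<le> (\<Sum>i\<in>UNIV. \<Sum>j\<in>UNIV. L i j) * M"
      by (simp add: sum_distrib_right)
  qed
qed

text \<open>Clipping keeps the sign and does not increase the absolute value; these two properties are what the
  energy estimate needs of a truncation.\<close>

definition clip :: "real \<Rightarrow> real \<Rightarrow> real" where "clip R x = max (- R) (min R x)"

lemma clip: "R \<ge> 0 \<Longrightarrow> \<bar>clip R x\<bar> \<le> R" "\<bar>clip R x - clip R y\<bar> \<le> \<bar>x - y\<bar>"
  "R \<ge> 0 \<Longrightarrow> 0 \<le> clip R x * x" "R \<ge> 0 \<Longrightarrow> \<bar>clip R x\<bar> \<le> \<bar>x\<bar>" "\<bar>x\<bar> \<le> R \<Longrightarrow> clip R x = x"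
  by (auto simp: clip_def max_def min_def zero_le_mult_iff abs_if split: if_splits)

lemma clip_continuous: "continuous_on S f \<Longrightarrow> continuous_on S (\<lambda>x. clip R (f x))"
  unfolding clip_def by (intro continuous_intros)

lemma locally_Lipschitz_imp_lipschitz_on:
  assumes "locally_Lipschitz f"
  obtains L where "L-lipschitz_on {-R..R} f"
proof -
  have ll: "local_lipschitz {0::real} {-R..R} (\<lambda>_. f)"
    unfolding local_lipschitz_def
  proof (intro ballI)
    fix x t :: real
    obtain \<delta> L where dL: "\<delta> > 0" "L-lipschitz_on (ball x \<delta>) f"
      using assms unfolding locally_Lipschitz_def by blast
    have "L-lipschitz_on (cball x (\<delta> / 2) \<inter> {-R..R}) f"
      using dL(2) by (rule lipschitz_on_subset) (use dL(1) in auto)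
    then show "\<exists>u>0. \<exists>L. \<forall>t\<in>cball t u \<inter> {0}. L-lipschitz_on (cball x u \<inter> {-R..R}) f"
      using dL(1) by (intro exI[of _ "\<delta> / 2"]) auto
  qed
  show ?thesis
    by (rule local_lipschitz_compact_implies_lipschitz[OF ll]) (auto intro: that)
qed

lemma bounded_lipschitz_cong:
  assumes "\<And>s w. s \<in> {t0..T} \<Longrightarrow> f s w = g s w" "bounded_lipschitz t0 T g"
  shows "bounded_lipschitz t0 T f"
  using assms unfolding bounded_lipschitz_def bounded_lipschitz_with_def by auto

text \<open>The analytic content of the hypotheses that solutions on bounded time intervals depend on.  The
  signs of \<open>A\<close> and \<open>B\<close> let the decay terms be dropped from the energy estimate; the measures are
  finite by the exponential moment condition, whose integrand is at least \<open>1\<close>.\<close>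

locale neuron_network =
  fixes A I :: "'n::finite \<Rightarrow> real \<Rightarrow> real"
    and B :: "'n \<Rightarrow> 'n \<Rightarrow> real \<Rightarrow> real"
    and c d :: "'n \<Rightarrow> 'n \<Rightarrow> real"
    and \<Gamma> :: "'n \<Rightarrow> real"
    and \<mu> :: "'n \<Rightarrow> 'n \<Rightarrow> real measure"
    and \<gamma> :: real
  assumes gamma_pos: "\<gamma> > 0"
    and measures: "\<And>i j. i \<noteq> j \<Longrightarrow> sets (\<mu> i j) = sets (restrict_space borel {..0})"
      "\<And>i j. i \<noteq> j \<Longrightarrow> finite_measure (\<mu> i j)"
    and Lipschitz: "\<And>i. locally_Lipschitz (A i)" "\<And>i j. i \<noteq> j \<Longrightarrow> locally_Lipschitz (B i j)"
    and nonneg: "\<And>i s. A i s \<ge> 0" "\<And>i j s. i \<noteq> j \<Longrightarrow> B i j s \<ge> 0"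
    and I: "\<And>i. continuous_on UNIV (I i)"
begin

lemma space_mu: "i \<noteq> j \<Longrightarrow> space (\<mu> i j) = {..0}"
  using sets_eq_imp_space_eq[OF measures(1)] by (simp add: space_restrict_space)

lemma measurable_mu:
  assumes "i \<noteq> j" "continuous_on {..0} g"
  shows "g \<in> borel_measurable (\<mu> i j)"
  using borel_measurable_continuous_on_restrict[OF assms(2)] measurable_cong_sets[OF measures(1)[OF assms(1)] refl]
  by blast

definition mass :: "'n \<Rightarrow> 'n \<Rightarrow> real" where "mass i j = measure (\<mu> i j) (space (\<mu> i j))"

lemma mass_nonneg: "mass i j \<ge> 0" by (simp add: mass_def)

definition act :: "real \<Rightarrow> 'n \<Rightarrow> 'n \<Rightarrow> (real \<Rightarrow> 'n state) \<Rightarrow> real" where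
  "act \<epsilon> i j u = (LINT \<tau>|\<mu> i j. sigmoid \<epsilon> (xc (u \<tau>) i - \<Gamma> i))"

lemma act_bounds: assumes "i \<noteq> j" shows "0 \<le> act \<epsilon> i j u" "act \<epsilon> i j u \<le> mass i j"
proof -
  interpret finite_measure "\<mu> i j" using measures(2)[OF assms] .
  show "0 \<le> act \<epsilon> i j u" unfolding act_def by (intro integral_nonneg_AE) (simp add: sigmoid_bounds)
  show "act \<epsilon> i j u \<le> mass i j"
  proof (cases "integrable (\<mu> i j) (\<lambda>\<tau>. sigmoid \<epsilon> (xc (u \<tau>) i - \<Gamma> i))")
    case True
    then have "act \<epsilon> i j u \<le> (LINT \<tau>|\<mu> i j. 1)"
      unfolding act_def by (intro integral_mono) (auto simp: sigmoid_bounds)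
    then show ?thesis by (simp add: mass_def)
  next
    case False
    then show ?thesis by (simp add: act_def not_integrable_integral_eq mass_nonneg)
  qed
qed

lemma sigmoid_integrable:
  assumes ij: "i \<noteq> j" and e: "\<epsilon> > 0" and u: "continuous_on {..0} u"
  shows "integrable (\<mu> i j) (\<lambda>\<tau>. sigmoid \<epsilon> (xc (u \<tau>) i - \<Gamma> i))"
proof -
  interpret finite_measure "\<mu> i j" using measures(2)[OF ij] .
  have "continuous_on {..0} (\<lambda>\<tau>. sigmoid \<epsilon> (xc (u \<tau>) i - \<Gamma> i))"
    by (rule continuous_on_compose2[OF sigmoid_continuous[OF e, of UNIV]]) (auto intro!: continuous_intros u)
  then show ?thesis
    by (intro integrable_const_bound[of _ 1] measurable_mu ij AE_I2) (auto simp: sigmoid_bounds)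
qed

lemma act_lipschitz:
  assumes ij: "i \<noteq> j" and e: "\<epsilon> > 0" and u: "continuous_on {..0} u" "continuous_on {..0} v"
    and M: "\<And>\<tau>. \<tau> \<le> 0 \<Longrightarrow> \<bar>xc (u \<tau>) i - xc (v \<tau>) i\<bar> \<le> M"
  shows "\<bar>act \<epsilon> i j u - act \<epsilon> i j v\<bar> \<le> mass i j / \<epsilon> * M"
proof -
  interpret finite_measure "\<mu> i j" using measures(2)[OF ij] .
  note int = sigmoid_integrable[OF ij e u(1)] sigmoid_integrable[OF ij e u(2)]
  have "\<bar>act \<epsilon> i j u - act \<epsilon> i j v\<bar> = norm (LINT \<tau>|\<mu> i j. sigmoid \<epsilon> (xc (u \<tau>) i - \<Gamma> i) - sigmoid \<epsilon> (xc (v \<tau>) i - \<Gamma> i))"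
    unfolding act_def using int by (simp add: Bochner_Integration.integral_diff)
  also have "\<dots> \<le> (LINT \<tau>|\<mu> i j. norm (sigmoid \<epsilon> (xc (u \<tau>) i - \<Gamma> i) - sigmoid \<epsilon> (xc (v \<tau>) i - \<Gamma> i)))"
    by (rule integral_norm_bound)
  also have "\<dots> \<le> (LINT \<tau>|\<mu> i j. 1 / \<epsilon> * M)"
  proof (rule integral_mono)
    fix \<tau> assume "\<tau> \<in> space (\<mu> i j)"
    then have "\<tau> \<le> 0" using space_mu[OF ij] by simp
    have "\<bar>sigmoid \<epsilon> (xc (u \<tau>) i - \<Gamma> i) - sigmoid \<epsilon> (xc (v \<tau>) i - \<Gamma> i)\<bar> \<le> 1 / \<epsilon> * \<bar>xc (u \<tau>) i - xc (v \<tau>) i\<bar>"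
      using sigmoid_lipschitz[OF e, of "xc (u \<tau>) i - \<Gamma> i" "xc (v \<tau>) i - \<Gamma> i"] by simp
    also have "\<dots> \<le> 1 / \<epsilon> * M" using M[OF \<open>\<tau> \<le> 0\<close>] e by (intro mult_left_mono) auto
    finally show "norm (sigmoid \<epsilon> (xc (u \<tau>) i - \<Gamma> i) - sigmoid \<epsilon> (xc (v \<tau>) i - \<Gamma> i)) \<le> 1 / \<epsilon> * M" by simp
  qed (use int in \<open>auto intro: integrable_norm\<close>)
  also have "\<dots> = mass i j / \<epsilon> * M" by (simp add: mass_def)
  finally show ?thesis .
qed

text \<open>Dominated convergence, the sigmoid being bounded and the measure finite.\<close>

lemma act_tendsto:
  assumes ij: "i \<noteq> j" and e: "\<epsilon> > 0" and u: "\<And>k::nat. continuous_on {..0} (u k)" "continuous_on {..0} v"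
    and lim: "\<And>\<tau>. \<tau> \<le> 0 \<Longrightarrow> (\<lambda>k. u k \<tau>) \<longlonglongrightarrow> v \<tau>"
  shows "(\<lambda>k. act \<epsilon> i j (u k)) \<longlonglongrightarrow> act \<epsilon> i j v"
proof -
  interpret finite_measure "\<mu> i j" using measures(2)[OF ij] .
  show ?thesis unfolding act_def
  proof (rule integral_dominated_convergence[where w="\<lambda>_. 1"])
    show "AE \<tau> in \<mu> i j. (\<lambda>k. sigmoid \<epsilon> (xc (u k \<tau>) i - \<Gamma> i)) \<longlonglongrightarrow> sigmoid \<epsilon> (xc (v \<tau>) i - \<Gamma> i)"
    proof (rule AE_I2)
      fix \<tau> assume "\<tau> \<in> space (\<mu> i j)"
      then have "(\<lambda>k. xc (u k \<tau>) i - \<Gamma> i) \<longlonglongrightarrow> xc (v \<tau>) i - \<Gamma> i"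
        using space_mu[OF ij] by (intro tendsto_intros lim) auto
      then show "(\<lambda>k. sigmoid \<epsilon> (xc (u k \<tau>) i - \<Gamma> i)) \<longlonglongrightarrow> sigmoid \<epsilon> (xc (v \<tau>) i - \<Gamma> i)"
        by (rule continuous_on_tendsto_compose[OF sigmoid_continuous[OF e, of UNIV]]) auto
    qed
  qed (use sigmoid_integrable[OF ij e u(1)] sigmoid_integrable[OF ij e u(2)] in \<open>auto simp: sigmoid_bounds\<close>)
qed

definition rhs :: "real \<Rightarrow> real \<Rightarrow> (real \<Rightarrow> 'n state) \<Rightarrow> 'n state" where
  "rhs \<epsilon> t u = decay_term A B u + sigmoid_term c d \<Gamma> \<mu> \<epsilon> u + input_term I t"

lemma rhs_diag: "rhs \<epsilon> t u $ i $ i = - A i (u 0 $ i $ i) * u 0 $ i $ i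
    + (\<Sum>k\<in>UNIV - {i}. (u 0 $ k $ i - c k i) * act \<epsilon> k i u) + I i t"
  by (simp add: rhs_def decay_term_def sigmoid_term_def input_term_def state_of_def act_def)

lemma rhs_offdiag: "i \<noteq> j \<Longrightarrow> rhs \<epsilon> t u $ i $ j = - B i j (u 0 $ i $ j) * u 0 $ i $ j
    + d i j * act \<epsilon> i j u * max (u 0 $ j $ j) 0"
  by (simp add: rhs_def decay_term_def sigmoid_term_def input_term_def state_of_def act_def)

text \<open>The argument \<open>y\<close> may differ from the current state \<open>u 0\<close>, as long as \<open>u 0\<close> is a componentwise
  truncation of it, so that the same estimate serves the equation and its truncation.  The decay term
  contributes with a good sign; the activities lie between \<open>0\<close> and the total masses, so all other
  terms grow at most linearly, with constants independent of \<open>\<epsilon>\<close>.\<close>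

lemma energy:
  obtains C where "C \<ge> 0"
    "\<And>\<epsilon> t u y. t \<in> {t0..T} \<Longrightarrow> (\<And>i j. 0 \<le> u 0 $ i $ j * y $ i $ j \<and> \<bar>u 0 $ i $ j\<bar> \<le> \<bar>y $ i $ j\<bar>)
      \<Longrightarrow> inner y (rhs \<epsilon> t u) \<le> C * (1 + (norm y)\<^sup>2)"
proof -
  have "\<exists>C. \<forall>t\<in>{t0..T}. \<bar>I i t\<bar> \<le> C" for i
  proof -
    have "bounded (I i ` {t0..T})"
      by (intro compact_imp_bounded compact_continuous_image continuous_on_subset[OF I] compact_Icc) auto
    then show ?thesis unfolding bounded_iff by auto
  qed
  then obtain CI where CI: "\<And>i t. t \<in> {t0..T} \<Longrightarrow> \<bar>I i t\<bar> \<le> CI i" by metis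
  define K where "K = (\<Sum>i\<in>UNIV. \<bar>CI i\<bar>) + (\<Sum>k\<in>UNIV. \<Sum>i\<in>UNIV. mass k i * (1 + \<bar>c k i\<bar> + \<bar>d k i\<bar>))"
  have K0: "K \<ge> 0" unfolding K_def using mass_nonneg by (intro add_nonneg_nonneg sum_nonneg mult_nonneg_nonneg) auto
  have sK: "(\<Sum>k\<in>UNIV - {i}. mass k i * (1 + \<bar>c k i\<bar> + \<bar>d k i\<bar>)) \<le> (\<Sum>k\<in>UNIV. \<Sum>i\<in>UNIV. mass k i * (1 + \<bar>c k i\<bar> + \<bar>d k i\<bar>))" for i
  proof -
    have "(\<Sum>k\<in>UNIV - {i}. mass k i * (1 + \<bar>c k i\<bar> + \<bar>d k i\<bar>)) \<le> (\<Sum>k\<in>UNIV. mass k i * (1 + \<bar>c k i\<bar> + \<bar>d k i\<bar>))"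
      using mass_nonneg by (intro sum_mono2 mult_nonneg_nonneg) auto
    also have "\<dots> \<le> (\<Sum>k\<in>UNIV. \<Sum>i\<in>UNIV. mass k i * (1 + \<bar>c k i\<bar> + \<bar>d k i\<bar>))"
      using mass_nonneg by (intro sum_mono member_le_sum mult_nonneg_nonneg) auto
    finally show ?thesis .
  qed
  have "y $ i $ j * rhs \<epsilon> t u $ i $ j \<le> 2 * K * (1 + (norm y)\<^sup>2)"
    if t: "t \<in> {t0..T}" and uy: "\<And>i j. 0 \<le> u 0 $ i $ j * y $ i $ j \<and> \<bar>u 0 $ i $ j\<bar> \<le> \<bar>y $ i $ j\<bar>" for \<epsilon> t u y i j
  proof -
    define N where "N = norm y"
    have N: "N \<ge> 0" "\<bar>u 0 $ i $ j\<bar> \<le> N" "\<bar>y $ i $ j\<bar> \<le> N" for i j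
      using uy[of i j] state_component_le_norm[of y i j] by (auto simp: N_def)
    have "\<exists>r. y $ i $ j * rhs \<epsilon> t u $ i $ j \<le> y $ i $ j * r \<and> \<bar>r\<bar> \<le> K * (1 + N)"
    proof (cases "i = j")
      case True
      define r where "r = (\<Sum>k\<in>UNIV - {i}. (u 0 $ k $ i - c k i) * act \<epsilon> k i u) + I i t"
      have "A i (u 0 $ i $ i) * (u 0 $ i $ i * y $ i $ i) \<ge> 0"
        using uy[of i i] nonneg(1) mult_nonneg_nonneg by blast
      then have 1: "y $ i $ j * rhs \<epsilon> t u $ i $ j \<le> y $ i $ j * r"
        unfolding True[symmetric] rhs_diag r_def by (simp add: algebra_simps)
      have "\<bar>\<Sum>k\<in>UNIV - {i}. (u 0 $ k $ i - c k i) * act \<epsilon> k i u\<bar> \<le> (\<Sum>k\<in>UNIV - {i}. mass k i * (1 + \<bar>c k i\<bar> + \<bar>d k i\<bar>) * (1 + N))"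
      proof (rule order_trans[OF sum_abs sum_mono])
        fix k assume "k \<in> UNIV - {i}"
        then have a: "0 \<le> act \<epsilon> k i u" "act \<epsilon> k i u \<le> mass k i" using act_bounds[of k i] by auto
        have "\<bar>u 0 $ k $ i - c k i\<bar> \<le> N + \<bar>c k i\<bar>" using N(2)[of k i] by linarith
        also have "\<dots> \<le> (1 + \<bar>c k i\<bar> + \<bar>d k i\<bar>) * (1 + N)"
        proof -
          have "0 \<le> \<bar>c k i\<bar> * N" "0 \<le> \<bar>d k i\<bar> * N" using N by auto
          then show ?thesis by (simp add: algebra_simps)
        qed
        finally have "\<bar>u 0 $ k $ i - c k i\<bar> * \<bar>act \<epsilon> k i u\<bar> \<le> ((1 + \<bar>c k i\<bar> + \<bar>d k i\<bar>) * (1 + N)) * mass k i"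
          using a N by (intro mult_mono) auto
        then show "\<bar>(u 0 $ k $ i - c k i) * act \<epsilon> k i u\<bar> \<le> mass k i * (1 + \<bar>c k i\<bar> + \<bar>d k i\<bar>) * (1 + N)"
          by (simp add: abs_mult mult_ac)
      qed
      also have "\<dots> = (\<Sum>k\<in>UNIV - {i}. mass k i * (1 + \<bar>c k i\<bar> + \<bar>d k i\<bar>)) * (1 + N)"
        by (simp add: sum_distrib_right)
      also have "\<dots> \<le> (\<Sum>k\<in>UNIV. \<Sum>i\<in>UNIV. mass k i * (1 + \<bar>c k i\<bar> + \<bar>d k i\<bar>)) * (1 + N)"
        using sK N(1) by (intro mult_right_mono) auto
      finally have 2: "\<bar>\<Sum>k\<in>UNIV - {i}. (u 0 $ k $ i - c k i) * act \<epsilon> k i u\<bar>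
          \<le> (\<Sum>k\<in>UNIV. \<Sum>i\<in>UNIV. mass k i * (1 + \<bar>c k i\<bar> + \<bar>d k i\<bar>)) * (1 + N)" .
      have "\<bar>I i t\<bar> \<le> (\<Sum>i\<in>UNIV. \<bar>CI i\<bar>)"
        using CI[OF t, of i] member_le_sum[of i UNIV "\<lambda>i. \<bar>CI i\<bar>"] by simp
      moreover have "(\<Sum>i\<in>UNIV. \<bar>CI i\<bar>) \<le> (\<Sum>i\<in>UNIV. \<bar>CI i\<bar>) * (1 + N)"
        using N(1) mult_left_mono[of 1 "1 + N" "\<Sum>i\<in>UNIV. \<bar>CI i\<bar>"] by (simp add: sum_nonneg)
      ultimately have "\<bar>r\<bar> \<le> K * (1 + N)"
        using 2 unfolding r_def K_def distrib_right by linarith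
      then show ?thesis using 1 by blast
    next
      case False
      define r where "r = d i j * act \<epsilon> i j u * max (u 0 $ j $ j) 0"
      have "B i j (u 0 $ i $ j) * (u 0 $ i $ j * y $ i $ j) \<ge> 0"
        using uy[of i j] nonneg(2)[OF False] mult_nonneg_nonneg by blast
      then have 1: "y $ i $ j * rhs \<epsilon> t u $ i $ j \<le> y $ i $ j * r"
        unfolding rhs_offdiag[OF False] r_def by (simp add: algebra_simps)
      have "\<bar>r\<bar> = \<bar>d i j\<bar> * \<bar>act \<epsilon> i j u\<bar> * \<bar>max (u 0 $ j $ j) 0\<bar>" by (simp add: r_def abs_mult)
      also have "\<dots> \<le> (1 + \<bar>c i j\<bar> + \<bar>d i j\<bar>) * mass i j * (1 + N)"
        using act_bounds[OF False, of \<epsilon> u] N(1) N(2)[of j j] mass_nonneg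
        by (intro mult_mono mult_nonneg_nonneg) (auto simp: max_def abs_if)
      also have "\<dots> = (mass i j * (1 + \<bar>c i j\<bar> + \<bar>d i j\<bar>)) * (1 + N)" by (simp add: mult_ac)
      also have "\<dots> \<le> K * (1 + N)"
      proof (rule mult_right_mono)
        have "mass i j * (1 + \<bar>c i j\<bar> + \<bar>d i j\<bar>) \<le> (\<Sum>k\<in>UNIV - {j}. mass k j * (1 + \<bar>c k j\<bar> + \<bar>d k j\<bar>))"
          using False mass_nonneg by (intro member_le_sum[of i _ "\<lambda>k. mass k j * (1 + \<bar>c k j\<bar> + \<bar>d k j\<bar>)"] mult_nonneg_nonneg) auto
        then show "mass i j * (1 + \<bar>c i j\<bar> + \<bar>d i j\<bar>) \<le> K"
          using sK[of j] unfolding K_def by (simp add: sum_nonneg add_increasing)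
      qed (use N in auto)
      finally show ?thesis using 1 by blast
    qed
    then obtain r where r: "y $ i $ j * rhs \<epsilon> t u $ i $ j \<le> y $ i $ j * r" "\<bar>r\<bar> \<le> K * (1 + N)" by blast
    have "y $ i $ j * r \<le> \<bar>y $ i $ j\<bar> * \<bar>r\<bar>" by (metis abs_ge_self abs_mult)
    also have "\<dots> \<le> N * (K * (1 + N))" using N r by (intro mult_mono) auto
    also have "\<dots> = K * (N + N\<^sup>2)" by (simp add: algebra_simps power2_eq_square)
    also have "\<dots> \<le> K * (2 * (1 + N\<^sup>2))"
    proof (rule mult_left_mono[OF _ K0])
      have "0 \<le> (N - 1)\<^sup>2" by simp
      then have "2 * N \<le> 1 + N\<^sup>2" by (simp add: power2_eq_square algebra_simps)
      then show "N + N\<^sup>2 \<le> 2 * (1 + N\<^sup>2)" using N(1) by simp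
    qed
    finally show ?thesis using r(1) by (simp add: N_def mult_ac)
  qed
  note bound = this
  show ?thesis
  proof (rule that)
    let ?n = "real CARD('n)"
    show "0 \<le> ?n * ?n * (2 * K)" using K0 by simp
    fix \<epsilon> t and u :: "real \<Rightarrow> 'n state" and y :: "'n state"
    assume "t \<in> {t0..T}" "\<And>i j. 0 \<le> u 0 $ i $ j * y $ i $ j \<and> \<bar>u 0 $ i $ j\<bar> \<le> \<bar>y $ i $ j\<bar>"
    from bound[where t=t and u=u and y=y, OF this] have "(\<Sum>i\<in>UNIV. \<Sum>j\<in>UNIV. y $ i $ j * rhs \<epsilon> t u $ i $ j) \<le> (\<Sum>i\<in>(UNIV::'n set). \<Sum>j\<in>(UNIV :: 'n set). 2 * K * (1 + (norm y)\<^sup>2))"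
      by (intro sum_mono)
    then show "inner y (rhs \<epsilon> t u) \<le> ?n * ?n * (2 * K) * (1 + (norm y)\<^sup>2)"
      by (simp add: inner_vec_def mult_ac)
  qed
qed

lemma history_apply: "\<tau> \<le> 0 \<Longrightarrow> history t u \<tau> = u (t + \<tau>)" by (simp add: history_def)

lemma history_0 [simp]: "history t u 0 = u t" by (simp add: history_def)

lemma history_cong: "(\<And>\<tau>. \<tau> \<le> t \<Longrightarrow> u \<tau> = v \<tau>) \<Longrightarrow> history t u = history t v"
  by (auto simp: history_def fun_eq_iff)

lemma history_continuous: "continuous_on {..T} u \<Longrightarrow> t \<le> T \<Longrightarrow> continuous_on {..0} (history t u)"
  unfolding history_def
  by (rule continuous_on_eq[where f="\<lambda>s. u (t + s)"])
     (auto intro!: continuous_on_compose2[of "{..T}" u] continuous_intros)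

lemma rhs_tendsto:
  assumes e: "\<epsilon> > 0" and u: "\<And>k::nat. continuous_on {..0} (u k)" "continuous_on {..0} v"
    and lim: "\<And>\<tau>. \<tau> \<le> 0 \<Longrightarrow> (\<lambda>k. u k \<tau>) \<longlonglongrightarrow> v \<tau>" and t: "t \<longlonglongrightarrow> s"
  shows "(\<lambda>k. rhs \<epsilon> (t k) (u k)) \<longlonglongrightarrow> rhs \<epsilon> s v"
proof -
  have cA: "isCont (A i) x" for i x
  proof -
    obtain \<delta> L where "\<delta> > 0" "L-lipschitz_on (ball x \<delta>) (A i)"
      using Lipschitz(1) unfolding locally_Lipschitz_def by blast
    then show ?thesis
      by (meson centre_in_ball continuous_on_eq_continuous_at lipschitz_on_continuous_on open_ball)
  qed
  have cB: "isCont (B i j) x" if ij: "i \<noteq> j" for i j x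
  proof -
    obtain \<delta> L where "\<delta> > 0" "L-lipschitz_on (ball x \<delta>) (B i j)"
      using Lipschitz(2)[OF ij] unfolding locally_Lipschitz_def by blast
    then show ?thesis
      by (meson centre_in_ball continuous_on_eq_continuous_at lipschitz_on_continuous_on open_ball)
  qed
  have cI: "isCont (I i) x" for i x using I by (simp add: continuous_on_eq_continuous_at)
  have u0: "(\<lambda>k. u k 0 $ i $ j) \<longlonglongrightarrow> v 0 $ i $ j" for i j by (intro tendsto_intros lim) auto
  have "(\<lambda>k. rhs \<epsilon> (t k) (u k) $ i $ j) \<longlonglongrightarrow> rhs \<epsilon> s v $ i $ j" for i j
  proof (cases "i = j")
    case True
    show ?thesis unfolding True rhs_diag
      by (intro tendsto_intros isCont_tendsto_compose[OF cA] isCont_tendsto_compose[OF cI] u0 t act_tendsto e u lim) auto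
  next
    case False
    show ?thesis unfolding rhs_offdiag[OF False]
      by (intro tendsto_intros tendsto_max isCont_tendsto_compose[OF cB[OF False]] u0 act_tendsto False e u lim)
  qed
  then have "(\<lambda>k. \<chi> i j. rhs \<epsilon> (t k) (u k) $ i $ j) \<longlonglongrightarrow> (\<chi> i j. rhs \<epsilon> s v $ i $ j)"
    by (intro vec_tendstoI) simp
  then show ?thesis by simp
qed

lemma rhs_history_continuous:
  assumes e: "\<epsilon> > 0" and u: "continuous_on {..T} u"
  shows "continuous_on {..T} (\<lambda>s. rhs \<epsilon> s (history s u))"
proof (rule continuous_on_sequentiallyI)
  fix t :: "nat \<Rightarrow> real" and s assume t: "\<forall>k. t k \<in> {..T}" "s \<in> {..T}" "t \<longlonglongrightarrow> s"
  show "(\<lambda>k. rhs \<epsilon> (t k) (history (t k) u)) \<longlonglongrightarrow> rhs \<epsilon> s (history s u)"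
  proof (rule rhs_tendsto[OF e _ _ _ t(3)])
    show "continuous_on {..0} (history (t k) u)" for k using history_continuous[OF u] t by simp
    show "continuous_on {..0} (history s u)" using history_continuous[OF u] t by simp
    fix \<tau> :: real assume \<tau>: "\<tau> \<le> 0"
    have "(\<lambda>k. u (t k + \<tau>)) \<longlonglongrightarrow> u (s + \<tau>)"
    proof (rule continuous_on_tendsto_compose[OF u])
      show "(\<lambda>k. t k + \<tau>) \<longlonglongrightarrow> s + \<tau>" by (intro tendsto_intros t)
      show "s + \<tau> \<in> {..T}" using t \<tau> by simp
      have "t k + \<tau> \<in> {..T}" for k using spec[OF t(1), of k] \<tau> by simp
      then show "\<forall>\<^sub>F k in sequentially. t k + \<tau> \<in> {..T}" by simp
    qed
    then show "(\<lambda>k. history (t k) u \<tau>) \<longlonglongrightarrow> history s u \<tau>" using \<tau> by (simp add: history_apply)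
  qed
qed

text \<open>The history \<open>u0\<close> continued by the clipped path.  The path is shifted to start at \<open>u0 0\<close>, so that the
  result is continuous for every continuous \<open>w\<close> and the truncated right-hand side is defined on all
  of them; for a path that already starts at \<open>u0 0\<close> the shift vanishes.\<close>

definition trunc :: "real \<Rightarrow> real \<Rightarrow> (real \<Rightarrow> 'n state) \<Rightarrow> (real \<Rightarrow> 'n state) \<Rightarrow> real \<Rightarrow> 'n state" where
  "trunc R t0 u0 w \<tau> = (if \<tau> \<le> t0 then u0 (\<tau> - t0)
     else (\<chi> i j. clip R (w \<tau> $ i $ j - w t0 $ i $ j + u0 0 $ i $ j)))"

context
  fixes R t0 T :: real and u0 :: "real \<Rightarrow> 'n state"
  assumes R: "\<And>i j. \<bar>u0 0 $ i $ j\<bar> \<le> R" and T: "t0 \<le> T" and u0: "continuous_on {..0} u0"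
begin

lemma R0: "R \<ge> 0" using R abs_ge_zero order_trans by blast

lemma trunc_eq: "\<tau> \<ge> t0 \<Longrightarrow> trunc R t0 u0 w \<tau> $ i $ j = clip R (w \<tau> $ i $ j - w t0 $ i $ j + u0 0 $ i $ j)"
  using clip(5)[OF R[of i j]] by (auto simp: trunc_def)

lemma trunc_continuous:
  assumes w: "continuous_on {t0..T} w"
  shows "continuous_on {..T} (trunc R t0 u0 w)"
proof -
  have "continuous_on ({..t0} \<union> {t0..T}) (trunc R t0 u0 w)"
  proof (rule continuous_on_closed_Un)
    have "continuous_on {..t0} (\<lambda>\<tau>. u0 (\<tau> - t0))"
      by (intro continuous_on_compose2[OF u0] continuous_intros) auto
    then show "continuous_on {..t0} (trunc R t0 u0 w)"
      by (rule continuous_on_eq) (simp add: trunc_def)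
    have "continuous_on {t0..T} (\<lambda>\<tau>. clip R (w \<tau> $ i $ j - w t0 $ i $ j + u0 0 $ i $ j))" for i j
      by (intro clip_continuous continuous_intros w)
    then have "continuous_on {t0..T} (\<lambda>\<tau>. trunc R t0 u0 w \<tau> $ i $ j)" for i j
      by (rule continuous_on_eq) (simp add: trunc_eq)
    then show "continuous_on {t0..T} (trunc R t0 u0 w)" by (rule continuous_on_state)
  qed auto
  moreover have "{..t0} \<union> {t0..T} = {..T}" using T by auto
  ultimately show ?thesis by simp
qed

lemma trunc_lipschitz:
  assumes M: "\<And>r. r \<in> {t0..s} \<Longrightarrow> norm (w1 r - w2 r) \<le> M" and s: "s \<in> {t0..T}" and \<tau>: "\<tau> \<le> s"
  shows "\<bar>trunc R t0 u0 w1 \<tau> $ i $ j - trunc R t0 u0 w2 \<tau> $ i $ j\<bar> \<le> 2 * M"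
proof (cases "\<tau> \<le> t0")
  case True
  have "norm (w1 t0 - w2 t0) \<le> M" using M[of t0] s by simp
  then have "0 \<le> M" by (meson norm_ge_zero order_trans)
  then show ?thesis using True by (simp add: trunc_def)
next
  case False
  have "\<bar>trunc R t0 u0 w1 \<tau> $ i $ j - trunc R t0 u0 w2 \<tau> $ i $ j\<bar>
      \<le> \<bar>(w1 \<tau> $ i $ j - w1 t0 $ i $ j + u0 0 $ i $ j) - (w2 \<tau> $ i $ j - w2 t0 $ i $ j + u0 0 $ i $ j)\<bar>"
    using False clip(2) by (simp only: trunc_eq less_imp_le not_le)
  also have "\<dots> \<le> \<bar>(w1 \<tau> - w2 \<tau>) $ i $ j\<bar> + \<bar>(w1 t0 - w2 t0) $ i $ j\<bar>" by simp
  also have "\<dots> \<le> M + M"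
    using False \<tau> s by (intro add_mono order_trans[OF state_component_le_norm M]) auto
  finally show ?thesis by simp
qed

lemma trunc_bounded_lipschitz: "bounded_lipschitz t0 T (\<lambda>s w. history s (trunc R t0 u0 w) 0 $ i $ j)"
proof (rule bounded_lipschitzI[of _ _ _ R 2])
  show "\<bar>history s (trunc R t0 u0 w) 0 $ i $ j\<bar> \<le> R" if "s \<in> {t0..T}" for s w
    using that clip(1)[OF R0] by (simp add: trunc_eq)
  fix s and w1 w2 :: "real \<Rightarrow> 'n state" and M :: real
  assume *: "s \<in> {t0..T}" "\<And>r. r \<in> {t0..s} \<Longrightarrow> norm (w1 r - w2 r) \<le> M"
  show "\<bar>history s (trunc R t0 u0 w1) 0 $ i $ j - history s (trunc R t0 u0 w2) 0 $ i $ j\<bar> \<le> 2 * M"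
    using trunc_lipschitz[of s w1 w2 M s i j] * by simp
qed

lemma act_trunc_bounded_lipschitz:
  assumes e: "\<epsilon> > 0" and ij: "i \<noteq> j"
  shows "bounded_lipschitz t0 T (\<lambda>s w. act \<epsilon> i j (history s (trunc R t0 u0 w)))"
proof (rule bounded_lipschitzI[of _ _ _ "mass i j" "mass i j / \<epsilon> * 2"])
  show "\<bar>act \<epsilon> i j (history s (trunc R t0 u0 w))\<bar> \<le> mass i j" for s w
    using act_bounds[OF ij] by simp
  fix s and w1 w2 :: "real \<Rightarrow> 'n state" and M :: real
  assume *: "s \<in> {t0..T}" "continuous_on {t0..T} w1" "continuous_on {t0..T} w2"
    "\<And>r. r \<in> {t0..s} \<Longrightarrow> norm (w1 r - w2 r) \<le> M" and "M \<ge> 0"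
  have "\<bar>act \<epsilon> i j (history s (trunc R t0 u0 w1)) - act \<epsilon> i j (history s (trunc R t0 u0 w2))\<bar> \<le> mass i j / \<epsilon> * (2 * M)"
  proof (rule act_lipschitz[OF ij e])
    show "continuous_on {..0} (history s (trunc R t0 u0 w1))" "continuous_on {..0} (history s (trunc R t0 u0 w2))"
      using * by (auto intro: history_continuous trunc_continuous)
    fix \<tau> :: real assume "\<tau> \<le> 0"
    then show "\<bar>history s (trunc R t0 u0 w1) \<tau> $ i $ i - history s (trunc R t0 u0 w2) \<tau> $ i $ i\<bar> \<le> 2 * M"
      using trunc_lipschitz[of s w1 w2 M "s + \<tau>"] * by (simp add: history_apply)
  qed
  then show "\<bar>act \<epsilon> i j (history s (trunc R t0 u0 w1)) - act \<epsilon> i j (history s (trunc R t0 u0 w2))\<bar> \<le> mass i j / \<epsilon> * 2 * M"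
    by simp
qed

text \<open>Along truncated paths all states lie in a fixed box, where the locally Lipschitz coefficients are
  Lipschitz, and the right-hand side is a sum of products of bounded Lipschitz functionals.\<close>

lemma rhs_trunc_bounded_lipschitz:
  assumes e: "\<epsilon> > 0"
  shows "bounded_lipschitz t0 T (\<lambda>s w. rhs \<epsilon> s (history s (trunc R t0 u0 w)) $ i $ j)"
proof -
  have pR: "\<bar>max (- R) (min R (history s (trunc R t0 u0 w) 0 $ i $ j))\<bar> \<le> R" for s w i j
    using R0 by (auto simp: max_def min_def)
  have comp: "bounded_lipschitz t0 T (\<lambda>s w. g (history s (trunc R t0 u0 w) 0 $ i $ j))" if g: "L-lipschitz_on {-R..R} g" for g L i j
  proof -
    have "bounded_lipschitz t0 T (\<lambda>s w. g (clip R (history s (trunc R t0 u0 w) 0 $ i $ j)))"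
    proof (rule bounded_lipschitz_compose[OF g])
      show "bounded_lipschitz t0 T (\<lambda>s w. clip R (history s (trunc R t0 u0 w) 0 $ i $ j))"
      proof (rule bounded_lipschitz_cong[OF _ trunc_bounded_lipschitz])
        show "clip R (history s (trunc R t0 u0 w) 0 $ i $ j) = history s (trunc R t0 u0 w) 0 $ i $ j"
          if "s \<in> {t0..T}" for s w
          using that by (intro clip(5)) (simp add: trunc_eq clip(1)[OF R0])
      qed
    qed (rule clip(1)[OF R0])
    then show ?thesis
    proof (rule bounded_lipschitz_cong[rotated])
      show "g (history s (trunc R t0 u0 w) 0 $ i $ j) = g (clip R (history s (trunc R t0 u0 w) 0 $ i $ j))"
        if "s \<in> {t0..T}" for s w
        using that by (subst clip(5)) (simp_all add: trunc_eq clip(1)[OF R0])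
    qed
  qed
  have const: "bounded_lipschitz t0 T (\<lambda>s w. k)" for k :: real by (intro bounded_lipschitz_const continuous_intros)
  have neg: "bounded_lipschitz t0 T (\<lambda>s w. - f s w)" if "bounded_lipschitz t0 T f" for f :: "real \<Rightarrow> (real \<Rightarrow> 'n state) \<Rightarrow> real"
    using bounded_lipschitz_mult[OF const[of "-1"] that] by simp
  show ?thesis
  proof (cases "i = j")
    case True
    obtain L where L: "L-lipschitz_on {-R..R} (A i)"
      by (rule locally_Lipschitz_imp_lipschitz_on[OF Lipschitz(1)])
    have "bounded_lipschitz t0 T (\<lambda>s w. history s (trunc R t0 u0 w) 0 $ k $ i - c k i)" for k
      using bounded_lipschitz_add[OF trunc_bounded_lipschitz const[of "- c k i"]] by simp
    moreover have "bounded_lipschitz t0 T (\<lambda>s w. I i s)" by (intro bounded_lipschitz_const continuous_on_subset[OF I]) auto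
    ultimately show ?thesis unfolding True[symmetric] rhs_diag
      by (intro bounded_lipschitz_add bounded_lipschitz_mult bounded_lipschitz_sum neg comp[OF L] trunc_bounded_lipschitz act_trunc_bounded_lipschitz e) auto
  next
    case False
    obtain L where L: "L-lipschitz_on {-R..R} (B i j)"
      by (rule locally_Lipschitz_imp_lipschitz_on[OF Lipschitz(2)[OF False]])
    have "1-lipschitz_on {-R..R} (\<lambda>x::real. max x 0)"
      by (intro lipschitz_onI) (auto simp: dist_real_def max_def)
    note m = comp[OF this, of j j]
    show ?thesis unfolding rhs_offdiag[OF False]
      by (intro bounded_lipschitz_add bounded_lipschitz_mult neg comp[OF L] trunc_bounded_lipschitz act_trunc_bounded_lipschitz e m const False)
  qed
qed

lemma truncated_volterra:
  assumes e: "\<epsilon> > 0"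
  obtains L where "volterra (\<lambda>s w. rhs \<epsilon> s (history s (trunc R t0 u0 w))) t0 T L"
proof -
  obtain L where L: "L \<ge> 0" "\<And>s w1 w2 M. s \<in> {t0..T} \<Longrightarrow> continuous_on {t0..T} w1 \<Longrightarrow> continuous_on {t0..T} w2 \<Longrightarrow>
      (\<And>r. r \<in> {t0..s} \<Longrightarrow> norm (w1 r - w2 r) \<le> M) \<Longrightarrow>
      norm (rhs \<epsilon> s (history s (trunc R t0 u0 w1)) - rhs \<epsilon> s (history s (trunc R t0 u0 w2))) \<le> L * M"
    by (rule bounded_lipschitz_components_lipschitz[of t0 T "\<lambda>s w. rhs \<epsilon> s (history s (trunc R t0 u0 w))", OF rhs_trunc_bounded_lipschitz[OF e]]) blast
  have "volterra (\<lambda>s w. rhs \<epsilon> s (history s (trunc R t0 u0 w))) t0 T L"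
  proof
    fix w :: "real \<Rightarrow> 'n state" assume w: "continuous_on {t0..T} w"
    show "continuous_on {t0..T} (\<lambda>s. rhs \<epsilon> s (history s (trunc R t0 u0 w)))"
      by (rule continuous_on_subset[OF rhs_history_continuous[OF e trunc_continuous[OF w]]]) auto
  qed (use T L in auto)
  then show ?thesis using that by blast
qed

end

definition solution_on :: "real \<Rightarrow> real \<Rightarrow> real \<Rightarrow> (real \<Rightarrow> 'n state) \<Rightarrow> (real \<Rightarrow> 'n state) \<Rightarrow> bool" where
  "solution_on \<epsilon> t0 T u0 u \<longleftrightarrow> (\<forall>\<tau>\<le>t0. u \<tau> = u0 (\<tau> - t0)) \<and>
     (\<forall>t\<in>{t0..T}. (u has_vector_derivative rhs \<epsilon> t (history t u)) (at t within {t0..T}))"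

lemma solution_on_continuous:
  assumes u0: "continuous_on {..0} u0" and u: "solution_on \<epsilon> t0 T u0 u" and T: "t0 \<le> T"
  shows "continuous_on {..T} u"
proof -
  have "continuous_on ({..t0} \<union> {t0..T}) u"
  proof (rule continuous_on_closed_Un)
    have "continuous_on {..t0} (\<lambda>\<tau>. u0 (\<tau> - t0))"
      by (intro continuous_on_compose2[OF u0] continuous_intros) auto
    then show "continuous_on {..t0} u" by (rule continuous_on_eq) (use u in \<open>simp add: solution_on_def\<close>)
    show "continuous_on {t0..T} u" unfolding continuous_on_eq_continuous_within
      using u has_vector_derivative_continuous unfolding solution_on_def by blast
  qed auto
  moreover have "{..t0} \<union> {t0..T} = {..T}" using T by auto
  ultimately show ?thesis by simp
qed

text \<open>The bound depends on the initial datum only through its value at time \<open>0\<close>, and not on \<open>\<epsilon>\<close>; the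
  latter gives compactness as \<open>\<epsilon> \<rightarrow> 0\<close>.\<close>

lemma solution_on_bound:
  obtains C where "\<And>\<epsilon> u0 u t. solution_on \<epsilon> t0 T u0 u \<Longrightarrow> t \<in> {t0..T} \<Longrightarrow> norm (u t) \<le> (1 + (norm (u0 0))\<^sup>2) * C"
proof -
  obtain C where C: "C \<ge> 0"
    "\<And>\<epsilon> t u y. t \<in> {t0..T} \<Longrightarrow> (\<And>i j. 0 \<le> u 0 $ i $ j * y $ i $ j \<and> \<bar>u 0 $ i $ j\<bar> \<le> \<bar>y $ i $ j\<bar>)
      \<Longrightarrow> inner y (rhs \<epsilon> t u) \<le> C * (1 + (norm y)\<^sup>2)" using energy[of t0 T] by blast
  show ?thesis
  proof (rule that)
    fix \<epsilon> t and u0 u :: "real \<Rightarrow> 'n state" assume u: "solution_on \<epsilon> t0 T u0 u" and t: "t \<in> {t0..T}"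
    have "1 + (norm (u t))\<^sup>2 \<le> (1 + (norm (u t0))\<^sup>2) * exp (2 * C * (t - t0))"
    proof (rule growth_bound[OF _ _ t])
      show "(u has_vector_derivative rhs \<epsilon> s (history s u)) (at s within {t0..T})" if "s \<in> {t0..T}" for s
        using u that unfolding solution_on_def by blast
      show "inner (u s) (rhs \<epsilon> s (history s u)) \<le> C * (1 + (norm (u s))\<^sup>2)" if "s \<in> {t0..T}" for s
        using that by (intro C(2)) auto
    qed
    also have "\<dots> \<le> (1 + (norm (u t0))\<^sup>2) * exp (2 * C * (T - t0))"
      using t C(1) by (intro mult_left_mono) (auto intro!: mult_left_mono)
    finally have "1 + (norm (u t))\<^sup>2 \<le> (1 + (norm (u0 0))\<^sup>2) * exp (2 * C * (T - t0))"
      using u by (simp add: solution_on_def)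
    moreover have "norm (u t) \<le> 1 + (norm (u t))\<^sup>2"
    proof -
      have "0 \<le> (norm (u t) - 1)\<^sup>2 + (norm (u t))\<^sup>2 + 1" by simp
      then show ?thesis by (simp add: power2_eq_square algebra_simps)
    qed
    ultimately show "norm (u t) \<le> (1 + (norm (u0 0))\<^sup>2) * exp (2 * C * (T - t0))" by linarith
  qed
qed

text \<open>The truncation level \<open>R\<close> is the a priori bound that the truncated solution itself obeys, so the
  truncation is never active.\<close>

lemma solution_on_exists:
  assumes u0: "continuous_on {..0} u0" and T: "t0 \<le> T" and e: "\<epsilon> > 0"
  obtains u where "solution_on \<epsilon> t0 T u0 u"
proof -
  obtain C where C: "C \<ge> 0"
    "\<And>\<epsilon> t u y. t \<in> {t0..T} \<Longrightarrow> (\<And>i j. 0 \<le> u 0 $ i $ j * y $ i $ j \<and> \<bar>u 0 $ i $ j\<bar> \<le> \<bar>y $ i $ j\<bar>)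
      \<Longrightarrow> inner y (rhs \<epsilon> t u) \<le> C * (1 + (norm y)\<^sup>2)" using energy[of t0 T] by blast
  define R where "R = (1 + (norm (u0 0))\<^sup>2) * exp (2 * C * (T - t0))"
  have sq: "a \<le> 1 + a\<^sup>2" for a :: real
  proof -
    have "0 \<le> (a - 1)\<^sup>2 + a\<^sup>2 + 1" by simp
    then show ?thesis by (simp add: power2_eq_square algebra_simps)
  qed
  \<comment> \<open>The a priori bound controls \<open>1 + |w|\<^sup>2\<close>, which dominates \<open>|w|\<close>.\<close>
  have Rge: "1 + (norm (u0 0))\<^sup>2 \<le> R"
    unfolding R_def using C(1) T mult_left_mono[of 1 "exp (2 * C * (T - t0))" "1 + (norm (u0 0))\<^sup>2"] by simp
  have R: "\<bar>u0 0 $ i $ j\<bar> \<le> R" for i j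
    using state_component_le_norm[of "u0 0" i j] sq[of "norm (u0 0)"] Rge by linarith
  have R0: "R \<ge> 0" using Rge by (smt (verit) zero_le_power2)
  let ?F = "\<lambda>s w. rhs \<epsilon> s (history s (trunc R t0 u0 w))"
  obtain L where "volterra ?F t0 T L" by (rule truncated_volterra[OF R T u0 e])
  then interpret V: volterra ?F t0 T L "u0 0" .
  obtain w where w: "continuous_on {t0..T} w" "\<And>t. t \<in> {t0..T} \<Longrightarrow> w t = u0 0 + integral {t0..t} (\<lambda>s. ?F s w)"
    using V.exists_solution by blast
  have w0: "w t0 = u0 0" using w(2)[of t0] T by simp
  have dw: "(w has_vector_derivative ?F t w) (at t within {t0..T})" if t: "t \<in> {t0..T}" for t
  proof -
    have "((\<lambda>t. u0 0 + integral {t0..t} (\<lambda>s. ?F s w)) has_vector_derivative 0 + ?F t w) (at t within {t0..T})"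
      by (intro has_vector_derivative_add has_vector_derivative_const
          integral_has_vector_derivative[OF V.cont[OF w(1)] t])
    then show ?thesis
      using t w(2) by (auto intro: has_vector_derivative_transform)
  qed
  have bound: "norm (w t) \<le> R" if t: "t \<in> {t0..T}" for t
  proof -
    have "1 + (norm (w t))\<^sup>2 \<le> (1 + (norm (w t0))\<^sup>2) * exp (2 * C * (t - t0))"
    proof (rule growth_bound[OF dw _ t])
      show "inner (w s) (?F s w) \<le> C * (1 + (norm (w s))\<^sup>2)" if s: "s \<in> {t0..T}" for s
        using s clip(3,4)[OF R0] by (intro C(2)) (auto simp: trunc_eq[where ?u0.0=u0 and R=R, OF R T u0] w0)
    qed
    also have "\<dots> \<le> R"
      unfolding R_def w0 using t C(1) by (intro mult_left_mono) (auto intro!: mult_left_mono)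
    finally show ?thesis using sq[of "norm (w t)"] by linarith
  qed
  define u where "u = trunc R t0 u0 w"
  have uw: "u t = w t" if "t \<in> {t0..T}" for t
  proof -
    have "u t $ i $ j = w t $ i $ j" for i j
      using that clip(5)[OF order_trans[OF state_component_le_norm bound[OF that]]] unfolding u_def
      by (simp add: trunc_eq[where ?u0.0=u0 and R=R, OF R T u0] w0)
    then show ?thesis by (simp add: vec_eq_iff)
  qed
  have "solution_on \<epsilon> t0 T u0 u"
    unfolding solution_on_def
  proof (intro conjI allI impI ballI)
    show "u \<tau> = u0 (\<tau> - t0)" if "\<tau> \<le> t0" for \<tau> using that by (simp add: u_def trunc_def)
    fix t assume t: "t \<in> {t0..T}"
    have "(u has_vector_derivative ?F t w) (at t within {t0..T})"
      using dw[OF t] by (rule has_vector_derivative_transform[OF t, rotated]) (simp add: uw)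
    then show "(u has_vector_derivative rhs \<epsilon> t (history t u)) (at t within {t0..T})"
      by (simp add: u_def)
  qed
  then show ?thesis using that by blast
qed

text \<open>Both solutions obey the a priori bound, so they solve the same truncated Volterra equation.\<close>

lemma solution_on_unique:
  assumes u0: "continuous_on {..0} u0" and T: "t0 \<le> T" and e: "\<epsilon> > 0"
    and u: "solution_on \<epsilon> t0 T u0 u" and v: "solution_on \<epsilon> t0 T u0 v" and t: "t \<le> T"
  shows "u t = v t"
proof (cases "t \<le> t0")
  case True
  then show ?thesis using u v by (simp add: solution_on_def)
next
  case False
  obtain C where C: "\<And>\<epsilon> u0 u t. solution_on \<epsilon> t0 T u0 u \<Longrightarrow> t \<in> {t0..T} \<Longrightarrow> norm (u t) \<le> (1 + (norm (u0 0))\<^sup>2) * C"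
    using solution_on_bound[of t0 T] by blast
  define R where "R = (1 + (norm (u0 0))\<^sup>2) * C"
  have R: "\<bar>u0 0 $ i $ j\<bar> \<le> R" for i j
    using order_trans[OF state_component_le_norm C[OF u, of t0]] T u by (simp add: R_def solution_on_def)
  let ?F = "\<lambda>s w. rhs \<epsilon> s (history s (trunc R t0 u0 w))"
  obtain L where "volterra ?F t0 T L" by (rule truncated_volterra[OF R T u0 e])
  then interpret V: volterra ?F t0 T L "u0 0" .
  have *: "continuous_on {t0..T} w \<and> (\<forall>t\<in>{t0..T}. w t = u0 0 + integral {t0..t} (\<lambda>s. ?F s w))"
    if w: "solution_on \<epsilon> t0 T u0 w" for w
  proof (intro conjI ballI)
    show "continuous_on {t0..T} w"
      by (rule continuous_on_subset[OF solution_on_continuous[OF u0 w T]]) auto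
    have w0: "w t0 = u0 0" using w by (simp add: solution_on_def)
    have tw: "trunc R t0 u0 w s = w s" if "s \<le> T" for s
    proof (cases "s \<le> t0")
      case True
      then show ?thesis using w by (simp add: trunc_def solution_on_def)
    next
      case False
      then have s: "s \<in> {t0..T}" using that by simp
      have "trunc R t0 u0 w s $ i $ j = w s $ i $ j" for i j
        using s clip(5)[OF order_trans[OF state_component_le_norm C[OF w s, folded R_def]]]
        by (simp add: trunc_eq[where ?u0.0=u0 and R=R, OF R T u0] w0)
      then show ?thesis by (simp add: vec_eq_iff)
    qed
    fix t assume t: "t \<in> {t0..T}"
    have "((\<lambda>s. ?F s w) has_integral w t - w t0) {t0..t}"
    proof (rule fundamental_theorem_of_calculus)
      fix s assume s: "s \<in> {t0..t}"
      have "?F s w = rhs \<epsilon> s (history s w)" using s t tw by (intro arg_cong[where f="rhs \<epsilon> s"] history_cong) auto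
      then have "(w has_vector_derivative ?F s w) (at s within {t0..T})" using w s t by (simp add: solution_on_def)
      then show "(w has_vector_derivative ?F s w) (at s within {t0..t})"
        by (rule has_vector_derivative_within_subset) (use t in auto)
    qed (use t in auto)
    then show "w t = u0 0 + integral {t0..t} (\<lambda>s. ?F s w)" using w0 by (simp add: integral_unique)
  qed
  show ?thesis using V.unique[of u v t] *[OF u] *[OF v] False t by auto
qed

lemma solution_on_subset: "solution_on \<epsilon> t0 T u0 u \<Longrightarrow> T' \<le> T \<Longrightarrow> solution_on \<epsilon> t0 T' u0 u"
  unfolding solution_on_def
proof (intro conjI ballI; elim conjE)
  fix t assume *: "T' \<le> T" "t \<in> {t0..T'}"
    "\<forall>t\<in>{t0..T}. (u has_vector_derivative rhs \<epsilon> t (history t u)) (at t within {t0..T})"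
  then have "(u has_vector_derivative rhs \<epsilon> t (history t u)) (at t within {t0..T})" by simp
  then show "(u has_vector_derivative rhs \<epsilon> t (history t u)) (at t within {t0..T'})"
    by (rule has_vector_derivative_within_subset) (use * in auto)
qed

lemma sigmoid_solution_iff_solution_on:
  assumes u0: "u0 \<in> extensional {..0}"
  shows "sigmoid_solution A B I c d \<Gamma> \<mu> \<epsilon> t0 u0 u \<longleftrightarrow> (\<forall>T\<ge>t0. solution_on \<epsilon> t0 T u0 u)"
proof -
  have h: "history t0 u = u0 \<longleftrightarrow> (\<forall>\<tau>\<le>t0. u \<tau> = u0 (\<tau> - t0))"
  proof
    assume "history t0 u = u0"
    then have "history t0 u (\<tau> - t0) = u0 (\<tau> - t0)" for \<tau> by simp
    then show "\<forall>\<tau>\<le>t0. u \<tau> = u0 (\<tau> - t0)" by (metis add.commute diff_add_cancel diff_le_0_iff_le history_apply)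
  next
    assume *: "\<forall>\<tau>\<le>t0. u \<tau> = u0 (\<tau> - t0)"
    show "history t0 u = u0"
      by (rule extensionalityI[OF _ u0]) (auto simp: history_def *)
  qed
  have atw: "at t within {t0..} = at t within {t0..t + 1}" if "t0 \<le> t" for t
    by (rule at_within_nhd[of t "{..<t + 1}"]) auto
  show ?thesis
    unfolding sigmoid_solution_def h solution_on_def rhs_def[symmetric]
  proof (intro iffI conjI allI impI ballI; (elim conjE)?)
    fix T t assume *: "t \<in> {t0..T}"
      "\<forall>t\<ge>t0. (u has_vector_derivative rhs \<epsilon> t (history t u)) (at t within {t0..})"
    then have "(u has_vector_derivative rhs \<epsilon> t (history t u)) (at t within {t0..})" by simp
    then show "(u has_vector_derivative rhs \<epsilon> t (history t u)) (at t within {t0..T})"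
      by (rule has_vector_derivative_within_subset) auto
  next
    fix t assume *: "t0 \<le> t" "\<forall>T\<ge>t0. (\<forall>\<tau>\<le>t0. u \<tau> = u0 (\<tau> - t0)) \<and>
       (\<forall>t\<in>{t0..T}. (u has_vector_derivative rhs \<epsilon> t (history t u)) (at t within {t0..T}))"
    from *(2)[rule_format, of "t + 1"] *(1)
    show "(u has_vector_derivative rhs \<epsilon> t (history t u)) (at t within {t0..})"
      unfolding atw[OF *(1)] by auto
  qed auto
qed

text \<open>The solutions on \<open>[t0, t0 + n]\<close> agree on common domains and are glued together.\<close>

lemma sigmoid_solution_exists1:
  assumes u0: "u0 \<in> phase_space \<gamma>" and e: "\<epsilon> > 0"
  shows "\<exists>!u. sigmoid_solution A B I c d \<Gamma> \<mu> \<epsilon> t0 u0 u"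
proof -
  have c: "continuous_on {..0} u0" and ext: "u0 \<in> extensional {..0}" using u0 by (auto simp: phase_space_def)
  have "\<exists>u. solution_on \<epsilon> t0 (t0 + real n) u0 u" for n
    using solution_on_exists[OF c _ e, of t0 "t0 + real n"] by (metis le_add_same_cancel1 of_nat_0_le_iff)
  then obtain v where v: "\<And>n. solution_on \<epsilon> t0 (t0 + real n) u0 (v n)" by metis
  have agree: "v m t = v n t" if "t \<le> t0 + real m" "t \<le> t0 + real n" for m n t
  proof -
    have "t \<le> t0 + real (min m n)" using that by (auto simp: min_def)
    moreover have "solution_on \<epsilon> t0 (t0 + real (min m n)) u0 (v m)" "solution_on \<epsilon> t0 (t0 + real (min m n)) u0 (v n)"
      using solution_on_subset[OF v] by auto
    ultimately show ?thesis by (intro solution_on_unique[OF c _ e]) auto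
  qed
  define u where "u t = v (nat \<lceil>t - t0\<rceil>) t" for t
  have uv: "u t = v n t" if "t \<le> t0 + real n" for t n
  proof -
    have "t \<le> t0 + real (nat \<lceil>t - t0\<rceil>)" by linarith
    then show ?thesis unfolding u_def using that by (rule agree)
  qed
  have "solution_on \<epsilon> t0 T u0 u" if T: "T \<ge> t0" for T
  proof -
    obtain n where n: "T \<le> t0 + real n" using real_arch_simple[of "T - t0"] by (auto simp: algebra_simps)
    have s: "solution_on \<epsilon> t0 T u0 (v n)" using solution_on_subset[OF v n] .
    show ?thesis unfolding solution_on_def
    proof (intro conjI allI impI ballI)
      show "u \<tau> = u0 (\<tau> - t0)" if "\<tau> \<le> t0" for \<tau>
        using that s uv[of \<tau> n] T n by (simp add: solution_on_def)
      fix t assume t: "t \<in> {t0..T}"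
      have "(v n has_vector_derivative rhs \<epsilon> t (history t (v n))) (at t within {t0..T})"
        using s t by (simp add: solution_on_def)
      moreover have "history t (v n) = history t u"
      proof (rule history_cong)
        fix \<tau> assume "\<tau> \<le> t"
        then have "\<tau> \<le> t0 + real n" using n t by simp
        then show "v n \<tau> = u \<tau>" by (rule uv[symmetric])
      qed
      ultimately have der: "(v n has_vector_derivative rhs \<epsilon> t (history t u)) (at t within {t0..T})" by simp
      have "u x = v n x" if "x \<in> {t0..T}" for x using that n by (intro uv) simp
      then show "(u has_vector_derivative rhs \<epsilon> t (history t u)) (at t within {t0..T})"
        by (rule has_vector_derivative_transform[OF t _ der])
    qed
  qed
  then have ex: "sigmoid_solution A B I c d \<Gamma> \<mu> \<epsilon> t0 u0 u"
    using sigmoid_solution_iff_solution_on[OF ext] by blast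
  show ?thesis
  proof (rule ex1I[where a=u])
    show "sigmoid_solution A B I c d \<Gamma> \<mu> \<epsilon> t0 u0 u" by (rule ex)
    fix w assume "sigmoid_solution A B I c d \<Gamma> \<mu> \<epsilon> t0 u0 w"
    then have w: "\<And>T. T \<ge> t0 \<Longrightarrow> solution_on \<epsilon> t0 T u0 w" and u: "\<And>T. T \<ge> t0 \<Longrightarrow> solution_on \<epsilon> t0 T u0 u"
      using ex sigmoid_solution_iff_solution_on[OF ext] by blast+
    show "w = u"
    proof
      fix t show "w t = u t"
        by (rule solution_on_unique[OF c _ e w u, of "max t t0"]) auto
    qed
  qed
qed

end

section \<open>The sigmoidal process\<close>

lemma has_vector_derivative_state_iff:
  fixes f :: "real \<Rightarrow> 'n::finite state"
  shows "(f has_vector_derivative w) (at x within S) \<longleftrightarrow>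
    (\<forall>i j. ((\<lambda>s. f s $ i $ j) has_real_derivative w $ i $ j) (at x within S))"
proof -
  have "(f has_vector_derivative w) (at x within S) \<longleftrightarrow>
    (\<forall>b\<in>Basis. ((\<lambda>s. inner (f s) b) has_derivative (\<lambda>h. inner (h *\<^sub>R w) b)) (at x within S))"
    unfolding has_vector_derivative_def by (rule has_derivative_componentwise_within)
  also have "\<dots> \<longleftrightarrow> (\<forall>i j. ((\<lambda>s. f s $ i $ j) has_derivative (\<lambda>h. h * w $ i $ j)) (at x within S))"
    unfolding Basis_vec_def by (auto simp: inner_axis)
  finally show ?thesis by (simp add: has_field_derivative_def mult_commute_abs)
qed

text \<open>The upper semicontinuity of the derivative bounds \<open>g k\<close> along diagonal sequences gives a
  neighbourhood of \<open>q0\<close> and an index from which on they are at most \<open>G + e\<close>; the mean value inequality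
  turns this into a bound for increments, which survives pointwise limits.  The limits of the
  derivatives themselves need not exist.\<close>

lemma limit_differential_inequality:
  fixes f :: "nat \<Rightarrow> real \<Rightarrow> real"
  assumes ac: "\<And>k. absolutely_continuous_on s t (f k)"
    and der: "\<And>k. AE q in lebesgue. s < q \<and> q < t \<longrightarrow> (\<exists>d\<le>g k q. (f k has_real_derivative d) (at q))"
    and lim: "\<And>q. q \<in> {s..t} \<Longrightarrow> (\<lambda>k. f k q) \<longlonglongrightarrow> F q"
    and usc: "\<And>\<kappa> q. (\<And>n. n \<le> \<kappa> n) \<Longrightarrow> (\<And>n. q n \<in> {s..t}) \<Longrightarrow> q \<longlonglongrightarrow> q0 \<Longrightarrow> \<exists>n. g (\<kappa> n) (q n) \<le> G + e"
  shows "\<exists>h>0. \<forall>q1 q2. s \<le> q1 \<longrightarrow> q1 \<le> q2 \<longrightarrow> q2 \<le> t \<longrightarrow> \<bar>q1 - q0\<bar> < h \<longrightarrow> \<bar>q2 - q0\<bar> < h \<longrightarrow>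
      F q2 - F q1 \<le> (G + e) * (q2 - q1)"
proof -
  have "\<exists>n. \<forall>k\<ge>n. \<forall>q\<in>{s..t}. \<bar>q - q0\<bar> < 1 / Suc n \<longrightarrow> g k q \<le> G + e"
  proof (rule ccontr)
    assume "\<not> ?thesis"
    then have "\<forall>n. \<exists>k q. n \<le> k \<and> q \<in> {s..t} \<and> \<bar>q - q0\<bar> < 1 / Suc n \<and> \<not> g k q \<le> G + e" by blast
    then obtain \<kappa> q where *: "\<And>n. n \<le> \<kappa> n" "\<And>n. q n \<in> {s..t}" "\<And>n. \<bar>q n - q0\<bar> < 1 / Suc n"
      "\<And>n. \<not> g (\<kappa> n) (q n) \<le> G + e" by metis
    have "(\<lambda>n. q n - q0) \<longlonglongrightarrow> 0"
      by (rule Lim_null_comparison[OF _ LIMSEQ_inverse_real_of_nat])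
         (use *(3) in \<open>auto simp: inverse_eq_divide intro!: always_eventually less_imp_le\<close>)
    then have "q \<longlonglongrightarrow> q0" by (simp add: LIM_zero_iff)
    then show False using usc[of \<kappa> q, OF *(1,2)] *(4) by blast
  qed
  then obtain n where n: "\<And>k q. k \<ge> n \<Longrightarrow> q \<in> {s..t} \<Longrightarrow> \<bar>q - q0\<bar> < 1 / Suc n \<Longrightarrow> g k q \<le> G + e"
    by blast
  show ?thesis
  proof (intro exI[of _ "1 / Suc n"] conjI allI impI)
    fix q1 q2 assume q: "s \<le> q1" "q1 \<le> q2" "q2 \<le> t" "\<bar>q1 - q0\<bar> < 1 / Suc n" "\<bar>q2 - q0\<bar> < 1 / Suc n"
    have "f k q2 - f k q1 \<le> (G + e) * (q2 - q1)" if k: "k \<ge> n" for k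
    proof (rule absolutely_continuous_derivative_le[OF absolutely_continuous_on_subset[OF ac q(1,3)] q(2)])
      show "AE x in lebesgue. q1 < x \<and> x < q2 \<longrightarrow> (\<exists>d\<le>G + e. (f k has_real_derivative d) (at x))"
        using der[of k]
      proof (rule AE_mp, intro AE_I2 impI)
        fix x assume d: "s < x \<and> x < t \<longrightarrow> (\<exists>d\<le>g k x. (f k has_real_derivative d) (at x))" and x: "q1 < x \<and> x < q2"
        have "g k x \<le> G + e" using q x by (intro n[OF k]) auto
        moreover obtain d where "d \<le> g k x" "(f k has_real_derivative d) (at x)"
          using d x q(1,3) by auto
        ultimately show "\<exists>d\<le>G + e. (f k has_real_derivative d) (at x)" by (meson order_trans)
      qed
    qed
    moreover have "(\<lambda>k. f k q2 - f k q1) \<longlonglongrightarrow> F q2 - F q1" using q by (intro tendsto_intros lim) auto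
    ultimately show "F q2 - F q1 \<le> (G + e) * (q2 - q1)"
      by (intro LIMSEQ_le_const2) blast+
  qed simp
qed

text \<open>Convergence in the phase space is continuous convergence: the argument may move with the index.\<close>

lemma phase_limit_diagonal:
  fixes y :: "nat \<Rightarrow> real \<Rightarrow> 'n::finite state"
  assumes lim: "phase_limit \<gamma> y b" and \<gamma>: "\<gamma> > 0" and \<kappa>: "\<And>n. n \<le> \<kappa> n"
    and p: "\<And>n. p n \<le> 0" "p \<longlonglongrightarrow> p0"
  shows "(\<lambda>n. y (\<kappa> n) (p n)) \<longlonglongrightarrow> b p0"
proof -
  have b: "b \<in> phase_space \<gamma>" using lim unfolding phase_limit_iff by blast
  have p0: "p0 \<le> 0" using p by (intro LIMSEQ_le_const2[OF p(2)]) auto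
  have "(\<lambda>n. b (p n)) \<longlonglongrightarrow> b p0"
    by (rule continuous_on_tendsto_compose[of "{..0}" b]) (use b p p0 in \<open>auto simp: phase_space_def\<close>)
  moreover have "(\<lambda>n. y (\<kappa> n) (p n) - b (p n)) \<longlonglongrightarrow> 0"
  proof (rule tendstoI)
    fix e :: real assume e: "e > 0"
    obtain r where r: "\<And>n. \<bar>p n\<bar> \<le> r" using convergent_imp_Bseq[of p] p(2) unfolding convergent_def Bseq_def by auto
    have "\<forall>\<^sub>F k in sequentially. \<forall>t\<in>{-r..0}. dist (y k t) (b t) < e"
      by (rule phase_limit_locally_uniform[OF lim \<gamma> e])
    then obtain N where "\<forall>k\<ge>N. \<forall>t\<in>{-r..0}. dist (y k t) (b t) < e"
      unfolding eventually_sequentially by blast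
    then have N: "\<And>k t. k \<ge> N \<Longrightarrow> t \<in> {-r..0} \<Longrightarrow> dist (y k t) (b t) < e" by blast
    have "dist (y (\<kappa> n) (p n) - b (p n)) 0 < e" if "n \<ge> N" for n
    proof -
      have "\<kappa> n \<ge> N" using \<kappa>[of n] that by linarith
      moreover have "p n \<in> {-r..0}" using p(1) r[of n] by (auto simp: abs_le_iff)
      ultimately show ?thesis using N[of "\<kappa> n" "p n"] by (simp add: dist_norm)
    qed
    then show "\<forall>\<^sub>F n in sequentially. dist (y (\<kappa> n) (p n) - b (p n)) 0 < e"
      by (auto simp: eventually_sequentially)
  qed
  ultimately have "(\<lambda>n. y (\<kappa> n) (p n) - b (p n) + b (p n)) \<longlonglongrightarrow> 0 + b p0" by (intro tendsto_add)
  then show ?thesis by simp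
qed

context neuron_network begin

lemma history_phase_space:
  assumes u0: "u0 \<in> phase_space \<gamma>" and u: "\<And>\<tau>. \<tau> \<le> t0 \<Longrightarrow> u \<tau> = u0 (\<tau> - t0)" and c: "continuous_on {..t} u"
    and t: "t0 \<le> t"
  shows "history t u \<in> phase_space \<gamma>"
  unfolding phase_space_def
proof (intro CollectI conjI)
  show "history t u \<in> extensional {..0}" by (simp add: history_def)
  show "continuous_on {..0} (history t u)" using history_continuous[OF c] by simp
  obtain l where l: "((\<lambda>t. exp (\<gamma> * t) *\<^sub>R u0 t) \<longlongrightarrow> l) at_bot" using u0 by (auto simp: phase_space_def)
  have f: "filterlim (\<lambda>s. s + (t - t0)) at_bot at_bot"
    unfolding filterlim_at_bot eventually_at_bot_linorder by (metis add_le_cancel_right diff_add_cancel)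
  have "((\<lambda>s. exp (- \<gamma> * (t - t0)) *\<^sub>R (exp (\<gamma> * (s + (t - t0))) *\<^sub>R u0 (s + (t - t0)))) \<longlongrightarrow> exp (- \<gamma> * (t - t0)) *\<^sub>R l) at_bot"
    by (intro tendsto_intros filterlim_compose[OF l f])
  moreover have "\<forall>\<^sub>F s in at_bot. exp (- \<gamma> * (t - t0)) *\<^sub>R (exp (\<gamma> * (s + (t - t0))) *\<^sub>R u0 (s + (t - t0)))
      = exp (\<gamma> * s) *\<^sub>R history t u s"
    unfolding eventually_at_bot_linorder
  proof (intro exI[of _ "t0 - t"] allI impI)
    fix s assume s: "s \<le> t0 - t"
    have "exp (- \<gamma> * (t - t0)) * exp (\<gamma> * (s + (t - t0))) = exp (\<gamma> * s)"
      by (simp flip: exp_add add: algebra_simps)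
    moreover have "history t u s = u0 (s + (t - t0))" using s t u[of "t + s"] by (simp add: history_apply algebra_simps)
    ultimately show "exp (- \<gamma> * (t - t0)) *\<^sub>R (exp (\<gamma> * (s + (t - t0))) *\<^sub>R u0 (s + (t - t0)))
      = exp (\<gamma> * s) *\<^sub>R history t u s" by simp
  qed
  ultimately have "((\<lambda>s. exp (\<gamma> * s) *\<^sub>R history t u s) \<longlongrightarrow> exp (- \<gamma> * (t - t0)) *\<^sub>R l) at_bot"
    by (rule Lim_transform_eventually)
  then show "\<exists>l. ((\<lambda>s. exp (\<gamma> * s) *\<^sub>R history t u s) \<longlongrightarrow> l) at_bot" by blast
qed

lemma sigmoid_solution_iff_phase: "u0 \<in> phase_space \<gamma> \<Longrightarrow> sigmoid_solution A B I c d \<Gamma> \<mu> \<epsilon> t0 u0 u \<longleftrightarrow> (\<forall>T\<ge>t0. solution_on \<epsilon> t0 T u0 u)"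
  by (rule sigmoid_solution_iff_solution_on) (simp add: phase_space_def)

abbreviation sigmoid_flow :: "real \<Rightarrow> real \<Rightarrow> real \<Rightarrow> (real \<Rightarrow> 'n state) \<Rightarrow> (real \<Rightarrow> 'n state) set" where
  "sigmoid_flow \<epsilon> \<equiv> as_set_valued (sigmoid_process A B I c d \<Gamma> \<mu> \<epsilon>)"

lemma sigmoid_flow_eq:
  assumes u0: "u0 \<in> phase_space \<gamma>" and e: "\<epsilon> > 0" and u: "sigmoid_solution A B I c d \<Gamma> \<mu> \<epsilon> t0 u0 u"
  shows "sigmoid_flow \<epsilon> t t0 u0 = {history t u}"
  unfolding as_set_valued_def sigmoid_process_def
  using theI_unique[OF sigmoid_solution_exists1[OF u0 e, of t0], of u] u by metis

lemma sigmoid_solution_phase: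
  assumes u0: "u0 \<in> phase_space \<gamma>" and u: "sigmoid_solution A B I c d \<Gamma> \<mu> \<epsilon> t0 u0 u" and t: "t0 \<le> t"
  shows "continuous_on {..t} u" "history t u \<in> phase_space \<gamma>"
proof -
  have s: "solution_on \<epsilon> t0 t u0 u" using u t sigmoid_solution_iff_phase[OF u0] by blast
  show c: "continuous_on {..t} u"
    by (rule solution_on_continuous[OF _ s t]) (use u0 in \<open>simp add: phase_space_def\<close>)
  show "history t u \<in> phase_space \<gamma>"
    by (rule history_phase_space[OF u0 _ c t]) (use s in \<open>simp add: solution_on_def\<close>)
qed

lemma sigmoid_flow_cocycle:
  assumes e: "\<epsilon> > 0"
  shows "cocycle_on \<gamma> (sigmoid_flow \<epsilon>)"
  unfolding cocycle_on_def
proof (intro ballI allI impI)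
  fix x :: "real \<Rightarrow> 'n state" and s r t assume x: "x \<in> phase_space \<gamma>" and sr: "s \<le> r" "r \<le> (t::real)"
  obtain u where u: "sigmoid_solution A B I c d \<Gamma> \<mu> \<epsilon> s x u" using sigmoid_solution_exists1[OF x e] by blast
  note phase = sigmoid_solution_phase[OF x u]
  have u': "sigmoid_solution A B I c d \<Gamma> \<mu> \<epsilon> r (history r u) u"
    using u sr unfolding sigmoid_solution_def
    by (auto intro: has_vector_derivative_within_subset[where S="{s..}"])
  have "history s u = x" using u by (simp add: sigmoid_solution_def)
  then show "sigmoid_flow \<epsilon> s s x = {x} \<and> sigmoid_flow \<epsilon> r s x \<subseteq> phase_space \<gamma> \<and> (\<Union>y\<in>sigmoid_flow \<epsilon> r s x. sigmoid_flow \<epsilon> t r y) = sigmoid_flow \<epsilon> t s x"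
    using sigmoid_flow_eq[OF x e u] sigmoid_flow_eq[OF phase(2)[OF sr(1)] e u'] phase(2)[OF sr(1)] by simp
qed

lemma solution_on_absolutely_continuous:
  assumes u0: "continuous_on {..0} u0" and e: "\<epsilon> > 0" and u: "solution_on \<epsilon> t0 T u0 u" and T: "t0 \<le> T"
  shows "absolutely_continuous_on t0 T u"
proof -
  have "continuous_on {t0..T} (\<lambda>s. rhs \<epsilon> s (history s u))"
    by (rule continuous_on_subset[OF rhs_history_continuous[OF e solution_on_continuous[OF u0 u T]]]) auto
  then have "bounded ((\<lambda>s. rhs \<epsilon> s (history s u)) ` {t0..T})"
    by (intro compact_imp_bounded compact_continuous_image) auto
  then obtain M where "\<forall>v\<in>(\<lambda>s. rhs \<epsilon> s (history s u)) ` {t0..T}. norm v \<le> M" unfolding bounded_iff by blast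
  then have M: "\<And>s. s \<in> {t0..T} \<Longrightarrow> norm (rhs \<epsilon> s (history s u)) \<le> M" by blast
  show ?thesis
  proof (rule lipschitz_imp_absolutely_continuous_on)
    fix p q assume pq: "t0 \<le> p" "p \<le> q" "q \<le> T"
    have "norm (u q - u p) \<le> M * norm (q - p)"
    proof (rule differentiable_bound[of "{t0..T}" u "\<lambda>s h. h *\<^sub>R rhs \<epsilon> s (history s u)"])
      show "(u has_derivative (\<lambda>h. h *\<^sub>R rhs \<epsilon> s (history s u))) (at s within {t0..T})" if "s \<in> {t0..T}" for s
        using u that by (simp add: solution_on_def has_vector_derivative_def)
      show "onorm (\<lambda>h. h *\<^sub>R rhs \<epsilon> s (history s u)) \<le> M" if s: "s \<in> {t0..T}" for s
      proof (rule onorm_bound)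
        show "0 \<le> M" using norm_ge_zero M[OF s] by (rule order_trans)
        show "norm (h *\<^sub>R rhs \<epsilon> s (history s u)) \<le> M * norm h" for h
          using mult_right_mono[OF M[OF s], of "\<bar>h\<bar>"] by (simp add: mult.commute)
      qed
    qed (use pq in auto)
    then show "norm (u q - u p) \<le> M * (q - p)" using pq by simp
  qed
qed

text \<open>The final histories determine the solutions on the whole past, so their limit \<open>b\<close>, shifted in time, is
  the only candidate \<open>v\<close> for the limiting solution.  Along the convergent solutions the right-hand sides
  converge, and \<open>limit_differential_inequality\<close> from above and below shows that \<open>v\<close> solves the equation;
  uniqueness identifies it with the orbit of \<open>a\<close>.\<close>

lemma sigmoid_flow_closed_graph:
  assumes e: "\<epsilon> > 0"
  shows "closed_graph \<gamma> (sigmoid_flow \<epsilon>)"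
  unfolding closed_graph_def
proof (intro allI impI)
  fix s t :: real and x y :: "nat \<Rightarrow> real \<Rightarrow> 'n state" and a b
  assume st: "s \<le> t" and xa: "phase_limit \<gamma> x a" and yb: "phase_limit \<gamma> y b"
    and xy: "\<forall>k. x k \<in> phase_space \<gamma> \<and> y k \<in> sigmoid_flow \<epsilon> t s (x k)"
  have a: "a \<in> phase_space \<gamma>" and b: "b \<in> phase_space \<gamma>" using xa yb unfolding phase_limit_iff by blast+
  then have ac: "continuous_on {..0} a" and bc: "continuous_on {..0} b" by (auto simp: phase_space_def)
  have xc: "continuous_on {..0} (x k)" for k using xy by (auto simp: phase_space_def)
  have "\<exists>u. sigmoid_solution A B I c d \<Gamma> \<mu> \<epsilon> s (x k) u" for k using sigmoid_solution_exists1[OF _ e] xy by blast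
  then obtain u where u: "\<And>k. sigmoid_solution A B I c d \<Gamma> \<mu> \<epsilon> s (x k) (u k)" by metis
  have y: "y k = history t (u k)" for k using xy sigmoid_flow_eq[OF _ e u[of k]] by blast
  have us: "solution_on \<epsilon> s T (x k) (u k)" if "T \<ge> s" for T k using u that xy sigmoid_solution_iff_phase by blast
  have uc: "continuous_on {..t} (u k)" for k using solution_on_continuous[OF xc us[OF st] st] .
  define v where "v \<tau> = b (\<tau> - t)" for \<tau>
  have vc: "continuous_on {..t} v" unfolding v_def
    by (intro continuous_on_compose2[OF bc] continuous_intros) auto
  have uv: "(\<lambda>n. u (\<kappa> n) (p n)) \<longlonglongrightarrow> v p0" if "\<And>n. n \<le> \<kappa> n" "\<And>n. p n \<le> t" "p \<longlonglongrightarrow> p0" for \<kappa> p p0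
  proof -
    have "(\<lambda>n. y (\<kappa> n) (p n - t)) \<longlonglongrightarrow> b (p0 - t)"
      using that by (intro phase_limit_diagonal[OF yb gamma_pos] tendsto_intros) auto
    then show ?thesis using that(2) by (simp add: y history_apply v_def)
  qed
  have uv1: "(\<lambda>k. u k q) \<longlonglongrightarrow> v q" if "q \<le> t" for q using uv[of id "\<lambda>_. q" q] that by simp
  have "solution_on \<epsilon> s t a v"
    unfolding solution_on_def
  proof (intro conjI allI impI ballI)
    fix \<tau> assume \<tau>: "\<tau> \<le> s"
    have "(\<lambda>k. x k (\<tau> - s)) \<longlonglongrightarrow> a (\<tau> - s)" using \<tau> by (intro phase_limit_pointwise[OF xa]) simp
    moreover have "x k (\<tau> - s) = u k \<tau>" for k using us[OF st] \<tau> by (simp add: solution_on_def)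
    ultimately show "v \<tau> = a (\<tau> - s)" using uv1[of \<tau>] \<tau> st LIMSEQ_unique by fastforce
  next
    fix q0 assume q0: "q0 \<in> {s..t}"
    have "((\<lambda>q. v q $ i $ j) has_real_derivative rhs \<epsilon> q0 (history q0 v) $ i $ j) (at q0 within {s..t})" for i j
    proof -
      define G where "G = rhs \<epsilon> q0 (history q0 v) $ i $ j"
      define g where "g k q = rhs \<epsilon> q (history q (u k)) $ i $ j" for k q
      have gG: "(\<lambda>n. g (\<kappa> n) (q n)) \<longlonglongrightarrow> G"
        if *: "\<And>n. n \<le> \<kappa> n" "\<And>n. q n \<in> {s..t}" "q \<longlonglongrightarrow> q0" for \<kappa> q
        unfolding g_def G_def
      proof (intro tendsto_vec_nth rhs_tendsto[OF e _ _ _ *(3)])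
        show "continuous_on {..0} (history (q n) (u (\<kappa> n)))" for n using history_continuous[OF uc] *(2)[of n] by simp
        show "continuous_on {..0} (history q0 v)" using history_continuous[OF vc] q0 by simp
        fix \<tau> :: real assume \<tau>: "\<tau> \<le> 0"
        have "(\<lambda>n. u (\<kappa> n) (q n + \<tau>)) \<longlonglongrightarrow> v (q0 + \<tau>)"
        proof (rule uv[OF *(1)])
          show "q n + \<tau> \<le> t" for n using *(2)[of n] \<tau> by simp
        qed (intro tendsto_intros *)
        then show "(\<lambda>n. history (q n) (u (\<kappa> n)) \<tau>) \<longlonglongrightarrow> history q0 v \<tau>" using \<tau> by (simp add: history_apply)
      qed
      have ac: "absolutely_continuous_on s t (\<lambda>q. u k q $ i $ j)" for k
      proof (rule absolutely_continuous_on_mono_norm[OF solution_on_absolutely_continuous[OF xc e us[OF st] st]])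
        show "norm (u k q $ i $ j - u k p $ i $ j) \<le> norm (u k q - u k p)" for p q
          using state_component_le_norm[of "u k q - u k p" i j] by simp
      qed
      have d: "((\<lambda>q. u k q $ i $ j) has_real_derivative g k q) (at q)" if "s < q" "q < t" for k q
      proof -
        have "(u k has_vector_derivative rhs \<epsilon> q (history q (u k))) (at q within {s..t})"
          using us[OF st, of k] that unfolding solution_on_def by auto
        then show ?thesis unfolding has_vector_derivative_state_iff g_def
          using that at_within_interior[of q "{s..t}"] by simp
      qed
      have U: "\<exists>h>0. \<forall>q1 q2. s \<le> q1 \<longrightarrow> q1 \<le> q2 \<longrightarrow> q2 \<le> t \<longrightarrow> \<bar>q1 - q0\<bar> < h \<longrightarrow> \<bar>q2 - q0\<bar> < h \<longrightarrow>
          v q2 $ i $ j - v q1 $ i $ j \<le> (G + e) * (q2 - q1)" if e: "e > 0" for e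
      proof (rule limit_differential_inequality[where f="\<lambda>k q. u k q $ i $ j" and g=g])
        show "\<exists>n. g (\<kappa> n) (q n) \<le> G + e" if "\<And>n. n \<le> \<kappa> n" "\<And>n. q n \<in> {s..t}" "q \<longlonglongrightarrow> q0" for \<kappa> q
        proof -
          have "\<forall>\<^sub>F n in sequentially. g (\<kappa> n) (q n) < G + e"
            using order_tendstoD(2)[OF gG[OF that], of "G + e"] e by simp
          then show ?thesis unfolding eventually_sequentially by (meson less_imp_le order_refl)
        qed
      qed (use ac d uv1 in \<open>auto intro!: AE_I2 tendsto_vec_nth\<close>)
      have Lo: "\<exists>h>0. \<forall>q1 q2. s \<le> q1 \<longrightarrow> q1 \<le> q2 \<longrightarrow> q2 \<le> t \<longrightarrow> \<bar>q1 - q0\<bar> < h \<longrightarrow> \<bar>q2 - q0\<bar> < h \<longrightarrow>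
          - v q2 $ i $ j - - v q1 $ i $ j \<le> (- G + e) * (q2 - q1)" if e: "e > 0" for e
      proof (rule limit_differential_inequality[where f="\<lambda>k q. - u k q $ i $ j" and g="\<lambda>k q. - g k q"])
        show "absolutely_continuous_on s t (\<lambda>q. - u k q $ i $ j)" for k
          by (rule absolutely_continuous_on_mono_norm[OF ac[of k]]) simp
        show "AE q in lebesgue. s < q \<and> q < t \<longrightarrow> (\<exists>d\<le>- g k q. ((\<lambda>q. - u k q $ i $ j) has_real_derivative d) (at q))" for k
          using d[of _ k] by (auto intro!: AE_I2 exI[of _ "- g k _"] DERIV_minus)
        show "\<exists>n. - g (\<kappa> n) (q n) \<le> - G + e" if "\<And>n. n \<le> \<kappa> n" "\<And>n. q n \<in> {s..t}" "q \<longlonglongrightarrow> q0" for \<kappa> q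
        proof -
          have "\<forall>\<^sub>F n in sequentially. g (\<kappa> n) (q n) > G - e"
            using order_tendstoD(1)[OF gG[OF that], of "G - e"] e by simp
          then have "\<exists>n. g (\<kappa> n) (q n) > G - e" unfolding eventually_sequentially by blast
          then obtain n where "g (\<kappa> n) (q n) > G - e" by blast
          then show ?thesis by (intro exI[of _ n]) simp
        qed
        show "(\<lambda>k. - u k q $ i $ j) \<longlonglongrightarrow> - v q $ i $ j" if "q \<in> {s..t}" for q
          using that uv1[of q] by (intro tendsto_minus tendsto_vec_nth) auto
      qed
      have "((\<lambda>q. v q $ i $ j) has_derivative (\<lambda>h. h * G)) (at q0 within {s..t})"
        unfolding has_derivative_within_alt
      proof (intro conjI allI impI)
        show "bounded_linear (\<lambda>h. h * G)" by (rule bounded_linear_mult_left)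
        fix e :: real assume e: "e > 0"
        obtain h1 where h1: "h1 > 0" "\<And>q1 q2. s \<le> q1 \<Longrightarrow> q1 \<le> q2 \<Longrightarrow> q2 \<le> t \<Longrightarrow> \<bar>q1 - q0\<bar> < h1 \<Longrightarrow> \<bar>q2 - q0\<bar> < h1 \<Longrightarrow>
          v q2 $ i $ j - v q1 $ i $ j \<le> (G + e) * (q2 - q1)" using U[OF e] by blast
        obtain h2 where h2: "h2 > 0" "\<And>q1 q2. s \<le> q1 \<Longrightarrow> q1 \<le> q2 \<Longrightarrow> q2 \<le> t \<Longrightarrow> \<bar>q1 - q0\<bar> < h2 \<Longrightarrow> \<bar>q2 - q0\<bar> < h2 \<Longrightarrow>
          - v q2 $ i $ j - - v q1 $ i $ j \<le> (- G + e) * (q2 - q1)" using Lo[OF e] by blast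
        have "norm (v q $ i $ j - v q0 $ i $ j - (q - q0) * G) \<le> e * norm (q - q0)"
          if q: "q \<in> {s..t}" "norm (q - q0) < min h1 h2" for q
        proof (cases "q0 \<le> q")
          case True
          then show ?thesis using h1(2)[of q0 q] h2(2)[of q0 q] q q0 by (auto simp: abs_le_iff algebra_simps)
        next
          case False
          then show ?thesis using h1(2)[of q q0] h2(2)[of q q0] q q0 by (auto simp: abs_le_iff algebra_simps)
        qed
        then show "\<exists>da>0. \<forall>q\<in>{s..t}. norm (q - q0) < da \<longrightarrow>
            norm (v q $ i $ j - v q0 $ i $ j - (q - q0) * G) \<le> e * norm (q - q0)"
          using h1(1) h2(1) by (intro exI[of _ "min h1 h2"]) auto
      qed
      then show ?thesis by (simp add: has_field_derivative_def mult_commute_abs G_def)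
    qed
    then show "(v has_vector_derivative rhs \<epsilon> q0 (history q0 v)) (at q0 within {s..t})"
      unfolding has_vector_derivative_state_iff by blast
  qed
  note sv = this
  obtain w where w: "sigmoid_solution A B I c d \<Gamma> \<mu> \<epsilon> s a w" using sigmoid_solution_exists1[OF a e] by blast
  have sw: "solution_on \<epsilon> s t a w" using w st sigmoid_solution_iff_phase[OF a] by blast
  have "history t w = b"
  proof
    fix \<tau> show "history t w \<tau> = b \<tau>"
    proof (cases "\<tau> \<le> 0")
      case True
      then have "w (t + \<tau>) = v (t + \<tau>)" by (intro solution_on_unique[OF ac st e sw sv]) simp
      then show ?thesis using True by (simp add: history_apply v_def)
    next
      case False
      then show ?thesis using b by (auto simp: history_def phase_space_def extensional_def)
    qed
  qed
  then show "b \<in> sigmoid_flow \<epsilon> t s a" using sigmoid_flow_eq[OF a e w] by simp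
qed

end

section \<open>The inflated term as a box\<close>

text \<open>Both endpoints are expressed by the same expression with \<open>a\<close> and \<open>- a\<close>, so that one upper bound,
  used with either sign, describes the interval.\<close>

lemma set_times_interval:
  fixes l h :: real
  assumes "l \<le> h"
  shows "a *o {l..h} = {- max ((- a) * l) ((- a) * h)..max (a * l) (a * h)}"
proof (cases "a = 0")
  case True
  then show ?thesis using assms by (auto simp: elt_set_times_def)
next
  case False
  have "(\<exists>b\<in>{l..h}. y = a * b) \<longleftrightarrow> y / a \<in> {l..h}" for y
  proof
    assume "y / a \<in> {l..h}"
    then show "\<exists>b\<in>{l..h}. y = a * b" using False by (intro bexI[of _ "y / a"]) auto
  qed (use False in auto)
  then have "y \<in> a *o {l..h} \<longleftrightarrow> y / a \<in> {l..h}" for y unfolding elt_set_times_def by auto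
  moreover have "y / a \<in> {l..h} \<longleftrightarrow> y \<in> {- max ((- a) * l) ((- a) * h)..max (a * l) (a * h)}" for y
  proof (cases "a > 0")
    case True
    then have "a * l \<le> a * h" using assms by simp
    then show ?thesis using True by (auto simp: field_simps max_def)
  next
    case False
    then have a: "a < 0" using \<open>a \<noteq> 0\<close> by simp
    then have "a * h \<le> a * l" using assms by simp
    then show ?thesis using a by (auto simp: field_simps max_def)
  qed
  ultimately show ?thesis by blast
qed

lemma interval_plus_interval:
  fixes a b p q :: real
  assumes "a \<le> b" "p \<le> q"
  shows "{a..b} + {p..q} = {a + p..b + q}"
proof (intro equalityI subsetI)
  fix y assume "y \<in> {a + p..b + q}"
  then have "y = max a (y - q) + (y - max a (y - q))" "max a (y - q) \<in> {a..b}" "y - max a (y - q) \<in> {p..q}"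
    using assms by (auto simp: max_def)
  then show "y \<in> {a..b} + {p..q}" by (metis set_plus_intro)
qed (auto simp: set_plus_def)

lemma sum_intervals:
  fixes l h :: "'a \<Rightarrow> real"
  assumes "finite K" "\<And>k. k \<in> K \<Longrightarrow> l k \<le> h k"
  shows "(\<Sum>k\<in>K. {l k..h k}) = {(\<Sum>k\<in>K. l k)..(\<Sum>k\<in>K. h k)}"
  using assms
proof (induction K rule: finite_induct)
  case (insert k K)
  then show ?case by (simp add: interval_plus_interval sum_mono)
qed simp

text \<open>The maximum of \<open>a * x\<close> over \<open>x\<close> in \<open>[l, h]\<close>.\<close>

definition scaled_max :: "real \<Rightarrow> real \<Rightarrow> real \<Rightarrow> real" where "scaled_max a l h = max (a * l) (a * h)"

lemma scaled_max_mono: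
  assumes "l' \<le> l" "l \<le> h" "h \<le> h'"
  shows "scaled_max a l h \<le> scaled_max a l' h'"
proof (cases "a \<ge> 0")
  case True
  then have "a * l \<le> a * h" "a * h \<le> a * h'" using assms by (auto intro: mult_left_mono)
  then show ?thesis by (auto simp: scaled_max_def)
next
  case False
  then have "a * l \<le> a * l'" "a * h \<le> a * l" using assms by auto
  then show ?thesis by (auto simp: scaled_max_def)
qed

lemma scaled_max_ge: "l \<le> x \<Longrightarrow> x \<le> h \<Longrightarrow> a * x \<le> scaled_max a l h"
  using scaled_max_mono[of l x x h a] by (simp add: scaled_max_def)

text \<open>From \<open>ln (1 / x) = 2 * ln (1 / sqrt x) \<le> 2 / sqrt x\<close> the width is at most \<open>2 * sqrt x\<close>.\<close>

lemma inflation_width_tendsto_0: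
  assumes e: "\<And>k::nat. 0 \<le> \<epsilon> k \<and> \<epsilon> k \<le> 1/5" and lim: "\<epsilon> \<longlonglongrightarrow> 0"
  shows "(\<lambda>k. inflation_width (\<epsilon> k)) \<longlonglongrightarrow> 0"
proof (rule tendsto_sandwich[OF _ _ tendsto_const])
  have "(\<lambda>k. 2 * sqrt (\<epsilon> k)) \<longlonglongrightarrow> 2 * sqrt 0" by (intro tendsto_intros lim)
  then show "(\<lambda>k. 2 * sqrt (\<epsilon> k)) \<longlonglongrightarrow> 0" by simp
  show "\<forall>\<^sub>F k in sequentially. 0 \<le> inflation_width (\<epsilon> k)" using e inflation_width_nonneg by auto
  have "inflation_width x \<le> 2 * sqrt x" if x: "0 < x" "x \<le> 1/5" for x
  proof -
    have "ln ((1 - x) / x) \<le> ln (1 / x)" using x by (intro ln_mono) (auto simp: field_simps)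
    also have "\<dots> = 2 * ln (1 / sqrt x)" using x by (simp add: ln_div ln_sqrt)
    also have "\<dots> \<le> 2 * (1 / sqrt x - 1)" using x by (intro mult_left_mono ln_le_minus_one) auto
    also have "\<dots> \<le> 2 * (1 / sqrt x)" by simp
    finally have "x * ln ((1 - x) / x) \<le> x * (2 * (1 / sqrt x))" using x by (intro mult_left_mono) auto
    also have "\<dots> = 2 * (x / sqrt x)" by simp
    also have "\<dots> = 2 * sqrt x" using x by (simp only: real_div_sqrt less_imp_le)
    finally show ?thesis using x by (simp add: inflation_width_def)
  qed
  then have "inflation_width (\<epsilon> k) \<le> 2 * sqrt (\<epsilon> k)" for k
    using e[of k] by (cases "\<epsilon> k = 0") (auto simp: inflation_width_def[of 0])
  then show "\<forall>\<^sub>F k in sequentially. inflation_width (\<epsilon> k) \<le> 2 * sqrt (\<epsilon> k)" by simp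
qed

context neuron_network begin

definition act_lo :: "real \<Rightarrow> 'n \<Rightarrow> 'n \<Rightarrow> (real \<Rightarrow> 'n state) \<Rightarrow> real" where
  "act_lo \<epsilon> i j u = (LINT \<tau>|\<mu> i j. chi_lo \<epsilon> (xc (u \<tau>) i - \<Gamma> i))"
definition act_up :: "real \<Rightarrow> 'n \<Rightarrow> 'n \<Rightarrow> (real \<Rightarrow> 'n state) \<Rightarrow> real" where
  "act_up \<epsilon> i j u = (LINT \<tau>|\<mu> i j. chi_up \<epsilon> (xc (u \<tau>) i - \<Gamma> i))"

text \<open>The support function of the box \<open>inflated_term\<close>: the largest value of \<open>\<sigma>\<close> times component \<open>(i, j)\<close>, for
  \<open>\<sigma> = 1\<close> and \<open>\<sigma> = -1\<close>.\<close>

definition coupling_bound :: "real \<Rightarrow> (real \<Rightarrow> 'n state) \<Rightarrow> 'n \<Rightarrow> 'n \<Rightarrow> real \<Rightarrow> real" where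
  "coupling_bound \<epsilon> u i j \<sigma> = (if i = j then \<Sum>k\<in>UNIV - {i}. scaled_max (\<sigma> * (u 0 $ k $ i - c k i)) (act_lo \<epsilon> k i u) (act_up \<epsilon> k i u)
     else scaled_max (\<sigma> * (d i j * max (u 0 $ j $ j) 0)) (act_lo \<epsilon> i j u) (act_up \<epsilon> i j u))"

lemma x_measurable:
  assumes "i \<noteq> j" "continuous_on {..0} u"
  shows "(\<lambda>\<tau>. xc (u \<tau>) i - \<Gamma> i) \<in> borel_measurable (\<mu> i j)"
  by (rule measurable_mu[OF assms(1)]) (intro continuous_intros assms)

lemma chi_integrable:
  assumes ij: "i \<noteq> j" and u: "continuous_on {..0} u" and e: "0 \<le> \<epsilon>" "\<epsilon> \<le> 1/5"
  shows "integrable (\<mu> i j) (\<lambda>\<tau>. chi_lo \<epsilon> (xc (u \<tau>) i - \<Gamma> i))"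
    and "integrable (\<mu> i j) (\<lambda>\<tau>. chi_up \<epsilon> (xc (u \<tau>) i - \<Gamma> i))"
proof -
  interpret finite_measure "\<mu> i j" using measures(2)[OF ij] .
  have "\<bar>chi_lo \<epsilon> s\<bar> \<le> 1" "\<bar>chi_up \<epsilon> s\<bar> \<le> 1" for s using chi_bounds[OF e, of s] by auto
  then show "integrable (\<mu> i j) (\<lambda>\<tau>. chi_lo \<epsilon> (xc (u \<tau>) i - \<Gamma> i))"
    "integrable (\<mu> i j) (\<lambda>\<tau>. chi_up \<epsilon> (xc (u \<tau>) i - \<Gamma> i))"
    by (auto intro!: integrable_const_bound[of _ 1] AE_I2 measurable_compose[OF x_measurable[OF ij u]])
qed

lemma act_lo_le_act_up:
  assumes "i \<noteq> j" "continuous_on {..0} u" "0 \<le> \<epsilon>" "\<epsilon> \<le> 1/5"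
  shows "act_lo \<epsilon> i j u \<le> act_up \<epsilon> i j u"
  unfolding act_lo_def act_up_def using chi_integrable[OF assms] chi_bounds(2)[OF assms(3,4)] by (intro integral_mono)

lemma act_lo_up_mono:
  assumes ij: "i \<noteq> j" and u: "continuous_on {..0} u" and e: "0 \<le> \<epsilon>" "\<epsilon> \<le> \<delta>" "\<delta> \<le> 1/5"
  shows "act_lo \<delta> i j u \<le> act_lo \<epsilon> i j u" "act_up \<epsilon> i j u \<le> act_up \<delta> i j u"
proof -
  have "{chi_lo \<epsilon> s..chi_up \<epsilon> s} \<subseteq> {chi_lo \<delta> s..chi_up \<delta> s}" for s
    using inflated_Heaviside_mono[OF e, of s] inflated_Heaviside_eq[of \<epsilon> s] inflated_Heaviside_eq[of \<delta> s] e by simp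
  then have m: "chi_lo \<delta> s \<le> chi_lo \<epsilon> s" "chi_up \<epsilon> s \<le> chi_up \<delta> s" for s
    using chi_bounds(2)[of \<epsilon> s] e by (auto dest: spec[where x=s])
  show "act_lo \<delta> i j u \<le> act_lo \<epsilon> i j u" unfolding act_lo_def
    using chi_integrable(1)[OF ij u] e m by (intro integral_mono) auto
  show "act_up \<epsilon> i j u \<le> act_up \<delta> i j u" unfolding act_up_def
    using chi_integrable(2)[OF ij u] e m by (intro integral_mono) auto
qed

lemma act_between:
  assumes ij: "i \<noteq> j" and u: "continuous_on {..0} u" and e: "0 < \<epsilon>" "\<epsilon> \<le> 1/5"
  shows "act_lo \<epsilon> i j u \<le> act \<epsilon> i j u" "act \<epsilon> i j u \<le> act_up \<epsilon> i j u"
proof -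
  have m: "chi_lo \<epsilon> s \<le> sigmoid \<epsilon> s" "sigmoid \<epsilon> s \<le> chi_up \<epsilon> s" for s
    using sigmoid_in_inflated_Heaviside[OF e, of s] inflated_Heaviside_eq[of \<epsilon> s] e by auto
  show "act_lo \<epsilon> i j u \<le> act \<epsilon> i j u" unfolding act_lo_def act_def
    using chi_integrable(1)[OF ij u] sigmoid_integrable[OF ij e(1) u] e m by (intro integral_mono) auto
  show "act \<epsilon> i j u \<le> act_up \<epsilon> i j u" unfolding act_up_def act_def
    using chi_integrable(2)[OF ij u] sigmoid_integrable[OF ij e(1) u] e m by (intro integral_mono) auto
qed

text \<open>Aumann integrals of interval-valued maps are intervals and Minkowski sums of intervals are
  intervals, so the inflated term is a box.\<close>

lemma inflated_term_iff:
  assumes u: "continuous_on {..0} u" and e: "0 \<le> \<epsilon>" "\<epsilon> \<le> 1/5"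
  shows "w \<in> inflated_term c d \<Gamma> \<mu> \<epsilon> u \<longleftrightarrow> (\<forall>i j. - coupling_bound \<epsilon> u i j (- 1) \<le> w $ i $ j \<and> w $ i $ j \<le> coupling_bound \<epsilon> u i j 1)"
proof -
  have Au: "Aumann_integral (\<mu> i j) (\<lambda>\<tau>. inflated_Heaviside \<epsilon> (xc (u \<tau>) i - \<Gamma> i)) = {act_lo \<epsilon> i j u..act_up \<epsilon> i j u}"
    if "i \<noteq> j" for i j
    unfolding act_lo_def act_up_def by (rule Aumann_integral_interval[OF measures(2)[OF that] x_measurable[OF that u] e])
  have times: "a *o {act_lo \<epsilon> i j u..act_up \<epsilon> i j u}
      = {- scaled_max (- 1 * a) (act_lo \<epsilon> i j u) (act_up \<epsilon> i j u)..scaled_max (1 * a) (act_lo \<epsilon> i j u) (act_up \<epsilon> i j u)}" if "i \<noteq> j" for a i j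
    using set_times_interval[OF act_lo_le_act_up[OF that u e]] by (simp add: scaled_max_def)
  have le: "- scaled_max (- 1 * a) l h \<le> scaled_max (1 * a) l h" for a l h :: real by (auto simp: scaled_max_def max_def)
  have le2: "- scaled_max (x - y) l h \<le> scaled_max (y - x) l h" for x y l h :: real
    using le[of "y - x" l h] by simp
  have diag: "(\<Sum>k\<in>UNIV - {i}. (zc (u 0) k i - c k i) *o
       Aumann_integral (\<mu> k i) (\<lambda>\<tau>. inflated_Heaviside \<epsilon> (xc (u \<tau>) k - \<Gamma> k))) = {- coupling_bound \<epsilon> u i i (- 1)..coupling_bound \<epsilon> u i i 1}" for i
  proof -
    have "(\<Sum>k\<in>UNIV - {i}. (zc (u 0) k i - c k i) *o
       Aumann_integral (\<mu> k i) (\<lambda>\<tau>. inflated_Heaviside \<epsilon> (xc (u \<tau>) k - \<Gamma> k)))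
      = (\<Sum>k\<in>UNIV - {i}. {- scaled_max (- 1 * (zc (u 0) k i - c k i)) (act_lo \<epsilon> k i u) (act_up \<epsilon> k i u)..
           scaled_max (1 * (zc (u 0) k i - c k i)) (act_lo \<epsilon> k i u) (act_up \<epsilon> k i u)})"
      by (rule sum.cong) (auto simp: Au times simp del: mult_1 mult_minus_left)
    also have "\<dots> = {- coupling_bound \<epsilon> u i i (- 1)..coupling_bound \<epsilon> u i i 1}"
      by (subst sum_intervals) (auto simp: coupling_bound_def sum_negf intro: le2)
    finally show ?thesis .
  qed
  have off: "(d i j * max (xc (u 0) j) 0) *o Aumann_integral (\<mu> i j) (\<lambda>\<tau>. inflated_Heaviside \<epsilon> (xc (u \<tau>) i - \<Gamma> i))
      = {- coupling_bound \<epsilon> u i j (- 1)..coupling_bound \<epsilon> u i j 1}" if "i \<noteq> j" for i j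
    unfolding Au[OF that] times[OF that] using that by (simp add: coupling_bound_def)
  have gen: "(\<forall>i. P i i) \<and> (\<forall>i j. i \<noteq> j \<longrightarrow> P i j) \<longleftrightarrow> (\<forall>i j. P i j)" for P :: "'n \<Rightarrow> 'n \<Rightarrow> bool" by metis
  have "w \<in> inflated_term c d \<Gamma> \<mu> \<epsilon> u \<longleftrightarrow> (\<forall>i. w $ i $ i \<in> {- coupling_bound \<epsilon> u i i (- 1)..coupling_bound \<epsilon> u i i 1}) \<and>
      (\<forall>i j. i \<noteq> j \<longrightarrow> w $ i $ j \<in> {- coupling_bound \<epsilon> u i j (- 1)..coupling_bound \<epsilon> u i j 1})"
    unfolding inflated_term_def mem_Collect_eq diag by (intro conj_cong refl all_cong1 imp_cong) (simp only: off simp_thms)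
  also have "\<dots> \<longleftrightarrow> (\<forall>i j. w $ i $ j \<in> {- coupling_bound \<epsilon> u i j (- 1)..coupling_bound \<epsilon> u i j 1})" by (rule gen)
  finally show ?thesis by simp
qed

lemma coupling_bound_mono:
  assumes u: "continuous_on {..0} u" and e: "0 \<le> \<epsilon>" "\<epsilon> \<le> \<delta>" "\<delta> \<le> 1/5"
  shows "coupling_bound \<epsilon> u i j \<sigma> \<le> coupling_bound \<delta> u i j \<sigma>"
proof -
  have e': "\<epsilon> \<le> 1/5" using e by simp
  have "scaled_max a (act_lo \<epsilon> k l u) (act_up \<epsilon> k l u) \<le> scaled_max a (act_lo \<delta> k l u) (act_up \<delta> k l u)" if "k \<noteq> l" for a k l
    by (intro scaled_max_mono act_lo_up_mono act_lo_le_act_up that u e e')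
  then show ?thesis unfolding coupling_bound_def by (auto intro!: sum_mono)
qed

lemma sigmoid_term_inflated:
  assumes u: "continuous_on {..0} u" and e: "0 < \<epsilon>" "\<epsilon> \<le> 1/5"
  shows "sigmoid_term c d \<Gamma> \<mu> \<epsilon> u \<in> inflated_term c d \<Gamma> \<mu> \<epsilon> u"
proof -
  have h: "\<sigma> * sigmoid_term c d \<Gamma> \<mu> \<epsilon> u $ i $ j \<le> coupling_bound \<epsilon> u i j \<sigma>" for i j \<sigma>
  proof (cases "i = j")
    case True
    have "\<sigma> * sigmoid_term c d \<Gamma> \<mu> \<epsilon> u $ i $ j = (\<Sum>k\<in>UNIV - {i}. (\<sigma> * (u 0 $ k $ i - c k i)) * act \<epsilon> k i u)"
      using True by (simp add: sigmoid_term_def state_of_def act_def sum_distrib_left mult_ac)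
    also have "\<dots> \<le> coupling_bound \<epsilon> u i j \<sigma>"
      unfolding coupling_bound_def using True by (auto intro!: sum_mono scaled_max_ge act_between u e)
    finally show ?thesis .
  next
    case False
    have "\<sigma> * sigmoid_term c d \<Gamma> \<mu> \<epsilon> u $ i $ j = (\<sigma> * (d i j * max (u 0 $ j $ j) 0)) * act \<epsilon> i j u"
      using False by (simp add: sigmoid_term_def state_of_def act_def mult_ac)
    also have "\<dots> \<le> coupling_bound \<epsilon> u i j \<sigma>"
      unfolding coupling_bound_def using False by (auto intro!: scaled_max_ge act_between u e)
    finally show ?thesis .
  qed
  have "- coupling_bound \<epsilon> u i j (- 1) \<le> sigmoid_term c d \<Gamma> \<mu> \<epsilon> u $ i $ j" "sigmoid_term c d \<Gamma> \<mu> \<epsilon> u $ i $ j \<le> coupling_bound \<epsilon> u i j 1" for i j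
    using h[of "-1" i j] h[of 1 i j] by auto
  then show ?thesis using e by (subst inflated_term_iff[OF u]) auto
qed

text \<open>Semicontinuity of the envelopes in the pair (parameter, argument), stated as convergence of a
  majorant and of a minorant: at a point of continuity of the Heaviside function the envelopes
  converge, at the jump they are bounded by the limit anyway.\<close>

lemma chi_limit:
  assumes e: "\<And>k::nat. 0 \<le> \<epsilon> k \<and> \<epsilon> k \<le> 1/5" and lim: "\<epsilon> \<longlonglongrightarrow> 0" and x: "x \<longlonglongrightarrow> y"
  shows "(\<lambda>k. max (chi_up (\<epsilon> k) (x k)) (chi_up 0 y)) \<longlonglongrightarrow> chi_up 0 y"
    and "(\<lambda>k. min (chi_lo (\<epsilon> k) (x k)) (chi_lo 0 y)) \<longlonglongrightarrow> chi_lo 0 y"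
proof -
  have b: "(\<lambda>k. inflation_width (\<epsilon> k)) \<longlonglongrightarrow> 0" using inflation_width_tendsto_0[OF e lim] .
  have b0: "inflation_width 0 = 0" by (simp add: inflation_width_def)
  have bd: "0 \<le> chi_lo (\<epsilon> k) s" "chi_up (\<epsilon> k) s \<le> 1" for k s using chi_bounds[of "\<epsilon> k" s] e[of k] by auto
  show "(\<lambda>k. max (chi_up (\<epsilon> k) (x k)) (chi_up 0 y)) \<longlonglongrightarrow> chi_up 0 y"
  proof (cases "y < 0")
    case True
    have "(\<lambda>k. x k + inflation_width (\<epsilon> k)) \<longlonglongrightarrow> y + 0" by (intro tendsto_intros x b)
    then have "\<forall>\<^sub>F k in sequentially. x k + inflation_width (\<epsilon> k) < 0"
      using True by (auto dest: order_tendstoD(2))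
    \<comment> \<open>Left of the jump the argument eventually leaves the inflated zone.\<close>
    then have "\<forall>\<^sub>F k in sequentially. \<epsilon> k = max (chi_up (\<epsilon> k) (x k)) (chi_up 0 y)"
      by eventually_elim (use e True in \<open>auto simp: chi_up_def b0\<close>)
    then have "(\<lambda>k. max (chi_up (\<epsilon> k) (x k)) (chi_up 0 y)) \<longlonglongrightarrow> 0"
      by (rule Lim_transform_eventually[OF lim])
    then show ?thesis using True by (simp add: chi_up_def b0)
  next
    case False
    then have "max (chi_up (\<epsilon> k) (x k)) (chi_up 0 y) = chi_up 0 y" for k
      using bd[of k "x k"] by (auto simp: chi_up_def[of 0] b0)
    then show ?thesis by simp
  qed
  show "(\<lambda>k. min (chi_lo (\<epsilon> k) (x k)) (chi_lo 0 y)) \<longlonglongrightarrow> chi_lo 0 y"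
  proof (cases "y > 0")
    case True
    have "(\<lambda>k. x k - inflation_width (\<epsilon> k)) \<longlonglongrightarrow> y - 0" by (intro tendsto_intros x b)
    then have "\<forall>\<^sub>F k in sequentially. x k - inflation_width (\<epsilon> k) > 0"
      using True by (auto dest: order_tendstoD(1))
    then have "\<forall>\<^sub>F k in sequentially. 1 - \<epsilon> k = min (chi_lo (\<epsilon> k) (x k)) (chi_lo 0 y)"
      by eventually_elim (use e True in \<open>auto simp: chi_lo_def b0\<close>)
    moreover have "(\<lambda>k. 1 - \<epsilon> k) \<longlonglongrightarrow> 1 - 0" by (intro tendsto_intros lim)
    ultimately have "(\<lambda>k. min (chi_lo (\<epsilon> k) (x k)) (chi_lo 0 y)) \<longlonglongrightarrow> 1 - 0"
      using Lim_transform_eventually by fast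
    then show ?thesis using True by (simp add: chi_lo_def b0)
  next
    case False
    then have "min (chi_lo (\<epsilon> k) (x k)) (chi_lo 0 y) = chi_lo 0 y" for k
      using bd[of k "x k"] by (auto simp: chi_lo_def[of 0] b0)
    then show ?thesis by simp
  qed
qed

text \<open>Dominated convergence for the majorants and minorants of the envelopes.\<close>

lemma act_lo_up_limit:
  assumes ij: "i \<noteq> j" and e: "\<And>k::nat. 0 \<le> \<epsilon> k \<and> \<epsilon> k \<le> 1/5" "\<epsilon> \<longlonglongrightarrow> 0"
    and u: "\<And>k. continuous_on {..0} (u k)" and v: "continuous_on {..0} v"
    and lim: "\<And>\<tau>. \<tau> \<le> 0 \<Longrightarrow> (\<lambda>k. u k \<tau>) \<longlonglongrightarrow> v \<tau>"
  obtains l h where "l \<longlonglongrightarrow> act_lo 0 i j v" "h \<longlonglongrightarrow> act_up 0 i j v"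
    "\<forall>k. l k \<le> act_lo (\<epsilon> k) i j (u k)" "\<forall>k. act_up (\<epsilon> k) i j (u k) \<le> h k"
proof -
  interpret finite_measure "\<mu> i j" using measures(2)[OF ij] .
  define x where "x k \<tau> = xc (u k \<tau>) i - \<Gamma> i" for k \<tau>
  define y where "y \<tau> = xc (v \<tau>) i - \<Gamma> i" for \<tau>
  have xm [measurable]: "x k \<in> borel_measurable (\<mu> i j)" for k unfolding x_def by (rule x_measurable[OF ij u])
  have ym [measurable]: "y \<in> borel_measurable (\<mu> i j)" unfolding y_def by (rule x_measurable[OF ij v])
  have xy: "(\<lambda>k. x k \<tau>) \<longlonglongrightarrow> y \<tau>" if "\<tau> \<in> space (\<mu> i j)" for \<tau>
    unfolding x_def y_def using that space_mu[OF ij] by (intro tendsto_intros lim) auto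
  have bm: "\<bar>max (chi_up (\<epsilon> k) s) (chi_up 0 s')\<bar> \<le> 1" "\<bar>min (chi_lo (\<epsilon> k) s) (chi_lo 0 s')\<bar> \<le> 1" for k s s'
    using chi_bounds[of "\<epsilon> k" s] chi_bounds[of 0 s'] e(1)[of k] by auto
  define h where "h k = (LINT \<tau>|\<mu> i j. max (chi_up (\<epsilon> k) (x k \<tau>)) (chi_up 0 (y \<tau>)))" for k
  define l where "l k = (LINT \<tau>|\<mu> i j. min (chi_lo (\<epsilon> k) (x k \<tau>)) (chi_lo 0 (y \<tau>)))" for k
  have int: "integrable (\<mu> i j) (\<lambda>\<tau>. max (chi_up (\<epsilon> k) (x k \<tau>)) (chi_up 0 (y \<tau>)))"
    "integrable (\<mu> i j) (\<lambda>\<tau>. min (chi_lo (\<epsilon> k) (x k \<tau>)) (chi_lo 0 (y \<tau>)))" for k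
    using bm by (auto intro!: integrable_const_bound[of _ 1] AE_I2 simp del: max.bounded_iff)
  show ?thesis
  proof (rule that)
    show "h \<longlonglongrightarrow> act_up 0 i j v" unfolding h_def act_up_def y_def[symmetric]
      by (rule integral_dominated_convergence[where w="\<lambda>_. 1"])
         (use bm chi_limit(1)[OF e xy] in \<open>auto intro!: AE_I2\<close>)
    show "l \<longlonglongrightarrow> act_lo 0 i j v" unfolding l_def act_lo_def y_def[symmetric]
      by (rule integral_dominated_convergence[where w="\<lambda>_. 1"])
         (use bm chi_limit(2)[OF e xy] in \<open>auto intro!: AE_I2\<close>)
    have "l k \<le> act_lo (\<epsilon> k) i j (u k)" for k unfolding l_def act_lo_def x_def[symmetric]
      using int(2) chi_integrable(1)[OF ij u] e(1) unfolding x_def by (intro integral_mono) auto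
    then show "\<forall>k. l k \<le> act_lo (\<epsilon> k) i j (u k)" by blast
    have "act_up (\<epsilon> k) i j (u k) \<le> h k" for k unfolding h_def act_up_def x_def[symmetric]
      using int(1) chi_integrable(2)[OF ij u] e(1) unfolding x_def by (intro integral_mono) auto
    then show "\<forall>k. act_up (\<epsilon> k) i j (u k) \<le> h k" by blast
  qed
qed

text \<open>Upper semicontinuity is expressed by a convergent majorant, which is stable under sums and under
  \<open>scaled_max\<close> with convergent factors.\<close>

lemma coupling_bound_usc:
  assumes e: "\<And>k::nat. 0 \<le> \<epsilon> k \<and> \<epsilon> k \<le> 1/5" "\<epsilon> \<longlonglongrightarrow> 0"
    and u: "\<And>k. continuous_on {..0} (u k)" and v: "continuous_on {..0} v"
    and lim: "\<And>\<tau>. \<tau> \<le> 0 \<Longrightarrow> (\<lambda>k. u k \<tau>) \<longlonglongrightarrow> v \<tau>"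
  obtains s where "s \<longlonglongrightarrow> coupling_bound 0 v i j \<sigma>" "\<forall>k. coupling_bound (\<epsilon> k) (u k) i j \<sigma> \<le> s k"
proof -
  have u0: "(\<lambda>k. u k 0 $ p $ q) \<longlonglongrightarrow> v 0 $ p $ q" for p q by (intro tendsto_intros lim) auto
  have *: "\<exists>s. s \<longlonglongrightarrow> scaled_max b (act_lo 0 p q v) (act_up 0 p q v) \<and>
      (\<forall>k. scaled_max (a k) (act_lo (\<epsilon> k) p q (u k)) (act_up (\<epsilon> k) p q (u k)) \<le> s k)"
    if pq: "p \<noteq> q" and a: "a \<longlonglongrightarrow> b" for a b p q
  proof -
    obtain l h where lh: "l \<longlonglongrightarrow> act_lo 0 p q v" "h \<longlonglongrightarrow> act_up 0 p q v"
      "\<forall>k. l k \<le> act_lo (\<epsilon> k) p q (u k)" "\<forall>k. act_up (\<epsilon> k) p q (u k) \<le> h k"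
      by (rule act_lo_up_limit[OF pq e u v lim])
    have "(\<lambda>k. scaled_max (a k) (l k) (h k)) \<longlonglongrightarrow> scaled_max b (act_lo 0 p q v) (act_up 0 p q v)"
      unfolding scaled_max_def by (intro tendsto_max tendsto_mult a lh)
    moreover have "scaled_max (a k) (act_lo (\<epsilon> k) p q (u k)) (act_up (\<epsilon> k) p q (u k)) \<le> scaled_max (a k) (l k) (h k)" for k
      using e(1) lh(3,4) by (intro scaled_max_mono act_lo_le_act_up pq u) auto
    ultimately show ?thesis by blast
  qed
  show ?thesis
  proof (cases "i = j")
    case True
    have "\<exists>s. s \<longlonglongrightarrow> scaled_max (\<sigma> * (v 0 $ p $ i - c p i)) (act_lo 0 p i v) (act_up 0 p i v) \<and>
      (\<forall>k. scaled_max (\<sigma> * (u k 0 $ p $ i - c p i)) (act_lo (\<epsilon> k) p i (u k)) (act_up (\<epsilon> k) p i (u k)) \<le> s k)"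
      if "p \<in> UNIV - {i}" for p
      using that by (intro *) (auto intro!: tendsto_intros u0)
    then obtain s where s: "\<And>p. p \<in> UNIV - {i} \<Longrightarrow> s p \<longlonglongrightarrow> scaled_max (\<sigma> * (v 0 $ p $ i - c p i)) (act_lo 0 p i v) (act_up 0 p i v)"
      "\<And>p k. p \<in> UNIV - {i} \<Longrightarrow> scaled_max (\<sigma> * (u k 0 $ p $ i - c p i)) (act_lo (\<epsilon> k) p i (u k)) (act_up (\<epsilon> k) p i (u k)) \<le> s p k"
      by metis
    show ?thesis
    proof (rule that[of "\<lambda>k. \<Sum>p\<in>UNIV - {i}. s p k"])
      show "(\<lambda>k. \<Sum>p\<in>UNIV - {i}. s p k) \<longlonglongrightarrow> coupling_bound 0 v i j \<sigma>"
        unfolding coupling_bound_def using True s(1) by (auto intro!: tendsto_sum)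
      show "\<forall>k. coupling_bound (\<epsilon> k) (u k) i j \<sigma> \<le> (\<Sum>p\<in>UNIV - {i}. s p k)"
        unfolding coupling_bound_def using True s(2) by (auto intro!: sum_mono)
    qed
  next
    case False
    have "(\<lambda>k. \<sigma> * (d i j * max (u k 0 $ j $ j) 0)) \<longlonglongrightarrow> \<sigma> * (d i j * max (v 0 $ j $ j) 0)"
      by (intro tendsto_intros tendsto_max u0)
    from *[OF False this] show ?thesis using that False unfolding coupling_bound_def by auto
  qed
qed

end

section \<open>Limits of solutions of the inclusions\<close>

text \<open>If the derivative bounds \<open>g k\<close> were not uniformly bounded for large \<open>k\<close>, compactness of \<open>[s, t]\<close>
  would give a convergent sequence of points along which they tend to infinity.\<close>

lemma limit_upper_lipschitz:
  fixes f :: "nat \<Rightarrow> real \<Rightarrow> real"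
  assumes ac: "\<And>k. absolutely_continuous_on s t (f k)"
    and der: "\<And>k. AE q in lebesgue. s < q \<and> q < t \<longrightarrow> (\<exists>d\<le>g k q. (f k has_real_derivative d) (at q))"
    and lim: "\<And>q. q \<in> {s..t} \<Longrightarrow> (\<lambda>k. f k q) \<longlonglongrightarrow> F q"
    and bdd: "\<And>\<kappa> q q0. (\<And>n. n \<le> \<kappa> n) \<Longrightarrow> (\<And>n. q n \<in> {s..t}) \<Longrightarrow> q0 \<in> {s..t} \<Longrightarrow> q \<longlonglongrightarrow> q0 \<Longrightarrow> \<exists>G. \<forall>n. g (\<kappa> n) (q n) \<le> G"
  shows "\<exists>K. \<forall>q1 q2. s \<le> q1 \<longrightarrow> q1 \<le> q2 \<longrightarrow> q2 \<le> t \<longrightarrow> F q2 - F q1 \<le> K * (q2 - q1)"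
proof -
  have "\<exists>n. \<forall>k\<ge>n. \<forall>q\<in>{s..t}. g k q \<le> real n"
  proof (rule ccontr)
    assume "\<not> ?thesis"
    then have "\<forall>n. \<exists>k q. n \<le> k \<and> q \<in> {s..t} \<and> \<not> g k q \<le> real n" by blast
    then obtain \<kappa> q where *: "\<And>n. n \<le> \<kappa> n" "\<And>n. q n \<in> {s..t}" "\<And>n. \<not> g (\<kappa> n) (q n) \<le> real n" by metis
    obtain q0 r where r: "q0 \<in> {s..t}" "strict_mono (r :: nat \<Rightarrow> nat)" "(q \<circ> r) \<longlonglongrightarrow> q0"
      using compact_Icc[of s t] *(2) unfolding compact_def by metis
    have "\<exists>G. \<forall>n. g ((\<kappa> \<circ> r) n) ((q \<circ> r) n) \<le> G"
    proof (rule bdd[OF _ _ r(1,3)])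
      show "n \<le> (\<kappa> \<circ> r) n" for n using *(1)[of "r n"] seq_suble[OF r(2), of n] by simp
      show "(q \<circ> r) n \<in> {s..t}" for n using *(2)[of "r n"] by (simp only: comp_apply)
    qed
    then obtain G where G: "\<And>n. g (\<kappa> (r n)) (q (r n)) \<le> G" by auto
    obtain n :: nat where "G \<le> real n" using real_arch_simple by blast
    then have "g (\<kappa> (r n)) (q (r n)) \<le> real (r n)" using G[of n] seq_suble[OF r(2), of n] by simp
    then show False using *(3) by blast
  qed
  then obtain n where n: "\<And>k q. k \<ge> n \<Longrightarrow> q \<in> {s..t} \<Longrightarrow> g k q \<le> real n" by blast
  show ?thesis
  proof (intro exI[of _ "real n"] allI impI)
    fix q1 q2 assume q: "s \<le> q1" "q1 \<le> q2" "q2 \<le> t"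
    have "f k q2 - f k q1 \<le> real n * (q2 - q1)" if k: "k \<ge> n" for k
    proof (rule absolutely_continuous_derivative_le[OF absolutely_continuous_on_subset[OF ac q(1,3)] q(2)])
      show "AE x in lebesgue. q1 < x \<and> x < q2 \<longrightarrow> (\<exists>d\<le>real n. (f k has_real_derivative d) (at x))"
        using der[of k]
      proof (rule AE_mp, intro AE_I2 impI)
        fix x assume d: "s < x \<and> x < t \<longrightarrow> (\<exists>d\<le>g k x. (f k has_real_derivative d) (at x))" and x: "q1 < x \<and> x < q2"
        have "g k x \<le> real n" using q x by (intro n[OF k]) auto
        moreover obtain d where "d \<le> g k x" "(f k has_real_derivative d) (at x)"
          using d x q(1,3) by auto
        ultimately show "\<exists>d\<le>real n. (f k has_real_derivative d) (at x)" by (meson order_trans)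
      qed
    qed
    moreover have "(\<lambda>k. f k q2 - f k q1) \<longlonglongrightarrow> F q2 - F q1" using q by (intro tendsto_intros lim) auto
    ultimately show "F q2 - F q1 \<le> real n * (q2 - q1)"
      by (intro LIMSEQ_le_const2) blast+
  qed
qed

lemma derivative_le_if_increments_le:
  fixes F :: "real \<Rightarrow> real"
  assumes d: "(F has_real_derivative d) (at x)" and h: "h > 0"
    and le: "\<And>y. x < y \<Longrightarrow> y < x + h \<Longrightarrow> F y - F x \<le> C * (y - x)"
  shows "d \<le> C"
proof (rule ccontr)
  assume "\<not> d \<le> C"
  define e where "e = (d - C) / 2"
  have e: "e > 0" using \<open>\<not> d \<le> C\<close> by (simp add: e_def)
  have "(F has_derivative (\<lambda>h. h * d)) (at x)" using d by (simp add: has_field_derivative_def mult_commute_abs)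
  then have "\<forall>e>0. \<exists>r>0. \<forall>y\<in>UNIV. norm (y - x) < r \<longrightarrow> norm (F y - F x - (y - x) * d) \<le> e * norm (y - x)"
    unfolding has_derivative_within_alt by blast
  then obtain r where r: "r > 0" "\<And>y. norm (y - x) < r \<Longrightarrow> norm (F y - F x - (y - x) * d) \<le> e * norm (y - x)"
    using e by blast
  define y where "y = x + min h r / 2"
  have y: "x < y" "y < x + h" "norm (y - x) < r" using h r(1) by (auto simp: y_def)
  have "(d - e) * (y - x) \<le> F y - F x" using r(2)[OF y(3)] y by (auto simp: abs_le_iff algebra_simps)
  then have "(d - e) * (y - x) \<le> C * (y - x)" using le[OF y(1,2)] by simp
  then have "d - e \<le> C" using y by simp
  then show False using e by (simp add: e_def field_simps)
qed

lemma lipschitz_Icc_AE_differentiable: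
  fixes f :: "real \<Rightarrow> real"
  assumes L: "\<And>p q. s \<le> p \<Longrightarrow> p \<le> q \<Longrightarrow> q \<le> t \<Longrightarrow> \<bar>f q - f p\<bar> \<le> L * (q - p)" and st: "s \<le> t"
  shows "AE x in lebesgue. s < x \<and> x < t \<longrightarrow> (\<exists>d. (f has_real_derivative d) (at x))"
proof -
  define h where "h x = f (max s (min t x))" for x
  have "\<bar>L\<bar>-lipschitz_on UNIV h"
  proof (rule lipschitz_onI)
    have *: "\<bar>h q - h p\<bar> \<le> \<bar>L\<bar> * (q - p)" if "p \<le> q" for p q
    proof -
      have "max s (min t p) \<le> max s (min t q)" using that by auto
      then have "\<bar>h q - h p\<bar> \<le> L * (max s (min t q) - max s (min t p))"
        unfolding h_def using st by (intro L) auto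
      also have "\<dots> \<le> \<bar>L\<bar> * (max s (min t q) - max s (min t p))"
        using \<open>max s (min t p) \<le> max s (min t q)\<close> by (intro mult_right_mono) auto
      also have "\<dots> \<le> \<bar>L\<bar> * (q - p)" using that by (intro mult_left_mono) auto
      finally show ?thesis .
    qed
    show "dist (h x) (h y) \<le> \<bar>L\<bar> * dist x y" for x y
      using *[of x y] *[of y x] by (cases "x \<le> y") (auto simp: dist_real_def abs_minus_commute)
  qed simp
  then have "AE x in lborel. \<exists>d. (h has_real_derivative d) (at x)" by (rule lipschitz_AE_differentiable)
  then have "AE x in lebesgue. \<exists>d. (h has_real_derivative d) (at x)" by (rule AE_completion)
  then show ?thesis
  proof (rule AE_mp, intro AE_I2 impI)
    fix x assume "\<exists>d. (h has_real_derivative d) (at x)" and x: "s < x \<and> x < t"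
    then obtain d where "(h has_real_derivative d) (at x)" by blast
    then have "(f has_real_derivative d) (at x)"
      by (rule has_field_derivative_transform_within_open[where S="{s<..<t}"]) (use x in \<open>auto simp: h_def\<close>)
    then show "\<exists>d. (f has_real_derivative d) (at x)" by blast
  qed
qed

context neuron_network begin

text \<open>The largest value of \<open>\<sigma>\<close> times component \<open>(i, j)\<close> of the velocities that the inclusion allows at time
  \<open>q\<close> with history \<open>u\<close>.\<close>

definition rate_bound :: "real \<Rightarrow> real \<Rightarrow> (real \<Rightarrow> 'n state) \<Rightarrow> 'n \<Rightarrow> 'n \<Rightarrow> real \<Rightarrow> real" where
  "rate_bound \<epsilon> q u i j \<sigma> = \<sigma> * (decay_term A B u + input_term I q) $ i $ j + coupling_bound \<epsilon> u i j \<sigma>"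

definition velocity :: "real \<Rightarrow> real \<Rightarrow> (real \<Rightarrow> 'n state) \<Rightarrow> 'n state \<Rightarrow> bool" where
  "velocity \<epsilon> q u D \<longleftrightarrow> (\<forall>i j. D $ i $ j \<le> rate_bound \<epsilon> q u i j 1 \<and> - D $ i $ j \<le> rate_bound \<epsilon> q u i j (- 1))"

lemma velocity_iff:
  assumes u: "continuous_on {..0} u" and e: "0 \<le> \<epsilon>" "\<epsilon> \<le> 1/5"
  shows "velocity \<epsilon> q u (decay_term A B u + w + input_term I q) \<longleftrightarrow> w \<in> inflated_term c d \<Gamma> \<mu> \<epsilon> u"
proof -
  have "(decay_term A B u + w + input_term I q) $ i $ j \<le> rate_bound \<epsilon> q u i j 1 \<longleftrightarrow> w $ i $ j \<le> coupling_bound \<epsilon> u i j 1"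
    "- (decay_term A B u + w + input_term I q) $ i $ j \<le> rate_bound \<epsilon> q u i j (- 1) \<longleftrightarrow> - coupling_bound \<epsilon> u i j (- 1) \<le> w $ i $ j" for i j
    unfolding rate_bound_def by auto
  then show ?thesis unfolding velocity_def inflated_term_iff[OF assms] by blast
qed

lemma velocity_alt:
  assumes u: "continuous_on {..0} u" and e: "0 \<le> \<epsilon>" "\<epsilon> \<le> 1/5"
  shows "(\<exists>w\<in>inflated_term c d \<Gamma> \<mu> \<epsilon> u. (f has_vector_derivative (decay_term A B u + w + input_term I q)) (at q))
    \<longleftrightarrow> (\<exists>D. (f has_vector_derivative D) (at q) \<and> velocity \<epsilon> q u D)"
proof
  assume "\<exists>D. (f has_vector_derivative D) (at q) \<and> velocity \<epsilon> q u D"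
  then obtain D where D: "(f has_vector_derivative D) (at q)" "velocity \<epsilon> q u D" by blast
  define w where "w = D - decay_term A B u - input_term I q"
  have "D = decay_term A B u + w + input_term I q" by (simp add: w_def)
  then show "\<exists>w\<in>inflated_term c d \<Gamma> \<mu> \<epsilon> u. (f has_vector_derivative (decay_term A B u + w + input_term I q)) (at q)"
    using D velocity_iff[OF assms, of q w] by auto
qed (use velocity_iff[OF assms] in blast)

text \<open>The inclusion on a bounded interval, without an initial condition and with the velocity set in
  box form.\<close>

definition inclusion_path :: "real \<Rightarrow> real \<Rightarrow> real \<Rightarrow> (real \<Rightarrow> 'n state) \<Rightarrow> bool" where
  "inclusion_path \<epsilon> s t u \<longleftrightarrow> absolutely_continuous_on s t u \<and>
    (AE q in lebesgue. s < q \<and> q < t \<longrightarrow> (\<exists>D. (u has_vector_derivative D) (at q) \<and> velocity \<epsilon> q (history q u) D))"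

lemma A_isCont: "isCont (A i) x"
proof -
  obtain \<delta> L where "\<delta> > 0" "L-lipschitz_on (ball x \<delta>) (A i)"
    using Lipschitz(1) unfolding locally_Lipschitz_def by blast
  then show ?thesis
    by (meson centre_in_ball continuous_on_eq_continuous_at lipschitz_on_continuous_on open_ball)
qed

lemma B_isCont: assumes ij: "i \<noteq> j" shows "isCont (B i j) x"
proof -
  obtain \<delta> L where "\<delta> > 0" "L-lipschitz_on (ball x \<delta>) (B i j)"
    using Lipschitz(2)[OF ij] unfolding locally_Lipschitz_def by blast
  then show ?thesis
    by (meson centre_in_ball continuous_on_eq_continuous_at lipschitz_on_continuous_on open_ball)
qed

lemma rate_bound_usc:
  assumes e: "\<And>k::nat. 0 \<le> \<epsilon> k \<and> \<epsilon> k \<le> 1/5" "\<epsilon> \<longlonglongrightarrow> 0"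
    and u: "\<And>k. continuous_on {..0} (u k)" and v: "continuous_on {..0} v"
    and lim: "\<And>\<tau>. \<tau> \<le> 0 \<Longrightarrow> (\<lambda>k. u k \<tau>) \<longlonglongrightarrow> v \<tau>" and q: "q \<longlonglongrightarrow> q0"
  obtains S where "S \<longlonglongrightarrow> rate_bound 0 q0 v i j \<sigma>" "\<forall>k. rate_bound (\<epsilon> k) (q k) (u k) i j \<sigma> \<le> S k"
proof -
  obtain s where s: "s \<longlonglongrightarrow> coupling_bound 0 v i j \<sigma>" "\<forall>k. coupling_bound (\<epsilon> k) (u k) i j \<sigma> \<le> s k"
    by (rule coupling_bound_usc[OF e u v lim])
  have cI: "isCont (I i) x" for i x using I by (simp add: continuous_on_eq_continuous_at)
  have u0: "(\<lambda>k. u k 0 $ p $ q) \<longlonglongrightarrow> v 0 $ p $ q" for p q by (intro tendsto_intros lim) auto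
  have "(\<lambda>k. (decay_term A B (u k) + input_term I (q k)) $ i $ j) \<longlonglongrightarrow> (decay_term A B v + input_term I q0) $ i $ j"
  proof (cases "i = j")
    case True
    have "(\<lambda>k. - A i (u k 0 $ i $ i) * u k 0 $ i $ i + I i (q k)) \<longlonglongrightarrow> - A i (v 0 $ i $ i) * v 0 $ i $ i + I i q0"
      by (intro tendsto_intros isCont_tendsto_compose[OF A_isCont] isCont_tendsto_compose[OF cI] u0 q)
    then show ?thesis using True by (simp add: decay_term_def input_term_def state_of_def)
  next
    case False
    have "(\<lambda>k. - B i j (u k 0 $ i $ j) * u k 0 $ i $ j) \<longlonglongrightarrow> - B i j (v 0 $ i $ j) * v 0 $ i $ j"
      by (intro tendsto_intros isCont_tendsto_compose[OF B_isCont[OF False]] u0)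
    then show ?thesis using False by (simp add: decay_term_def input_term_def state_of_def)
  qed
  from tendsto_add[OF tendsto_mult[OF tendsto_const this] s(1)]
  have "(\<lambda>k. \<sigma> * (decay_term A B (u k) + input_term I (q k)) $ i $ j + s k) \<longlonglongrightarrow> rate_bound 0 q0 v i j \<sigma>"
    unfolding rate_bound_def .
  then show ?thesis by (rule that) (use s(2) in \<open>simp add: rate_bound_def\<close>)
qed

text \<open>A limit of solutions of the inclusions with parameters tending to \<open>0\<close> is a solution of the Heaviside
  inclusion.  Each component of \<open>u k\<close>, with either sign, obeys a one-sided differential inequality whose
  bound is upper semicontinuous.  Boundedness of these bounds makes the limit Lipschitz, hence almost
  everywhere differentiable, and the localized inequality bounds its derivative by the limiting bound.
  The mode of convergence \<open>conv\<close> is continuous convergence, up to time \<open>t\<close> and on the whole past.\<close>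

lemma inclusion_path_closure:
  assumes e: "\<And>k::nat. 0 \<le> \<epsilon> k \<and> \<epsilon> k \<le> 1/5" "\<epsilon> \<longlonglongrightarrow> 0" and st: "s \<le> t"
    and u: "\<And>k. continuous_on {..t} (u k)" and v: "continuous_on {..t} v"
    and paths: "\<And>k. inclusion_path (\<epsilon> k) s t (u k)"
    and conv: "\<And>\<kappa> p p0. (\<And>n. n \<le> \<kappa> n) \<Longrightarrow> (\<And>n. p n \<le> t) \<Longrightarrow> p \<longlonglongrightarrow> p0 \<Longrightarrow> (\<lambda>n. u (\<kappa> n) (p n)) \<longlonglongrightarrow> v p0"
  shows "\<exists>L. \<forall>p q. s \<le> p \<longrightarrow> p \<le> q \<longrightarrow> q \<le> t \<longrightarrow> norm (v q - v p) \<le> L * (q - p)"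
    and "inclusion_path 0 s t v"
proof -
  define g where "g i j \<sigma> k q = rate_bound (\<epsilon> k) q (history q (u k)) i j \<sigma>" for i j \<sigma> k q
  have usc: "\<exists>S. S \<longlonglongrightarrow> rate_bound 0 q0 (history q0 v) i j \<sigma> \<and> (\<forall>n. g i j \<sigma> (\<kappa> n) (q n) \<le> S n)"
    if *: "\<And>n. n \<le> \<kappa> n" "\<And>n. q n \<in> {s..t}" "q0 \<in> {s..t}" "q \<longlonglongrightarrow> q0" for i j \<sigma> \<kappa> q q0
  proof -
    have k: "filterlim \<kappa> sequentially sequentially"
      unfolding filterlim_at_top eventually_sequentially using *(1) order_trans by blast
    have 1: "0 \<le> \<epsilon> (\<kappa> n) \<and> \<epsilon> (\<kappa> n) \<le> 1/5" for n by (rule e(1))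
    have 2: "(\<lambda>n. \<epsilon> (\<kappa> n)) \<longlonglongrightarrow> 0" using filterlim_compose[OF e(2) k] .
    have 3: "continuous_on {..0} (history (q n) (u (\<kappa> n)))" for n using history_continuous[OF u] *(2)[of n] by simp
    have 4: "continuous_on {..0} (history q0 v)" using history_continuous[OF v] *(3) by simp
    have 5: "(\<lambda>n. history (q n) (u (\<kappa> n)) \<tau>) \<longlonglongrightarrow> history q0 v \<tau>" if \<tau>: "\<tau> \<le> 0" for \<tau>
    proof -
      have "(\<lambda>n. u (\<kappa> n) (q n + \<tau>)) \<longlonglongrightarrow> v (q0 + \<tau>)"
      proof (rule conv[OF *(1)])
        show "q n + \<tau> \<le> t" for n using *(2)[of n] \<tau> by simp
      qed (intro tendsto_intros *)
      then show ?thesis using \<tau> by (simp add: history_apply)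
    qed
    show ?thesis unfolding g_def
      by (rule rate_bound_usc[OF 1 2 3 4 5 *(4), where i=i and j=j and \<sigma>=\<sigma>]) blast+
  qed
  have uv: "(\<lambda>k. u k q) \<longlonglongrightarrow> v q" if "q \<le> t" for q using conv[of id "\<lambda>_. q" q] that by simp
  have ac: "absolutely_continuous_on s t (\<lambda>q. \<sigma> * u k q $ i $ j)" if "\<bar>\<sigma>\<bar> = 1" for k i j \<sigma>
  proof (rule absolutely_continuous_on_mono_norm)
    show "absolutely_continuous_on s t (u k)" using paths[of k] by (simp add: inclusion_path_def)
    show "norm (\<sigma> * u k q $ i $ j - \<sigma> * u k p $ i $ j) \<le> norm (u k q - u k p)" for p q
    proof -
      have "norm (\<sigma> * u k q $ i $ j - \<sigma> * u k p $ i $ j) = \<bar>\<sigma>\<bar> * \<bar>(u k q - u k p) $ i $ j\<bar>"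
        by (simp flip: abs_mult right_diff_distrib)
      then show ?thesis using that state_component_le_norm[of "u k q - u k p" i j] by simp
    qed
  qed
  have der: "AE q in lebesgue. s < q \<and> q < t \<longrightarrow> (\<exists>d\<le>g i j \<sigma> k q. ((\<lambda>q. \<sigma> * u k q $ i $ j) has_real_derivative d) (at q))"
    if \<sigma>: "\<sigma> = 1 \<or> \<sigma> = - 1" for k i j \<sigma>
  proof -
    have "AE q in lebesgue. s < q \<and> q < t \<longrightarrow> (\<exists>D. (u k has_vector_derivative D) (at q) \<and> velocity (\<epsilon> k) q (history q (u k)) D)"
      using paths[of k] by (simp add: inclusion_path_def)
    then show ?thesis
    proof (rule AE_mp, intro AE_I2 impI)
      fix q assume "s < q \<and> q < t \<longrightarrow> (\<exists>D. (u k has_vector_derivative D) (at q) \<and> velocity (\<epsilon> k) q (history q (u k)) D)"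
        "s < q \<and> q < t"
      then obtain D where D: "(u k has_vector_derivative D) (at q)" "velocity (\<epsilon> k) q (history q (u k)) D" by blast
      have "((\<lambda>q. u k q $ i $ j) has_real_derivative D $ i $ j) (at q)"
        using D(1) unfolding has_vector_derivative_state_iff by blast
      then have "((\<lambda>q. \<sigma> * u k q $ i $ j) has_real_derivative \<sigma> * D $ i $ j) (at q)" by (rule DERIV_cmult)
      moreover have "\<sigma> * D $ i $ j \<le> g i j \<sigma> k q" using D(2) \<sigma> unfolding velocity_def g_def by auto
      ultimately show "\<exists>d\<le>g i j \<sigma> k q. ((\<lambda>q. \<sigma> * u k q $ i $ j) has_real_derivative d) (at q)" by blast
    qed
  qed
  have lim: "(\<lambda>k. \<sigma> * u k q $ i $ j) \<longlonglongrightarrow> \<sigma> * v q $ i $ j" if "q \<in> {s..t}" for q i j \<sigma>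
    using uv[of q] that by (intro tendsto_intros) auto
  have ub: "\<exists>K. \<forall>q1 q2. s \<le> q1 \<longrightarrow> q1 \<le> q2 \<longrightarrow> q2 \<le> t \<longrightarrow> \<sigma> * v q2 $ i $ j - \<sigma> * v q1 $ i $ j \<le> K * (q2 - q1)"
    if \<sigma>: "\<sigma> = 1 \<or> \<sigma> = - 1" for i j \<sigma>
  proof (rule limit_upper_lipschitz[where f="\<lambda>k q. \<sigma> * u k q $ i $ j" and g="g i j \<sigma>"])
    show "absolutely_continuous_on s t (\<lambda>q. \<sigma> * u k q $ i $ j)" for k using \<sigma> by (intro ac) auto
    show "AE q in lebesgue. s < q \<and> q < t \<longrightarrow> (\<exists>d\<le>g i j \<sigma> k q. ((\<lambda>q. \<sigma> * u k q $ i $ j) has_real_derivative d) (at q))" for k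
      by (rule der[OF \<sigma>])
    show "\<exists>G. \<forall>n. g i j \<sigma> (\<kappa> n) (q n) \<le> G"
      if *: "\<And>n. n \<le> \<kappa> n" "\<And>n. q n \<in> {s..t}" "q0 \<in> {s..t}" "q \<longlonglongrightarrow> q0" for \<kappa> q q0
    proof -
      obtain S where S: "S \<longlonglongrightarrow> rate_bound 0 q0 (history q0 v) i j \<sigma>" "\<forall>n. g i j \<sigma> (\<kappa> n) (q n) \<le> S n"
        using usc[OF *] by blast
      obtain G where "\<And>n. \<bar>S n\<bar> \<le> G" using convergent_imp_Bseq[of S] S(1) unfolding convergent_def Bseq_def by auto
      then have "g i j \<sigma> (\<kappa> n) (q n) \<le> G" for n using S(2) by (meson abs_le_iff order_trans)
      then show ?thesis by blast
    qed
  qed (rule lim)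
  have "\<exists>K. \<forall>q1 q2. s \<le> q1 \<longrightarrow> q1 \<le> q2 \<longrightarrow> q2 \<le> t \<longrightarrow> \<bar>v q2 $ i $ j - v q1 $ i $ j\<bar> \<le> K * (q2 - q1)" for i j
  proof -
    obtain K1 where K1: "\<And>q1 q2. s \<le> q1 \<Longrightarrow> q1 \<le> q2 \<Longrightarrow> q2 \<le> t \<Longrightarrow> 1 * v q2 $ i $ j - 1 * v q1 $ i $ j \<le> K1 * (q2 - q1)"
      using ub[of 1 i j] by blast
    obtain K2 where K2: "\<And>q1 q2. s \<le> q1 \<Longrightarrow> q1 \<le> q2 \<Longrightarrow> q2 \<le> t \<Longrightarrow> - 1 * v q2 $ i $ j - - 1 * v q1 $ i $ j \<le> K2 * (q2 - q1)"
      using ub[of "-1" i j] by blast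
    have "\<bar>v q2 $ i $ j - v q1 $ i $ j\<bar> \<le> max K1 K2 * (q2 - q1)" if q: "s \<le> q1" "q1 \<le> q2" "q2 \<le> t" for q1 q2
    proof -
      have "K1 * (q2 - q1) \<le> max K1 K2 * (q2 - q1)" "K2 * (q2 - q1) \<le> max K1 K2 * (q2 - q1)"
        using q by (auto intro: mult_right_mono)
      then show ?thesis using K1[OF q] K2[OF q] by linarith
    qed
    then show ?thesis by blast
  qed
  then obtain K where Kabs: "\<And>i j q1 q2. s \<le> q1 \<Longrightarrow> q1 \<le> q2 \<Longrightarrow> q2 \<le> t \<Longrightarrow>
      \<bar>v q2 $ i $ j - v q1 $ i $ j\<bar> \<le> K i j * (q2 - q1)" by metis
  have Lip: "norm (v q - v p) \<le> (\<Sum>i\<in>UNIV. \<Sum>j\<in>UNIV. K i j) * (q - p)" if "s \<le> p" "p \<le> q" "q \<le> t" for p q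
  proof -
    have "norm (v q - v p) \<le> (\<Sum>i\<in>UNIV. \<Sum>j\<in>UNIV. \<bar>(v q - v p) $ i $ j\<bar>)" by (rule norm_state_le_sum)
    also have "\<dots> \<le> (\<Sum>i\<in>UNIV. \<Sum>j\<in>UNIV. K i j * (q - p))" using Kabs that by (intro sum_mono) auto
    finally show ?thesis by (simp add: sum_distrib_right)
  qed
  then show "\<exists>L. \<forall>p q. s \<le> p \<longrightarrow> p \<le> q \<longrightarrow> q \<le> t \<longrightarrow> norm (v q - v p) \<le> L * (q - p)" by blast
  show "inclusion_path 0 s t v"
    unfolding inclusion_path_def
  proof
    show "absolutely_continuous_on s t v" using Lip by (rule lipschitz_imp_absolutely_continuous_on)
    have "AE q in lebesgue. s < q \<and> q < t \<longrightarrow> (\<exists>d. ((\<lambda>q. v q $ i $ j) has_real_derivative d) (at q))" for i j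
      by (rule lipschitz_Icc_AE_differentiable[OF Kabs st])
    then have "AE q in lebesgue. \<forall>i\<in>UNIV. \<forall>j\<in>UNIV. s < q \<and> q < t \<longrightarrow> (\<exists>d. ((\<lambda>q. v q $ i $ j) has_real_derivative d) (at q))"
      by (intro AE_finite_allI finite)
    then show "AE q in lebesgue. s < q \<and> q < t \<longrightarrow> (\<exists>D. (v has_vector_derivative D) (at q) \<and> velocity 0 q (history q v) D)"
    proof (rule AE_mp, intro AE_I2 impI)
      fix q0 assume "\<forall>i\<in>UNIV. \<forall>j\<in>UNIV. s < q0 \<and> q0 < t \<longrightarrow> (\<exists>d. ((\<lambda>q. v q $ i $ j) has_real_derivative d) (at q0))"
        and q0: "s < q0 \<and> q0 < t"
      then obtain d where d: "\<And>i j. ((\<lambda>q. v q $ i $ j) has_real_derivative d i j) (at q0)" by (metis UNIV_I)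
      define D where "D = (\<chi> i j. d i j)"
      have "(v has_vector_derivative D) (at q0)"
        unfolding has_vector_derivative_state_iff D_def using d by simp
      moreover have "\<sigma> * D $ i $ j \<le> rate_bound 0 q0 (history q0 v) i j \<sigma>" if \<sigma>: "\<sigma> = 1 \<or> \<sigma> = - 1" for i j \<sigma>
      proof (rule field_le_epsilon)
        fix e :: real assume e: "e > 0"
        define G where "G = rate_bound 0 q0 (history q0 v) i j \<sigma>"
        have "\<exists>h>0. \<forall>q1 q2. s \<le> q1 \<longrightarrow> q1 \<le> q2 \<longrightarrow> q2 \<le> t \<longrightarrow> \<bar>q1 - q0\<bar> < h \<longrightarrow> \<bar>q2 - q0\<bar> < h \<longrightarrow>
            \<sigma> * v q2 $ i $ j - \<sigma> * v q1 $ i $ j \<le> (G + e) * (q2 - q1)"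
        proof (rule limit_differential_inequality[where f="\<lambda>k q. \<sigma> * u k q $ i $ j" and g="g i j \<sigma>"])
          show "absolutely_continuous_on s t (\<lambda>q. \<sigma> * u k q $ i $ j)" for k using \<sigma> by (intro ac) auto
          show "AE q in lebesgue. s < q \<and> q < t \<longrightarrow> (\<exists>d\<le>g i j \<sigma> k q. ((\<lambda>q. \<sigma> * u k q $ i $ j) has_real_derivative d) (at q))" for k
            by (rule der[OF \<sigma>])
          show "\<exists>n. g i j \<sigma> (\<kappa> n) (q n) \<le> G + e"
            if *: "\<And>n. n \<le> \<kappa> n" "\<And>n. q n \<in> {s..t}" "q \<longlonglongrightarrow> q0" for \<kappa> q
          proof -
            obtain S where S: "S \<longlonglongrightarrow> G" "\<forall>n. g i j \<sigma> (\<kappa> n) (q n) \<le> S n"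
              using usc[OF *(1,2) _ *(3), where i=i and j=j and \<sigma>=\<sigma>] q0 unfolding G_def by auto
            have "\<forall>\<^sub>F n in sequentially. S n < G + e" using order_tendstoD(2)[OF S(1), of "G + e"] e by simp
            then obtain n where "S n < G + e" unfolding eventually_sequentially by blast
            then show ?thesis using S(2) by (intro exI[of _ n]) (meson less_imp_le order_trans)
          qed
        qed (rule lim)
        then obtain h where h: "h > 0" "\<And>q1 q2. s \<le> q1 \<Longrightarrow> q1 \<le> q2 \<Longrightarrow> q2 \<le> t \<Longrightarrow> \<bar>q1 - q0\<bar> < h \<Longrightarrow> \<bar>q2 - q0\<bar> < h \<Longrightarrow>
            \<sigma> * v q2 $ i $ j - \<sigma> * v q1 $ i $ j \<le> (G + e) * (q2 - q1)" by blast
        have "\<sigma> * D $ i $ j \<le> G + e"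
        proof (rule derivative_le_if_increments_le[where x=q0 and h="min h (t - q0)"])
          show "((\<lambda>q. \<sigma> * v q $ i $ j) has_real_derivative \<sigma> * D $ i $ j) (at q0)"
            using DERIV_cmult[OF d[of i j], of \<sigma>] by (simp add: D_def)
        qed (use h q0 in auto)
        then show "\<sigma> * D $ i $ j \<le> rate_bound 0 q0 (history q0 v) i j \<sigma> + e" by (simp add: G_def)
      qed
      from this[of 1] this[of "-1"] have "velocity 0 q0 (history q0 v) D" unfolding velocity_def by simp
      ultimately show "\<exists>D. (v has_vector_derivative D) (at q0) \<and> velocity 0 q0 (history q0 v) D" by blast
    qed
  qed
qed

end

section \<open>Solutions of the inclusions\<close>

lemma continuous_Icc_abs_bounded:
  fixes f :: "real \<Rightarrow> real"
  assumes "continuous_on {a..b} f"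
  obtains M where "\<And>x. x \<in> {a..b} \<Longrightarrow> \<bar>f x\<bar> \<le> M"
proof -
  have "bounded (f ` {a..b})" by (intro compact_imp_bounded compact_continuous_image assms) simp
  then obtain M where "\<forall>y\<in>f ` {a..b}. norm y \<le> M" unfolding bounded_iff by blast
  then show ?thesis by (intro that) auto
qed

lemma uniform_limit_diagonal:
  fixes f :: "nat \<Rightarrow> 'a::metric_space \<Rightarrow> 'b::metric_space"
  assumes ul: "uniform_limit S f w sequentially" and w: "continuous_on S w"
    and \<kappa>: "\<And>n. n \<le> \<kappa> n" and p: "\<And>n. p n \<in> S" "p \<longlonglongrightarrow> p0" "p0 \<in> S"
  shows "(\<lambda>n. f (\<kappa> n) (p n)) \<longlonglongrightarrow> w p0"
proof (rule tendstoI)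
  fix e :: real assume e: "e > 0"
  have "\<forall>\<^sub>F n in sequentially. \<forall>x\<in>S. dist (f n x) (w x) < e / 2"
    using uniform_limitD[OF ul, of "e / 2"] e by simp
  then obtain N where N: "\<And>n x. n \<ge> N \<Longrightarrow> x \<in> S \<Longrightarrow> dist (f n x) (w x) < e / 2"
    unfolding eventually_sequentially by blast
  have "(\<lambda>n. w (p n)) \<longlonglongrightarrow> w p0"
    by (rule continuous_on_tendsto_compose[OF w p(2,3)]) (simp add: p)
  then have "\<forall>\<^sub>F n in sequentially. dist (w (p n)) (w p0) < e / 2" using e by (intro tendstoD) auto
  then show "\<forall>\<^sub>F n in sequentially. dist (f (\<kappa> n) (p n)) (w p0) < e"
    using eventually_ge_at_top[of N]
  proof eventually_elim
    case (elim n)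
    have "dist (f (\<kappa> n) (p n)) (w (p n)) < e / 2" using N \<kappa>[of n] elim(2) p(1) order_trans by blast
    then show ?case using elim(1) dist_triangle[of "f (\<kappa> n) (p n)" "w p0" "w (p n)"] by simp
  qed
qed

lemma history_eq_iff:
  assumes "u0 \<in> extensional {..0}"
  shows "history s u = u0 \<longleftrightarrow> (\<forall>\<tau>\<le>s. u \<tau> = u0 (\<tau> - s))"
proof
  assume *: "\<forall>\<tau>\<le>s. u \<tau> = u0 (\<tau> - s)"
  show "history s u = u0"
    by (rule extensionalityI[OF _ assms]) (use * in \<open>auto simp: history_def\<close>)
qed (auto simp: history_def)

context neuron_network begin

text \<open>The constant does not depend on \<open>\<epsilon>\<close>, because the activities are bounded by the masses.\<close>

lemma rhs_bound:
  obtains K where "\<And>\<epsilon> t u. t \<in> {t0..T} \<Longrightarrow> norm (u 0) \<le> R \<Longrightarrow> norm (rhs \<epsilon> t u) \<le> K"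
proof -
  have "\<exists>K. \<forall>\<epsilon> t u. t \<in> {t0..T} \<longrightarrow> norm (u 0) \<le> R \<longrightarrow> \<bar>rhs \<epsilon> t u $ i $ j\<bar> \<le> K" for i j
  proof (cases "i = j")
    case True
    obtain a where a: "\<And>x. x \<in> {-R..R} \<Longrightarrow> \<bar>A i x\<bar> \<le> a"
      by (rule continuous_Icc_abs_bounded[of "-R" R "A i"]) (auto intro: continuous_at_imp_continuous_on A_isCont)
    obtain b where b: "\<And>x. x \<in> {t0..T} \<Longrightarrow> \<bar>I i x\<bar> \<le> b"
      using continuous_Icc_abs_bounded[of t0 T "I i"] continuous_on_subset[OF I] by blast
    have "\<bar>rhs \<epsilon> t u $ i $ j\<bar> \<le> a * R + (\<Sum>k\<in>UNIV - {i}. (R + \<bar>c k i\<bar>) * mass k i) + b"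
      if t: "t \<in> {t0..T}" and u: "norm (u 0) \<le> R" for \<epsilon> t u
    proof -
      have c: "\<bar>u 0 $ p $ q\<bar> \<le> R" for p q using state_component_le_norm[of "u 0" p q] u by simp
      have "\<bar>- A i (u 0 $ i $ i) * u 0 $ i $ i\<bar> \<le> a * R"
        unfolding abs_mult abs_minus by (rule mult_mono') (use a[of "u 0 $ i $ i"] c[of i i] in \<open>auto simp: abs_le_iff\<close>)
      moreover have "\<bar>\<Sum>k\<in>UNIV - {i}. (u 0 $ k $ i - c k i) * act \<epsilon> k i u\<bar> \<le> (\<Sum>k\<in>UNIV - {i}. (R + \<bar>c k i\<bar>) * mass k i)"
      proof (rule order_trans[OF sum_abs], rule sum_mono)
        fix k assume "k \<in> UNIV - {i}"
        then have "\<bar>act \<epsilon> k i u\<bar> \<le> mass k i" using act_bounds[of k i \<epsilon> u] by auto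
        moreover have "\<bar>u 0 $ k $ i - c k i\<bar> \<le> R + \<bar>c k i\<bar>" using c[of k i] by linarith
        ultimately show "\<bar>(u 0 $ k $ i - c k i) * act \<epsilon> k i u\<bar> \<le> (R + \<bar>c k i\<bar>) * mass k i"
          unfolding abs_mult by (intro mult_mono') auto
      qed
      moreover have "\<bar>x + y + z\<bar> \<le> X + Y + Z" if "\<bar>x\<bar> \<le> X" "\<bar>y\<bar> \<le> Y" "\<bar>z\<bar> \<le> Z" for x y z X Y Z :: real
        using that by linarith
      ultimately show ?thesis using b[OF t] unfolding True[symmetric] rhs_diag by blast
    qed
    then show ?thesis by blast
  next
    case False
    obtain a where a: "\<And>x. x \<in> {-R..R} \<Longrightarrow> \<bar>B i j x\<bar> \<le> a"
      by (rule continuous_Icc_abs_bounded[of "-R" R "B i j"]) (auto intro: continuous_at_imp_continuous_on B_isCont[OF False])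
    have "\<bar>rhs \<epsilon> t u $ i $ j\<bar> \<le> a * R + \<bar>d i j\<bar> * mass i j * R"
      if t: "t \<in> {t0..T}" and u: "norm (u 0) \<le> R" for \<epsilon> t u
    proof -
      have c: "\<bar>u 0 $ p $ q\<bar> \<le> R" for p q using state_component_le_norm[of "u 0" p q] u by simp
      have "\<bar>- B i j (u 0 $ i $ j) * u 0 $ i $ j\<bar> \<le> a * R"
        unfolding abs_mult abs_minus by (rule mult_mono') (use a[of "u 0 $ i $ j"] c[of i j] in \<open>auto simp: abs_le_iff\<close>)
      moreover have "\<bar>d i j * act \<epsilon> i j u * max (u 0 $ j $ j) 0\<bar> \<le> \<bar>d i j\<bar> * mass i j * R"
        unfolding abs_mult using act_bounds[OF False, of \<epsilon> u] c[of j j] by (intro mult_mono') (auto simp: mass_nonneg)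
      ultimately show ?thesis unfolding rhs_offdiag[OF False] by linarith
    qed
    then show ?thesis by blast
  qed
  then obtain K where K: "\<And>i j \<epsilon> t u. t \<in> {t0..T} \<Longrightarrow> norm (u 0) \<le> R \<Longrightarrow> \<bar>rhs \<epsilon> t u $ i $ j\<bar> \<le> K i j" by metis
  have "norm (rhs \<epsilon> t u) \<le> (\<Sum>i\<in>UNIV. \<Sum>j\<in>UNIV. K i j)" if "t \<in> {t0..T}" "norm (u 0) \<le> R" for \<epsilon> t u
  proof -
    have "\<bar>rhs \<epsilon> t u $ i $ j\<bar> \<le> K i j" for i j using K that by blast
    then show ?thesis using norm_state_le_sum[of "rhs \<epsilon> t u"] by (meson order_trans sum_mono)
  qed
  then show ?thesis by (rule that)
qed

abbreviation inclusion_solution :: "real \<Rightarrow> real \<Rightarrow> (real \<Rightarrow> 'n state) \<Rightarrow> (real \<Rightarrow> 'n state) \<Rightarrow> bool" where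
  "inclusion_solution \<epsilon> \<equiv> inflated_solution A B I c d \<Gamma> \<mu> \<epsilon>"

abbreviation inflated_flow :: "real \<Rightarrow> real \<Rightarrow> real \<Rightarrow> (real \<Rightarrow> 'n state) \<Rightarrow> (real \<Rightarrow> 'n state) set" where
  "inflated_flow \<epsilon> \<equiv> inflated_process A B I c d \<Gamma> \<mu> \<epsilon>"

lemma absolutely_continuous_extension_continuous:
  assumes u0: "u0 \<in> phase_space \<gamma>" and h: "history s u = u0" and ac: "absolutely_continuous_on s t u" and st: "s \<le> t"
  shows "continuous_on {..t} u"
proof -
  have e: "u \<tau> = u0 (\<tau> - s)" if "\<tau> \<le> s" for \<tau>
    using fun_cong[OF h, of "\<tau> - s"] that by (simp add: history_apply)
  have c0: "continuous_on {..0} u0" using u0 by (simp add: phase_space_def)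
  have "continuous_on {..s} (\<lambda>\<tau>. u0 (\<tau> - s))"
    by (rule continuous_on_compose2[OF c0]) (auto intro!: continuous_intros)
  then have 1: "continuous_on {..s} u" by (rule continuous_on_eq) (simp add: e)
  have "continuous_on ({..s} \<union> {s..t}) u"
    by (rule continuous_on_closed_Un[OF _ _ 1 absolutely_continuous_on_imp_continuous_on[OF ac]]) auto
  also have "{..s} \<union> {s..t} = {..t}" using st by auto
  finally show ?thesis .
qed

lemma inclusion_path_continuous:
  assumes "u0 \<in> phase_space \<gamma>" "history s u = u0" "inclusion_path \<epsilon> s t u" "s \<le> t"
  shows "continuous_on {..t} u"
  by (rule absolutely_continuous_extension_continuous[OF assms(1,2) _ assms(4)]) (use assms(3) in \<open>simp add: inclusion_path_def\<close>)

lemma inclusion_path_subinterval: "inclusion_path \<epsilon> s t u \<Longrightarrow> s \<le> s' \<Longrightarrow> t' \<le> t \<Longrightarrow> inclusion_path \<epsilon> s' t' u"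
  unfolding inclusion_path_def by (auto intro: absolutely_continuous_on_subset elim!: eventually_mono)

lemma inclusion_path_cong:
  assumes p: "inclusion_path \<epsilon> s t u" and eq: "\<And>\<tau>. \<tau> \<le> t \<Longrightarrow> u \<tau> = v \<tau>"
  shows "inclusion_path \<epsilon> s t v"
  unfolding inclusion_path_def
proof
  have "absolutely_continuous_on s t u" using p by (simp add: inclusion_path_def)
  then show "absolutely_continuous_on s t v"
    by (rule absolutely_continuous_on_mono_norm) (simp add: eq)
  have "AE q in lebesgue. s < q \<and> q < t \<longrightarrow> (\<exists>D. (u has_vector_derivative D) (at q) \<and> velocity \<epsilon> q (history q u) D)"
    using p by (simp add: inclusion_path_def)
  then show "AE q in lebesgue. s < q \<and> q < t \<longrightarrow> (\<exists>D. (v has_vector_derivative D) (at q) \<and> velocity \<epsilon> q (history q v) D)"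
  proof (rule AE_mp, intro AE_I2 impI)
    fix q assume "s < q \<and> q < t \<longrightarrow> (\<exists>D. (u has_vector_derivative D) (at q) \<and> velocity \<epsilon> q (history q u) D)"
      and q: "s < q \<and> q < t"
    then obtain D where D: "(u has_vector_derivative D) (at q)" "velocity \<epsilon> q (history q u) D" by blast
    have "(v has_vector_derivative D) (at q)"
      by (rule has_vector_derivative_transform_within_open[OF D(1), of "{s<..<t}"]) (use q eq in auto)
    moreover have "history q u = history q v" using q eq by (intro history_cong) auto
    ultimately show "\<exists>D. (v has_vector_derivative D) (at q) \<and> velocity \<epsilon> q (history q v) D" using D(2) by auto
  qed
qed

lemma inclusion_path_mono:
  assumes p: "inclusion_path \<epsilon> s t u" and u: "continuous_on {..t} u" and e: "0 \<le> \<epsilon>" "\<epsilon> \<le> \<delta>" "\<delta> \<le> 1/5"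
  shows "inclusion_path \<delta> s t u"
proof -
  have v: "velocity \<delta> q (history q u) D" if "q < t" "velocity \<epsilon> q (history q u) D" for q D
  proof -
    have h: "coupling_bound \<epsilon> (history q u) i j \<sigma> \<le> coupling_bound \<delta> (history q u) i j \<sigma>" for i j \<sigma>
      using history_continuous[OF u] that(1) by (intro coupling_bound_mono e) auto
    have "rate_bound \<epsilon> q (history q u) i j \<sigma> \<le> rate_bound \<delta> q (history q u) i j \<sigma>" for i j \<sigma>
      unfolding rate_bound_def using h by simp
    then show ?thesis using that(2) unfolding velocity_def by (meson order_trans)
  qed
  show ?thesis using p unfolding inclusion_path_def by (auto elim!: eventually_mono dest: v)
qed

text \<open>A global solution is a path on every bounded interval: countably many of the intervals
  \<open>[s, s + n]\<close> suffice, and the endpoint \<open>s\<close> is a null set.\<close>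

lemma inflated_solution_iff:
  assumes u0: "u0 \<in> phase_space \<gamma>" and e: "0 \<le> \<epsilon>" "\<epsilon> \<le> 1/5"
  shows "inclusion_solution \<epsilon> s u0 u \<longleftrightarrow> history s u = u0 \<and> (\<forall>t\<ge>s. inclusion_path \<epsilon> s t u)"
proof
  assume u: "inclusion_solution \<epsilon> s u0 u"
  then have h: "history s u = u0" and ac: "\<And>t. s \<le> t \<Longrightarrow> absolutely_continuous_on s t u"
    by (auto simp: inflated_solution_def)
  have "inclusion_path \<epsilon> s t u" if t: "s \<le> t" for t
    unfolding inclusion_path_def
  proof
    have cont: "continuous_on {..t} u"
      by (rule absolutely_continuous_extension_continuous[OF u0 h ac[OF t] t])
    show "absolutely_continuous_on s t u" using ac t .
    have "AE q in lebesgue. q \<ge> s \<longrightarrow> (\<exists>w\<in>inflated_term c d \<Gamma> \<mu> \<epsilon> (history q u).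
        (u has_vector_derivative (decay_term A B (history q u) + w + input_term I q)) (at q))"
      using u by (simp add: inflated_solution_def)
    then show "AE q in lebesgue. s < q \<and> q < t \<longrightarrow> (\<exists>D. (u has_vector_derivative D) (at q) \<and> velocity \<epsilon> q (history q u) D)"
    proof (rule AE_mp, intro AE_I2 impI)
      fix q assume *: "q \<ge> s \<longrightarrow> (\<exists>w\<in>inflated_term c d \<Gamma> \<mu> \<epsilon> (history q u).
        (u has_vector_derivative (decay_term A B (history q u) + w + input_term I q)) (at q))" and q: "s < q \<and> q < t"
      have "continuous_on {..0} (history q u)" using history_continuous[OF cont] q by simp
      from velocity_alt[OF this e] show "\<exists>D. (u has_vector_derivative D) (at q) \<and> velocity \<epsilon> q (history q u) D"
        using * q by auto
    qed
  qed
  then show "history s u = u0 \<and> (\<forall>t\<ge>s. inclusion_path \<epsilon> s t u)" using h by blast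
next
  assume u: "history s u = u0 \<and> (\<forall>t\<ge>s. inclusion_path \<epsilon> s t u)"
  have cont: "continuous_on {..t} u" if "s \<le> t" for t
    using inclusion_path_continuous[OF u0] u that by blast
  have "AE q in lebesgue. s < q \<and> q < s + real n \<longrightarrow> (\<exists>D. (u has_vector_derivative D) (at q) \<and> velocity \<epsilon> q (history q u) D)" for n
  proof -
    have "inclusion_path \<epsilon> s (s + real n) u" using u by simp
    then show ?thesis by (simp add: inclusion_path_def)
  qed
  then have "AE q in lebesgue. \<forall>n. s < q \<and> q < s + real n \<longrightarrow> (\<exists>D. (u has_vector_derivative D) (at q) \<and> velocity \<epsilon> q (history q u) D)"
    unfolding AE_all_countable by blast
  moreover have "AE q in lebesgue. q \<noteq> s" by (rule AE_completion[OF AE_lborel_singleton])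
  ultimately have "AE q in lebesgue. q \<ge> s \<longrightarrow> (\<exists>w\<in>inflated_term c d \<Gamma> \<mu> \<epsilon> (history q u).
      (u has_vector_derivative (decay_term A B (history q u) + w + input_term I q)) (at q))"
  proof eventually_elim
    case (elim q)
    show ?case
    proof
      assume q: "s \<le> q"
      obtain n where "q - s < real n" using reals_Archimedean2 by blast
      then have "\<exists>D. (u has_vector_derivative D) (at q) \<and> velocity \<epsilon> q (history q u) D"
        using elim(1)[rule_format, of n] elim(2) q by auto
      moreover have "continuous_on {..0} (history q u)" using history_continuous[OF cont[OF q]] by simp
      ultimately show "\<exists>w\<in>inflated_term c d \<Gamma> \<mu> \<epsilon> (history q u).
          (u has_vector_derivative (decay_term A B (history q u) + w + input_term I q)) (at q)"
        using velocity_alt[OF _ e] by blast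
    qed
  qed
  then show "inclusion_solution \<epsilon> s u0 u" using u by (simp add: inflated_solution_def inclusion_path_def)
qed

lemma solution_on_inclusion_path:
  assumes u0: "continuous_on {..0} u0" and e: "0 < \<epsilon>" "\<epsilon> \<le> 1/5" and u: "solution_on \<epsilon> s t u0 u" and st: "s \<le> t"
  shows "inclusion_path \<epsilon> s t u"
  unfolding inclusion_path_def
proof
  show "absolutely_continuous_on s t u" by (rule solution_on_absolutely_continuous[OF u0 e(1) u st])
  have "\<exists>D. (u has_vector_derivative D) (at q) \<and> velocity \<epsilon> q (history q u) D" if q: "s < q" "q < t" for q
  proof -
    have cont: "continuous_on {..0} (history q u)"
      using history_continuous[OF solution_on_continuous[OF u0 u st]] q by simp
    have "(u has_vector_derivative rhs \<epsilon> q (history q u)) (at q within {s..t})" using u q by (simp add: solution_on_def)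
    then have "(u has_vector_derivative rhs \<epsilon> q (history q u)) (at q)" using at_within_Icc_at[OF q] by simp
    moreover have "velocity \<epsilon> q (history q u) (rhs \<epsilon> q (history q u))"
      unfolding rhs_def using velocity_iff[OF cont, of \<epsilon> q] sigmoid_term_inflated[OF cont e] e by simp
    ultimately show ?thesis by blast
  qed
  then show "AE q in lebesgue. s < q \<and> q < t \<longrightarrow> (\<exists>D. (u has_vector_derivative D) (at q) \<and> velocity \<epsilon> q (history q u) D)"
    by simp
qed

text \<open>The closure lemma applied to a constant sequence improves absolute continuity to Lipschitz
  continuity.\<close>

lemma Heaviside_path_lipschitz:
  assumes u: "continuous_on {..t} u" and p: "inclusion_path 0 s t u" and st: "s \<le> t"
  obtains L where "\<And>p q. s \<le> p \<Longrightarrow> p \<le> q \<Longrightarrow> q \<le> t \<Longrightarrow> norm (u q - u p) \<le> L * (q - p)"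
proof -
  have "\<exists>L. \<forall>p q. s \<le> p \<longrightarrow> p \<le> q \<longrightarrow> q \<le> t \<longrightarrow> norm (u q - u p) \<le> L * (q - p)"
  proof (rule inclusion_path_closure(1)[where \<epsilon>="\<lambda>_. 0" and u="\<lambda>_. u"])
    fix \<kappa> :: "nat \<Rightarrow> nat" and p p0 assume "\<And>n. p n \<le> t" and p: "p \<longlonglongrightarrow> p0"
    then have "p0 \<le> t" using LIMSEQ_le_const2 by blast
    then show "(\<lambda>n. u (p n)) \<longlonglongrightarrow> u p0"
      by (intro continuous_on_tendsto_compose[OF u p]) (simp_all add: \<open>\<And>n. p n \<le> t\<close>)
  qed (use assms in auto)
  then show ?thesis using that by blast
qed

text \<open>Lipschitz constants, unlike the moduli in the definition of absolute continuity, pass to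
  concatenations at once.\<close>

lemma Heaviside_path_join:
  assumes u: "continuous_on {..t} u" and p: "inclusion_path 0 r s u" "inclusion_path 0 s t u" and st: "r \<le> s" "s \<le> t"
  shows "inclusion_path 0 r t u"
  unfolding inclusion_path_def
proof
  have us: "continuous_on {..s} u" by (rule continuous_on_subset[OF u]) (use st in auto)
  obtain L1 where L1: "\<And>p q. r \<le> p \<Longrightarrow> p \<le> q \<Longrightarrow> q \<le> s \<Longrightarrow> norm (u q - u p) \<le> L1 * (q - p)"
    by (rule Heaviside_path_lipschitz[OF us p(1) st(1)]) blast
  obtain L2 where L2: "\<And>p q. s \<le> p \<Longrightarrow> p \<le> q \<Longrightarrow> q \<le> t \<Longrightarrow> norm (u q - u p) \<le> L2 * (q - p)"
    by (rule Heaviside_path_lipschitz[OF u p(2) st(2)]) blast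
  define L where "L = max L1 L2"
  have L: "L1 * h \<le> L * h" "L2 * h \<le> L * h" if "h \<ge> 0" for h
    using that by (auto simp: L_def intro: mult_right_mono)
  show "absolutely_continuous_on r t u"
  proof (rule lipschitz_imp_absolutely_continuous_on)
    fix p q assume pq: "r \<le> p" "p \<le> q" "q \<le> t"
    consider "q \<le> s" | "s \<le> p" | "p \<le> s" "s \<le> q" by linarith
    then show "norm (u q - u p) \<le> L * (q - p)"
    proof cases
      case 1
      then show ?thesis using L1[of p q] L(1)[of "q - p"] pq by simp
    next
      case 2
      then show ?thesis using L2[of p q] L(2)[of "q - p"] pq by simp
    next
      case 3
      have "norm (u q - u p) \<le> norm (u s - u p) + norm (u q - u s)"
        using norm_triangle_ineq[of "u s - u p" "u q - u s"] by simp
      also have "\<dots> \<le> L * (s - p) + L * (q - s)"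
        using L1[of p s] L2[of s q] L(1)[of "s - p"] L(2)[of "q - s"] pq 3 by simp
      finally show ?thesis by (simp add: algebra_simps)
    qed
  qed
  have "AE q in lebesgue. r < q \<and> q < s \<longrightarrow> (\<exists>D. (u has_vector_derivative D) (at q) \<and> velocity 0 q (history q u) D)"
    "AE q in lebesgue. s < q \<and> q < t \<longrightarrow> (\<exists>D. (u has_vector_derivative D) (at q) \<and> velocity 0 q (history q u) D)"
    using p by (simp_all add: inclusion_path_def)
  moreover have "AE q in lebesgue. q \<noteq> s" by (rule AE_completion[OF AE_lborel_singleton])
  ultimately show "AE q in lebesgue. r < q \<and> q < t \<longrightarrow> (\<exists>D. (u has_vector_derivative D) (at q) \<and> velocity 0 q (history q u) D)"
    by eventually_elim (auto simp: linorder_neq_iff)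
qed

lemma Heaviside_glue:
  assumes ph: "history s v \<in> phase_space \<gamma>" and st: "s \<le> t" and p: "inclusion_path 0 s t v"
    and w: "inclusion_solution 0 t (history t v) w"
  shows "inclusion_solution 0 s (history s v) w" and "history t w = history t v"
proof -
  have v: "continuous_on {..t} v" by (rule inclusion_path_continuous[OF ph refl p st])
  have vt: "history t v \<in> phase_space \<gamma>"
    by (rule history_phase_space[OF ph _ v st]) (simp add: history_def)
  have w': "history t w = history t v" "\<And>T. T \<ge> t \<Longrightarrow> inclusion_path 0 t T w"
    using w inflated_solution_iff[OF vt, of 0] by auto
  have eq: "v \<tau> = w \<tau>" if "\<tau> \<le> t" for \<tau>
    using fun_cong[OF w'(1), of "\<tau> - t"] that by (simp add: history_apply)
  have hs: "history s w = history s v" using eq st by (intro history_cong) auto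
  have pst: "inclusion_path 0 s t w" by (rule inclusion_path_cong[OF p eq])
  have "inclusion_path 0 s T w" if T: "T \<ge> s" for T
  proof (cases "T \<le> t")
    case True
    show ?thesis by (rule inclusion_path_subinterval[OF pst order_refl True])
  next
    case False
    have "continuous_on {..T} w" using inclusion_path_continuous[OF vt w'(1) w'(2)[of T]] False by simp
    then show ?thesis using False pst w'(2)[of T] st by (intro Heaviside_path_join[of T w s t]) auto
  qed
  then show "inclusion_solution 0 s (history s v) w" using hs inflated_solution_iff[OF ph, of 0] by auto
  show "history t w = history t v" by fact
qed

end

section \<open>Convergence of the attractors\<close>

context neuron_network begin

text \<open>By the a priori bound the states lie in one ball for all \<open>\<epsilon>\<close>, and there the velocities are
  uniformly bounded.\<close>

lemma solution_on_equilipschitz: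
  obtains R K where "\<And>\<epsilon> u t. solution_on \<epsilon> t0 T u0 u \<Longrightarrow> t \<in> {t0..T} \<Longrightarrow> norm (u t) \<le> R"
    and "\<And>\<epsilon> u p q. solution_on \<epsilon> t0 T u0 u \<Longrightarrow> p \<in> {t0..T} \<Longrightarrow> q \<in> {t0..T} \<Longrightarrow> norm (u p - u q) \<le> K * norm (p - q)"
proof -
  obtain C where C: "\<And>\<epsilon> u0 u t. solution_on \<epsilon> t0 T u0 u \<Longrightarrow> t \<in> {t0..T} \<Longrightarrow> norm (u t) \<le> (1 + (norm (u0 0))\<^sup>2) * C"
    by (rule solution_on_bound[of t0 T]) blast
  define R where "R = (1 + (norm (u0 0))\<^sup>2) * C"
  have R: "norm (u t) \<le> R" if "solution_on \<epsilon> t0 T u0 u" "t \<in> {t0..T}" for \<epsilon> u t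
    unfolding R_def using C that by blast
  obtain K where K: "\<And>\<epsilon> t u. t \<in> {t0..T} \<Longrightarrow> norm (u 0) \<le> R \<Longrightarrow> norm (rhs \<epsilon> t u) \<le> K"
    by (rule rhs_bound[of t0 T R]) blast
  have "norm (u p - u q) \<le> K * norm (p - q)"
    if u: "solution_on \<epsilon> t0 T u0 u" and pq: "p \<in> {t0..T}" "q \<in> {t0..T}" for \<epsilon> u p q
  proof (rule differentiable_bound[of "{t0..T}" u "\<lambda>s h. h *\<^sub>R rhs \<epsilon> s (history s u)"])
    show "(u has_derivative (\<lambda>h. h *\<^sub>R rhs \<epsilon> s (history s u))) (at s within {t0..T})" if "s \<in> {t0..T}" for s
      using u that by (simp add: solution_on_def has_vector_derivative_def)
    show "onorm (\<lambda>h. h *\<^sub>R rhs \<epsilon> s (history s u)) \<le> K" if s: "s \<in> {t0..T}" for s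
    proof (rule onorm_bound)
      have M: "norm (rhs \<epsilon> s (history s u)) \<le> K" using K[OF s, of "history s u"] R[OF u s] by simp
      then show "0 \<le> K" using norm_ge_zero order_trans by blast
      show "norm (h *\<^sub>R rhs \<epsilon> s (history s u)) \<le> K * norm h" for h
        using mult_right_mono[OF M, of "\<bar>h\<bar>"] by (simp add: mult.commute)
    qed
  qed (use pq in auto)
  with R show ?thesis by (rule that)
qed

text \<open>Sigmoidal solutions with \<open>\<epsilon>\<^sub>k = 1 / (k + 5)\<close> and the given initial history are equi-Lipschitz on
  bounded intervals.  The Arzela--Ascoli theorem and a diagonal argument give a subsequence that
  converges locally uniformly, and its limit solves the Heaviside inclusion.\<close>

lemma Heaviside_solution_exists:
  assumes x: "x \<in> phase_space \<gamma>"
  obtains u where "inclusion_solution 0 s x u"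
proof -
  define \<epsilon> where "\<epsilon> k = 1 / (real k + 5)" for k
  have e: "0 < \<epsilon> k" "\<epsilon> k \<le> 1/5" for k by (auto simp: \<epsilon>_def field_simps)
  have e0: "\<epsilon> \<longlonglongrightarrow> 0" unfolding \<epsilon>_def by real_asymp
  have x0: "continuous_on {..0} x" using x by (simp add: phase_space_def)
  have "\<exists>v. \<forall>T\<ge>s. solution_on (\<epsilon> k) s T x v" for k
    using sigmoid_solution_exists1[OF x e(1), of k s] sigmoid_solution_iff_phase[OF x] by auto
  then obtain v where v: "\<And>k T. s \<le> T \<Longrightarrow> solution_on (\<epsilon> k) s T x (v k)" by metis
  have pre: "v k \<tau> = x (\<tau> - s)" if "\<tau> \<le> s" for k \<tau> using v[OF order_refl, of k] that by (simp add: solution_on_def)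
  \<comment> \<open>The diagonal argument runs over subsequences \<open>r\<close> of indices; \<open>P n r\<close> is uniform convergence on \<open>[s, s + n]\<close>.\<close>
  define P where "P n r \<longleftrightarrow> (\<exists>g. uniform_limit {s..s + real n} (\<lambda>k. v (r k)) g sequentially)" for n and r :: "nat \<Rightarrow> nat"
  have P1: "\<exists>k. strict_mono k \<and> P n (r \<circ> k)" for n and r :: "nat \<Rightarrow> nat"
  proof -
    have T: "s \<le> s + real n" by simp
    obtain R K where R: "\<And>\<epsilon> u t. solution_on \<epsilon> s (s + real n) x u \<Longrightarrow> t \<in> {s..s + real n} \<Longrightarrow> norm (u t) \<le> R"
      and K: "\<And>\<epsilon> u p q. solution_on \<epsilon> s (s + real n) x u \<Longrightarrow> p \<in> {s..s + real n} \<Longrightarrow> q \<in> {s..s + real n} \<Longrightarrow> norm (u p - u q) \<le> K * norm (p - q)"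
      by (rule solution_on_equilipschitz[of s "s + real n" x]) blast
    have eq: "\<exists>d. 0 < d \<and> (\<forall>m y. y \<in> {s..s + real n} \<and> norm (p - y) < d \<longrightarrow> norm (v (r m) p - v (r m) y) < \<eta>)"
      if p: "p \<in> {s..s + real n}" and \<eta>: "0 < \<eta>" for p \<eta>
    proof (intro exI[of _ "\<eta> / (\<bar>K\<bar> + 1)"] conjI allI impI)
      show "0 < \<eta> / (\<bar>K\<bar> + 1)" using \<eta> by simp
      fix m y assume y: "y \<in> {s..s + real n} \<and> norm (p - y) < \<eta> / (\<bar>K\<bar> + 1)"
      have "norm (v (r m) p - v (r m) y) \<le> K * norm (p - y)" using K[OF v[OF T] p] y by blast
      also have "\<dots> \<le> (\<bar>K\<bar> + 1) * norm (p - y)" by (intro mult_right_mono) auto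
      also have "\<dots> < \<eta>" using y by (simp add: field_simps)
      finally show "norm (v (r m) p - v (r m) y) < \<eta>" .
    qed
    have R': "norm (v (r m) p) \<le> R" if "p \<in> {s..s + real n}" for m p using R[OF v[OF T] that] .
    obtain g k where gk: "strict_mono (k :: nat \<Rightarrow> nat)"
      "\<And>\<eta>. 0 < \<eta> \<Longrightarrow> \<exists>N. \<forall>m p. m \<ge> N \<and> p \<in> {s..s + real n} \<longrightarrow> norm (v (r (k m)) p - g p) < \<eta>"
      by (rule Arzela_Ascoli[of "{s..s + real n}" "\<lambda>m. v (r m)" R, OF compact_Icc R' eq]) blast+
    have "uniform_limit {s..s + real n} (\<lambda>m. v ((r \<circ> k) m)) g sequentially"
      unfolding uniform_limit_iff eventually_sequentially dist_norm comp_def using gk(2) by blast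
    then show ?thesis using gk(1) unfolding P_def by blast
  qed
  have P2: "P n (r \<circ> k2)" if P: "P n (r \<circ> k1)" and sub: "\<And>j. N \<le> j \<Longrightarrow> \<exists>j'. j \<le> j' \<and> k2 j = k1 j'"
    for n and r :: "nat \<Rightarrow> nat" and k1 k2 N
  proof -
    obtain g where g: "uniform_limit {s..s + real n} (\<lambda>m. v ((r \<circ> k1) m)) g sequentially"
      using P unfolding P_def by blast
    have "uniform_limit {s..s + real n} (\<lambda>m. v ((r \<circ> k2) m)) g sequentially"
    proof (rule uniform_limitI)
      fix \<eta> :: real assume "\<eta> > 0"
      then obtain M where M: "\<And>m. m \<ge> M \<Longrightarrow> \<forall>p\<in>{s..s + real n}. dist (v ((r \<circ> k1) m) p) (g p) < \<eta>"
        using uniform_limitD[OF g] unfolding eventually_sequentially by blast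
      have "\<forall>p\<in>{s..s + real n}. dist (v ((r \<circ> k2) m) p) (g p) < \<eta>" if m: "m \<ge> max M N" for m
      proof -
        obtain j' where "m \<le> j'" "k2 m = k1 j'" using sub[of m] m by auto
        then show ?thesis using M[of j'] m by simp
      qed
      then show "\<forall>\<^sub>F m in sequentially. \<forall>p\<in>{s..s + real n}. dist (v ((r \<circ> k2) m) p) (g p) < \<eta>"
        unfolding eventually_sequentially by blast
    qed
    then show ?thesis unfolding P_def by blast
  qed
  obtain k :: "nat \<Rightarrow> nat" where k: "strict_mono k" "\<And>n. P n (id \<circ> k)"
    by (rule subsequence_diagonalization_lemma[of P id, OF P1 P2]) blast+
  define w where "w \<tau> = lim (\<lambda>m. v (k m) \<tau>)" for \<tau>
  have wpre: "w \<tau> = x (\<tau> - s)" if "\<tau> \<le> s" for \<tau>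
    unfolding w_def using pre[OF that] by simp
  have ul: "uniform_limit {..s + real n} (\<lambda>m. v (k m)) w sequentially" for n
  proof -
    obtain g where g: "uniform_limit {s..s + real n} (\<lambda>m. v (k m)) g sequentially"
      using k(2)[of n] unfolding P_def by auto
    have "w \<tau> = g \<tau>" if "\<tau> \<in> {s..s + real n}" for \<tau>
      unfolding w_def using tendsto_uniform_limitI[OF g that] by (rule limI)
    then have ev: "\<forall>\<^sub>F m in sequentially. \<forall>\<tau>\<in>{s..s + real n}. dist (v (k m) \<tau>) (w \<tau>) < \<eta>" if "\<eta> > 0" for \<eta>
      using uniform_limitD[OF g that] by (auto elim!: eventually_mono)
    show ?thesis
    proof (rule uniform_limitI)
      fix \<eta> :: real assume \<eta>: "\<eta> > 0"
      show "\<forall>\<^sub>F m in sequentially. \<forall>\<tau>\<in>{..s + real n}. dist (v (k m) \<tau>) (w \<tau>) < \<eta>"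
        using ev[OF \<eta>]
      proof eventually_elim
        case (elim m)
        show ?case
        proof
          fix \<tau> assume \<tau>: "\<tau> \<in> {..s + real n}"
          show "dist (v (k m) \<tau>) (w \<tau>) < \<eta>"
          proof (cases "\<tau> \<le> s")
            case True
            then show ?thesis using pre[OF True] wpre[OF True] \<eta> by simp
          next
            case False
            then show ?thesis using elim \<tau> by simp
          qed
        qed
      qed
    qed
  qed
  have vc: "continuous_on {..T} (v j)" if "s \<le> T" for j T using solution_on_continuous[OF x0 v[OF that] that] .
  have wc: "continuous_on {..s + real n} w" for n
    by (rule uniform_limit_theorem[OF _ ul]) (auto intro!: always_eventually vc)
  have "inclusion_path 0 s T w" if T: "s \<le> T" for T
  proof -
    obtain n where n: "T - s < real n" using reals_Archimedean2 by blast
    have lim: "(\<lambda>m. v (k (\<kappa> m)) (p m)) \<longlonglongrightarrow> w p0"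
      if \<kappa>: "\<And>m. m \<le> \<kappa> m" and p: "\<And>m. p m \<le> T" "p \<longlonglongrightarrow> p0" for \<kappa> p p0
    proof (rule uniform_limit_diagonal[OF ul[of n] wc \<kappa>])
      have "p0 \<le> T" using p LIMSEQ_le_const2 by blast
      then show "p0 \<in> {..s + real n}" using n by simp
      show "p m \<in> {..s + real n}" for m using p(1)[of m] n by simp
    qed (rule p)
    show ?thesis
    proof (rule inclusion_path_closure(2)[where \<epsilon>="\<lambda>m. \<epsilon> (k m)" and u="\<lambda>m. v (k m)"])
      show "0 \<le> \<epsilon> (k m) \<and> \<epsilon> (k m) \<le> 1/5" for m using e[of "k m"] by simp
      show "(\<lambda>m. \<epsilon> (k m)) \<longlonglongrightarrow> 0" using LIMSEQ_subseq_LIMSEQ[OF e0 k(1)] by (simp add: comp_def)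
      show "continuous_on {..T} (v (k m))" for m using vc[OF T] .
      show "continuous_on {..T} w" by (rule continuous_on_subset[OF wc[of n]]) (use n in auto)
      show "inclusion_path (\<epsilon> (k m)) s T (v (k m))" for m using solution_on_inclusion_path[OF x0 e v[OF T] T] .
    qed (use T lim in auto)
  qed
  moreover have "history s w = x"
    using x wpre history_eq_iff[of x s w] by (auto simp: phase_space_def)
  ultimately show ?thesis using that[of w] inflated_solution_iff[OF x, of 0 s w] by simp
qed

text \<open>As in the single-valued case, the final histories carry the whole past of the solutions, so the
  limit \<open>b\<close> determines a path up to time \<open>t\<close>.  Membership in the process asks for a solution on the
  whole half-line, whence the continuation beyond \<open>t\<close>.\<close>

lemma Heaviside_limit:
  assumes e: "\<And>k::nat. 0 \<le> \<epsilon> k \<and> \<epsilon> k \<le> 1/5" "\<epsilon> \<longlonglongrightarrow> 0" and st: "s \<le> t"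
    and lim: "phase_limit \<gamma> x a" "phase_limit \<gamma> y b" and x: "\<And>k. x k \<in> phase_space \<gamma>"
    and u: "\<And>k. \<exists>u. history s u = x k \<and> history t u = y k \<and> inclusion_path (\<epsilon> k) s t u"
  shows "b \<in> inflated_flow 0 t s a"
proof -
  obtain u where u: "\<And>k. history s (u k) = x k" "\<And>k. history t (u k) = y k" "\<And>k. inclusion_path (\<epsilon> k) s t (u k)"
    using u by metis
  have a: "a \<in> phase_space \<gamma>" and b: "b \<in> phase_space \<gamma>" using lim unfolding phase_limit_iff by auto
  have b0: "continuous_on {..0} b" "b \<in> extensional {..0}" using b by (auto simp: phase_space_def)
  define v where "v \<tau> = b (\<tau> - t)" for \<tau>
  have uy: "u k \<tau> = y k (\<tau> - t)" if "\<tau> \<le> t" for k \<tau>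
    using fun_cong[OF u(2)[of k], of "\<tau> - t"] that by (simp add: history_apply)
  have conv: "(\<lambda>n. u (\<kappa> n) (p n)) \<longlonglongrightarrow> v p0" if \<kappa>: "\<And>n. n \<le> \<kappa> n" and p: "\<And>n. p n \<le> t" "p \<longlonglongrightarrow> p0" for \<kappa> p p0
  proof -
    have "(\<lambda>n. y (\<kappa> n) (p n - t)) \<longlonglongrightarrow> b (p0 - t)"
      by (rule phase_limit_diagonal[OF lim(2) gamma_pos \<kappa>]) (use p in \<open>auto intro!: tendsto_intros\<close>)
    then show ?thesis using uy[OF p(1)] by (simp add: v_def)
  qed
  have v: "inclusion_path 0 s t v"
  proof (rule inclusion_path_closure(2)[OF e st])
    show "continuous_on {..t} (u k)" for k by (rule inclusion_path_continuous[OF x u(1,3) st])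
    show "continuous_on {..t} v"
      unfolding v_def by (rule continuous_on_compose2[OF b0(1)]) (auto intro!: continuous_intros)
  qed (use u conv in auto)
  have "v \<tau> = a (\<tau> - s)" if \<tau>: "\<tau> \<le> s" for \<tau>
  proof (rule LIMSEQ_unique)
    show "(\<lambda>n. u n \<tau>) \<longlonglongrightarrow> v \<tau>" using conv[of id "\<lambda>_. \<tau>" \<tau>] \<tau> st by simp
    have "u n \<tau> = x n (\<tau> - s)" for n
      using fun_cong[OF u(1)[of n], of "\<tau> - s"] \<tau> by (simp add: history_apply)
    then show "(\<lambda>n. u n \<tau>) \<longlonglongrightarrow> a (\<tau> - s)" using phase_limit_pointwise[OF lim(1), of "\<tau> - s"] \<tau> by simp
  qed
  then have hs: "history s v = a" using a history_eq_iff[of a s v] by (auto simp: phase_space_def)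
  have ht: "history t v = b" using b0(2) history_eq_iff[of b t v] by (simp add: v_def)
  obtain w where "inclusion_solution 0 t b w" by (rule Heaviside_solution_exists[OF b])
  then have "inclusion_solution 0 s a w" "history t w = b"
    using Heaviside_glue[of s v t w] a st v hs ht by auto
  then show ?thesis unfolding inflated_process_def by blast
qed

lemma inflated_process_path:
  assumes x: "x \<in> phase_space \<gamma>" and e: "0 \<le> \<epsilon>" "\<epsilon> \<le> 1/5" and st: "s \<le> t" and y: "y \<in> inflated_flow \<epsilon> t s x"
  shows "\<exists>u. history s u = x \<and> history t u = y \<and> inclusion_path \<epsilon> s t u"
  using y inflated_solution_iff[OF x e] st unfolding inflated_process_def by auto

lemma sigmoid_solution_path:
  assumes x: "x \<in> phase_space \<gamma>" and e: "0 < \<epsilon>" "\<epsilon> \<le> 1/5" and u: "sigmoid_solution A B I c d \<Gamma> \<mu> \<epsilon> s x u" and st: "s \<le> t"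
  shows "inclusion_path \<epsilon> s t u"
proof -
  have "solution_on \<epsilon> s t x u" using u st sigmoid_solution_iff_phase[OF x] by blast
  then show ?thesis using x by (intro solution_on_inclusion_path[OF _ e _ st]) (auto simp: phase_space_def)
qed

lemma sigmoid_process_path:
  assumes x: "x \<in> phase_space \<gamma>" and e: "0 < \<epsilon>" "\<epsilon> \<le> 1/5" and y: "y \<in> sigmoid_flow \<epsilon> t s x"
  obtains u where "history s u = x" "history t u = y" "\<And>T. s \<le> T \<Longrightarrow> inclusion_path \<epsilon> s T u"
proof -
  obtain u where u: "sigmoid_solution A B I c d \<Gamma> \<mu> \<epsilon> s x u"
    using sigmoid_solution_exists1[OF x e(1)] by blast
  have "history s u = x" using u by (simp add: sigmoid_solution_def)
  moreover have "history t u = y" using y sigmoid_flow_eq[OF x e(1) u] by simp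
  ultimately show ?thesis by (rule that) (rule sigmoid_solution_path[OF x e u])
qed

lemma Heaviside_cocycle: "cocycle_on \<gamma> (inflated_flow 0)"
  unfolding cocycle_on_def
proof (intro ballI allI impI conjI)
  fix x :: "real \<Rightarrow> 'n state" and s r t :: real
  assume x: "x \<in> phase_space \<gamma>" and sr: "s \<le> r" and rt: "r \<le> t"
  have iff: "inclusion_solution 0 s x u \<longleftrightarrow> history s u = x \<and> (\<forall>t\<ge>s. inclusion_path 0 s t u)" for u
    by (rule inflated_solution_iff[OF x]) auto
  have ph: "history r u \<in> phase_space \<gamma>" if "inclusion_solution 0 s x u" for u
  proof -
    have h: "history s u = x" "inclusion_path 0 s r u" using that sr iff by auto
    have "u \<tau> = x (\<tau> - s)" if "\<tau> \<le> s" for \<tau>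
      using fun_cong[OF h(1), of "\<tau> - s"] that by (simp add: history_apply)
    then show ?thesis using history_phase_space[OF x _ inclusion_path_continuous[OF x h sr] sr] by blast
  qed
  then show "inflated_flow 0 r s x \<subseteq> phase_space \<gamma>" unfolding inflated_process_def by blast
  obtain u where "inclusion_solution 0 s x u" by (rule Heaviside_solution_exists[OF x])
  then show "inflated_flow 0 s s x = {x}" unfolding inflated_process_def iff by auto
  show "(\<Union>y\<in>inflated_flow 0 r s x. inflated_flow 0 t r y) = inflated_flow 0 t s x"
  proof (intro equalityI subsetI)
    fix z assume "z \<in> (\<Union>y\<in>inflated_flow 0 r s x. inflated_flow 0 t r y)"
    then obtain u w where u: "inclusion_solution 0 s x u" and w: "inclusion_solution 0 r (history r u) w" and z: "z = history t w"
      unfolding inflated_process_def by blast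
    have "inclusion_solution 0 s (history s u) w"
      by (rule Heaviside_glue(1)[OF _ sr _ w]) (use u x sr iff in auto)
    then show "z \<in> inflated_flow 0 t s x" using z u iff unfolding inflated_process_def by auto
  next
    fix z assume "z \<in> inflated_flow 0 t s x"
    then obtain u where u: "inclusion_solution 0 s x u" and z: "z = history t u" unfolding inflated_process_def by blast
    have "inclusion_path 0 r T u" if "r \<le> T" for T
      using inclusion_path_subinterval[of 0 s T u r T] u iff sr that by auto
    then have "inclusion_solution 0 r (history r u) u" using inflated_solution_iff[OF ph[OF u], of 0 r u] by simp
    then show "z \<in> (\<Union>y\<in>inflated_flow 0 r s x. inflated_flow 0 t r y)" using u z unfolding inflated_process_def by blast
  qed
qed

lemma Heaviside_closed_graph: "closed_graph \<gamma> (inflated_flow 0)"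
  unfolding closed_graph_def
proof (intro allI impI)
  fix s t and x y :: "nat \<Rightarrow> real \<Rightarrow> 'n state" and a b
  assume st: "s \<le> t" and lim: "phase_limit \<gamma> x a" "phase_limit \<gamma> y b"
    and xy: "\<forall>k. x k \<in> phase_space \<gamma> \<and> y k \<in> inflated_flow 0 t s (x k)"
  show "b \<in> inflated_flow 0 t s a"
    by (rule Heaviside_limit[where \<epsilon>="\<lambda>_. 0", OF _ _ st lim])
      (use xy st in \<open>auto intro!: inflated_process_path\<close>)
qed

lemma path_in_inflated_process:
  assumes x: "x \<in> phase_space \<gamma>" and e: "0 \<le> \<epsilon>" "\<epsilon> \<le> \<delta>" "\<delta> \<le> 1/5"
    and u: "history s u = x" "\<And>T. s \<le> T \<Longrightarrow> inclusion_path \<epsilon> s T u"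
  shows "history t u \<in> inflated_flow \<delta> t s x"
proof -
  have "inclusion_path \<delta> s T u" if "s \<le> T" for T
    by (rule inclusion_path_mono[OF u(2)[OF that] inclusion_path_continuous[OF x u(1) u(2)[OF that] that] e])
  then have "inclusion_solution \<delta> s x u" using inflated_solution_iff[OF x, of \<delta> s u] u(1) e by simp
  then show ?thesis unfolding inflated_process_def by blast
qed

theorem attractors_converge:
  assumes attractor_\<Phi>: "\<And>\<epsilon>. \<epsilon> \<in> {0..1/5} \<Longrightarrow> \<exists>!K. is_pullback_attractor \<gamma> (inflated_flow \<epsilon>) K"
    and attractor_S: "\<And>\<epsilon>. \<epsilon> \<in> {0<..1/5} \<Longrightarrow> \<exists>!K. is_pullback_attractor \<gamma> (sigmoid_flow \<epsilon>) K"
  shows "((\<lambda>\<epsilon>. hsemidist \<gamma> (pullback_attractor \<gamma> (sigmoid_flow \<epsilon>) t) (pullback_attractor \<gamma> (inflated_flow 0) t)) \<longlongrightarrow> 0) (at_right 0)"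
proof (rule attractors_upper_semicontinuous[where c="1/5" and G=sigmoid_flow and H=inflated_flow])
  show "cocycle_on \<gamma> (sigmoid_flow \<epsilon>)" if "\<epsilon> \<in> {0<..1/5}" for \<epsilon> using that by (intro sigmoid_flow_cocycle) simp
  show "closed_graph \<gamma> (sigmoid_flow \<epsilon>)" if "\<epsilon> \<in> {0<..1/5}" for \<epsilon> using that by (intro sigmoid_flow_closed_graph) simp
  show "sigmoid_flow \<epsilon> t s x \<subseteq> inflated_flow \<delta> t s x" if e: "0 < \<epsilon>" "\<epsilon> \<le> \<delta>" "\<delta> \<le> 1/5" and x: "x \<in> phase_space \<gamma>" for \<epsilon> \<delta> s t x
  proof
    fix y assume y: "y \<in> sigmoid_flow \<epsilon> t s x"
    obtain u where u: "history s u = x" "history t u = y" "\<And>T. s \<le> T \<Longrightarrow> inclusion_path \<epsilon> s T u"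
      by (rule sigmoid_process_path[OF x _ _ y]) (use e in auto)
    have "history t u \<in> inflated_flow \<delta> t s x" by (rule path_in_inflated_process[OF x _ e(2,3) u(1,3)]) (use e in auto)
    then show "y \<in> inflated_flow \<delta> t s x" using u(2) by simp
  qed
  show "inflated_flow 0 t s x \<subseteq> inflated_flow \<delta> t s x" if d: "0 < \<delta>" "\<delta> \<le> 1/5" and x: "x \<in> phase_space \<gamma>" for \<delta> s t x
  proof
    fix y assume "y \<in> inflated_flow 0 t s x"
    then obtain u where u: "inclusion_solution 0 s x u" and y: "y = history t u" unfolding inflated_process_def by blast
    then have h: "history s u = x" "\<And>T. s \<le> T \<Longrightarrow> inclusion_path 0 s T u" using inflated_solution_iff[OF x, of 0 s u] by auto
    have "history t u \<in> inflated_flow \<delta> t s x" by (rule path_in_inflated_process[OF x order_refl _ d(2) h]) (use d in auto)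
    then show "y \<in> inflated_flow \<delta> t s x" using y by simp
  qed
  show "b \<in> inflated_flow 0 t s a"
    if e: "filterlim \<epsilon> (at_right 0) sequentially" "\<And>k. \<epsilon> k \<in> {0<..1/5}" and st: "s \<le> t"
      and lim: "phase_limit \<gamma> x a" "phase_limit \<gamma> y b" and x: "\<And>k. x k \<in> phase_space \<gamma>"
      and y: "\<And>k. y k \<in> sigmoid_flow (\<epsilon> k) t s (x k)"
    for \<epsilon> s t and x y :: "nat \<Rightarrow> real \<Rightarrow> 'n state" and a b
  proof (rule Heaviside_limit[OF _ _ st lim x])
    show "0 \<le> \<epsilon> k \<and> \<epsilon> k \<le> 1/5" for k using e(2)[of k] by simp
    show "\<epsilon> \<longlonglongrightarrow> 0" using e(1) by (auto simp: filterlim_at)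
    show "\<exists>u. history s u = x k \<and> history t u = y k \<and> inclusion_path (\<epsilon> k) s t u" for k
    proof (rule sigmoid_process_path[OF x _ _ y])
      show "0 < \<epsilon> k" "\<epsilon> k \<le> 1/5" using e(2)[of k] by auto
    qed (use st in blast)
  qed
qed (use assms Heaviside_cocycle Heaviside_closed_graph in auto)

end

theorem corollary5p2:
  fixes A I :: "'n::finite \<Rightarrow> real \<Rightarrow> real"
    and B :: "'n \<Rightarrow> 'n \<Rightarrow> real \<Rightarrow> real"
    and c d :: "'n \<Rightarrow> 'n \<Rightarrow> real"
    and \<Gamma> :: "'n \<Rightarrow> real"
    and \<mu> :: "'n \<Rightarrow> 'n \<Rightarrow> real measure"
    and \<alpha> \<gamma> :: real
  defines "\<Phi> \<equiv> \<lambda>\<epsilon>. inflated_process A B I c d \<Gamma> \<mu> \<epsilon>"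
    and "S \<equiv> \<lambda>\<epsilon>. as_set_valued (sigmoid_process A B I c d \<Gamma> \<mu> \<epsilon>)"
  assumes nonneg: "\<And>i j. i \<noteq> j \<Longrightarrow> c i j \<ge> 0 \<and> d i j \<ge> 0"
    and measures: "\<And>i j. i \<noteq> j \<Longrightarrow> regular_Borel_measure {..0} (\<mu> i j)"
    and gamma_pos: "\<gamma> > 0"
    and D_Lipschitz: "\<And>i. locally_Lipschitz (A i)"
      "\<And>i j. i \<noteq> j \<Longrightarrow> locally_Lipschitz (B i j)"
    and D_bound: "\<alpha> > 0" "\<And>i s. A i s \<ge> \<alpha>" "\<And>i j s. i \<noteq> j \<Longrightarrow> B i j s \<ge> \<alpha>"
    and M: "\<And>i j. i \<noteq> j \<Longrightarrow> (\<integral>\<^sup>+ t. ennreal (exp (- \<gamma> * t)) \<partial>\<mu> i j) < \<infinity>"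
    and I: "\<And>i. continuous_on UNIV (I i)"
    and A: "coupling_condition \<alpha> d \<mu>"
    and attractor_\<Phi>: "\<And>\<epsilon>. \<epsilon> \<in> {0..1/5} \<Longrightarrow> \<exists>!K. is_pullback_attractor \<gamma> (\<Phi> \<epsilon>) K"
    and attractor_S: "\<And>\<epsilon>. \<epsilon> \<in> {0<..1/5} \<Longrightarrow> \<exists>!K. is_pullback_attractor \<gamma> (S \<epsilon>) K"
  shows "\<forall>t. ((\<lambda>\<epsilon>. hsemidist \<gamma> (pullback_attractor \<gamma> (S \<epsilon>) t) (pullback_attractor \<gamma> (\<Phi> 0) t))
              \<longlongrightarrow> 0) (at_right 0)"
proof -
  interpret neuron_network A I B c d \<Gamma> \<mu> \<gamma>
  proof (rule neuron_network.intro)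
    show sets: "sets (\<mu> i j) = sets (restrict_space borel {..0})" if "i \<noteq> j" for i j
      using measures[OF that] by (simp add: regular_Borel_measure_def)
    show "finite_measure (\<mu> i j)" if ij: "i \<noteq> j" for i j
    proof (rule finite_measureI)
      have space: "space (\<mu> i j) = {..0}" using sets_eq_imp_space_eq[OF sets[OF ij]] by (simp add: space_restrict_space)
      have "emeasure (\<mu> i j) (space (\<mu> i j)) = (\<integral>\<^sup>+ t. 1 \<partial>\<mu> i j)" by simp
      also have "\<dots> \<le> (\<integral>\<^sup>+ t. ennreal (exp (- \<gamma> * t)) \<partial>\<mu> i j)"
      proof (rule nn_integral_mono)
        fix t assume "t \<in> space (\<mu> i j)"
        \<comment> \<open>On the half-line \<open>t \<le> 0\<close> the integrand of the moment condition is at least \<open>1\<close>.\<close>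
        then have "0 \<le> - \<gamma> * t" using space gamma_pos by (simp add: mult_nonneg_nonpos)
        then show "1 \<le> ennreal (exp (- \<gamma> * t))" by simp
      qed
      also have "\<dots> < \<infinity>" by (rule M[OF ij])
      finally show "emeasure (\<mu> i j) (space (\<mu> i j)) \<noteq> \<infinity>" by simp
    qed
    show "0 \<le> A i s" for i s using D_bound(1) D_bound(2)[of i s] by linarith
    show "0 \<le> B i j s" if "i \<noteq> j" for i j s using D_bound(1) D_bound(3)[OF that, of s] by linarith
  qed (use gamma_pos D_Lipschitz I in auto)
  show ?thesis
    unfolding \<Phi>_def S_def
    using attractors_converge attractor_\<Phi>[unfolded \<Phi>_def] attractor_S[unfolded S_def] by blast
qed

end
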